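(* Let $p:E\to B$ be a univalent fibration in a $\pi$-tribe $\mathcal C$. Then $\top:\mathsf{El}(\Omega_p)\to\Omega_p$ is a homotopy subobject classifier for $S_p$, i.e. for the homotopy monic fibrations that are classified by (are pullbacks of) the univalent fibration $p$.
   Context: **Tribes.** A tribe is a category $\mathcal C$ with a subcategory of morphisms called fibrations such that, calling a morphism anodyne if it has the left lifting property with respect to all fibrations: (1) $\mathcal C$ has a terminal object $1$ and every $X\to1$ is a fibration; (2) pullbacks along fibrations exist and fibrations are stable under pullback; (3) every morphism factors as an anodyne morphism followed by a fibration; (4) anodyne morphisms are stable under pullback along fibrations. The fibrant slice $\mathcal C/\!\!/X$ is the full subcategory of $\mathcal C/X$ spanned by fibrations with codomain $X$; it is again a tribe. A path object of $X$ is a factorisation $X\to P_X\xrightarrow{(\partial_0,\partial_1)}X\times X$ of the diagonal into an anodyne map followed by a fibration; a fibered path object of a fibration $p:E\to B$ is a path object $E\to P_p\to E\times_BE$ of $p$ in $\mathcal C/\!\!/B$. Maps $f,g:Y\to X$ are homotopic, $f\sim g$, if $(f,g)$ factors through $(\partial_0,\partial_1)$; homotopy equivalences are the maps invertible up to $\sim$. A fibration $f:X\to Y$ is a homotopy monomorphism (homotopy monic) if the diagonal $X\to X\times_YX$ is a homotopy equivalence. A $\pi$-tribe is a tribe such that for every fibration $p:X\to Y$ the pullback functor $p^*:\mathcal C/Y\to\mathcal C/X$ has a partial right adjoint $\Pi_p:\mathcal C/\!\!/X\to\mathcal C/\!\!/Y$ (i.e. $\mathrm{Hom}_{\mathcal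 C/Y}(h,\Pi_pf)\cong\mathrm{Hom}_{\mathcal C/X}(p^*h,f)$ naturally for $h\in\mathcal C/Y$, $f\in\mathcal C/\!\!/X$) which preserves homotopy equivalences. A $\pi$-tribe is cartesian closed, with internal hom $\underline{\mathrm{Hom}}(A,B)$. **Univalent fibrations.** For objects $A,B$ of a $\pi$-tribe with path objects $P_A,P_B$, let $c_{X,Y,Z}:\underline{\mathrm{Hom}}(Y,Z)\times\underline{\mathrm{Hom}}(X,Y)\to\underline{\mathrm{Hom}}(X,Z)$ be internal composition and $const_A:Z\to1\to\underline{\mathrm{Hom}}(A,A)$ the map naming $\mathrm{id}_A$. Let $\underline{\mathsf{RInv}}(A,B)$ be the pullback of $({\partial_0}_*,{\partial_1}_* ):\underline{\mathrm{Hom}}(B,P_B)\to\underline{\mathrm{Hom}}(B,B)^2$ along $(c_{B,A,B},const_B):\underline{\mathrm{Hom}}(A,B)\times\underline{\mathrm{Hom}}(B,A)\to\underline{\mathrm{Hom}}(B,B)^2$, let $\underline{\mathsf{LInv}}(A,B)$ be the pullback of $({\partial_0}_*,{\partial_1}_* ):\underline{\mathrm{Hom}}(A,P_A)\to\underline{\mathrm{Hom}}(A,A)^2$ along $(c_{A,B,A},const_A):\underline{\mathrm{Hom}}(B,A)\times\underline{\mathrm{Hom}}(A,B)\to\underline{\mathrm{Hom}}(A,A)^2$, and $\underline{\mathsf{Eq}}(A,B):=\underline{\mathsf{LInv}}(A,B)\times_{\underline{\mathrm{Hom}}(A,B)}\underline{\mathsf{RInv}}(A,B)$. For fibrations $p_1,p_2$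 over $B$, $\underline{\mathsf{Eq}}_B(p_1,p_2)\to B$ is the same construction in $\mathcal C/\!\!/B$. For a fibration $p:E\to B$ put $\underline{\mathsf{Eq}}_B(E):=\underline{\mathsf{Eq}}_{B\times B}(\pi_1^*p,\pi_2^*p)\to B\times B$, and let $\delta_E:B\to\underline{\mathsf{Eq}}_B(E)$ be the map over $B\times B$ (with $B\to B\times B$ the diagonal) corresponding to the identity of $p$ (with identities as inverses and constant homotopies). The fibration $p$ is univalent if $\delta_E$ is a homotopy equivalence. **Homotopy subobject classifiers.** A local class is a class $S$ of fibrations closed under pullback; $S_p$ is the local class of all pullbacks of $p$. A homotopy subobject classifier for a local class $S$ is a homotopy monic fibration $\top:\mathsf{El}(\Omega_S)\to\Omega_S$ that is univalent and such that every homotopy monic fibration in $S$ is a pullback of $\top$ along some map. **The map $\top$.** For $p:E\to B$, let $p\times p:E\times_BE\to B$ be the product of $p$ with itself in $\mathcal C/\!\!/B$, and let $E\to P_p\xrightarrow{(\partial_0,\partial_1)}E\times_BE$ be a fibered path object of $p$. Define $Pr_p:\Omega_p\to B$ to be the fibration $\Pi_{p\times p}(\partial_0,\partial_1)$, so $\Omega_p=\Pi_{p\times p}(P_p)$, and define $\top:\mathsf{El}(\Omega_p)\to\Omega_p$ to be the pullback of $p$ along $Pr_p$. *)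

theory Defs
  imports Main
begin

section \<open>Categories, functors, universal constructions\<close>

text \<open>Composition is written in the usual order: \<open>g \<cdot> f\<close> is \<open>g\<close> after \<open>f\<close>.
  Values outside \<open>Obj\<close> and \<open>Arr\<close> are irrelevant.\<close>

record ('o, 'm) cat =
  Obj :: "'o set"
  Arr :: "'m set"
  Dom :: "'m \<Rightarrow> 'o"
  Cod :: "'m \<Rightarrow> 'o"
  Idn :: "'o \<Rightarrow> 'm"
  Cmp :: "'m \<Rightarrow> 'm \<Rightarrow> 'm"  (infixl "\<cdot>\<index>" 70)

definition Hom :: "('o, 'm, 'x) cat_scheme \<Rightarrow> 'o \<Rightarrow> 'o \<Rightarrow> 'm set" where
  "Hom C X Y = {f \<in> Arr C. Dom C f = X \<and> Cod C f = Y}"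

locale category =
  fixes C :: "('o, 'm, 'x) cat_scheme" (structure)
  assumes dom_obj: "f \<in> Arr C \<Longrightarrow> Dom C f \<in> Obj C"
    and cod_obj: "f \<in> Arr C \<Longrightarrow> Cod C f \<in> Obj C"
    and idn_hom: "X \<in> Obj C \<Longrightarrow> Idn C X \<in> Hom C X X"
    and cmp_hom: "\<lbrakk>f \<in> Hom C X Y; g \<in> Hom C Y Z\<rbrakk> \<Longrightarrow> g \<cdot> f \<in> Hom C X Z"
    and idn_left: "f \<in> Hom C X Y \<Longrightarrow> Idn C Y \<cdot> f = f"
    and idn_right: "f \<in> Hom C X Y \<Longrightarrow> f \<cdot> Idn C X = f"
    and cmp_assoc: "\<lbrakk>f \<in> Hom C W X; g \<in> Hom C X Y; h \<in> Hom C Y Z\<rbrakk>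
        \<Longrightarrow> (h \<cdot> g) \<cdot> f = h \<cdot> (g \<cdot> f)"

definition is_functor ::
  "('o, 'm, 'x) cat_scheme \<Rightarrow> ('p, 'n, 'y) cat_scheme \<Rightarrow> ('o \<Rightarrow> 'p) \<Rightarrow> ('m \<Rightarrow> 'n) \<Rightarrow> bool" where
  "is_functor C D Fo Fa \<longleftrightarrow>
     (\<forall>X\<in>Obj C. Fo X \<in> Obj D) \<and>
     (\<forall>f\<in>Arr C. Fa f \<in> Hom D (Fo (Dom C f)) (Fo (Cod C f))) \<and>
     (\<forall>X\<in>Obj C. Fa (Idn C X) = Idn D (Fo X)) \<and>
     (\<forall>f\<in>Arr C. \<forall>g\<in>Arr C. Dom C g = Cod C f \<longrightarrow>
        Fa (g \<cdot>\<^bsub>C\<^esub> f) = Fa g \<cdot>\<^bsub>D\<^esub> Fa f)"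

definition is_terminal :: "('o, 'm, 'x) cat_scheme \<Rightarrow> 'o \<Rightarrow> bool" where
  "is_terminal C t \<longleftrightarrow> t \<in> Obj C \<and> (\<forall>X\<in>Obj C. \<exists>!f. f \<in> Hom C X t)"

text \<open>A product cone is given by its two projections; the product object is
  their common domain. Likewise for pullbacks, where \<open>is_pullback C f g q1 q2\<close> says that
  \<open>q1\<close> is a pullback of \<open>g\<close> along \<open>f\<close> and \<open>q2\<close> a pullback of \<open>f\<close> along \<open>g\<close>.\<close>

definition is_product ::
  "('o, 'm, 'x) cat_scheme \<Rightarrow> 'o \<Rightarrow> 'o \<Rightarrow> 'm \<Rightarrow> 'm \<Rightarrow> bool" where
  "is_product C X Y q1 q2 \<longleftrightarrow>
     q1 \<in> Hom C (Dom C q1) X \<and> q2 \<in> Hom C (Dom C q1) Y \<and>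
     (\<forall>Z a b. a \<in> Hom C Z X \<longrightarrow> b \<in> Hom C Z Y \<longrightarrow>
        (\<exists>!h. h \<in> Hom C Z (Dom C q1) \<and> q1 \<cdot>\<^bsub>C\<^esub> h = a \<and> q2 \<cdot>\<^bsub>C\<^esub> h = b))"

definition is_pullback ::
  "('o, 'm, 'x) cat_scheme \<Rightarrow> 'm \<Rightarrow> 'm \<Rightarrow> 'm \<Rightarrow> 'm \<Rightarrow> bool" where
  "is_pullback C f g q1 q2 \<longleftrightarrow>
     f \<in> Arr C \<and> g \<in> Arr C \<and> Cod C f = Cod C g \<and>
     q1 \<in> Hom C (Dom C q1) (Dom C f) \<and> q2 \<in> Hom C (Dom C q1) (Dom C g) \<and>
     f \<cdot>\<^bsub>C\<^esub> q1 = g \<cdot>\<^bsub>C\<^esub> q2 \<and>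
     (\<forall>Z a b. a \<in> Hom C Z (Dom C f) \<longrightarrow> b \<in> Hom C Z (Dom C g) \<longrightarrow>
        f \<cdot>\<^bsub>C\<^esub> a = g \<cdot>\<^bsub>C\<^esub> b \<longrightarrow>
        (\<exists>!h. h \<in> Hom C Z (Dom C q1) \<and> q1 \<cdot>\<^bsub>C\<^esub> h = a \<and> q2 \<cdot>\<^bsub>C\<^esub> h = b))"

text \<open>The map \<open>(a, b)\<close> into a product or pullback with projections \<open>q1\<close>, \<open>q2\<close>.\<close>

definition tuple :: "('o, 'm, 'x) cat_scheme \<Rightarrow> 'm \<Rightarrow> 'm \<Rightarrow> 'm \<Rightarrow> 'm \<Rightarrow> 'm" where
  "tuple C q1 q2 a b =
     (THE h. h \<in> Hom C (Dom C a) (Dom C q1) \<and> q1 \<cdot>\<^bsub>C\<^esub> h = a \<and> q2 \<cdot>\<^bsub>C\<^esub> h = b)"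

section \<open>Slices and tribes\<close>

record ('o, 'm) fcat = "('o, 'm) cat" +
  Fib :: "'m set"

text \<open>An arrow of a slice is a triple \<open>(a, k, b)\<close> with \<open>a\<close>, \<open>b\<close> its domain and codomain and
  \<open>k\<close> the underlying arrow of \<open>C\<close>.\<close>

abbreviation und :: "'m \<times> 'm \<times> 'm \<Rightarrow> 'm" where
  "und k \<equiv> fst (snd k)"

definition slice :: "('o, 'm, 'x) cat_scheme \<Rightarrow> 'o \<Rightarrow> ('m, 'm \<times> 'm \<times> 'm) cat" where
  "slice C X = \<lparr>
     Obj = {a \<in> Arr C. Cod C a = X},
     Arr = {(a, k, b). a \<in> Arr C \<and> Cod C a = X \<and> b \<in> Arr C \<and> Cod C b = X \<and>
              k \<in> Hom C (Dom C a) (Dom C b) \<and> b \<cdot>\<^bsub>C\<^esub> k = a},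
     Dom = fst,
     Cod = (\<lambda>k. snd (snd k)),
     Idn = (\<lambda>a. (a, Idn C (Dom C a), a)),
     Cmp = (\<lambda>l k. (fst k, und l \<cdot>\<^bsub>C\<^esub> und k, snd (snd l)))\<rparr>"

definition fslice :: "('o, 'm, 'x) fcat_scheme \<Rightarrow> 'o \<Rightarrow> ('m, 'm \<times> 'm \<times> 'm) fcat" where
  "fslice C X = \<lparr>
     Obj = {a \<in> Fib C. Cod C a = X},
     Arr = {k \<in> Arr (slice C X). fst k \<in> Fib C \<and> snd (snd k) \<in> Fib C},
     Dom = Dom (slice C X),
     Cod = Cod (slice C X),
     Idn = Idn (slice C X),
     Cmp = Cmp (slice C X),
     Fib = {k \<in> Arr (slice C X). fst k \<in> Fib C \<and> snd (snd k) \<in> Fib C \<and> und k \<in> Fib C}\<rparr>"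

definition anodyne :: "('o, 'm, 'x) fcat_scheme \<Rightarrow> 'm \<Rightarrow> bool" where
  "anodyne C i \<longleftrightarrow> i \<in> Arr C \<and>
     (\<forall>p\<in>Fib C. \<forall>u v. u \<in> Hom C (Dom C i) (Dom C p) \<longrightarrow> v \<in> Hom C (Cod C i) (Cod C p) \<longrightarrow>
        p \<cdot>\<^bsub>C\<^esub> u = v \<cdot>\<^bsub>C\<^esub> i \<longrightarrow>
        (\<exists>l \<in> Hom C (Cod C i) (Dom C p). l \<cdot>\<^bsub>C\<^esub> i = u \<and> p \<cdot>\<^bsub>C\<^esub> l = v))"

locale tribe = category C
  for C :: "('o, 'm, 'x) fcat_scheme" (structure) +
  assumes fib_arr: "Fib C \<subseteq> Arr C"
    and fib_idn: "X \<in> Obj C \<Longrightarrow> Idn C X \<in> Fib C"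
    and fib_cmp: "\<lbrakk>f \<in> Fib C; g \<in> Fib C; Dom C g = Cod C f\<rbrakk> \<Longrightarrow> g \<cdot> f \<in> Fib C"
    and terminal_fibrant: "\<exists>t. is_terminal C t \<and> (\<forall>X\<in>Obj C. \<forall>f \<in> Hom C X t. f \<in> Fib C)"
    and fib_pullback_ex: "\<lbrakk>p \<in> Fib C; f \<in> Arr C; Cod C f = Cod C p\<rbrakk>
        \<Longrightarrow> \<exists>q1 q2. is_pullback C f p q1 q2"
    and fib_stable: "\<lbrakk>p \<in> Fib C; is_pullback C f p q1 q2\<rbrakk> \<Longrightarrow> q1 \<in> Fib C"
    and factorisation: "f \<in> Arr C
        \<Longrightarrow> \<exists>i q. anodyne C i \<and> q \<in> Fib C \<and> Dom C q = Cod C i \<and> f = q \<cdot> i"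
    and anodyne_stable: "\<lbrakk>anodyne C i; p \<in> Fib C; is_pullback C p i q1 q2\<rbrakk> \<Longrightarrow> anodyne C q1"

section \<open>Homotopies\<close>

text \<open>\<open>q1\<close>, \<open>q2\<close> are the projections of the product of \<open>X\<close> with itself, \<open>r\<close> is the
  map from \<open>X\<close> to the path object, and \<open>d\<close> is the map \<open>(\<partial>\<^sub>0, \<partial>\<^sub>1)\<close>.\<close>

definition path_object ::
  "('o, 'm, 'x) fcat_scheme \<Rightarrow> 'o \<Rightarrow> 'm \<Rightarrow> 'm \<Rightarrow> 'm \<Rightarrow> 'm \<Rightarrow> bool" where
  "path_object C X q1 q2 r d \<longleftrightarrow>
     X \<in> Obj C \<and> is_product C X X q1 q2 \<and>
     anodyne C r \<and> d \<in> Fib C \<and>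
     Dom C r = X \<and> Dom C d = Cod C r \<and> Cod C d = Dom C q1 \<and>
     d \<cdot>\<^bsub>C\<^esub> r = tuple C q1 q2 (Idn C X) (Idn C X)"

text \<open>In a tribe the following does not depend on the choice of the path object.\<close>

definition homotopic :: "('o, 'm, 'x) fcat_scheme \<Rightarrow> 'm \<Rightarrow> 'm \<Rightarrow> bool" where
  "homotopic C f g \<longleftrightarrow>
     f \<in> Arr C \<and> g \<in> Hom C (Dom C f) (Cod C f) \<and>
     (\<exists>q1 q2 r d. path_object C (Cod C f) q1 q2 r d \<and>
        (\<exists>h \<in> Hom C (Dom C f) (Dom C d). d \<cdot>\<^bsub>C\<^esub> h = tuple C q1 q2 f g))"

definition homotopy_equivalence :: "('o, 'm, 'x) fcat_scheme \<Rightarrow> 'm \<Rightarrow> bool" where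
  "homotopy_equivalence C f \<longleftrightarrow> f \<in> Arr C \<and>
     (\<exists>g \<in> Hom C (Cod C f) (Dom C f).
        homotopic C (g \<cdot>\<^bsub>C\<^esub> f) (Idn C (Dom C f)) \<and>
        homotopic C (f \<cdot>\<^bsub>C\<^esub> g) (Idn C (Cod C f)))"

definition homotopy_monic :: "('o, 'm, 'x) fcat_scheme \<Rightarrow> 'm \<Rightarrow> bool" where
  "homotopy_monic C f \<longleftrightarrow> f \<in> Fib C \<and>
     (\<exists>q1 q2. is_pullback C f f q1 q2 \<and>
        homotopy_equivalence C (tuple C q1 q2 (Idn C (Dom C f)) (Idn C (Dom C f))))"

section \<open>Pi-tribes\<close>

text \<open>A pullback functor \<open>p\<^sup>*\<close> between the full slices, for some choice of pullbacks;
  \<open>\<theta> h\<close> is the projection from the pullback to the domain of \<open>h\<close>.\<close>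

definition pullback_functor ::
  "('o, 'm, 'x) cat_scheme \<Rightarrow> 'm \<Rightarrow> ('m \<Rightarrow> 'm) \<Rightarrow> ('m \<times> 'm \<times> 'm \<Rightarrow> 'm \<times> 'm \<times> 'm) \<Rightarrow> bool" where
  "pullback_functor C p Fo Fa \<longleftrightarrow>
     is_functor (slice C (Cod C p)) (slice C (Dom C p)) Fo Fa \<and>
     (\<exists>\<theta>. (\<forall>h \<in> Obj (slice C (Cod C p)). is_pullback C p h (Fo h) (\<theta> h)) \<and>
          (\<forall>k \<in> Arr (slice C (Cod C p)).
             \<theta> (snd (snd k)) \<cdot>\<^bsub>C\<^esub> und (Fa k) = und k \<cdot>\<^bsub>C\<^esub> \<theta> (fst k)))"

definition partial_right_adjoint ::
  "('o, 'm, 'x) fcat_scheme \<Rightarrow> 'm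
     \<Rightarrow> ('m \<Rightarrow> 'm) \<Rightarrow> ('m \<times> 'm \<times> 'm \<Rightarrow> 'm \<times> 'm \<times> 'm)
     \<Rightarrow> ('m \<Rightarrow> 'm) \<Rightarrow> ('m \<times> 'm \<times> 'm \<Rightarrow> 'm \<times> 'm \<times> 'm) \<Rightarrow> bool" where
  "partial_right_adjoint C p Fo Fa Go Ga \<longleftrightarrow>
     (let X = Dom C p; Y = Cod C p in
     is_functor (fslice C X) (fslice C Y) Go Ga \<and>
     (\<exists>\<phi>.
       (\<forall>h \<in> Obj (slice C Y). \<forall>f \<in> Obj (fslice C X).
          bij_betw (\<phi> h f) (Hom (slice C X) (Fo h) f) (Hom (slice C Y) h (Go f))) \<and>
       (\<forall>h \<in> Obj (slice C Y). \<forall>f \<in> Obj (fslice C X).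
          \<forall>u \<in> Hom (slice C X) (Fo h) f. \<forall>k \<in> Arr (slice C Y). snd (snd k) = h \<longrightarrow>
            \<phi> (fst k) f (u \<cdot>\<^bsub>slice C X\<^esub> Fa k) = \<phi> h f u \<cdot>\<^bsub>slice C Y\<^esub> k) \<and>
       (\<forall>h \<in> Obj (slice C Y). \<forall>f \<in> Obj (fslice C X).
          \<forall>u \<in> Hom (slice C X) (Fo h) f. \<forall>w \<in> Arr (fslice C X). fst w = f \<longrightarrow>
            \<phi> h (snd (snd w)) (w \<cdot>\<^bsub>slice C X\<^esub> u) = Ga w \<cdot>\<^bsub>slice C Y\<^esub> \<phi> h f u)))"

locale pi_tribe = tribe C
  for C :: "('o, 'm, 'x) fcat_scheme" (structure) +
  assumes pi_ex: "p \<in> Fib C \<Longrightarrow>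
    \<exists>Fo Fa Go Ga. pullback_functor C p Fo Fa \<and> partial_right_adjoint C p Fo Fa Go Ga \<and>
      (\<forall>w \<in> Arr (fslice C (Dom C p)). homotopy_equivalence (fslice C (Dom C p)) w
         \<longrightarrow> homotopy_equivalence (fslice C (Cod C p)) (Ga w))"

text \<open>\<open>g\<close> is a value \<open>\<Pi>\<^sub>p f\<close> of some partial right adjoint; it is determined up to
  isomorphism over the codomain of \<open>p\<close>.\<close>

definition is_Pi :: "('o, 'm, 'x) fcat_scheme \<Rightarrow> 'm \<Rightarrow> 'm \<Rightarrow> 'm \<Rightarrow> bool" where
  "is_Pi C p f g \<longleftrightarrow> p \<in> Fib C \<and> f \<in> Obj (fslice C (Dom C p)) \<and>
     (\<exists>Fo Fa Go Ga. pullback_functor C p Fo Fa \<and> partial_right_adjoint C p Fo Fa Go Ga \<and>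
        g = Go f)"

section \<open>Internal homs and objects of equivalences\<close>

text \<open>A choice of terminal object, binary products and internal homs
  \<open>Ev A B : IHom A B \<times> A \<rightarrow> B\<close>.\<close>

record ('o, 'm) ccs =
  One :: 'o
  Pr1 :: "'o \<Rightarrow> 'o \<Rightarrow> 'm"
  Pr2 :: "'o \<Rightarrow> 'o \<Rightarrow> 'm"
  IHom :: "'o \<Rightarrow> 'o \<Rightarrow> 'o"
  Ev :: "'o \<Rightarrow> 'o \<Rightarrow> 'm"

definition prod_ob :: "('o, 'm, 'x) cat_scheme \<Rightarrow> ('o, 'm) ccs \<Rightarrow> 'o \<Rightarrow> 'o \<Rightarrow> 'o" where
  "prod_ob C K X Y = Dom C (Pr1 K X Y)"

definition pair ::
  "('o, 'm, 'x) cat_scheme \<Rightarrow> ('o, 'm) ccs \<Rightarrow> 'm \<Rightarrow> 'm \<Rightarrow> 'm" where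
  "pair C K a b = tuple C (Pr1 K (Cod C a) (Cod C b)) (Pr2 K (Cod C a) (Cod C b)) a b"

definition uncurry ::
  "('o, 'm, 'x) cat_scheme \<Rightarrow> ('o, 'm) ccs \<Rightarrow> 'o \<Rightarrow> 'o \<Rightarrow> 'o \<Rightarrow> 'm \<Rightarrow> 'm" where
  "uncurry C K Z A B h = Ev K A B \<cdot>\<^bsub>C\<^esub> pair C K (h \<cdot>\<^bsub>C\<^esub> Pr1 K Z A) (Pr2 K Z A)"

definition is_ccs :: "('o, 'm, 'x) cat_scheme \<Rightarrow> ('o, 'm) ccs \<Rightarrow> bool" where
  "is_ccs C K \<longleftrightarrow>
     is_terminal C (One K) \<and>
     (\<forall>X\<in>Obj C. \<forall>Y\<in>Obj C. is_product C X Y (Pr1 K X Y) (Pr2 K X Y)) \<and>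
     (\<forall>A\<in>Obj C. \<forall>B\<in>Obj C. IHom K A B \<in> Obj C \<and>
        Ev K A B \<in> Hom C (prod_ob C K (IHom K A B) A) B \<and>
        (\<forall>Z\<in>Obj C. \<forall>f \<in> Hom C (prod_ob C K Z A) B.
           \<exists>!h. h \<in> Hom C Z (IHom K A B) \<and> uncurry C K Z A B h = f))"

definition curry_map ::
  "('o, 'm, 'x) cat_scheme \<Rightarrow> ('o, 'm) ccs \<Rightarrow> 'o \<Rightarrow> 'o \<Rightarrow> 'm \<Rightarrow> 'm" where
  "curry_map C K Z A f =
     (THE h. h \<in> Hom C Z (IHom K A (Cod C f)) \<and> uncurry C K Z A (Cod C f) h = f)"

definition icomp ::
  "('o, 'm, 'x) cat_scheme \<Rightarrow> ('o, 'm) ccs \<Rightarrow> 'o \<Rightarrow> 'o \<Rightarrow> 'o \<Rightarrow> 'm" where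
  "icomp C K X Y Z =
     (let H = IHom K Y Z; H' = IHom K X Y; Q = prod_ob C K H H';
          g = Pr1 K H H' \<cdot>\<^bsub>C\<^esub> Pr1 K Q X; f = Pr2 K H H' \<cdot>\<^bsub>C\<^esub> Pr1 K Q X; x = Pr2 K Q X
      in curry_map C K Q X
           (Ev K Y Z \<cdot>\<^bsub>C\<^esub> pair C K g (Ev K X Y \<cdot>\<^bsub>C\<^esub> pair C K f x)))"

definition iconst ::
  "('o, 'm, 'x) cat_scheme \<Rightarrow> ('o, 'm) ccs \<Rightarrow> 'o \<Rightarrow> 'o \<Rightarrow> 'm" where
  "iconst C K Z A =
     curry_map C K (One K) A (Pr2 K (One K) A) \<cdot>\<^bsub>C\<^esub> (THE t. t \<in> Hom C Z (One K))"

definition ipost ::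
  "('o, 'm, 'x) cat_scheme \<Rightarrow> ('o, 'm) ccs \<Rightarrow> 'o \<Rightarrow> 'm \<Rightarrow> 'm" where
  "ipost C K A f =
     curry_map C K (IHom K A (Dom C f)) A (f \<cdot>\<^bsub>C\<^esub> Ev K A (Dom C f))"

text \<open>\<open>d = (\<partial>\<^sub>0, \<partial>\<^sub>1)\<close> is the fibration of a path object of \<open>B\<close>; \<open>u\<close>, \<open>v\<close> are the projections
  of \<open>RInv(A, B)\<close> to \<open>IHom A B \<times> IHom B A\<close> and to \<open>IHom B P\<^sub>B\<close>.\<close>

definition is_RInv ::
  "('o, 'm, 'x) cat_scheme \<Rightarrow> ('o, 'm) ccs \<Rightarrow> 'o \<Rightarrow> 'o \<Rightarrow> 'm \<Rightarrow> 'm \<Rightarrow> 'm \<Rightarrow> bool" where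
  "is_RInv C K A B d u v \<longleftrightarrow>
     is_pullback C
       (pair C K (icomp C K B A B) (iconst C K (prod_ob C K (IHom K A B) (IHom K B A)) B))
       (pair C K (ipost C K B (Pr1 K B B \<cdot>\<^bsub>C\<^esub> d)) (ipost C K B (Pr2 K B B \<cdot>\<^bsub>C\<^esub> d)))
       u v"

text \<open>Here \<open>d\<close> belongs to a path object of \<open>A\<close>, and \<open>u\<close> goes to \<open>IHom B A \<times> IHom A B\<close>.\<close>

definition is_LInv ::
  "('o, 'm, 'x) cat_scheme \<Rightarrow> ('o, 'm) ccs \<Rightarrow> 'o \<Rightarrow> 'o \<Rightarrow> 'm \<Rightarrow> 'm \<Rightarrow> 'm \<Rightarrow> bool" where
  "is_LInv C K A B d u v \<longleftrightarrow>
     is_pullback C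
       (pair C K (icomp C K A B A) (iconst C K (prod_ob C K (IHom K B A) (IHom K A B)) A))
       (pair C K (ipost C K A (Pr1 K A A \<cdot>\<^bsub>C\<^esub> d)) (ipost C K A (Pr2 K A A \<cdot>\<^bsub>C\<^esub> d)))
       u v"

text \<open>The data of a construction of \<open>Eq(A, B)\<close>: path objects \<open>(rA, dA)\<close>, \<open>(rB, dB)\<close>, projections
  of \<open>LInv\<close> and \<open>RInv\<close>, and projections \<open>eql\<close>, \<open>eqr\<close> of \<open>Eq\<close> to \<open>LInv\<close> and \<open>RInv\<close>.\<close>

record 'm eq_data =
  rA :: 'm
  dA :: 'm
  rB :: 'm
  dB :: 'm
  lu :: 'm
  lv :: 'm
  ru :: 'm
  rv :: 'm
  eql :: 'm
  eqr :: 'm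

definition is_Eq ::
  "('o, 'm, 'x) fcat_scheme \<Rightarrow> ('o, 'm) ccs \<Rightarrow> 'o \<Rightarrow> 'o \<Rightarrow> 'm eq_data \<Rightarrow> bool" where
  "is_Eq C K A B Q \<longleftrightarrow>
     path_object C A (Pr1 K A A) (Pr2 K A A) (rA Q) (dA Q) \<and>
     path_object C B (Pr1 K B B) (Pr2 K B B) (rB Q) (dB Q) \<and>
     is_LInv C K A B (dA Q) (lu Q) (lv Q) \<and>
     is_RInv C K A B (dB Q) (ru Q) (rv Q) \<and>
     is_pullback C
       (Pr2 K (IHom K B A) (IHom K A B) \<cdot>\<^bsub>C\<^esub> lu Q)
       (Pr1 K (IHom K A B) (IHom K B A) \<cdot>\<^bsub>C\<^esub> ru Q)
       (eql Q) (eqr Q)"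

section \<open>Univalence\<close>

text \<open>Let \<open>K\<close> be a cartesian closed structure on \<open>C//X\<close>, \<open>A\<close>, \<open>A'\<close> fibrations over \<open>X\<close>, and let
  \<open>p : E \<rightarrow> B\<close> be the pullback of \<open>A\<close> along some \<open>m : B \<rightarrow> X\<close>, with top map \<open>e : E \<rightarrow> dom A\<close>.
  For a map \<open>x\<close> over \<open>X\<close> from \<open>m\<close> to the internal hom of \<open>A\<close> and \<open>A'\<close>, this is the
  corresponding map \<open>E \<rightarrow> dom A'\<close> over \<open>X\<close>. Here \<open>m\<close> need not be a fibration.\<close>

definition uncurry_over ::
  "('o, 'm, 'x) cat_scheme \<Rightarrow> ('m, 'm \<times> 'm \<times> 'm) ccs \<Rightarrow> 'm \<Rightarrow> 'm \<Rightarrow> 'm \<Rightarrow> 'm \<Rightarrow> 'm \<Rightarrow> 'm" where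
  "uncurry_over C K p e A A' x =
     und (Ev K A A') \<cdot>\<^bsub>C\<^esub>
       tuple C (und (Pr1 K (IHom K A A') A)) (und (Pr2 K (IHom K A A') A)) (x \<cdot>\<^bsub>C\<^esub> p) e"

text \<open>The map \<open>\<delta>\<close> over \<open>X = B \<times> B\<close>, from the diagonal \<open>m : B \<rightarrow> X\<close> to \<open>Eq(A1, A2)\<close>, where \<open>A1\<close> and
  \<open>A2\<close> are the two pullbacks of \<open>p\<close> to \<open>X\<close> and \<open>e1\<close>, \<open>e2\<close> exhibit \<open>p\<close> as their pullbacks along \<open>m\<close>.
  The components of \<open>\<delta>\<close> are, after uncurrying: the identity of \<open>p\<close> as underlying map, as left
  inverse and as right inverse (\<open>e2\<close>, \<open>e1\<close>, \<open>e1\<close>), and the constant homotopies in \<open>P\<^sub>A\<^sub>1\<close> and \<open>P\<^sub>A\<^sub>2\<close>.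
  In a pi-tribe there is exactly one such \<open>\<delta>\<close>.\<close>

definition is_delta ::
  "('o, 'm, 'x) fcat_scheme \<Rightarrow> 'o \<Rightarrow> ('m, 'm \<times> 'm \<times> 'm) ccs \<Rightarrow> 'm \<Rightarrow> 'm
     \<Rightarrow> 'm \<Rightarrow> 'm \<Rightarrow> 'm \<Rightarrow> 'm \<Rightarrow> ('m \<times> 'm \<times> 'm) eq_data \<Rightarrow> 'm \<Rightarrow> bool" where
  "is_delta C X K p m A1 e1 A2 e2 Q \<delta> \<longleftrightarrow>
     (let T = fslice C X;
          EqO = Dom T (eql Q);
          H = IHom K A1 A2; H' = IHom K A2 A1;
          f = und (Pr2 K H' H \<cdot>\<^bsub>T\<^esub> lu Q \<cdot>\<^bsub>T\<^esub> eql Q) \<cdot>\<^bsub>C\<^esub> \<delta>;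
          g = und (Pr1 K H' H \<cdot>\<^bsub>T\<^esub> lu Q \<cdot>\<^bsub>T\<^esub> eql Q) \<cdot>\<^bsub>C\<^esub> \<delta>;
          g' = und (Pr2 K H H' \<cdot>\<^bsub>T\<^esub> ru Q \<cdot>\<^bsub>T\<^esub> eqr Q) \<cdot>\<^bsub>C\<^esub> \<delta>;
          s = und (lv Q \<cdot>\<^bsub>T\<^esub> eql Q) \<cdot>\<^bsub>C\<^esub> \<delta>;
          s' = und (rv Q \<cdot>\<^bsub>T\<^esub> eqr Q) \<cdot>\<^bsub>C\<^esub> \<delta>
      in \<delta> \<in> Hom C (Cod C p) (Dom C EqO) \<and> EqO \<cdot>\<^bsub>C\<^esub> \<delta> = m \<and>
         uncurry_over C K p e1 A1 A2 f = e2 \<and>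
         uncurry_over C K p e2 A2 A1 g = e1 \<and>
         uncurry_over C K p e2 A2 A1 g' = e1 \<and>
         uncurry_over C K p e1 A1 (Dom T (dA Q)) s = und (rA Q) \<cdot>\<^bsub>C\<^esub> e1 \<and>
         uncurry_over C K p e2 A2 (Dom T (dB Q)) s' = und (rB Q) \<cdot>\<^bsub>C\<^esub> e2)"

text \<open>The choices (products, pullbacks, internal homs, path objects) are existentially quantified.
  They always exist in a pi-tribe and the condition does not depend on them.
  \<open>\<delta>\<close> is a homotopy equivalence in \<open>C\<close>: the diagonal is in general no object of \<open>C//(B \<times> B)\<close>.\<close>

definition univalent :: "('o, 'm, 'x) fcat_scheme \<Rightarrow> 'm \<Rightarrow> bool" where
  "univalent C p \<longleftrightarrow> p \<in> Fib C \<and>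
     (\<exists>b1 b2 A1 t1 A2 t2 K Q \<delta>.
        let B = Cod C p; X = Dom C b1; T = fslice C X;
            m = tuple C b1 b2 (Idn C B) (Idn C B);
            e1 = tuple C A1 t1 (m \<cdot>\<^bsub>C\<^esub> p) (Idn C (Dom C p));
            e2 = tuple C A2 t2 (m \<cdot>\<^bsub>C\<^esub> p) (Idn C (Dom C p))
        in is_product C B B b1 b2 \<and>
           is_pullback C b1 p A1 t1 \<and> is_pullback C b2 p A2 t2 \<and>
           is_ccs T K \<and> is_Eq T K A1 A2 Q \<and>
           is_delta C X K p m A1 e1 A2 e2 Q \<delta> \<and>
           homotopy_equivalence C \<delta>)"

section \<open>Local classes and homotopy subobject classifiers\<close>

definition local_class :: "('o, 'm, 'x) fcat_scheme \<Rightarrow> 'm set \<Rightarrow> bool" where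
  "local_class C S \<longleftrightarrow> S \<subseteq> Fib C \<and>
     (\<forall>p\<in>S. \<forall>f q1 q2. is_pullback C f p q1 q2 \<longrightarrow> q1 \<in> S)"

definition pullbacks_of :: "('o, 'm, 'x) cat_scheme \<Rightarrow> 'm \<Rightarrow> 'm set" where
  "pullbacks_of C p = {q. \<exists>f t. is_pullback C f p q t}"

definition homotopy_subobject_classifier ::
  "('o, 'm, 'x) fcat_scheme \<Rightarrow> 'm set \<Rightarrow> 'm \<Rightarrow> bool" where
  "homotopy_subobject_classifier C S tr \<longleftrightarrow>
     local_class C S \<and> homotopy_monic C tr \<and> univalent C tr \<and>
     (\<forall>q\<in>S. homotopy_monic C q \<longrightarrow> q \<in> pullbacks_of C tr)"

end

theory Submission
  imports Defs
begin

text \<open>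
  All homotopy theory takes place fibrewise: for a fibration \<open>j : Y \<rightarrow> X\<close>, two maps \<open>a, b\<close> into \<open>Y\<close> with
  \<open>j a = j b\<close> are homotopic over \<open>X\<close> if \<open>(a, b)\<close> lifts to a fibered path object of \<open>j\<close>. Call \<open>j\<close> path monic
  if any two such maps are homotopic over \<open>X\<close>. This implies homotopy monic, and it is stable under
  composition and under pullback along fibrations.

  The counit of \<open>\<Pi>\<close> equips the fibres of \<open>p\<close> over \<open>\<Omega>\<^sub>p\<close> with a path between any two points, so \<open>\<top>\<close> is
  path monic. Over any fibration on which two points of \<open>\<Omega>\<^sub>p\<close> live, the two resulting families of paths
  are homotopic, because the path spaces of a contractible fibre are contractible; as \<open>\<Pi>\<close> preserves
  homotopy equivalences, \<open>Pr\<^sub>p\<close> is path monic. A homotopy monic pullback \<open>q\<close> of \<open>p\<close> along \<open>f\<close> has a strict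
  section of its path fibration by homotopy lifting, and this section is a lift of \<open>f\<close> through \<open>Pr\<^sub>p\<close>.

  Univalence descends along path monic \<open>g : \<Omega> \<rightarrow> B\<close>: pulling back along the fibration \<open>g \<times> g\<close> preserves internal
  homs and objects of equivalences, so \<open>Eq\<close> over \<open>\<Omega> \<times> \<Omega>\<close> is the pullback of \<open>Eq\<close> over \<open>B \<times> B\<close>, with path monic
  projection \<open>\<eta>\<close>. If \<open>\<delta>\<close> is a homotopy equivalence then \<open>\<delta> \<pi>\<^sub>1 \<sim> id\<close>, so \<open>\<eta> \<delta>' \<pi>\<^sub>1 = \<delta> \<pi>\<^sub>1 \<eta> \<sim> \<eta>\<close>, and
  \<open>\<eta>\<close> can be cancelled.
\<close>

section \<open>Categories and pullbacks\<close>

text \<open>Two kinds of objects have to be kept apart. The diagonal of \<open>B\<close>, and with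
  it \<open>\<delta>\<close>, is not an object of a fibrant slice; therefore fibrewise homotopy and
  elements of internal homs are set up in \<open>C\<close> itself with arbitrary domains, and slices
  are entered only where the hypothesis on \<open>\<Pi>\<close> speaks about them. Universal
  properties inside a fibrant slice, on the other hand, are tested on fibrations only. They can be
  carried along a map when composition with that map keeps test objects fibrant, so it matters that
  \<open>Pr\<^sub>p\<close> and the induced map of squares are honest fibrations. Path monic is the
  working notion because it yields a homotopy for every strictly matching pair of points; path
  lifting along a fibration turns homotopies in the base into such strict matches. The definitions
  leave path objects, pullbacks, internal homs and adjoints to an arbitrary choice. Each choice is
  either compared with another one through its universal property or has to be constructed anew for
  the pulled back fibration.\<close>

lemma Hom_iff [simp]: "f \<in> Hom C X Y \<longleftrightarrow> f \<in> Arr C \<and> Dom C f = X \<and> Cod C f = Y"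
  by (simp add: Hom_def)

context category
begin

lemma arr_cmp [simp]: "\<lbrakk>f \<in> Arr C; g \<in> Arr C; Dom C g = Cod C f\<rbrakk> \<Longrightarrow> g \<cdot> f \<in> Arr C"
  and dom_cmp [simp]: "\<lbrakk>f \<in> Arr C; g \<in> Arr C; Dom C g = Cod C f\<rbrakk> \<Longrightarrow> Dom C (g \<cdot> f) = Dom C f"
  and cod_cmp [simp]: "\<lbrakk>f \<in> Arr C; g \<in> Arr C; Dom C g = Cod C f\<rbrakk> \<Longrightarrow> Cod C (g \<cdot> f) = Cod C g"
  using cmp_hom[of f "Dom C f" "Cod C f" g "Cod C g"] by simp_all

lemma arr_idn [simp]: "X \<in> Obj C \<Longrightarrow> Idn C X \<in> Arr C"
  and dom_idn [simp]: "X \<in> Obj C \<Longrightarrow> Dom C (Idn C X) = X"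
  and cod_idn [simp]: "X \<in> Obj C \<Longrightarrow> Cod C (Idn C X) = X"
  using idn_hom[of X] by simp_all

declare dom_obj [simp] cod_obj [simp]

lemma idn_cmp [simp]: "\<lbrakk>f \<in> Arr C; Cod C f = X\<rbrakk> \<Longrightarrow> Idn C X \<cdot> f = f"
  and cmp_idn [simp]: "\<lbrakk>f \<in> Arr C; Dom C f = X\<rbrakk> \<Longrightarrow> f \<cdot> Idn C X = f"
  using idn_left[of f "Dom C f" X] idn_right[of f X "Cod C f"] by simp_all

lemma assoc [simp]:
  "\<lbrakk>f \<in> Arr C; g \<in> Arr C; h \<in> Arr C; Dom C g = Cod C f; Dom C h = Cod C g\<rbrakk>
    \<Longrightarrow> (h \<cdot> g) \<cdot> f = h \<cdot> (g \<cdot> f)"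
  using cmp_assoc[of f "Dom C f" "Cod C f" g "Cod C g" h "Cod C h"] by simp

text \<open>Simplification nests composites to the right, which hides an equation
  \<open>g \<cdot> f = k\<close> inside a longer composite. Instances of this rule make such an
  equation usable in front of any tail \<open>x\<close>.\<close>

lemma reassoc:
  "\<lbrakk>g \<cdot> f = k; f \<in> Arr C; g \<in> Arr C; Dom C g = Cod C f; x \<in> Arr C; Cod C x = Dom C f\<rbrakk>
    \<Longrightarrow> g \<cdot> (f \<cdot> x) = k \<cdot> x"
  using assoc[of x f g] by simp

section \<open>Pullback squares, induced maps and pasting\<close>

lemma pbD:
  assumes "is_pullback C f g q1 q2"
  shows "f \<in> Arr C" "g \<in> Arr C" "Cod C g = Cod C f" "q1 \<in> Arr C" "q2 \<in> Arr C"
    "Dom C q2 = Dom C q1" "Cod C q1 = Dom C f" "Cod C q2 = Dom C g" "f \<cdot> q1 = g \<cdot> q2"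
  using assms by (simp_all add: is_pullback_def)

lemma pb_lift:
  assumes "is_pullback C f g q1 q2" "a \<in> Arr C" "b \<in> Arr C" "Dom C b = Dom C a"
    "Cod C a = Dom C f" "Cod C b = Dom C g" "f \<cdot> a = g \<cdot> b"
  obtains h where "h \<in> Arr C" "Dom C h = Dom C a" "Cod C h = Dom C q1" "q1 \<cdot> h = a" "q2 \<cdot> h = b"
proof -
  have "\<exists>!h. h \<in> Hom C (Dom C a) (Dom C q1) \<and> q1 \<cdot> h = a \<and> q2 \<cdot> h = b"
    using assms unfolding is_pullback_def by simp
  then show thesis using that by auto
qed

lemma pb_uniq:
  assumes "is_pullback C f g q1 q2" "h \<in> Arr C" "k \<in> Arr C" "Dom C k = Dom C h"
    "Cod C h = Dom C q1" "Cod C k = Dom C q1" "q1 \<cdot> h = q1 \<cdot> k" "q2 \<cdot> h = q2 \<cdot> k"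
  shows "h = k"
proof -
  note [simp] = pbD[OF assms(1)] assms(2-6)
  have "\<exists>!l. l \<in> Hom C (Dom C h) (Dom C q1) \<and> q1 \<cdot> l = q1 \<cdot> h \<and> q2 \<cdot> l = q2 \<cdot> h"
  proof -
    have "f \<cdot> (q1 \<cdot> h) = g \<cdot> (q2 \<cdot> h)"
      using reassoc[OF pbD(9)[OF assms(1)], of h] by simp
    moreover have "q1 \<cdot> h \<in> Hom C (Dom C h) (Dom C f)" "q2 \<cdot> h \<in> Hom C (Dom C h) (Dom C g)"
      by simp_all
    ultimately show ?thesis using assms(1) unfolding is_pullback_def by blast
  qed
  moreover have "h \<in> Hom C (Dom C h) (Dom C q1)" "k \<in> Hom C (Dom C h) (Dom C q1)" by simp_all
  ultimately show ?thesis using assms(7,8) by metis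
qed

lemma pbI:
  assumes "f \<in> Arr C" "g \<in> Arr C" "Cod C g = Cod C f" "q1 \<in> Arr C" "q2 \<in> Arr C"
    "Dom C q2 = Dom C q1" "Cod C q1 = Dom C f" "Cod C q2 = Dom C g" "f \<cdot> q1 = g \<cdot> q2"
    and ex: "\<And>a b. \<lbrakk>a \<in> Arr C; b \<in> Arr C; Dom C b = Dom C a; Cod C a = Dom C f; Cod C b = Dom C g;
       f \<cdot> a = g \<cdot> b\<rbrakk> \<Longrightarrow> \<exists>h. h \<in> Arr C \<and> Dom C h = Dom C a \<and> Cod C h = Dom C q1 \<and> q1 \<cdot> h = a \<and> q2 \<cdot> h = b"
    and un: "\<And>h k. \<lbrakk>h \<in> Arr C; k \<in> Arr C; Dom C k = Dom C h; Cod C h = Dom C q1; Cod C k = Dom C q1;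
       q1 \<cdot> h = q1 \<cdot> k; q2 \<cdot> h = q2 \<cdot> k\<rbrakk> \<Longrightarrow> h = k"
  shows "is_pullback C f g q1 q2"
  unfolding is_pullback_def
proof (intro conjI allI impI)
  fix Z a b assume *: "a \<in> Hom C Z (Dom C f)" "b \<in> Hom C Z (Dom C g)" "f \<cdot> a = g \<cdot> b"
  obtain h where h: "h \<in> Arr C" "Dom C h = Z" "Cod C h = Dom C q1" "q1 \<cdot> h = a" "q2 \<cdot> h = b"
    using ex[of a b] * by auto
  show "\<exists>!h. h \<in> Hom C Z (Dom C q1) \<and> q1 \<cdot> h = a \<and> q2 \<cdot> h = b"
  proof (rule ex1I[of _ h])
    fix k assume "k \<in> Hom C Z (Dom C q1) \<and> q1 \<cdot> k = a \<and> q2 \<cdot> k = b"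
    then show "k = h" by - (rule un, simp_all add: h)
  qed (simp add: h)
qed (use assms(1-9) in simp_all)

lemma pb_sym: "is_pullback C f g q1 q2 \<Longrightarrow> is_pullback C g f q2 q1"
proof (rule pbI)
  assume 1: "is_pullback C f g q1 q2"
  note [simp] = pbD(1-8)[OF 1]
  show "g \<cdot> q2 = f \<cdot> q1" by (simp add: pbD(9)[OF 1])
  fix a b assume "a \<in> Arr C" "b \<in> Arr C" "Dom C b = Dom C a" "Cod C a = Dom C g" "Cod C b = Dom C f"
      "g \<cdot> a = f \<cdot> b"
  then show "\<exists>h. h \<in> Arr C \<and> Dom C h = Dom C a \<and> Cod C h = Dom C q2 \<and> q2 \<cdot> h = a \<and> q1 \<cdot> h = b"
    using pb_lift[OF 1, of b a] by (metis pbD(6)[OF 1])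
next
  assume 1: "is_pullback C f g q1 q2"
  fix h k assume "h \<in> Arr C" "k \<in> Arr C" "Dom C k = Dom C h" "Cod C h = Dom C q2" "Cod C k = Dom C q2"
    "q2 \<cdot> h = q2 \<cdot> k" "q1 \<cdot> h = q1 \<cdot> k"
  then show "h = k" by - (rule pb_uniq[OF 1], simp_all add: pbD(6)[OF 1])
qed (simp_all add: pbD)

text \<open>\<open>tuple\<close> is a definite description and has its intended value only once
  uniqueness is known. The last premise supplies uniqueness in a form that serves both pullbacks and
  products.\<close>

lemma tuple_eqI:
  assumes "h \<in> Arr C" "Dom C h = Dom C a" "Cod C h = Dom C q1" "q1 \<cdot> h = a" "q2 \<cdot> h = b"
    and "\<And>k. \<lbrakk>k \<in> Arr C; Dom C k = Dom C a; Cod C k = Dom C q1; q1 \<cdot> k = a; q2 \<cdot> k = b\<rbrakk> \<Longrightarrow> k = h"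
  shows "tuple C q1 q2 a b = h"
  unfolding tuple_def
proof (rule the_equality)
  fix k assume "k \<in> Hom C (Dom C a) (Dom C q1) \<and> q1 \<cdot> k = a \<and> q2 \<cdot> k = b"
  then show "k = h" by - (rule assms(6), simp_all)
qed (use assms(1-5) in simp)

lemma pb_tuple_eq:
  assumes "is_pullback C f g q1 q2"
    and "h \<in> Arr C" "Dom C h = Dom C a" "Cod C h = Dom C q1" "q1 \<cdot> h = a" "q2 \<cdot> h = b"
  shows "tuple C q1 q2 a b = h"
proof (rule tuple_eqI)
  fix k assume "k \<in> Arr C" "Dom C k = Dom C a" "Cod C k = Dom C q1" "q1 \<cdot> k = a" "q2 \<cdot> k = b"
  then show "k = h" by - (rule pb_uniq[OF assms(1)], simp_all add: assms)
qed (use assms in simp_all)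

lemma pb_tuple:
  assumes "is_pullback C f g q1 q2" "a \<in> Arr C" "b \<in> Arr C" "Dom C b = Dom C a"
    "Cod C a = Dom C f" "Cod C b = Dom C g" "f \<cdot> a = g \<cdot> b"
  shows "tuple C q1 q2 a b \<in> Arr C" "Dom C (tuple C q1 q2 a b) = Dom C a"
    "Cod C (tuple C q1 q2 a b) = Dom C q1"
    "q1 \<cdot> tuple C q1 q2 a b = a" "q2 \<cdot> tuple C q1 q2 a b = b"
proof -
  obtain h where "h \<in> Arr C" "Dom C h = Dom C a" "Cod C h = Dom C q1" "q1 \<cdot> h = a" "q2 \<cdot> h = b"
    using pb_lift[OF assms] .
  moreover from this have "tuple C q1 q2 a b = h" by (rule pb_tuple_eq[OF assms(1)])
  ultimately show "tuple C q1 q2 a b \<in> Arr C" "Dom C (tuple C q1 q2 a b) = Dom C a"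
    "Cod C (tuple C q1 q2 a b) = Dom C q1"
    "q1 \<cdot> tuple C q1 q2 a b = a" "q2 \<cdot> tuple C q1 q2 a b = b" by simp_all
qed

lemma pb_tuple_cmp:
  assumes "is_pullback C f g q1 q2" "a \<in> Arr C" "b \<in> Arr C" "Dom C b = Dom C a"
    "Cod C a = Dom C f" "Cod C b = Dom C g" "f \<cdot> a = g \<cdot> b" "w \<in> Arr C" "Cod C w = Dom C a"
  shows "tuple C q1 q2 a b \<cdot> w = tuple C q1 q2 (a \<cdot> w) (b \<cdot> w)"
proof -
  note [simp] = pb_tuple[OF assms(1-7)] assms(2-9) pbD[OF assms(1)]
  show ?thesis
    by (rule pb_tuple_eq[OF assms(1), symmetric])
      (simp_all add: reassoc[OF pb_tuple(4)[OF assms(1-7)]] reassoc[OF pb_tuple(5)[OF assms(1-7)]])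
qed

lemma pb_paste:
  assumes 1: "is_pullback C f g q1 q2" and 2: "is_pullback C h q1 s1 s2"
  shows "is_pullback C (f \<cdot> h) g s1 (q2 \<cdot> s2)"
proof -
  note [simp] = pbD(1-8)[OF 1] pbD(1,4-8)[OF 2]
  have [simp]: "Cod C h = Dom C f" using pbD(3)[OF 2] by simp
  note e1 = pbD(9)[OF 1] and e2 = pbD(9)[OF 2]
  show ?thesis
  proof (rule pbI)
    show "(f \<cdot> h) \<cdot> s1 = g \<cdot> (q2 \<cdot> s2)" by (simp add: e2 reassoc[OF e1])
  next
    fix a b assume [simp]: "a \<in> Arr C" "b \<in> Arr C" "Dom C b = Dom C a" and a: "Cod C a = Dom C (f \<cdot> h)"
      and [simp]: "Cod C b = Dom C g" and e: "(f \<cdot> h) \<cdot> a = g \<cdot> b"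
    have [simp]: "Cod C a = Dom C h" using a by simp
    obtain k where [simp]: "k \<in> Arr C" "Dom C k = Dom C a" "Cod C k = Dom C q1" and k: "q1 \<cdot> k = h \<cdot> a"
        "q2 \<cdot> k = b"
      using pb_lift[OF 1, of "h \<cdot> a" b] e by auto
    obtain l where l: "l \<in> Arr C" "Dom C l = Dom C a" "Cod C l = Dom C s1" "s1 \<cdot> l = a" "s2 \<cdot> l = k"
      using pb_lift[OF 2, of a k] k by auto
    then show "\<exists>l. l \<in> Arr C \<and> Dom C l = Dom C a \<and> Cod C l = Dom C s1 \<and> s1 \<cdot> l = a \<and> (q2 \<cdot> s2) \<cdot> l = b"
      using k by (intro exI[of _ l]) simp
  next
    fix l k assume [simp]: "l \<in> Arr C" "k \<in> Arr C" "Dom C k = Dom C l" "Cod C l = Dom C s1" "Cod C k = Dom C s1"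
      and e: "s1 \<cdot> l = s1 \<cdot> k" "(q2 \<cdot> s2) \<cdot> l = (q2 \<cdot> s2) \<cdot> k"
    have "s2 \<cdot> l = s2 \<cdot> k"
      by (rule pb_uniq[OF 1]) (use e in \<open>simp_all add: reassoc[OF e2[symmetric]]\<close>)
    then show "l = k" using e by - (rule pb_uniq[OF 2], simp_all)
  qed simp_all
qed

text \<open>The cancellation half of the pasting law. Squares between total spaces are recognised as
  pullbacks by pasting them onto a known pullback.\<close>

lemma pb_unpaste:
  assumes 1: "is_pullback C f g q1 q2" and 2: "is_pullback C (f \<cdot> h) g s1 t"
    and [simp]: "h \<in> Arr C" "Cod C h = Dom C f" "s2 \<in> Arr C" "Dom C s2 = Dom C s1" "Cod C s2 = Dom C q1"
    and e2: "h \<cdot> s1 = q1 \<cdot> s2" and t: "q2 \<cdot> s2 = t"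
  shows "is_pullback C h q1 s1 s2"
proof -
  note [simp] = pbD(1-8)[OF 1]
  have [simp]: "s1 \<in> Arr C" "Cod C s1 = Dom C h" using pbD[OF 2] by simp_all
  note e1 = pbD(9)[OF 1]
  show ?thesis
  proof (rule pbI)
    fix a b assume [simp]: "a \<in> Arr C" "b \<in> Arr C" "Dom C b = Dom C a" "Cod C a = Dom C h"
      "Cod C b = Dom C q1" and e: "h \<cdot> a = q1 \<cdot> b"
    obtain l where [simp]: "l \<in> Arr C" "Dom C l = Dom C a" "Cod C l = Dom C s1" and l: "s1 \<cdot> l = a"
        "t \<cdot> l = q2 \<cdot> b"
      using pb_lift[OF 2, of a "q2 \<cdot> b"] e by (auto simp: reassoc[OF e1])
    have "s2 \<cdot> l = b"
      by (rule pb_uniq[OF 1]) (use l e t in \<open>auto simp: reassoc[OF e2[symmetric]]\<close>)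
    then show "\<exists>l. l \<in> Arr C \<and> Dom C l = Dom C a \<and> Cod C l = Dom C s1 \<and> s1 \<cdot> l = a \<and> s2 \<cdot> l = b"
      using l by (intro exI[of _ l]) simp
  next
    fix l k assume [simp]: "l \<in> Arr C" "k \<in> Arr C" "Dom C k = Dom C l" "Cod C l = Dom C s1" "Cod C k = Dom C s1"
      and e: "s1 \<cdot> l = s1 \<cdot> k" "s2 \<cdot> l = s2 \<cdot> k"
    show "l = k" by (rule pb_uniq[OF 2]) (use e in \<open>simp_all add: t[symmetric]\<close>)
  qed (use e2 in simp_all)
qed

text \<open>Parallel maps into a terminal object agree, so the commutativity condition of the
  pullback is automatic. Absolute path objects thereby become fibered path objects over the terminal
  object.\<close>

lemma product_iff_pb:
  assumes t: "is_terminal C u" and x: "x \<in> Hom C X u" and y: "y \<in> Hom C Y u"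
  shows "is_product C X Y q1 q2 \<longleftrightarrow> is_pullback C x y q1 q2"
proof -
  have u: "f = g" if "f \<in> Hom C Z u" "g \<in> Hom C Z u" for f g Z
    using t that dom_obj[of f] unfolding is_terminal_def by auto
  have *: "x \<cdot> a = y \<cdot> b" if "a \<in> Hom C Z X" "b \<in> Hom C Z Y" for a b Z
    by (rule u[of _ Z]) (use that x y in auto)
  have "is_pullback C x y q1 q2 \<longleftrightarrow> q1 \<in> Hom C (Dom C q1) X \<and> q2 \<in> Hom C (Dom C q1) Y \<and>
     (\<forall>Z a b. a \<in> Hom C Z X \<longrightarrow> b \<in> Hom C Z Y \<longrightarrow>
        (\<exists>!h. h \<in> Hom C Z (Dom C q1) \<and> q1 \<cdot> h = a \<and> q2 \<cdot> h = b))"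
    (is "?L \<longleftrightarrow> ?R")
  proof
    assume ?L then show ?R using * x y unfolding is_pullback_def by simp
  next
    assume R: ?R
    show ?L unfolding is_pullback_def
    proof (intro conjI)
      show "x \<cdot> q1 = y \<cdot> q2" using R by (intro *) simp_all
    qed (use R x y in simp_all)
  qed
  then show ?thesis unfolding is_product_def by simp
qed

end

section \<open>Fibrewise homotopies\<close>

text \<open>\<open>e0\<close>, \<open>e1\<close> are \<open>\<partial>\<^sub>0\<close>, \<open>\<partial>\<^sub>1\<close>; in contrast to \<open>path_object\<close> no fibrant slice is involved.\<close>

definition fpath :: "('o, 'm, 'x) fcat_scheme \<Rightarrow> 'm \<Rightarrow> 'm \<Rightarrow> 'm \<Rightarrow> 'm \<Rightarrow> bool" where
  "fpath C j r e0 e1 \<longleftrightarrow>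
     j \<in> Fib C \<and> anodyne C r \<and> Dom C r = Dom C j \<and>
     e0 \<cdot>\<^bsub>C\<^esub> r = Idn C (Dom C j) \<and> e1 \<cdot>\<^bsub>C\<^esub> r = Idn C (Dom C j) \<and>
     (\<exists>q1 q2 d. is_pullback C j j q1 q2 \<and> d \<in> Fib C \<and> Dom C d = Cod C r \<and> Cod C d = Dom C q1 \<and>
        e0 = q1 \<cdot>\<^bsub>C\<^esub> d \<and> e1 = q2 \<cdot>\<^bsub>C\<^esub> d)"

text \<open>The common domain of \<open>a\<close> and \<open>b\<close> carries no fibration to the
  base. This admits points at stages outside the fibrant slice, which homotopies inside the slice do
  not.\<close>

definition fhomotopic :: "('o, 'm, 'x) fcat_scheme \<Rightarrow> 'm \<Rightarrow> 'm \<Rightarrow> 'm \<Rightarrow> bool" where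
  "fhomotopic C j a b \<longleftrightarrow>
     a \<in> Arr C \<and> b \<in> Arr C \<and> Dom C b = Dom C a \<and> Cod C a = Dom C j \<and> Cod C b = Dom C j \<and>
     j \<cdot>\<^bsub>C\<^esub> a = j \<cdot>\<^bsub>C\<^esub> b \<and>
     (\<exists>r e0 e1. fpath C j r e0 e1 \<and>
        (\<exists>h\<in>Hom C (Dom C a) (Cod C r). e0 \<cdot>\<^bsub>C\<^esub> h = a \<and> e1 \<cdot>\<^bsub>C\<^esub> h = b))"

context tribe
begin

lemma fib_in_arr [simp]: "f \<in> Fib C \<Longrightarrow> f \<in> Arr C"
  using fib_arr by blast

declare fib_cmp [simp] fib_idn [simp]

lemma fib_pb1: "\<lbrakk>is_pullback C f p q1 q2; p \<in> Fib C\<rbrakk> \<Longrightarrow> q1 \<in> Fib C"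
  using fib_stable by blast

lemma fib_pb2: "\<lbrakk>is_pullback C f p q1 q2; f \<in> Fib C\<rbrakk> \<Longrightarrow> q2 \<in> Fib C"
  using fib_stable pb_sym by blast

lemma pb_ex:
  assumes "p \<in> Fib C" "f \<in> Arr C" "Cod C f = Cod C p"
  obtains q1 q2 where "is_pullback C f p q1 q2"
  using fib_pullback_ex[OF assms] by blast

lemma anodyne_arr [simp]: "anodyne C i \<Longrightarrow> i \<in> Arr C"
  by (simp add: anodyne_def)

lemma anodyne_lift:
  assumes "anodyne C i" "p \<in> Fib C" "u \<in> Arr C" "v \<in> Arr C" "Dom C u = Dom C i" "Cod C u = Dom C p"
    "Dom C v = Cod C i" "Cod C v = Cod C p" "p \<cdot> u = v \<cdot> i"
  obtains l where "l \<in> Arr C" "Dom C l = Cod C i" "Cod C l = Dom C p" "l \<cdot> i = u" "p \<cdot> l = v"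
proof -
  have "\<exists>l\<in>Hom C (Cod C i) (Dom C p). l \<cdot> i = u \<and> p \<cdot> l = v"
    using assms unfolding anodyne_def by simp
  then show thesis using that by auto
qed

section \<open>Lifting into fibered path objects\<close>

lemma fpathD:
  assumes "fpath C j r e0 e1"
  shows "j \<in> Fib C" "anodyne C r" "Dom C r = Dom C j" "e0 \<in> Fib C" "e1 \<in> Fib C"
    "Dom C e0 = Cod C r" "Dom C e1 = Cod C r" "Cod C e0 = Dom C j" "Cod C e1 = Dom C j"
    "e0 \<cdot> r = Idn C (Dom C j)" "e1 \<cdot> r = Idn C (Dom C j)" "j \<cdot> e0 = j \<cdot> e1"
proof -
  obtain q1 q2 d where pb: "is_pullback C j j q1 q2" and [simp]: "d \<in> Fib C" "Dom C d = Cod C r"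
    "Cod C d = Dom C q1" and e: "e0 = q1 \<cdot> d" "e1 = q2 \<cdot> d"
    using assms unfolding fpath_def by blast
  show j: "j \<in> Fib C" and "anodyne C r" "Dom C r = Dom C j"
    "e0 \<cdot> r = Idn C (Dom C j)" "e1 \<cdot> r = Idn C (Dom C j)"
    using assms unfolding fpath_def by simp_all
  have q: "q1 \<in> Fib C" "q2 \<in> Fib C" using j fib_pb1[OF pb] fib_pb2[OF pb] by simp_all
  show "e0 \<in> Fib C" "e1 \<in> Fib C" "Dom C e0 = Cod C r" "Dom C e1 = Cod C r"
    "Cod C e0 = Dom C j" "Cod C e1 = Dom C j" "j \<cdot> e0 = j \<cdot> e1"
    using pbD[OF pb] q j by (simp_all add: e reassoc[OF pbD(9)[OF pb]])
qed

text \<open>Relative extension of homotopies: the endpoints \<open>k0\<close>, \<open>k1\<close>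
  combine to a map \<open>m\<close> into the fibre product, and \<open>i\<close> is lifted against
  the fibration \<open>d\<close>. All homotopies below originate here.\<close>

lemma fpath_lift:
  assumes P: "fpath C j r e0 e1" and i: "anodyne C i"
    and k: "k0 \<in> Arr C" "k1 \<in> Arr C" "Dom C k0 = Cod C i" "Dom C k1 = Cod C i"
      "Cod C k0 = Dom C j" "Cod C k1 = Dom C j" "j \<cdot> k0 = j \<cdot> k1"
    and h: "h0 \<in> Arr C" "Dom C h0 = Dom C i" "Cod C h0 = Cod C r" "e0 \<cdot> h0 = k0 \<cdot> i" "e1 \<cdot> h0 = k1 \<cdot> i"
  obtains h where "h \<in> Arr C" "Dom C h = Cod C i" "Cod C h = Cod C r" "h \<cdot> i = h0" "e0 \<cdot> h = k0" "e1 \<cdot> h = k1"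
proof -
  obtain q1 q2 d where pb: "is_pullback C j j q1 q2" and [simp]: "d \<in> Fib C" "Dom C d = Cod C r"
    "Cod C d = Dom C q1" and e: "e0 = q1 \<cdot> d" "e1 = q2 \<cdot> d"
    using P unfolding fpath_def by blast
  note [simp] = i k(1-6) h(1-3) pbD(4-8)[OF pb] fpathD(1)[OF P]
  obtain m where [simp]: "m \<in> Arr C" "Dom C m = Cod C i" "Cod C m = Dom C q1" and m: "q1 \<cdot> m = k0" "q2 \<cdot> m = k1"
    using pb_lift[OF pb, of k0 k1] k by auto
  have "d \<cdot> h0 = m \<cdot> i"
    by (rule pb_uniq[OF pb]) (use h e in \<open>simp_all add: reassoc[OF m(1)] reassoc[OF m(2)]\<close>)
  then obtain l where "l \<in> Arr C" "Dom C l = Cod C i" "Cod C l = Cod C r" "l \<cdot> i = h0" "d \<cdot> l = m"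
    using anodyne_lift[of i d h0 m] by auto
  then show thesis using that[of l] m by (simp add: e)
qed

lemma fpath_ex:
  assumes "j \<in> Fib C"
  obtains r e0 e1 where "fpath C j r e0 e1"
proof -
  obtain q1 q2 where pb: "is_pullback C j j q1 q2" using pb_ex[OF assms, of j] assms by auto
  note [simp] = pbD(4-8)[OF pb] assms
  obtain m where [simp]: "m \<in> Arr C" "Dom C m = Dom C j" "Cod C m = Dom C q1"
    and m: "q1 \<cdot> m = Idn C (Dom C j)" "q2 \<cdot> m = Idn C (Dom C j)"
    using pb_lift[OF pb, of "Idn C (Dom C j)" "Idn C (Dom C j)"] by auto
  obtain r d where rd: "anodyne C r" "d \<in> Fib C" "Dom C d = Cod C r" "m = d \<cdot> r"
    using factorisation[of m] by auto
  have "Dom C r = Dom C j" "Cod C d = Dom C q1"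
    using rd \<open>Dom C m = Dom C j\<close> \<open>Cod C m = Dom C q1\<close> by simp_all
  then have "fpath C j r (q1 \<cdot> d) (q2 \<cdot> d)"
    unfolding fpath_def using rd m pb by auto
  then show thesis by (rule that)
qed

lemma fhomotopicD:
  assumes "fhomotopic C j a b"
  shows "j \<in> Fib C" "a \<in> Arr C" "b \<in> Arr C" "Dom C b = Dom C a" "Cod C a = Dom C j" "Cod C b = Dom C j"
    "j \<cdot> a = j \<cdot> b"
proof -
  show "j \<in> Fib C" using assms unfolding fhomotopic_def by (elim conjE exE) (rule fpathD(1))
qed (use assms in \<open>simp_all add: fhomotopic_def\<close>)

text \<open>Any two path objects of \<open>j\<close> are related by a map that preserves endpoints
  and constant paths, obtained by lifting one \<open>r'\<close> against the other path fibration.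
  Hence a homotopy may be realised in whichever path object is at hand.\<close>

lemma fhomotopic_path:
  assumes "fhomotopic C j a b" and P: "fpath C j r e0 e1"
  obtains h where "h \<in> Arr C" "Dom C h = Dom C a" "Cod C h = Cod C r" "e0 \<cdot> h = a" "e1 \<cdot> h = b"
proof -
  obtain r' e0' e1' h' where P': "fpath C j r' e0' e1'"
    and [simp]: "h' \<in> Arr C" "Dom C h' = Dom C a" "Cod C h' = Cod C r'"
    and h': "e0' \<cdot> h' = a" "e1' \<cdot> h' = b"
    using assms(1) unfolding fhomotopic_def by auto
  note [simp] = fpathD[OF P'] fpathD[OF P]
  obtain h where "h \<in> Arr C" "Dom C h = Cod C r'" "Cod C h = Cod C r" "h \<cdot> r' = r" "e0 \<cdot> h = e0'" "e1 \<cdot> h = e1'"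
    using fpath_lift[OF P fpathD(2)[OF P'], of e0' e1' r] by auto
  then show thesis using that[of "h \<cdot> h'"] h' by (simp add: reassoc[where g=e0] reassoc[where g=e1])
qed

section \<open>Fibrewise homotopy as a congruence\<close>

lemma fhomotopicI:
  assumes "fpath C j r e0 e1" "h \<in> Arr C" "Cod C h = Cod C r" "e0 \<cdot> h = a" "e1 \<cdot> h = b"
  shows "fhomotopic C j a b"
proof -
  note [simp] = fpathD[OF assms(1)] assms(2,3)
  have "a \<in> Arr C" "b \<in> Arr C" "Dom C b = Dom C a" "Cod C a = Dom C j" "Cod C b = Dom C j"
    "Dom C h = Dom C a" "j \<cdot> a = j \<cdot> b"
    using assms(4,5) by (auto simp: reassoc[OF fpathD(12)[OF assms(1)]])
  then show ?thesis unfolding fhomotopic_def using assms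
    by (intro conjI exI[of _ r] exI[of _ e0] exI[of _ e1] bexI[of _ h]) simp_all
qed

lemma fhomotopic_refl:
  assumes [simp]: "j \<in> Fib C" "a \<in> Arr C" "Cod C a = Dom C j"
  shows "fhomotopic C j a a"
proof -
  obtain r e0 e1 where P: "fpath C j r e0 e1" using fpath_ex[OF assms(1)] .
  note [simp] = fpathD[OF P]
  show ?thesis by (rule fhomotopicI[OF P, of "r \<cdot> a"]) (simp_all add: reassoc[OF fpathD(10)[OF P]] reassoc[OF
      fpathD(11)[OF P]])
qed

lemma fhomotopic_pre:
  assumes "fhomotopic C j a b" "w \<in> Arr C" "Cod C w = Dom C a"
  shows "fhomotopic C j (a \<cdot> w) (b \<cdot> w)"
proof -
  obtain r e0 e1 h where P: "fpath C j r e0 e1"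
    and [simp]: "h \<in> Arr C" "Dom C h = Dom C a" "Cod C h = Cod C r"
    and h: "e0 \<cdot> h = a" "e1 \<cdot> h = b"
    using assms(1) unfolding fhomotopic_def by auto
  note [simp] = fpathD[OF P] assms(2,3)
  show ?thesis by (rule fhomotopicI[OF P, of "h \<cdot> w"]) (simp_all add: reassoc[OF h(1)] reassoc[OF h(2)])
qed

lemma fhomotopic_ext:
  assumes "anodyne C i" "fhomotopic C j (k0 \<cdot> i) (k1 \<cdot> i)"
    and "k0 \<in> Arr C" "k1 \<in> Arr C" "Dom C k0 = Cod C i" "Dom C k1 = Cod C i"
      "Cod C k0 = Dom C j" "Cod C k1 = Dom C j" "j \<cdot> k0 = j \<cdot> k1"
  shows "fhomotopic C j k0 k1"
proof -
  obtain r e0 e1 h0 where P: "fpath C j r e0 e1"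
    and h0: "h0 \<in> Arr C" "Dom C h0 = Dom C i" "Cod C h0 = Cod C r" "e0 \<cdot> h0 = k0 \<cdot> i" "e1 \<cdot> h0 = k1 \<cdot> i"
    using assms unfolding fhomotopic_def by auto
  obtain h where "h \<in> Arr C" "Dom C h = Cod C i" "Cod C h = Cod C r" "h \<cdot> i = h0" "e0 \<cdot> h = k0" "e1 \<cdot> h = k1"
    using fpath_lift[OF P assms(1) assms(3-9) h0] .
  then show ?thesis using fhomotopicI[OF P, of h] by simp
qed

text \<open>Path induction in the form used most often: when \<open>i\<close> is the inclusion of
  constant paths, two constructions that agree on constant paths are homotopic.\<close>

lemma fhomotopic_ext_eq:
  assumes "anodyne C i" "k0 \<cdot> i = k1 \<cdot> i" "j \<in> Fib C"
    and "k0 \<in> Arr C" "k1 \<in> Arr C" "Dom C k0 = Cod C i" "Dom C k1 = Cod C i"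
      "Cod C k0 = Dom C j" "Cod C k1 = Dom C j" "j \<cdot> k0 = j \<cdot> k1"
  shows "fhomotopic C j k0 k1"
proof -
  have "fhomotopic C j (k0 \<cdot> i) (k1 \<cdot> i)"
    using assms fhomotopic_refl[of j "k0 \<cdot> i"] by simp
  then show ?thesis using fhomotopic_ext assms by blast
qed

text \<open>The map \<open>u\<close> may change the base as well, covering some \<open>v\<close>. It
  suffices to treat the two endpoint maps of the path object, where \<open>u \<cdot> e0\<close> and
  \<open>u \<cdot> e1\<close> agree on constant paths.\<close>

lemma fhomotopic_post:
  assumes "fhomotopic C j a b" and "j' \<in> Fib C" "u \<in> Arr C" "v \<in> Arr C" "Dom C u = Dom C j" "Cod C u = Dom C j'"
    "Dom C v = Cod C j" "Cod C v = Cod C j'" "j' \<cdot> u = v \<cdot> j"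
  shows "fhomotopic C j' (u \<cdot> a) (u \<cdot> b)"
proof -
  obtain r e0 e1 h where P: "fpath C j r e0 e1"
    and [simp]: "h \<in> Arr C" "Dom C h = Dom C a" "Cod C h = Cod C r"
    and h: "e0 \<cdot> h = a" "e1 \<cdot> h = b"
    using assms(1) unfolding fhomotopic_def by auto
  note [simp] = fpathD[OF P] assms(2-8)
  have "fhomotopic C j' (u \<cdot> e0) (u \<cdot> e1)"
    by (rule fhomotopic_ext_eq[of r]) (simp_all add: reassoc[OF assms(9)])
  from fhomotopic_pre[OF this, of h] show ?thesis by (simp add: h)
qed

lemma fhomotopic_sym:
  assumes "fhomotopic C j a b"
  shows "fhomotopic C j b a"
proof -
  obtain r e0 e1 h where P: "fpath C j r e0 e1"
    and [simp]: "h \<in> Arr C" "Dom C h = Dom C a" "Cod C h = Cod C r"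
    and h: "e0 \<cdot> h = a" "e1 \<cdot> h = b"
    using assms(1) unfolding fhomotopic_def by auto
  note [simp] = fpathD[OF P]
  have "fhomotopic C j e1 e0" by (rule fhomotopic_ext_eq[of r]) simp_all
  from fhomotopic_pre[OF this, of h] show ?thesis by (simp add: h)
qed

text \<open>The graph \<open>w \<mapsto> (w, r (f w))\<close> is a pullback of \<open>r\<close> along the fibration \<open>s2\<close>.\<close>

lemma anodyne_graph:
  assumes pb: "is_pullback C f e s1 s2" and f: "f \<in> Fib C" and r: "anodyne C r"
    and [simp]: "Dom C r = Cod C f" "Dom C e = Cod C r" and er: "e \<cdot> r = Idn C (Cod C f)"
  obtains i where "anodyne C i" "Dom C i = Dom C f" "Cod C i = Dom C s1"
    "s1 \<cdot> i = Idn C (Dom C f)" "s2 \<cdot> i = r \<cdot> f"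
proof -
  note [simp] = pbD(1-8)[OF pb] r
  have f_e: "f \<cdot> s1 = e \<cdot> s2" by (rule pbD(9)[OF pb])
  obtain i where [simp]: "i \<in> Arr C" "Dom C i = Dom C f" "Cod C i = Dom C s1"
    and i: "s1 \<cdot> i = Idn C (Dom C f)" "s2 \<cdot> i = r \<cdot> f"
    using pb_lift[OF pb, of "Idn C (Dom C f)" "r \<cdot> f"] by (auto simp: reassoc[OF er])
  have "is_pullback C s2 r i f"
  proof (rule pbI)
    fix a b assume [simp]: "a \<in> Arr C" "b \<in> Arr C" "Dom C b = Dom C a" "Cod C a = Dom C s2"
      and "Cod C b = Dom C r" and e: "s2 \<cdot> a = r \<cdot> b"
    have [simp]: "Cod C b = Cod C f" using \<open>Cod C b = Dom C r\<close> by simp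
    have [simp]: "Cod C a = Dom C s1" using \<open>Cod C a = Dom C s2\<close> by simp
    have fb: "f \<cdot> (s1 \<cdot> a) = b" by (simp add: reassoc[OF f_e] e reassoc[OF er])
    have "i \<cdot> (s1 \<cdot> a) = a"
      by (rule pb_uniq[OF pb]) (simp_all add: reassoc[OF i(1)] reassoc[OF i(2)] fb e)
    then show "\<exists>h. h \<in> Arr C \<and> Dom C h = Dom C a \<and> Cod C h = Dom C i \<and> i \<cdot> h = a \<and> f \<cdot> h = b"
      using fb by (intro exI[of _ "s1 \<cdot> a"]) simp
  next
    fix h k assume [simp]: "h \<in> Arr C" "k \<in> Arr C" "Dom C k = Dom C h" "Cod C h = Dom C i" "Cod C k = Dom C i"
      and e: "i \<cdot> h = i \<cdot> k"
    have "s1 \<cdot> (i \<cdot> h) = s1 \<cdot> (i \<cdot> k)" using e by simp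
    then show "h = k" by (simp add: reassoc[OF i(1)])
  qed (simp_all add: i)
  then have "anodyne C i" using anodyne_stable[OF r] fib_pb2[OF pb f] by blast
  then show thesis using that[of i] i by simp
qed

lemma fhomotopic_trans:
  assumes ab: "fhomotopic C j a b" and bc: "fhomotopic C j b c"
  shows "fhomotopic C j a c"
proof -
  obtain r e0 e1 h where P: "fpath C j r e0 e1"
    and [simp]: "h \<in> Arr C" "Dom C h = Dom C a" "Cod C h = Cod C r"
    and h: "e0 \<cdot> h = a" "e1 \<cdot> h = b"
    using assms(1) unfolding fhomotopic_def by auto
  note [simp] = fpathD[OF P] fhomotopicD(4)[OF ab]
  obtain k where [simp]: "k \<in> Arr C" "Dom C k = Dom C a" "Cod C k = Cod C r"
    and k: "e0 \<cdot> k = b" "e1 \<cdot> k = c"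
    using fhomotopic_path[OF bc P] by auto
  \<comment> \<open>Points of this pullback are composable pairs of paths, and \<open>i\<close>
    below appends the constant path at the end of a path. Restricted along \<open>i\<close>, the
    outer endpoints are those of the first path, so they are joined by that path.\<close>
  obtain s1 s2 where pb: "is_pullback C e1 e0 s1 s2" using pb_ex[of e0 e1] by auto
  note [simp] = pbD(4-8)[OF pb]
  obtain i where i: "anodyne C i" "Dom C i = Dom C e1" "Cod C i = Dom C s1"
    "s1 \<cdot> i = Idn C (Dom C e1)" "s2 \<cdot> i = r \<cdot> e1"
    using anodyne_graph[OF pb, of r] by auto
  note [simp] = i(1-3)
  have "fhomotopic C j ((e0 \<cdot> s1) \<cdot> i) ((e1 \<cdot> s2) \<cdot> i)"
    using fhomotopicI[OF P, of "Idn C (Cod C r)"] by (simp add: i(4,5) reassoc[OF fpathD(11)[OF P]])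
  then have *: "fhomotopic C j (e0 \<cdot> s1) (e1 \<cdot> s2)"
    by (rule fhomotopic_ext[OF i(1)]) (simp_all add: reassoc[OF fpathD(12)[OF P]] pbD(9)[OF pb])
  obtain l where [simp]: "l \<in> Arr C" "Dom C l = Dom C a" "Cod C l = Dom C s1" and l: "s1 \<cdot> l = h" "s2 \<cdot> l = k"
    using pb_lift[OF pb, of h k] h k by auto
  from fhomotopic_pre[OF *, of l] show ?thesis by (simp add: l h k)
qed

text \<open>Path lifting for the fibration \<open>g\<close>: a homotopy that starts at
  \<open>g \<cdot> a\<close> is followed upwards. The new point lies over \<open>b\<close> strictly,
  which later turns equations up to homotopy into equations.\<close>

lemma fhomotopic_transport:
  assumes [simp]: "g \<in> Fib C" "j \<in> Fib C" "Cod C g = Dom C j" "a \<in> Arr C" "Cod C a = Dom C g"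
    and H: "fhomotopic C j (g \<cdot> a) b"
  obtains a' where "a' \<in> Arr C" "Dom C a' = Dom C a" "Cod C a' = Dom C g" "g \<cdot> a' = b"
      "fhomotopic C (j \<cdot> g) a a'"
proof -
  obtain r e0 e1 h where P: "fpath C j r e0 e1"
    and [simp]: "h \<in> Arr C" "Dom C h = Dom C a" "Cod C h = Cod C r"
    and h: "e0 \<cdot> h = g \<cdot> a" "e1 \<cdot> h = b"
    using H unfolding fhomotopic_def by auto
  note [simp] = fpathD[OF P]
  obtain s1 s2 where pb: "is_pullback C g e0 s1 s2" using pb_ex[of e0 g] by auto
  note [simp] = pbD(4-8)[OF pb]
  obtain i where i: "anodyne C i" "Dom C i = Dom C g" "Cod C i = Dom C s1"
    "s1 \<cdot> i = Idn C (Dom C g)" "s2 \<cdot> i = r \<cdot> g"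
    using anodyne_graph[OF pb, of r] by auto
  note [simp] = i(1-3)
  \<comment> \<open>The map \<open>t\<close> transports a point along a path starting below it. It
    is prescribed to be the identity on constant paths and extends to all paths because
    \<open>i\<close> is anodyne and \<open>g\<close> is a fibration.\<close>
  obtain t where [simp]: "t \<in> Arr C" "Dom C t = Dom C s1" "Cod C t = Dom C g"
    and t: "t \<cdot> i = Idn C (Dom C g)" "g \<cdot> t = e1 \<cdot> s2"
    using anodyne_lift[OF i(1), of g "Idn C (Dom C g)" "e1 \<cdot> s2"]
    by (auto simp: i(4,5) reassoc[OF fpathD(11)[OF P]])
  have *: "fhomotopic C (j \<cdot> g) s1 t"
    by (rule fhomotopic_ext_eq[OF i(1)])
      (simp_all add: i(4) t reassoc[OF fpathD(12)[OF P]] pbD(9)[OF pb])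
  obtain l where [simp]: "l \<in> Arr C" "Dom C l = Dom C a" "Cod C l = Dom C s1" and l: "s1 \<cdot> l = a" "s2 \<cdot> l = h"
    using pb_lift[OF pb, of a h] h by auto
  show thesis
    by (rule that[of "t \<cdot> l"]) (use fhomotopic_pre[OF *, of l] in \<open>simp_all add: reassoc[OF t(2)] l h\<close>)
qed

text \<open>The pullback of a fibered path object along \<open>f\<close> serves as one for
  \<open>j'\<close>. That \<open>f\<close> is a fibration enters through the constant paths:
  \<open>r\<close> stays anodyne under pullback only along fibrations.\<close>

lemma fhomotopic_pullback:
  assumes pb: "is_pullback C f j j' w" and [simp]: "f \<in> Fib C" and H: "fhomotopic C j (w \<cdot> a) (w \<cdot> b)"
    and [simp]: "a \<in> Arr C" "b \<in> Arr C" "Dom C b = Dom C a" "Cod C a = Dom C j'" "Cod C b = Dom C j'"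
    and e: "j' \<cdot> a = j' \<cdot> b"
  shows "fhomotopic C j' a b"
proof -
  note [simp] = pbD(1-8)[OF pb]
  have j: "j \<in> Fib C" and [simp]: "j' \<in> Fib C" using fhomotopicD(1)[OF H] fib_pb1[OF pb] by auto
  obtain r e0 e1 h where P: "fpath C j r e0 e1"
    and [simp]: "h \<in> Arr C" "Dom C h = Dom C a" "Cod C h = Cod C r"
    and h: "e0 \<cdot> h = w \<cdot> a" "e1 \<cdot> h = w \<cdot> b"
    using H unfolding fhomotopic_def by auto
  note [simp] = fpathD(2-9)[OF P] j
  note P10 = fpathD(10)[OF P] and P11 = fpathD(11)[OF P] and P12 = fpathD(12)[OF P]
  obtain s1 s2 where pb': "is_pullback C f (j \<cdot> e0) s1 s2" using pb_ex[of "j \<cdot> e0" f] by auto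
  note [simp] = pbD(4-8)[OF pb']
  note e' = pbD(9)[OF pb'] and e'' = pbD(9)[OF pb]
  obtain r' where [simp]: "r' \<in> Arr C" "Dom C r' = Dom C j'" "Cod C r' = Dom C s1"
    and r': "s1 \<cdot> r' = j'" "s2 \<cdot> r' = r \<cdot> w"
    using pb_lift[OF pb', of j' "r \<cdot> w"] by (auto simp: e'' reassoc[OF P10])
  \<comment> \<open>This exhibits the constant paths \<open>r'\<close> of the pulled back family as
    the pullback of \<open>r\<close> along \<open>s2\<close>, which is a fibration as a pullback of
    \<open>f\<close>.\<close>
  have "is_pullback C s2 r r' w"
  proof (rule pbI)
    fix x y assume [simp]: "x \<in> Arr C" "y \<in> Arr C" "Dom C y = Dom C x" and x: "Cod C x = Dom C s2"
      "Cod C y = Dom C r" and xy: "s2 \<cdot> x = r \<cdot> y"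
    have [simp]: "Cod C x = Dom C s1" "Cod C y = Dom C j" using x by simp_all
    have "f \<cdot> (s1 \<cdot> x) = j \<cdot> y" by (simp add: reassoc[OF e'] xy reassoc[OF P10])
    then obtain z where [simp]: "z \<in> Arr C" "Dom C z = Dom C x" "Cod C z = Dom C j'"
      and z: "j' \<cdot> z = s1 \<cdot> x" "w \<cdot> z = y"
      using pb_lift[OF pb, of "s1 \<cdot> x" y] by auto
    have "r' \<cdot> z = x"
      by (rule pb_uniq[OF pb']) (simp_all add: reassoc[OF r'(1)] reassoc[OF r'(2)] z xy)
    then show "\<exists>h. h \<in> Arr C \<and> Dom C h = Dom C x \<and> Cod C h = Dom C r' \<and> r' \<cdot> h = x \<and> w \<cdot> h = y"
      using z by (intro exI[of _ z]) simp
  next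
    fix h k assume [simp]: "h \<in> Arr C" "k \<in> Arr C" "Dom C k = Dom C h" "Cod C h = Dom C r'" "Cod C k = Dom C r'"
      and hk: "r' \<cdot> h = r' \<cdot> k" "w \<cdot> h = w \<cdot> k"
    have "s1 \<cdot> (r' \<cdot> h) = s1 \<cdot> (r' \<cdot> k)" using hk by simp
    then have "j' \<cdot> h = j' \<cdot> k" by (simp add: reassoc[OF r'(1)])
    then show "h = k" using hk by - (rule pb_uniq[OF pb], simp_all)
  qed (simp_all add: r')
  then have [simp]: "anodyne C r'" using anodyne_stable[of r s2 r' w] fib_pb2[OF pb'] by simp
  obtain k0 where [simp]: "k0 \<in> Arr C" "Dom C k0 = Dom C s1" "Cod C k0 = Dom C j'"
    and k0: "j' \<cdot> k0 = s1" "w \<cdot> k0 = e0 \<cdot> s2"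
    using pb_lift[OF pb, of s1 "e0 \<cdot> s2"] by (auto simp: e')
  obtain k1 where [simp]: "k1 \<in> Arr C" "Dom C k1 = Dom C s1" "Cod C k1 = Dom C j'"
    and k1: "j' \<cdot> k1 = s1" "w \<cdot> k1 = e1 \<cdot> s2"
    using pb_lift[OF pb, of s1 "e1 \<cdot> s2"] by (auto simp: e' reassoc[OF P12])
  have "k0 \<cdot> r' = Idn C (Dom C j')"
    by (rule pb_uniq[OF pb]) (simp_all add: reassoc[OF k0(1)] reassoc[OF k0(2)] r' reassoc[OF P10])
  moreover have "k1 \<cdot> r' = Idn C (Dom C j')"
    by (rule pb_uniq[OF pb]) (simp_all add: reassoc[OF k1(1)] reassoc[OF k1(2)] r' reassoc[OF P11])
  ultimately have *: "fhomotopic C j' k0 k1"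
    by (intro fhomotopic_ext_eq[of r']) (simp_all add: k0 k1)
  obtain h' where [simp]: "h' \<in> Arr C" "Dom C h' = Dom C a" "Cod C h' = Dom C s1"
    and h': "s1 \<cdot> h' = j' \<cdot> a" "s2 \<cdot> h' = h"
    using pb_lift[OF pb', of "j' \<cdot> a" h] by (auto simp: h reassoc[OF e''])
  have "k0 \<cdot> h' = a"
    by (rule pb_uniq[OF pb]) (simp_all add: reassoc[OF k0(1)] reassoc[OF k0(2)] h' h)
  moreover have "k1 \<cdot> h' = b"
    by (rule pb_uniq[OF pb]) (simp_all add: reassoc[OF k1(1)] reassoc[OF k1(2)] h' h e)
  ultimately show ?thesis using fhomotopic_pre[OF *, of h'] by simp
qed

end

section \<open>Path monic fibrations\<close>

definition path_monic :: "('o, 'm, 'x) fcat_scheme \<Rightarrow> 'm \<Rightarrow> bool" where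
  "path_monic C j \<longleftrightarrow> j \<in> Fib C \<and>
     (\<forall>a b. a \<in> Arr C \<longrightarrow> b \<in> Arr C \<longrightarrow> Dom C b = Dom C a \<longrightarrow> Cod C a = Dom C j \<longrightarrow> Cod C b = Dom C j \<longrightarrow>
        j \<cdot>\<^bsub>C\<^esub> a = j \<cdot>\<^bsub>C\<^esub> b \<longrightarrow> fhomotopic C j a b)"

context tribe
begin

lemma path_monicD:
  assumes "path_monic C j"
  shows "j \<in> Fib C"
    and "\<lbrakk>a \<in> Arr C; b \<in> Arr C; Dom C b = Dom C a; Cod C a = Dom C j; Cod C b = Dom C j; j \<cdot> a = j \<cdot> b\<rbrakk>
      \<Longrightarrow> fhomotopic C j a b"
  using assms unfolding path_monic_def by simp_all

text \<open>The two projections of the fibre product are the universal pair of points in a common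
  fibre, and every other pair arises by precomposition.\<close>

lemma path_monicI:
  assumes pb: "is_pullback C j j q1 q2" and H: "fhomotopic C j q1 q2"
  shows "path_monic C j"
  unfolding path_monic_def
proof (intro conjI allI impI)
  show "j \<in> Fib C" by (rule fhomotopicD(1)[OF H])
  fix a b assume [simp]: "a \<in> Arr C" "b \<in> Arr C" "Dom C b = Dom C a" "Cod C a = Dom C j" "Cod C b = Dom C j"
    and e: "j \<cdot> a = j \<cdot> b"
  obtain h where [simp]: "h \<in> Arr C" "Dom C h = Dom C a" "Cod C h = Dom C q1" and h: "q1 \<cdot> h = a" "q2 \<cdot> h = b"
    using pb_lift[OF pb, of a b] e by auto
  show "fhomotopic C j a b" using fhomotopic_pre[OF H, of h] by (simp add: h)
qed

lemma path_monic_pullback: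
  assumes "path_monic C j" "is_pullback C f j j' w" "f \<in> Fib C"
  shows "path_monic C j'"
  unfolding path_monic_def
proof (intro conjI allI impI)
  note [simp] = path_monicD(1)[OF assms(1)] pbD(1-8)[OF assms(2)]
  show "j' \<in> Fib C" using fib_pb1[OF assms(2)] by simp
  fix a b assume [simp]: "a \<in> Arr C" "b \<in> Arr C" "Dom C b = Dom C a" "Cod C a = Dom C j'" "Cod C b = Dom C j'"
    and e: "j' \<cdot> a = j' \<cdot> b"
  have "fhomotopic C j (w \<cdot> a) (w \<cdot> b)"
    by (rule path_monicD(2)[OF assms(1)]) (simp_all add: reassoc[OF pbD(9)[OF assms(2), symmetric]] e)
  then show "fhomotopic C j' a b"
    by (rule fhomotopic_pullback[OF assms(2,3)]) (simp_all add: e)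
qed

text \<open>Points with the same image under \<open>g \<cdot> f\<close> first have homotopic images
  under \<open>f\<close>. Transport along that homotopy moves \<open>a\<close> into the fibre of
  \<open>f\<close> that contains \<open>b\<close>, where the hypothesis on \<open>f\<close>
  applies.\<close>

lemma path_monic_cmp:
  assumes 1: "path_monic C f" and 2: "path_monic C g" and [simp]: "Dom C g = Cod C f"
  shows "path_monic C (g \<cdot> f)"
  unfolding path_monic_def
proof (intro conjI allI impI)
  note [simp] = path_monicD(1)[OF 1] path_monicD(1)[OF 2]
  show "g \<cdot> f \<in> Fib C" by simp
  fix a b assume [simp]: "a \<in> Arr C" "b \<in> Arr C" "Dom C b = Dom C a"
    and c: "Cod C a = Dom C (g \<cdot> f)" "Cod C b = Dom C (g \<cdot> f)" and e: "(g \<cdot> f) \<cdot> a = (g \<cdot> f) \<cdot> b"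
  have [simp]: "Cod C a = Dom C f" "Cod C b = Dom C f" using c by simp_all
  have "fhomotopic C g (f \<cdot> a) (f \<cdot> b)" by (rule path_monicD(2)[OF 2]) (use e in simp_all)
  then obtain a' where [simp]: "a' \<in> Arr C" "Dom C a' = Dom C a" "Cod C a' = Dom C f"
    and a': "f \<cdot> a' = f \<cdot> b" "fhomotopic C (g \<cdot> f) a a'"
    using fhomotopic_transport[of f g a "f \<cdot> b"] by auto
  have "fhomotopic C f a' b" by (rule path_monicD(2)[OF 1]) (simp_all add: a')
  then have "fhomotopic C (g \<cdot> f) (Idn C (Dom C f) \<cdot> a') (Idn C (Dom C f) \<cdot> b)"
    by (rule fhomotopic_post[where v = g]) simp_all
  then show "fhomotopic C (g \<cdot> f) a b" using fhomotopic_trans[OF a'(2)] by simp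
qed

section \<open>Comparison with homotopies that have no base\<close>

lemma terminal_obtain:
  obtains u bang where "is_terminal C u" "\<And>X. X \<in> Obj C \<Longrightarrow> bang X \<in> Fib C"
    "\<And>X. X \<in> Obj C \<Longrightarrow> Dom C (bang X) = X" "\<And>X. X \<in> Obj C \<Longrightarrow> Cod C (bang X) = u"
    "\<And>f g. \<lbrakk>f \<in> Arr C; g \<in> Arr C; Dom C f = Dom C g; Cod C f = u; Cod C g = u\<rbrakk> \<Longrightarrow> f = g"
proof -
  obtain u where u: "is_terminal C u" "\<forall>X\<in>Obj C. \<forall>f\<in>Hom C X u. f \<in> Fib C"
    using terminal_fibrant by blast
  define bang where "bang X = (THE f. f \<in> Hom C X u)" for X
  have b: "bang X \<in> Hom C X u" if "X \<in> Obj C" for X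
    using u(1) that theI'[of "\<lambda>f. f \<in> Hom C X u"] unfolding bang_def is_terminal_def by blast
  show thesis
  proof (rule that[of u bang])
    fix f g assume *: "f \<in> Arr C" "g \<in> Arr C" "Dom C f = Dom C g" "Cod C f = u" "Cod C g = u"
    then have "f \<in> Hom C (Dom C g) u" "g \<in> Hom C (Dom C g) u" "Dom C g \<in> Obj C" by simp_all
    then show "f = g" using u(1) unfolding is_terminal_def by blast
  next
    fix X assume "X \<in> Obj C"
    then show "bang X \<in> Fib C" using u(2) b by blast
  qed (use u(1) b in simp_all)
qed

lemma path_object_fpath:
  assumes "is_terminal C u" "x \<in> Hom C X u" "x \<in> Fib C"
  shows "path_object C X q1 q2 r d \<Longrightarrow> fpath C x r (q1 \<cdot> d) (q2 \<cdot> d)"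
    and "\<lbrakk>fpath C x r e0 e1\<rbrakk> \<Longrightarrow> \<exists>q1 q2 d. path_object C X q1 q2 r d \<and> e0 = q1 \<cdot> d \<and> e1 = q2 \<cdot> d"
proof -
  have X: "X \<in> Obj C" using assms(2) dom_obj[of x] by simp
  note pr = product_iff_pb[OF assms(1,2,2)]
  have idx: "x \<cdot> Idn C X = x" using assms X by simp
  {
    assume P: "path_object C X q1 q2 r d"
    then have pb: "is_pullback C x x q1 q2" by (simp add: path_object_def pr)
    note [simp] = pbD(4-8)[OF pb]
    have [simp]: "Dom C x = X" "d \<in> Fib C" "anodyne C r" "Dom C r = X" "Dom C d = Cod C r" "Cod C d = Dom C q1"
      using assms P by (simp_all add: path_object_def)
    have dr: "d \<cdot> r = tuple C q1 q2 (Idn C X) (Idn C X)"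
      using P by (simp add: path_object_def)
    note t = pb_tuple[OF pb, of "Idn C X" "Idn C X", folded dr]
    have "q1 \<cdot> (d \<cdot> r) = Idn C X" "q2 \<cdot> (d \<cdot> r) = Idn C X" using t X by simp_all
    then show "fpath C x r (q1 \<cdot> d) (q2 \<cdot> d)"
      unfolding fpath_def using assms(3) pb by (intro conjI exI[of _ q1] exI[of _ q2] exI[of _ d]) simp_all
  next
    assume P: "fpath C x r e0 e1"
    obtain q1 q2 d where pb: "is_pullback C x x q1 q2" and [simp]: "d \<in> Fib C" "Dom C d = Cod C r"
      "Cod C d = Dom C q1" and e: "e0 = q1 \<cdot> d" "e1 = q2 \<cdot> d"
      using P unfolding fpath_def by blast
    note [simp] = pbD(4-8)[OF pb]
    have [simp]: "Dom C x = X" using assms by simp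
    have "tuple C q1 q2 (Idn C X) (Idn C X) = d \<cdot> r"
      by (rule pb_tuple_eq[OF pb]) (use fpathD[OF P] X in \<open>simp_all add: e\<close>)
    then have "path_object C X q1 q2 r d"
      unfolding path_object_def using fpathD[OF P] X pb by (simp add: pr)
    then show "\<exists>q1 q2 d. path_object C X q1 q2 r d \<and> e0 = q1 \<cdot> d \<and> e1 = q2 \<cdot> d"
      using e by blast
  }
qed

lemma homotopic_iff:
  assumes "is_terminal C u" "x \<in> Fib C" "Cod C x = u" and [simp]: "Dom C x = Cod C f"
  shows "homotopic C f g \<longleftrightarrow> fhomotopic C x f g"
proof
  assume H: "homotopic C f g"
  then obtain q1 q2 r d h where f: "f \<in> Arr C" "g \<in> Hom C (Dom C f) (Cod C f)"
    and P: "path_object C (Cod C f) q1 q2 r d" and h: "h \<in> Hom C (Dom C f) (Dom C d)"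
        "d \<cdot> h = tuple C q1 q2 f g"
    unfolding homotopic_def by blast
  have x: "x \<in> Hom C (Cod C f) u" using assms by simp
  have F: "fpath C x r (q1 \<cdot> d) (q2 \<cdot> d)" using path_object_fpath(1)[OF assms(1) x assms(2) P] .
  have pb: "is_pullback C x x q1 q2" using P product_iff_pb[OF assms(1) x x] by (simp add: path_object_def)
  have d: "d \<in> Fib C" "Cod C d = Dom C q1" "Dom C d = Cod C r" using P by (simp_all add: path_object_def)
  have "x \<cdot> f = x \<cdot> g"
  proof -
    have "\<exists>!k. k \<in> Hom C (Dom C f) u" using assms(1) dom_obj[OF f(1)] unfolding is_terminal_def by blast
    moreover have "x \<cdot> f \<in> Hom C (Dom C f) u" "x \<cdot> g \<in> Hom C (Dom C f) u" using f assms by simp_all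
    ultimately show ?thesis by blast
  qed
  then have t: "q1 \<cdot> tuple C q1 q2 f g = f" "q2 \<cdot> tuple C q1 q2 f g = g"
    using pb_tuple(4,5)[OF pb, of f g] f by simp_all
  show "fhomotopic C x f g"
    by (rule fhomotopicI[OF F, of h]) (use h d f t pbD(4-8)[OF pb] in simp_all)
next
  assume H: "fhomotopic C x f g"
  have x: "x \<in> Hom C (Cod C f) u" using assms by simp
  obtain r e0 e1 where "fpath C x r e0 e1" using fpath_ex[OF assms(2)] .
  moreover from this obtain q1 q2 d where P: "path_object C (Cod C f) q1 q2 r d" and e: "e0 = q1 \<cdot> d"
      "e1 = q2 \<cdot> d"
    using path_object_fpath(2)[OF assms(1) x assms(2)] by blast
  ultimately obtain h where h: "h \<in> Arr C" "Dom C h = Dom C f" "Cod C h = Cod C r" "(q1 \<cdot> d) \<cdot> h = f"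
      "(q2 \<cdot> d) \<cdot> h = g"
    using fhomotopic_path[OF H, of r e0 e1] by blast
  have pb: "is_pullback C x x q1 q2" using P product_iff_pb[OF assms(1) x x] by (simp add: path_object_def)
  have d: "d \<in> Fib C" "Cod C d = Dom C q1" "Dom C d = Cod C r" using P by (simp_all add: path_object_def)
  have "tuple C q1 q2 f g = d \<cdot> h"
    by (rule pb_tuple_eq[OF pb]) (use h d pbD(4-8)[OF pb] in simp_all)
  moreover have "h \<in> Hom C (Dom C f) (Dom C d)" using h d by simp
  ultimately have "\<exists>h\<in>Hom C (Dom C f) (Dom C d). d \<cdot> h = tuple C q1 q2 f g" by metis
  moreover have "f \<in> Arr C" "g \<in> Hom C (Dom C f) (Cod C f)" using fhomotopicD(2-6)[OF H] by simp_all
  ultimately show "homotopic C f g"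
    unfolding homotopic_def using P by (intro conjI exI)
qed

text \<open>Forgetting the base is postcomposition with an identity, regarded as a map from
  \<open>j\<close> to the fibration onto the terminal object.\<close>

lemma fhomotopic_homotopic:
  assumes H: "fhomotopic C j f g"
  shows "homotopic C f g"
proof -
  obtain u bang where u: "is_terminal C u" "\<And>X. X \<in> Obj C \<Longrightarrow> bang X \<in> Fib C"
    "\<And>X. X \<in> Obj C \<Longrightarrow> Dom C (bang X) = X" "\<And>X. X \<in> Obj C \<Longrightarrow> Cod C (bang X) = u"
    "\<And>f g. \<lbrakk>f \<in> Arr C; g \<in> Arr C; Dom C f = Dom C g; Cod C f = u; Cod C g = u\<rbrakk> \<Longrightarrow> f = g"
    by (rule terminal_obtain) blast
  note [simp] = fhomotopicD(1-6)[OF H] u(2-4)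
  have "fhomotopic C (bang (Cod C f)) (Idn C (Dom C j) \<cdot> f) (Idn C (Dom C j) \<cdot> g)"
    by (rule fhomotopic_post[OF H, where v = "bang (Cod C j)"]) (simp_all add: u(5))
  then show ?thesis using homotopic_iff[OF u(1), of "bang (Cod C f)" f g] by simp
qed

lemma homotopic_fhomotopic:
  assumes H: "homotopic C f g"
  obtains u x where "is_terminal C u" "x \<in> Fib C" "Dom C x = Cod C f" "Cod C x = u" "fhomotopic C x f g"
proof -
  obtain u bang where u: "is_terminal C u" "\<And>X. X \<in> Obj C \<Longrightarrow> bang X \<in> Fib C"
    "\<And>X. X \<in> Obj C \<Longrightarrow> Dom C (bang X) = X" "\<And>X. X \<in> Obj C \<Longrightarrow> Cod C (bang X) = u"
    by (rule terminal_obtain) blast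
  have "Cod C f \<in> Obj C" using H by (simp add: homotopic_def)
  then show thesis using that[OF u(1), of "bang (Cod C f)"] u(2-4) homotopic_iff[OF u(1), of "bang (Cod C f)" f
      g] H
    by simp
qed

lemma homotopicD:
  assumes "homotopic C f g"
  shows "f \<in> Arr C" "g \<in> Arr C" "Dom C g = Dom C f" "Cod C g = Cod C f"
  using assms by (simp_all add: homotopic_def)

lemma homotopic_refl: "f \<in> Arr C \<Longrightarrow> homotopic C f f"
  by (rule fhomotopic_homotopic[of "Idn C (Cod C f)"], rule fhomotopic_refl) simp_all

lemma homotopic_sym: "homotopic C f g \<Longrightarrow> homotopic C g f"
  by (meson fhomotopic_homotopic fhomotopic_sym homotopic_fhomotopic)

lemma homotopic_trans:
  assumes 1: "homotopic C f g" and 2: "homotopic C g h"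
  shows "homotopic C f h"
proof -
  obtain u x where u: "is_terminal C u" "x \<in> Fib C" "Dom C x = Cod C f" "Cod C x = u" "fhomotopic C x f g"
    using homotopic_fhomotopic[OF 1] .
  have "fhomotopic C x g h"
    using homotopic_iff[OF u(1,2,4), of g h] 2 u(3) homotopicD[OF 1] by simp
  then show ?thesis using fhomotopic_trans[OF u(5)] fhomotopic_homotopic by blast
qed

lemma homotopic_pre:
  assumes "homotopic C f g" "w \<in> Arr C" "Cod C w = Dom C f"
  shows "homotopic C (f \<cdot> w) (g \<cdot> w)"
  by (meson assms fhomotopic_homotopic fhomotopic_pre homotopic_fhomotopic)

lemma homotopic_post:
  assumes "homotopic C f g" "k \<in> Arr C" "Dom C k = Cod C f"
  shows "homotopic C (k \<cdot> f) (k \<cdot> g)"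
proof -
  obtain u bang where u: "is_terminal C u" "\<And>X. X \<in> Obj C \<Longrightarrow> bang X \<in> Fib C"
    "\<And>X. X \<in> Obj C \<Longrightarrow> Dom C (bang X) = X" "\<And>X. X \<in> Obj C \<Longrightarrow> Cod C (bang X) = u"
    "\<And>f g. \<lbrakk>f \<in> Arr C; g \<in> Arr C; Dom C f = Dom C g; Cod C f = u; Cod C g = u\<rbrakk> \<Longrightarrow> f = g"
    by (rule terminal_obtain) blast
  have o: "Cod C f \<in> Obj C" "Cod C k \<in> Obj C" "u \<in> Obj C"
    using homotopicD[OF assms(1)] assms(2) u(1) by (simp_all add: is_terminal_def)
  note [simp] = assms(2,3) u(2-4)[OF o(1)] u(2-4)[OF o(2)] o
  have "fhomotopic C (bang (Cod C f)) f g"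
    using homotopic_iff[OF u(1), of "bang (Cod C f)" f g] assms by simp
  then have "fhomotopic C (bang (Cod C k)) (k \<cdot> f) (k \<cdot> g)"
    by (rule fhomotopic_post[where v = "Idn C u"]) (simp_all add: u(5))
  then show ?thesis by (rule fhomotopic_homotopic)
qed

text \<open>The homotopy between the images is lifted by transport. This replaces \<open>a\<close>
  by a homotopic \<open>a'\<close> with \<open>j \<cdot> a' = j \<cdot> b\<close> strictly, and such
  points are homotopic.\<close>

lemma path_monic_cancel:
  assumes M: "path_monic C j" and H: "homotopic C (j \<cdot> a) (j \<cdot> b)"
    and [simp]: "a \<in> Arr C" "b \<in> Arr C" "Cod C a = Dom C j" "Cod C b = Dom C j"
  shows "homotopic C a b"
proof -
  note [simp] = path_monicD(1)[OF M]
  obtain u x where "x \<in> Fib C" "Dom C x = Cod C (j \<cdot> a)" "fhomotopic C x (j \<cdot> a) (j \<cdot> b)"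
    using homotopic_fhomotopic[OF H] by metis
  then obtain a' where [simp]: "a' \<in> Arr C" "Dom C a' = Dom C a" "Cod C a' = Dom C j"
    and a': "j \<cdot> a' = j \<cdot> b" "fhomotopic C (x \<cdot> j) a a'"
    using fhomotopic_transport[of j x a "j \<cdot> b"] by auto
  have "fhomotopic C j a' b"
    by (rule path_monicD(2)[OF M]) (use homotopicD(3)[OF H] a' in simp_all)
  then show ?thesis using homotopic_trans fhomotopic_homotopic a'(2) by blast
qed

text \<open>A homotopy between the projections \<open>q1\<close>, \<open>q2\<close> is a section
  \<open>h\<close> of the path fibration \<open>d\<close>. Then \<open>q1\<close> is a homotopy
  inverse of the diagonal \<open>d \<cdot> r\<close>.\<close>

lemma path_monic_homotopy_monic:
  assumes M: "path_monic C j"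
  shows "homotopy_monic C j"
proof -
  note [simp] = path_monicD(1)[OF M]
  obtain r e0 e1 where P: "fpath C j r e0 e1" using fpath_ex[of j] by auto
  obtain q1 q2 d where pb: "is_pullback C j j q1 q2" and [simp]: "d \<in> Fib C" "Dom C d = Cod C r"
      "Cod C d = Dom C q1" and e: "e0 = q1 \<cdot> d" "e1 = q2 \<cdot> d"
    using P unfolding fpath_def by blast
  note [simp] = pbD(4-8)[OF pb] fpathD(2-9)[OF P]
  note P10 = fpathD(10)[OF P] and P11 = fpathD(11)[OF P]
  have m: "tuple C q1 q2 (Idn C (Dom C j)) (Idn C (Dom C j)) = d \<cdot> r"
    by (rule pb_tuple_eq[OF pb]) (use P10 P11 in \<open>simp_all add: e\<close>)
  have "fhomotopic C j q1 q2" by (rule path_monicD(2)[OF M]) (simp_all add: pbD(9)[OF pb])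
  then obtain h where [simp]: "h \<in> Arr C" "Dom C h = Dom C q1" "Cod C h = Cod C r"
    and h: "e0 \<cdot> h = q1" "e1 \<cdot> h = q2"
    by (rule fhomotopic_path[OF _ P]) auto
  have dh: "d \<cdot> h = Idn C (Dom C q1)"
    by (rule pb_uniq[OF pb]) (use h in \<open>simp_all add: e\<close>)
  \<comment> \<open>Every path contracts to the constant path at its source. Inserting the section
    \<open>h\<close> and projecting by \<open>d\<close> turns this contraction into the homotopy
    from the diagonal after \<open>q1\<close> to the identity.\<close>
  have "fhomotopic C (j \<cdot> e0) (r \<cdot> e0) (Idn C (Cod C r))"
    by (rule fhomotopic_ext_eq[of r]) (simp_all add: P10 reassoc[OF P10])
  then have "homotopic C (r \<cdot> e0) (Idn C (Cod C r))" by (rule fhomotopic_homotopic)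
  from homotopic_post[OF homotopic_pre[OF this, of h], of d]
  have "homotopic C ((d \<cdot> r) \<cdot> q1) (Idn C (Dom C q1))" by (simp add: h dh)
  moreover have "homotopic C (q1 \<cdot> (d \<cdot> r)) (Idn C (Dom C j))"
    using P10 homotopic_refl[of "Idn C (Dom C j)"] by (simp add: e)
  ultimately have "homotopy_equivalence C (d \<cdot> r)"
    unfolding homotopy_equivalence_def by (intro conjI bexI[of _ q1]) simp_all
  then show ?thesis unfolding homotopy_monic_def using pb m by (intro conjI exI[of _ q1] exI[of _ q2]) simp_all
qed

text \<open>Used with the diagonal for \<open>m\<close> and a pulled back path fibration for
  \<open>g\<close>. Composing \<open>k\<close> with a homotopy inverse of \<open>m\<close> gives a
  section of \<open>g\<close> up to homotopy, and transport along \<open>g\<close> makes it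
  strict.\<close>

lemma homotopy_monic_section:
  assumes H: "homotopy_equivalence C m" and [simp]: "g \<in> Fib C" "k \<in> Arr C" "Dom C k = Dom C m"
    "Cod C k = Dom C g" and gk: "g \<cdot> k = m"
  obtains s where "s \<in> Arr C" "Dom C s = Cod C g" "Cod C s = Dom C g" "g \<cdot> s = Idn C (Cod C g)"
proof -
  obtain n where [simp]: "m \<in> Arr C" "n \<in> Arr C" "Dom C n = Cod C m" "Cod C n = Dom C m"
    and n: "homotopic C (m \<cdot> n) (Idn C (Cod C m))"
    using H unfolding homotopy_equivalence_def by auto
  have [simp]: "Cod C m = Cod C g" using gk by auto
  have "homotopic C (g \<cdot> (k \<cdot> n)) (Idn C (Cod C g))" using n by (simp add: reassoc[OF gk])
  then obtain x where "x \<in> Fib C" "Dom C x = Cod C g" "fhomotopic C x (g \<cdot> (k \<cdot> n)) (Idn C (Cod C g))"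
    using homotopic_fhomotopic by (metis \<open>Cod C m = Cod C g\<close> \<open>Cod C n = Dom C m\<close> \<open>Dom C k = Dom C m\<close> \<open>k \<in> Arr C\<close>
        \<open>n \<in> Arr C\<close> \<open>Cod C k = Dom C g\<close> arr_cmp assms(2) cod_cmp fib_in_arr)
  then show thesis using fhomotopic_transport[of g x "k \<cdot> n" "Idn C (Cod C g)"] that by auto
qed

text \<open>If the identity types of \<open>p\<close> are inhabited over \<open>Z\<close> then they are propositions: a
  contraction \<open>a\<close> can be normalised to \<open>k(y, y') = a(y, y)\<inverse> \<cdot> a(y, y')\<close>, and every path
  \<open>y = y'\<close> is homotopic to \<open>k(y, y')\<close> because this holds for the constant paths.\<close>

lemma path_space_sections_homotopic:
  assumes p: "p \<in> Fib C" and pb: "is_pullback C p p q1 q2" and d: "d \<in> Fib C" "Dom C d = Cod C r"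
      "Cod C d = Dom C q1"
    and r: "anodyne C r" "Dom C r = Dom C p"
    and dr: "q1 \<cdot> (d \<cdot> r) = Idn C (Dom C p)" "q2 \<cdot> (d \<cdot> r) = Idn C (Dom C p)"
    and z: "z \<in> Fib C" and pbz: "is_pullback C (p \<cdot> q1) z v n"
    and ab: "a \<in> Arr C" "b \<in> Arr C" "Dom C a = Dom C v" "Dom C b = Dom C v" "Cod C a = Dom C d"
        "Cod C b = Dom C d"
      "d \<cdot> a = v" "d \<cdot> b = v"
  shows "fhomotopic C d a b"
proof -
  note [simp] = p pbD(4-8)[OF pb] d r pbD(4-6)[OF pbz]
  have [simp]: "Cod C v = Dom C q1" "Cod C n = Dom C z" using pbD[OF pbz] by simp_all
  have vf [simp]: "v \<in> Fib C" using fib_pb1[OF pbz z] .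
  have qf [simp]: "q1 \<in> Fib C" "q2 \<in> Fib C" using fib_pb1[OF pb] fib_pb2[OF pb] by simp_all
  note pq = pbD(9)[OF pb] and vn = pbD(9)[OF pbz]
  have dr1: "q1 \<cdot> (d \<cdot> (r \<cdot> x)) = x" if "x \<in> Arr C" "Cod C x = Dom C p" for x
    using that reassoc[OF dr(1), of x] by simp
  have dr2: "q2 \<cdot> (d \<cdot> (r \<cdot> x)) = x" if "x \<in> Arr C" "Cod C x = Dom C p" for x
    using that reassoc[OF dr(2), of x] by simp
  \<comment> \<open>Points of this pullback are pairs of paths with a common source. The map
    \<open>i\<close> below pairs a path with the constant path at its source.\<close>
  obtain s1 s2 where pbs: "is_pullback C (q1 \<cdot> d) (q1 \<cdot> d) s1 s2" using pb_ex[of "q1 \<cdot> d" "q1 \<cdot> d"] by auto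
  have [simp]: "s1 \<in> Arr C" "s2 \<in> Arr C" "Dom C s2 = Dom C s1" "Cod C s1 = Cod C r" "Cod C s2 = Cod C r"
    using pbD[OF pbs] by simp_all
  have ss: "q1 \<cdot> (d \<cdot> s1) = q1 \<cdot> (d \<cdot> s2)" using pbD(9)[OF pbs] by simp
  obtain i where i: "anodyne C i" "Dom C i = Cod C r" "Cod C i = Dom C s1"
    "s1 \<cdot> i = Idn C (Cod C r)" "s2 \<cdot> i = r \<cdot> (q1 \<cdot> d)"
    using anodyne_graph[OF pbs, of r] dr by auto
  note [simp] = i(1-3)
  have pss: "p \<cdot> (q2 \<cdot> (d \<cdot> s2)) = p \<cdot> (q2 \<cdot> (d \<cdot> s1))"
    using ss by (simp add: reassoc[OF pq[symmetric]])
  \<comment> \<open>The pair \<open>k\<close> prescribes the endpoints of the path that runs back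
    along \<open>s2\<close> and then along \<open>s1\<close>. The lift \<open>c\<close> below is
    this composite, fixed by the requirement that nothing changes when \<open>s2\<close> is
    constant.\<close>
  obtain k where [simp]: "k \<in> Arr C" "Dom C k = Dom C s1" "Cod C k = Dom C q1"
    and k: "q1 \<cdot> k = q2 \<cdot> (d \<cdot> s2)" "q2 \<cdot> k = q2 \<cdot> (d \<cdot> s1)"
    using pb_lift[OF pb, of "q2 \<cdot> (d \<cdot> s2)" "q2 \<cdot> (d \<cdot> s1)"] pss by auto
  have ki: "k \<cdot> i = d"
    by (rule pb_uniq[OF pb]) (simp_all add: reassoc[OF k(1)] reassoc[OF k(2)] i(4,5) dr2)
  obtain c where [simp]: "c \<in> Arr C" "Dom C c = Dom C s1" "Cod C c = Cod C r"
    and c: "c \<cdot> i = Idn C (Cod C r)" "d \<cdot> c = k"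
    using anodyne_lift[of i d "Idn C (Cod C r)" k] by (auto simp: ki)
  obtain D where [simp]: "D \<in> Arr C" "Dom C D = Cod C r" "Cod C D = Dom C s1"
    and D: "s1 \<cdot> D = Idn C (Cod C r)" "s2 \<cdot> D = Idn C (Cod C r)"
    using pb_lift[OF pbs, of "Idn C (Cod C r)" "Idn C (Cod C r)"] by auto
  have Dr: "D \<cdot> r = i \<cdot> r"
    by (rule pb_uniq[OF pbs]) (simp_all add: reassoc[OF D(1)] reassoc[OF D(2)] reassoc[OF i(4)] reassoc[OF i(5)]
        dr)
  \<comment> \<open>A path preceded by its own inverse is homotopic to the constant path at its
    target; on constant paths the two sides agree.\<close>
  have cD: "fhomotopic C d (c \<cdot> D) (r \<cdot> (q2 \<cdot> d))"
  proof (rule fhomotopic_ext_eq[of r])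
    show "(c \<cdot> D) \<cdot> r = (r \<cdot> (q2 \<cdot> d)) \<cdot> r" by (simp add: Dr reassoc[OF c(1)] dr)
    show "d \<cdot> (c \<cdot> D) = d \<cdot> (r \<cdot> (q2 \<cdot> d))"
      by (rule pb_uniq[OF pb]) (simp_all add: reassoc[OF c(2)] reassoc[OF k(1)] reassoc[OF k(2)] D dr1 dr2)
  qed simp_all
  \<comment> \<open>The domain of \<open>d'\<close> consists of all paths between the points given
    by \<open>v\<close>. Since \<open>z\<close> is a fibration, so are \<open>v\<close> and
    \<open>w\<close>, and therefore the constant paths \<open>i'\<close> inside this object are
    anodyne.\<close>
  obtain w d' where pbw: "is_pullback C v d d' w" using pb_ex[of d v] by auto
  note [simp] = pbD(4-8)[OF pbw]
  have wf [simp]: "w \<in> Fib C" using fib_pb2[OF pbw] by simp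
  obtain e i' where pbi: "is_pullback C r w e i'" using pb_ex[of w r] by auto
  have ai: "anodyne C i'" using anodyne_stable[OF r(1) wf pb_sym[OF pbi]] .
  have [simp]: "e \<in> Arr C" "Dom C e = Dom C i'" "Cod C e = Dom C p" "Cod C i' = Dom C d'" "anodyne C i'"
    using pbD[OF pbi] ai by simp_all
  have dw: "v \<cdot> d' = d \<cdot> w" and we: "w \<cdot> i' = r \<cdot> e" using pbD(9)[OF pbw] pbD(9)[OF pbi] by simp_all
  have vx: "v \<cdot> (d' \<cdot> i') = d \<cdot> (r \<cdot> e)" by (simp add: reassoc[OF dw] we)
  \<comment> \<open>The map \<open>\<sigma>\<close> sends \<open>(y, y')\<close> to
    \<open>(y, y)\<close> over the same point of the domain of \<open>z\<close>. It exists because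
    the domain of \<open>v\<close> contains all pairs in the fibre, and it fixes diagonal
    points.\<close>
  obtain \<sigma> where [simp]: "\<sigma> \<in> Arr C" "Dom C \<sigma> = Dom C v" "Cod C \<sigma> = Dom C v"
    and \<sigma>: "v \<cdot> \<sigma> = d \<cdot> (r \<cdot> (q1 \<cdot> v))" "n \<cdot> \<sigma> = n"
    using pb_lift[OF pbz, of "d \<cdot> (r \<cdot> (q1 \<cdot> v))" n] vn by (auto simp: dr1)
  have \<sigma>x: "\<sigma> \<cdot> (d' \<cdot> i') = d' \<cdot> i'"
    by (rule pb_uniq[OF pbz]) (simp_all add: reassoc[OF \<sigma>(1)] reassoc[OF \<sigma>(2)] vx dr1)
  have main: "\<exists>l. \<forall>b. b \<in> Arr C \<longrightarrow> Dom C b = Dom C v \<longrightarrow> Cod C b = Cod C r \<longrightarrow> d \<cdot> b = v \<longrightarrow> fhomotopic C d l b"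
    if [simp]: "a \<in> Arr C" "Dom C a = Dom C v" "Cod C a = Cod C r" and da: "d \<cdot> a = v" for a
  proof -
    have "q1 \<cdot> (d \<cdot> (a \<cdot> \<sigma>)) = q1 \<cdot> (d \<cdot> a)" by (simp add: reassoc[OF da] da \<sigma> dr1)
    then obtain m where [simp]: "m \<in> Arr C" "Dom C m = Dom C v" "Cod C m = Dom C s1"
      and m: "s1 \<cdot> m = a" "s2 \<cdot> m = a \<cdot> \<sigma>"
      using pb_lift[OF pbs, of a "a \<cdot> \<sigma>"] by auto
    have dk: "d \<cdot> (c \<cdot> m) = v"
      by (rule pb_uniq[OF pb])
        (simp_all add: reassoc[OF c(2)] reassoc[OF k(1)] reassoc[OF k(2)] m da reassoc[OF da] \<sigma> dr2)
    \<comment> \<open>Over a diagonal point \<open>a\<close> and \<open>a \<cdot> \<sigma>\<close>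
      coincide, so there the normalised contraction \<open>c \<cdot> m\<close> is a path preceded by
      its own inverse and \<open>cD\<close> makes it homotopic to a constant path.\<close>
    have mx: "m \<cdot> (d' \<cdot> i') = D \<cdot> (a \<cdot> (d' \<cdot> i'))"
      by (rule pb_uniq[OF pbs])
        (simp_all add: reassoc[OF m(1)] reassoc[OF m(2)] reassoc[OF D(1)] reassoc[OF D(2)] \<sigma>x)
    have "fhomotopic C d ((c \<cdot> D) \<cdot> (a \<cdot> (d' \<cdot> i'))) ((r \<cdot> (q2 \<cdot> d)) \<cdot> (a \<cdot> (d' \<cdot> i')))"
      by (rule fhomotopic_pre[OF cD]) simp_all
    then have "fhomotopic C d (((c \<cdot> m) \<cdot> d') \<cdot> i') (w \<cdot> i')"
      by (simp add: mx reassoc[OF da] vx dr2 we)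
    then have *: "fhomotopic C d ((c \<cdot> m) \<cdot> d') w"
      by (rule fhomotopic_ext[OF ai]) (use reassoc[OF dk, of d'] dw in simp_all)
    show ?thesis
    proof (intro exI allI impI)
      fix b assume [simp]: "b \<in> Arr C" "Dom C b = Dom C v" "Cod C b = Cod C r" and db: "d \<cdot> b = v"
      \<comment> \<open>A section \<open>b\<close> selects one path between the points of
        \<open>v\<close>, that is, a section of \<open>d'\<close>. Restricting the homotopy for all
        paths along it compares \<open>c \<cdot> m\<close> with \<open>b\<close>.\<close>
      obtain b' where [simp]: "b' \<in> Arr C" "Dom C b' = Dom C v" "Cod C b' = Dom C d'"
        and b': "d' \<cdot> b' = Idn C (Dom C v)" "w \<cdot> b' = b"
        using pb_lift[OF pbw, of "Idn C (Dom C v)" b] db by auto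
      show "fhomotopic C d (c \<cdot> m) b" using fhomotopic_pre[OF *, of b'] by (simp add: b')
    qed
  qed
  obtain l where l: "\<And>b. \<lbrakk>b \<in> Arr C; Dom C b = Dom C v; Cod C b = Cod C r; d \<cdot> b = v\<rbrakk> \<Longrightarrow> fhomotopic C d l b"
    using main[of a] ab by auto
  have "fhomotopic C d l a" "fhomotopic C d l b" by (rule l, use ab in simp_all)+
  then show ?thesis using fhomotopic_sym fhomotopic_trans by blast
qed

end

section \<open>Fibrant slices\<close>

lemma slice_simps [simp]:
  "Obj (slice C X) = {a \<in> Arr C. Cod C a = X}"
  "Dom (slice C X) k = fst k" "Cod (slice C X) k = snd (snd k)"
  "Idn (slice C X) a = (a, Idn C (Dom C a), a)"
  "Cmp (slice C X) l k = (fst k, und l \<cdot>\<^bsub>C\<^esub> und k, snd (snd l))"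
  "k \<in> Arr (slice C X) \<longleftrightarrow> fst k \<in> Arr C \<and> Cod C (fst k) = X \<and> snd (snd k) \<in> Arr C \<and>
     Cod C (snd (snd k)) = X \<and> und k \<in> Arr C \<and> Dom C (und k) = Dom C (fst k) \<and>
     Cod C (und k) = Dom C (snd (snd k)) \<and> snd (snd k) \<cdot>\<^bsub>C\<^esub> und k = fst k"
  by (auto simp: slice_def)

context tribe
begin

lemma fslice_simps [simp]:
  "Obj (fslice C X) = {a \<in> Fib C. Cod C a = X}"
  "Dom (fslice C X) k = fst k" "Cod (fslice C X) k = snd (snd k)"
  "Idn (fslice C X) a = (a, Idn C (Dom C a), a)"
  "Cmp (fslice C X) l k = (fst k, und l \<cdot> und k, snd (snd l))"
  "k \<in> Arr (fslice C X) \<longleftrightarrow> fst k \<in> Fib C \<and> Cod C (fst k) = X \<and> snd (snd k) \<in> Fib C \<and>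
     Cod C (snd (snd k)) = X \<and> und k \<in> Arr C \<and> Dom C (und k) = Dom C (fst k) \<and>
     Cod C (und k) = Dom C (snd (snd k)) \<and> snd (snd k) \<cdot> und k = fst k"
  "k \<in> Fib (fslice C X) \<longleftrightarrow> k \<in> Arr (fslice C X) \<and> und k \<in> Fib C"
  by (auto simp: fslice_def)

lemma fslice_HomE:
  assumes "k \<in> Hom (fslice C X) a b"
  obtains k0 where "k = (a, k0, b)" "k0 \<in> Arr C" "Dom C k0 = Dom C a" "Cod C k0 = Dom C b" "b \<cdot> k0 = a"
    "a \<in> Fib C" "b \<in> Fib C" "Cod C a = X" "Cod C b = X"
  using assms by (cases k) auto

lemma fslice_category: "category (fslice C X)"
proof unfold_locales
  fix f g x y z assume f: "f \<in> Hom (fslice C X) x y" and g: "g \<in> Hom (fslice C X) y z"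
  obtain f0 where f0 [simp]: "f = (x, f0, y)" "f0 \<in> Arr C" "Dom C f0 = Dom C x" "Cod C f0 = Dom C y"
      "y \<cdot> f0 = x"
    "x \<in> Fib C" "y \<in> Fib C" "Cod C x = X" "Cod C y = X" by (rule fslice_HomE[OF f])
  obtain g0 where g0: "g = (y, g0, z)" "g0 \<in> Arr C" "Dom C g0 = Dom C y" "Cod C g0 = Dom C z" "z \<cdot> g0 = y"
    "y \<in> Fib C" "z \<in> Fib C" "Cod C y = X" "Cod C z = X" by (rule fslice_HomE[OF g])
  show "g \<cdot>\<^bsub>fslice C X\<^esub> f \<in> Hom (fslice C X) x z"
    using g0 by (simp add: reassoc[OF g0(5)])
next
  fix f g h w x y z
  assume f: "f \<in> Hom (fslice C X) w x" and g: "g \<in> Hom (fslice C X) x y" and h: "h \<in> Hom (fslice C X) y z"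
  show "(h \<cdot>\<^bsub>fslice C X\<^esub> g) \<cdot>\<^bsub>fslice C X\<^esub> f = h \<cdot>\<^bsub>fslice C X\<^esub> (g \<cdot>\<^bsub>fslice C X\<^esub> f)"
    by (rule fslice_HomE[OF f], rule fslice_HomE[OF g], rule fslice_HomE[OF h]) simp
next
  fix f x y assume f: "f \<in> Hom (fslice C X) x y"
  show "Idn (fslice C X) y \<cdot>\<^bsub>fslice C X\<^esub> f = f" "f \<cdot>\<^bsub>fslice C X\<^esub> Idn (fslice C X) x = f"
    by (rule fslice_HomE[OF f], simp)+
qed simp_all

text \<open>The slice only provides lifts against fibrations over \<open>X\<close>, while an
  arbitrary fibration of \<open>C\<close> has to be met. A lifting problem against \<open>p\<close>
  is equivalent to one against its pullback along \<open>v\<close>, and that pullback does live over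
  \<open>X\<close>.\<close>

lemma anodyne_und:
  assumes "anodyne (fslice C X) i"
  shows "anodyne C (und i)"
proof -
  have A: "i \<in> Arr (fslice C X)" using assms unfolding anodyne_def by blast
  note [simp] = A[unfolded fslice_simps]
  show ?thesis
    unfolding anodyne_def
  proof (intro conjI ballI allI impI)
    fix p u v assume [simp]: "p \<in> Fib C" and "u \<in> Hom C (Dom C (und i)) (Dom C p)"
      and "v \<in> Hom C (Cod C (und i)) (Cod C p)" and e: "p \<cdot> u = v \<cdot> und i"
    then have [simp]: "u \<in> Arr C" "Dom C u = Dom C (fst i)" "Cod C u = Dom C p"
      "v \<in> Arr C" "Dom C v = Dom C (snd (snd i))" "Cod C v = Cod C p" by simp_all
    obtain s1 s2 where pb: "is_pullback C v p s1 s2" using pb_ex[of p v] by auto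
    note [simp] = pbD(4-8)[OF pb]
    have [simp]: "s1 \<in> Fib C" using fib_pb1[OF pb] by simp
    obtain m where [simp]: "m \<in> Arr C" "Dom C m = Dom C (fst i)" "Cod C m = Dom C s1"
      and m: "s1 \<cdot> m = und i" "s2 \<cdot> m = u"
      using pb_lift[OF pb, of "und i" u] e by auto
    let ?p = "(snd (snd i) \<cdot> s1, s1, snd (snd i))"
    let ?u = "(fst i, m, snd (snd i) \<cdot> s1)"
    let ?v = "(snd (snd i), Idn C (Dom C (snd (snd i))), snd (snd i))"
    have "?p \<in> Fib (fslice C X)" by simp
    moreover have "?u \<in> Hom (fslice C X) (Dom (fslice C X) i) (Dom (fslice C X) ?p)"
      "?v \<in> Hom (fslice C X) (Cod (fslice C X) i) (Cod (fslice C X) ?p)"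
      by (simp_all add: m)
    moreover have "Cmp (fslice C X) ?p ?u = Cmp (fslice C X) ?v i" by (simp add: m)
    ultimately have "\<exists>l\<in>Hom (fslice C X) (Cod (fslice C X) i) (Dom (fslice C X) ?p).
        Cmp (fslice C X) l i = ?u \<and> Cmp (fslice C X) ?p l = ?v"
      using assms unfolding anodyne_def by blast
    then obtain l where [simp]: "l \<in> Arr C" "Dom C l = Dom C (snd (snd i))" "Cod C l = Dom C s1"
      and l: "l \<cdot> und i = m" "s1 \<cdot> l = Idn C (Dom C (snd (snd i)))"
      by auto
    show "\<exists>l\<in>Hom C (Cod C (und i)) (Dom C p). l \<cdot> und i = u \<and> p \<cdot> l = v"
      by (rule bexI[of _ "s2 \<cdot> l"])
        (simp_all add: l m reassoc[OF pbD(9)[OF pb, symmetric]])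
  qed simp
qed

lemma anodyne_fslice:
  assumes "i \<in> Arr (fslice C X)" "anodyne C (und i)"
  shows "anodyne (fslice C X) i"
  unfolding anodyne_def
proof (intro conjI ballI allI impI)
  note [simp] = assms(1)[unfolded fslice_simps]
  fix p u v assume p: "p \<in> Fib (fslice C X)" and u: "u \<in> Hom (fslice C X) (Dom (fslice C X) i) (Dom (fslice C X)
      p)"
    and v: "v \<in> Hom (fslice C X) (Cod (fslice C X) i) (Cod (fslice C X) p)"
    and e: "Cmp (fslice C X) p u = Cmp (fslice C X) v i"
  have e': "und p \<cdot> und u = und v \<cdot> und i" using e by simp
  obtain l where l: "l \<in> Arr C" "Dom C l = Cod C (und i)" "Cod C l = Dom C (und p)"
    "l \<cdot> und i = und u" "und p \<cdot> l = und v"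
    using anodyne_lift[OF assms(2), of "und p" "und u" "und v"] p u v e' by auto
  have "fst p \<cdot> l = snd (snd i)"
  proof -
    have "snd (snd p) \<cdot> und p = fst p" using p by simp
    then have "fst p \<cdot> l = snd (snd p) \<cdot> (und p \<cdot> l)" using reassoc[of "snd (snd p)" "und p" "fst p" l] p l by
        simp
    moreover have "snd (snd v) \<cdot> und v = fst v" "snd (snd v) = snd (snd p)" "fst v = snd (snd i)"
      using v[unfolded Hom_iff fslice_simps] by (elim conjE, simp only:)+
    ultimately show ?thesis using l(5) by simp
  qed
  then show "\<exists>l\<in>Hom (fslice C X) (Cod (fslice C X) i) (Dom (fslice C X) p).
      Cmp (fslice C X) l i = u \<and> Cmp (fslice C X) p l = v"
    using p u v l by (intro bexI[of _ "(snd (snd i), l, fst p)"]) (auto simp: prod_eq_iff)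
qed (rule assms(1))

section \<open>Uniqueness of pullbacks and products in slices\<close>

lemma pb_iso:
  assumes pb: "is_pullback C f g v1 v2" and [simp]: "h \<in> Arr C" "k \<in> Arr C" "Cod C h = Dom C v1"
      "Dom C k = Dom C v1"
    "Cod C k = Dom C h" and hk: "h \<cdot> k = Idn C (Dom C v1)" "k \<cdot> h = Idn C (Dom C h)"
  shows "is_pullback C f g (v1 \<cdot> h) (v2 \<cdot> h)"
proof -
  note [simp] = pbD(1-8)[OF pb]
  show ?thesis
  proof (rule pbI)
    show "f \<cdot> (v1 \<cdot> h) = g \<cdot> (v2 \<cdot> h)" by (simp add: reassoc[OF pbD(9)[OF pb]])
  next
    fix a b assume [simp]: "a \<in> Arr C" "b \<in> Arr C" "Dom C b = Dom C a" "Cod C a = Dom C f"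
      "Cod C b = Dom C g" and e: "f \<cdot> a = g \<cdot> b"
    obtain m where [simp]: "m \<in> Arr C" "Dom C m = Dom C a" "Cod C m = Dom C v1" and m: "v1 \<cdot> m = a" "v2 \<cdot> m = b"
      using pb_lift[OF pb, of a b] e by auto
    show "\<exists>m. m \<in> Arr C \<and> Dom C m = Dom C a \<and> Cod C m = Dom C (v1 \<cdot> h) \<and> (v1 \<cdot> h) \<cdot> m = a \<and> (v2 \<cdot> h) \<cdot> m = b"
      by (rule exI[of _ "k \<cdot> m"]) (simp add: m reassoc[OF hk(1)])
  next
    fix m n assume [simp]: "m \<in> Arr C" "n \<in> Arr C" "Dom C n = Dom C m"
      and c: "Cod C m = Dom C (v1 \<cdot> h)" "Cod C n = Dom C (v1 \<cdot> h)"
      and e: "(v1 \<cdot> h) \<cdot> m = (v1 \<cdot> h) \<cdot> n" "(v2 \<cdot> h) \<cdot> m = (v2 \<cdot> h) \<cdot> n"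
    have [simp]: "Cod C m = Dom C h" "Cod C n = Dom C h" using c by simp_all
    have "h \<cdot> m = h \<cdot> n" by (rule pb_uniq[OF pb]) (use e in simp_all)
    then have "k \<cdot> (h \<cdot> m) = k \<cdot> (h \<cdot> n)" by simp
    then show "m = n" by (simp add: reassoc[OF hk(2)])
  qed simp_all
qed

lemma pb_unique_iso:
  assumes 1: "is_pullback C f g v1 v2" and 2: "is_pullback C f g u1 u2"
  obtains h k where "h \<in> Arr C" "Dom C h = Dom C u1" "Cod C h = Dom C v1" "v1 \<cdot> h = u1" "v2 \<cdot> h = u2"
    "k \<in> Arr C" "Dom C k = Dom C v1" "Cod C k = Dom C u1" "u1 \<cdot> k = v1" "u2 \<cdot> k = v2"
    "h \<cdot> k = Idn C (Dom C v1)" "k \<cdot> h = Idn C (Dom C u1)"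
proof -
  note [simp] = pbD(1,2,4-8)[OF 1] pbD(4-8)[OF 2]
  obtain h where [simp]: "h \<in> Arr C" "Dom C h = Dom C u1" "Cod C h = Dom C v1" and h: "v1 \<cdot> h = u1"
      "v2 \<cdot> h = u2"
    using pb_lift[OF 1, of u1 u2] pbD(9)[OF 2] by auto
  obtain k where [simp]: "k \<in> Arr C" "Dom C k = Dom C v1" "Cod C k = Dom C u1" and k: "u1 \<cdot> k = v1"
      "u2 \<cdot> k = v2"
    using pb_lift[OF 2, of v1 v2] pbD(9)[OF 1] by auto
  have "h \<cdot> k = Idn C (Dom C v1)" by (rule pb_uniq[OF 1]) (simp_all add: reassoc[OF h(1)] reassoc[OF h(2)] k)
  moreover have "k \<cdot> h = Idn C (Dom C u1)" by (rule pb_uniq[OF 2]) (simp_all add: reassoc[OF k(1)] reassoc[OF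
      k(2)] h)
  ultimately show thesis using that[of h k] h k by simp
qed

lemma pb_fslice_product:
  assumes pb: "is_pullback C a b u1 u2" and ab: "a \<in> Fib C" "b \<in> Fib C" "Cod C a = X"
  shows "is_product (fslice C X) a b (a \<cdot> u1, u1, a) (a \<cdot> u1, u2, b)"
proof -
  note [simp] = pbD(1-8)[OF pb] ab
  have [simp]: "u1 \<in> Fib C" using fib_pb1[OF pb] by simp
  have abu: "a \<cdot> u1 = b \<cdot> u2" using pbD(9)[OF pb] .
  show ?thesis
    unfolding is_product_def
  proof (intro conjI allI impI)
    fix z x y assume x: "x \<in> Hom (fslice C X) z a" and y: "y \<in> Hom (fslice C X) z b"
    obtain x0 where x0: "x = (z, x0, a)" "x0 \<in> Arr C" "Dom C x0 = Dom C z" "Cod C x0 = Dom C a" "a \<cdot> x0 = z"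
      "z \<in> Fib C" "Cod C z = X" by (rule fslice_HomE[OF x])
    obtain y0 where y0: "y = (z, y0, b)" "y0 \<in> Arr C" "Dom C y0 = Dom C z" "Cod C y0 = Dom C b" "b \<cdot> y0 = z"
      by (rule fslice_HomE[OF y])
    obtain m where m: "m \<in> Arr C" "Dom C m = Dom C z" "Cod C m = Dom C u1" "u1 \<cdot> m = x0" "u2 \<cdot> m = y0"
      using pb_lift[OF pb, of x0 y0] x0 y0 by auto
    show "\<exists>!h. h \<in> Hom (fslice C X) z (Dom (fslice C X) (a \<cdot> u1, u1, a)) \<and>
        (a \<cdot> u1, u1, a) \<cdot>\<^bsub>fslice C X\<^esub> h = x \<and> (a \<cdot> u1, u2, b) \<cdot>\<^bsub>fslice C X\<^esub> h = y"
    proof (rule ex1I[of _ "(z, m, a \<cdot> u1)"])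
      fix h assume h: "h \<in> Hom (fslice C X) z (Dom (fslice C X) (a \<cdot> u1, u1, a)) \<and>
        (a \<cdot> u1, u1, a) \<cdot>\<^bsub>fslice C X\<^esub> h = x \<and> (a \<cdot> u1, u2, b) \<cdot>\<^bsub>fslice C X\<^esub> h = y"
      then have "h \<in> Hom (fslice C X) z (a \<cdot> u1)" by (simp only: fslice_simps(2) fst_conv)
      then obtain h0 where h0: "h = (z, h0, a \<cdot> u1)" "h0 \<in> Arr C" "Dom C h0 = Dom C z" "Cod C h0 = Dom C u1"
        by (rule fslice_HomE) simp
      have "h0 = m"
        by (rule pb_uniq[OF pb]) (use h h0 m x0 y0 in simp_all)
      then show "h = (z, m, a \<cdot> u1)" using h0 by simp
    qed (use x0 y0 m in simp)
  qed (simp_all add: abu[symmetric])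
qed

text \<open>A product in the slice is tested on fibrations over \<open>X\<close> only, a pullback in
  \<open>C\<close> on all objects. The gap is closed by a pullback in \<open>C\<close>: it is fibred
  over \<open>X\<close>, hence isomorphic to the given product by the slice property alone, and its
  stronger property is carried over.\<close>

lemma fslice_productE:
  assumes P: "is_product (fslice C X) a b q1 q2" and ab: "a \<in> Fib C" "b \<in> Fib C" "Cod C a = X" "Cod C b = X"
  obtains p1 p2 where "is_pullback C a b p1 p2" "q1 = (a \<cdot> p1, p1, a)" "q2 = (a \<cdot> p1, p2, b)"
    "p1 \<in> Fib C"
proof -
  note [simp] = ab
  obtain u1 u2 where pb: "is_pullback C a b u1 u2" using pb_ex[of b a] by auto
  note [simp] = pbD(4-8)[OF pb]
  have [simp]: "u1 \<in> Fib C" using fib_pb1[OF pb] by simp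
  have Q: "q1 \<in> Hom (fslice C X) (Dom (fslice C X) q1) a" "q2 \<in> Hom (fslice C X) (Dom (fslice C X) q1) b"
    using P unfolding is_product_def by blast+
  obtain p1 where p1: "q1 = (fst q1, p1, a)" "p1 \<in> Arr C" "Dom C p1 = Dom C (fst q1)" "Cod C p1 = Dom C a"
     "a \<cdot> p1 = fst q1" "fst q1 \<in> Fib C" using Q(1) by (rule fslice_HomE) simp
  obtain p2 where p2: "q2 = (fst q1, p2, b)" "p2 \<in> Arr C" "Dom C p2 = Dom C (fst q1)" "Cod C p2 = Dom C b"
     "b \<cdot> p2 = fst q1" using Q(2) by (rule fslice_HomE) simp
  define w where "w = fst q1"
  note p1 = p1[folded w_def] and p2 = p2[folded w_def]
  note [simp] = p1(2-4,6) p2(2-4)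
  have [simp]: "Cod C w = X" using arg_cong[OF p1(5), of "Cod C"] by simp
  have U: "\<exists>!h. h \<in> Hom (fslice C X) z w \<and>
      q1 \<cdot>\<^bsub>fslice C X\<^esub> h = x \<and> q2 \<cdot>\<^bsub>fslice C X\<^esub> h = y"
    if "x \<in> Hom (fslice C X) z a" "y \<in> Hom (fslice C X) z b" for x y z
    using P that unfolding is_product_def w_def fslice_simps by blast
  obtain k where [simp]: "k \<in> Arr C" "Dom C k = Dom C w" "Cod C k = Dom C u1"
    and k: "u1 \<cdot> k = p1" "u2 \<cdot> k = p2"
    using pb_lift[OF pb, of p1 p2] p1(5) p2(5) by auto
  have "(a \<cdot> u1, u1, a) \<in> Hom (fslice C X) (a \<cdot> u1) a" "(a \<cdot> u1, u2, b) \<in> Hom (fslice C X) (a \<cdot> u1) b"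
    by (simp_all add: pbD(9)[OF pb, symmetric])
  from U[OF this] obtain h where h: "h \<in> Hom (fslice C X) (a \<cdot> u1) w"
    "q1 \<cdot>\<^bsub>fslice C X\<^esub> h = (a \<cdot> u1, u1, a)" "q2 \<cdot>\<^bsub>fslice C X\<^esub> h = (a \<cdot> u1, u2, b)" by blast
  obtain h0 where [simp]: "h = (a \<cdot> u1, h0, w)" "h0 \<in> Arr C" "Dom C h0 = Dom C u1" "Cod C h0 = Dom C w"
    using h(1) by (rule fslice_HomE) simp
  have h0: "p1 \<cdot> h0 = u1" "p2 \<cdot> h0 = u2"
    using h(2,3)[unfolded p1(1) p2(1)] by simp_all
  have hk: "k \<cdot> h0 = Idn C (Dom C u1)"
    by (rule pb_uniq[OF pb]) (simp_all add: reassoc[OF k(1)] reassoc[OF k(2)] h0)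
  have "(w, h0 \<cdot> k, w) = (w, Idn C (Dom C w), w)"
  proof -
    have 1: "(w, x, w) \<in> Hom (fslice C X) w w \<and> q1 \<cdot>\<^bsub>fslice C X\<^esub> (w, x, w) = (w, p1, a) \<and>
        q2 \<cdot>\<^bsub>fslice C X\<^esub> (w, x, w) = (w, p2, b)"
      if [simp]: "x \<in> Arr C" "Dom C x = Dom C w" "Cod C x = Dom C w" and x: "p1 \<cdot> x = p1" "p2 \<cdot> x = p2" for x
    proof -
      have "w \<cdot> x = w" using reassoc[OF p1(5), of x] by (simp add: x p1(5))
      then show ?thesis by (subst p1(1), subst p2(1)) (simp add: x)
    qed
    have "(w, p1, a) \<in> Hom (fslice C X) w a" "(w, p2, b) \<in> Hom (fslice C X) w b"
      by (simp_all add: p1(5) p2(5))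
    from U[OF this] 1[of "h0 \<cdot> k"] 1[of "Idn C (Dom C w)"] show ?thesis
      by (auto simp: reassoc[OF h0(1)] reassoc[OF h0(2)] k simp del: fslice_simps)
  qed
  then have kh: "h0 \<cdot> k = Idn C (Dom C w)" by simp
  have "is_pullback C a b (u1 \<cdot> k) (u2 \<cdot> k)"
    by (rule pb_iso[OF pb, of k h0]) (simp_all add: hk kh)
  then have pb': "is_pullback C a b p1 p2" by (simp add: k)
  show thesis
    by (rule that[OF pb']) (use p1 p2 fib_pb1[OF pb'] in simp_all)
qed

lemma fslice_tuple:
  assumes pb: "is_pullback C a b p1 p2" and ab: "a \<in> Fib C" "b \<in> Fib C" "Cod C a = X"
    and xy: "x \<in> Arr C" "Dom C x = Dom C z" "Cod C x = Dom C a" "a \<cdot> x = z"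
     "y \<in> Arr C" "Dom C y = Dom C z" "Cod C y = Dom C b" "b \<cdot> y = z" and z: "z \<in> Fib C"
  shows "tuple (fslice C X) (a \<cdot> p1, p1, a) (a \<cdot> p1, p2, b) (z, x, a) (z, y, b) = (z, tuple C p1 p2 x y, a \<cdot>
      p1)"
proof -
  interpret T: category "fslice C X" by (rule fslice_category)
  have t: "tuple C p1 p2 x y \<in> Arr C" "Dom C (tuple C p1 p2 x y) = Dom C z"
      "Cod C (tuple C p1 p2 x y) = Dom C p1"
     "p1 \<cdot> tuple C p1 p2 x y = x" "p2 \<cdot> tuple C p1 p2 x y = y"
    using pb_tuple[OF pb, of x y] xy by simp_all
  have [simp]: "p1 \<in> Fib C" using fib_pb1[OF pb] ab by simp
  note [simp] = pbD(1-8)[OF pb] ab xy(1-3,5-7) t(1-3) z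
  have [simp]: "Cod C z = X" using arg_cong[OF xy(4), of "Cod C"] by simp
  show ?thesis
  proof (rule T.tuple_eqI)
    fix k assume k: "k \<in> Arr (fslice C X)" "Dom (fslice C X) k = Dom (fslice C X) (z, x, a)"
      "Cod (fslice C X) k = Dom (fslice C X) (a \<cdot> p1, p1, a)" "(a \<cdot> p1, p1, a) \<cdot>\<^bsub>fslice C X\<^esub> k = (z, x, a)"
      "(a \<cdot> p1, p2, b) \<cdot>\<^bsub>fslice C X\<^esub> k = (z, y, b)"
    then have "k \<in> Hom (fslice C X) z (a \<cdot> p1)" by simp
    then obtain k0 where k0: "k = (z, k0, a \<cdot> p1)" "k0 \<in> Arr C" "Dom C k0 = Dom C z" "Cod C k0 = Dom C p1"
      by (rule fslice_HomE) simp
    have "k0 = tuple C p1 p2 x y"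
      by (rule pb_tuple_eq[OF pb, symmetric]) (use k k0 in simp_all)
    then show "k = (z, tuple C p1 p2 x y, a \<cdot> p1)" using k0 by simp
  qed (simp_all add: t xy)
qed

section \<open>Path objects and homotopies in slices\<close>

lemma path_object_fslice:
  assumes pb: "is_pullback C a a p1 p2" and a: "a \<in> Fib C" "Cod C a = X"
    and r: "anodyne C r" "Dom C r = Dom C a" and d: "d \<in> Fib C" "Dom C d = Cod C r" "Cod C d = Dom C p1"
    and dr: "p1 \<cdot> (d \<cdot> r) = Idn C (Dom C a)" "p2 \<cdot> (d \<cdot> r) = Idn C (Dom C a)"
  shows "path_object (fslice C X) a (a \<cdot> p1, p1, a) (a \<cdot> p1, p2, a) (a, r, a \<cdot> (p1 \<cdot> d)) (a \<cdot> (p1 \<cdot> d), d, a \<cdot>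
      p1)"
proof -
  note [simp] = pbD(4-8)[OF pb] a r d fib_pb1[OF pb]
  have t: "tuple C p1 p2 (Idn C (Dom C a)) (Idn C (Dom C a)) = d \<cdot> r"
    by (rule pb_tuple_eq[OF pb]) (simp_all add: dr)
  have "anodyne (fslice C X) (a, r, a \<cdot> (p1 \<cdot> d))"
    by (rule anodyne_fslice) (simp_all add: dr)
  then show ?thesis
    unfolding path_object_def using pb_fslice_product[OF pb a(1,1) a(2)]
      fslice_tuple[OF pb a(1,1) a(2), of "Idn C (Dom C a)" a "Idn C (Dom C a)"] t by simp
qed

lemma path_object_fsliceE:
  assumes P: "path_object (fslice C X) a q1 q2 r d"
  obtains p1 p2 r0 d0 where "q1 = (a \<cdot> p1, p1, a)" "q2 = (a \<cdot> p1, p2, a)"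
    "r = (a, r0, a \<cdot> (p1 \<cdot> d0))" "d = (a \<cdot> (p1 \<cdot> d0), d0, a \<cdot> p1)"
    "is_pullback C a a p1 p2" "a \<in> Fib C" "Cod C a = X"
    "anodyne C r0" "Dom C r0 = Dom C a" "d0 \<in> Fib C" "Dom C d0 = Cod C r0" "Cod C d0 = Dom C p1"
    "p1 \<cdot> (d0 \<cdot> r0) = Idn C (Dom C a)" "p2 \<cdot> (d0 \<cdot> r0) = Idn C (Dom C a)"
proof -
  have pr: "is_product (fslice C X) a a q1 q2" and a: "a \<in> Fib C" "Cod C a = X"
    using P unfolding path_object_def by simp_all
  obtain p1 p2 where pb: "is_pullback C a a p1 p2" and q: "q1 = (a \<cdot> p1, p1, a)" "q2 = (a \<cdot> p1, p2, a)"
    using fslice_productE[OF pr a(1,1) a(2,2)] by metis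
  note [simp] = pbD(4-8)[OF pb] a fib_pb1[OF pb]
  have r: "anodyne (fslice C X) r" "fst r = a" and d: "d \<in> Fib (fslice C X)" "fst d = snd (snd r)"
      "snd (snd d) = a \<cdot> p1"
    and dr: "d \<cdot>\<^bsub>fslice C X\<^esub> r = tuple (fslice C X) q1 q2 (Idn (fslice C X) a) (Idn (fslice C X) a)"
    using P unfolding path_object_def q by (simp_all del: fslice_simps(5-7))
  have ra: "r \<in> Arr (fslice C X)" using r(1) unfolding anodyne_def by blast
  obtain d0 where d0: "d = (a \<cdot> (p1 \<cdot> d0), d0, a \<cdot> p1)" "d0 \<in> Fib C" "Cod C d0 = Dom C p1"
    using d(1,3) by (cases d) auto
  obtain r0 where r0: "r = (a, r0, a \<cdot> (p1 \<cdot> d0))" "Dom C r0 = Dom C a" "Dom C d0 = Cod C r0" "r0 \<in> Arr C"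
    using ra r(2) d(2) d0 by (cases r) auto
  have dr0: "d0 \<cdot> r0 = tuple C p1 p2 (Idn C (Dom C a)) (Idn C (Dom C a))"
    using dr fslice_tuple[OF pb a(1,1) a(2), of "Idn C (Dom C a)" a "Idn C (Dom C a)"] by (simp add: q d0 r0)
  have "p1 \<cdot> (d0 \<cdot> r0) = Idn C (Dom C a)" "p2 \<cdot> (d0 \<cdot> r0) = Idn C (Dom C a)"
    using pb_tuple(4,5)[OF pb, of "Idn C (Dom C a)" "Idn C (Dom C a)"] by (simp_all add: dr0)
  then show thesis
    using that[OF q r0(1) d0(1) pb a] r0 d0 anodyne_und[OF r(1)] by simp
qed

lemma homotopic_fslice_fhomotopic:
  assumes H: "homotopic (fslice C X) f g"
  shows "fhomotopic C (snd (snd f)) (und f) (und g)"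
proof -
  obtain q1 q2 r d h where f: "f \<in> Arr (fslice C X)" "g \<in> Hom (fslice C X) (fst f) (snd (snd f))"
    and P: "path_object (fslice C X) (snd (snd f)) q1 q2 r d" and h: "h \<in> Hom (fslice C X) (fst f) (fst d)"
    and dh: "d \<cdot>\<^bsub>fslice C X\<^esub> h = tuple (fslice C X) q1 q2 f g"
    using H unfolding homotopic_def fslice_simps(2,3) by (elim conjE exE bexE) (rule that)
  define a where "a = snd (snd f)"
  obtain p1 p2 r0 d0 where q: "q1 = (a \<cdot> p1, p1, a)" "q2 = (a \<cdot> p1, p2, a)"
    "r = (a, r0, a \<cdot> (p1 \<cdot> d0))" "d = (a \<cdot> (p1 \<cdot> d0), d0, a \<cdot> p1)"
    and pb: "is_pullback C a a p1 p2" and a: "a \<in> Fib C" "Cod C a = X" and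
    r0: "anodyne C r0" "Dom C r0 = Dom C a" "d0 \<in> Fib C" "Dom C d0 = Cod C r0" "Cod C d0 = Dom C p1"
    "p1 \<cdot> (d0 \<cdot> r0) = Idn C (Dom C a)" "p2 \<cdot> (d0 \<cdot> r0) = Idn C (Dom C a)"
    by (rule path_object_fsliceE[OF P, folded a_def])
  note [simp] = pbD(4-8)[OF pb] r0(1-5) a fib_pb1[OF pb]
  have "f \<in> Hom (fslice C X) (fst f) a" using f by (simp add: a_def)
  then obtain f0 where f0: "f = (fst f, f0, a)" "f0 \<in> Arr C" "Dom C f0 = Dom C (fst f)" "Cod C f0 = Dom C a"
    "a \<cdot> f0 = fst f" "fst f \<in> Fib C" by (rule fslice_HomE) simp
  obtain g0 where g0: "g = (fst f, g0, a)" "g0 \<in> Arr C" "Dom C g0 = Dom C (fst f)" "Cod C g0 = Dom C a"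
    "a \<cdot> g0 = fst f" using f(2)[folded a_def] by (rule fslice_HomE) simp
  obtain h0 where h0: "h = (fst f, h0, fst d)" "h0 \<in> Arr C" "Dom C h0 = Dom C (fst f)"
      "Cod C h0 = Dom C (fst d)"
    using h by (rule fslice_HomE) simp
  have [simp]: "Cod C h0 = Cod C r0" using h0 by (simp add: q)
  have "tuple (fslice C X) q1 q2 f g = (fst f, tuple C p1 p2 f0 g0, a \<cdot> p1)"
    unfolding q by (subst f0(1), subst g0(1), rule fslice_tuple[OF pb a(1,1) a(2)]) (use f0 g0 in simp_all)
  with dh have dh0: "d0 \<cdot> h0 = tuple C p1 p2 f0 g0" using h0 by (simp add: q)
  have t: "p1 \<cdot> (d0 \<cdot> h0) = f0" "p2 \<cdot> (d0 \<cdot> h0) = g0"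
    unfolding dh0 using pb_tuple(4,5)[OF pb, of f0 g0] f0 g0 by simp_all
  have F: "fpath C a r0 (p1 \<cdot> d0) (p2 \<cdot> d0)"
    unfolding fpath_def using r0 a pb
    by (intro conjI exI[of _ p1] exI[of _ p2] exI[of _ d0]) simp_all
  have "und f = f0" "und g = g0" using arg_cong[OF f0(1), of und] arg_cong[OF g0(1), of und] by simp_all
  then show ?thesis unfolding a_def[symmetric]
    using fhomotopicI[OF F, of h0 f0 g0] h0 t by simp
qed

text \<open>Here the stage has to be fibred: \<open>z\<close> is the object of the slice that serves
  as the domain of the two maps.\<close>

lemma fhomotopic_homotopic_fslice:
  assumes H: "fhomotopic C a f g" and X: "Cod C a = X" and z: "z \<in> Fib C" "a \<cdot> f = z"
  shows "homotopic (fslice C X) (z, f, a) (z, g, a)"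
proof -
  note [simp] = fhomotopicD(1-6)[OF H] X
  have [simp]: "Dom C f = Dom C z" "Cod C z = X" "a \<cdot> g = z" using z fhomotopicD(7)[OF H] by auto
  obtain r e0 e1 where F: "fpath C a r e0 e1" using fpath_ex[of a] by auto
  obtain p1 p2 d where pb: "is_pullback C a a p1 p2" and d [simp]: "d \<in> Fib C" "Dom C d = Cod C r"
      "Cod C d = Dom C p1" and e: "e0 = p1 \<cdot> d" "e1 = p2 \<cdot> d"
    using F unfolding fpath_def by blast
  note [simp] = pbD(4-8)[OF pb] fib_pb1[OF pb] fpathD(2,3)[OF F]
  have P: "path_object (fslice C X) a (a \<cdot> p1, p1, a) (a \<cdot> p1, p2, a) (a, r, a \<cdot> (p1 \<cdot> d)) (a \<cdot> (p1 \<cdot> d), d, a \<cdot>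
      p1)"
    by (rule path_object_fslice[OF pb]) (use fpathD(10,11)[OF F] in \<open>simp_all add: e\<close>)
  obtain h where h: "h \<in> Arr C" "Dom C h = Dom C z" "Cod C h = Cod C r" and h': "e0 \<cdot> h = f" "e1 \<cdot> h = g"
    using fhomotopic_path[OF H F] by auto
  have "tuple C p1 p2 f g = d \<cdot> h"
    by (rule pb_tuple_eq[OF pb]) (use h h' in \<open>simp_all add: e\<close>)
  then have t: "tuple (fslice C X) (a \<cdot> p1, p1, a) (a \<cdot> p1, p2, a) (z, f, a) (z, g, a) = (z, d \<cdot> h, a \<cdot> p1)"
    using fslice_tuple[OF pb, of X f z g] z by simp
  have "a \<cdot> (p1 \<cdot> (d \<cdot> h)) = z" using z h h' by (simp add: e)
  then have "\<exists>h\<in>Hom (fslice C X) (Dom (fslice C X) (z, f, a)) (Dom (fslice C X) (a \<cdot> (p1 \<cdot> d), d, a \<cdot> p1)).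
     (a \<cdot> (p1 \<cdot> d), d, a \<cdot> p1) \<cdot>\<^bsub>fslice C X\<^esub> h = tuple (fslice C X) (a \<cdot> p1, p1, a) (a \<cdot> p1, p2, a) (z, f, a)
         (z, g, a)"
    by (intro bexI[of _ "(z, h, a \<cdot> (p1 \<cdot> d))"]) (use h z in \<open>simp_all add: t\<close>)
  moreover have "(z, f, a) \<in> Arr (fslice C X)" "(z, g, a) \<in> Hom (fslice C X) (Dom (fslice C X) (z, f, a)) (Cod
      (fslice C X) (z, f, a))"
    using z by simp_all
  ultimately show ?thesis
    unfolding homotopic_def using P unfolding fslice_simps(3) snd_conv
    by (intro conjI exI) (simp_all only:)
qed

end

section \<open>Dependent products\<close>

text \<open>\<open>g = \<Pi>\<^sub>q f\<close> by its universal property: \<open>w\<close>, \<open>\<theta>\<close> are the projections of \<open>q\<^sup>* g\<close> and \<open>\<epsilon>\<close> is the counit.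
  Maps \<open>l\<close> into \<open>q\<^sup>* g\<close> are quantified over together with the maps \<open>k\<close> into \<open>g\<close> that induce them.\<close>

definition dep_prod :: "('o, 'm, 'x) fcat_scheme \<Rightarrow> 'm \<Rightarrow> 'm \<Rightarrow> 'm \<Rightarrow> 'm \<Rightarrow> 'm \<Rightarrow> 'm \<Rightarrow> bool" where
  "dep_prod C q f g w \<theta> \<epsilon> \<longleftrightarrow>
     q \<in> Fib C \<and> f \<in> Fib C \<and> Cod C f = Dom C q \<and> g \<in> Fib C \<and> Cod C g = Cod C q \<and>
     is_pullback C q g w \<theta> \<and> \<epsilon> \<in> Hom C (Dom C w) (Dom C f) \<and> f \<cdot>\<^bsub>C\<^esub> \<epsilon> = w \<and>
     (\<forall>h v n u. is_pullback C q h v n \<longrightarrow> u \<in> Hom C (Dom C v) (Dom C f) \<longrightarrow> f \<cdot>\<^bsub>C\<^esub> u = v \<longrightarrow>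
        (\<exists>k l. k \<in> Hom C (Dom C h) (Dom C g) \<and> l \<in> Hom C (Dom C v) (Dom C w) \<and>
           g \<cdot>\<^bsub>C\<^esub> k = h \<and> w \<cdot>\<^bsub>C\<^esub> l = v \<and> \<theta> \<cdot>\<^bsub>C\<^esub> l = k \<cdot>\<^bsub>C\<^esub> n \<and> \<epsilon> \<cdot>\<^bsub>C\<^esub> l = u)) \<and>
     (\<forall>h v n k k' l l'. is_pullback C q h v n \<longrightarrow>
        k \<in> Hom C (Dom C h) (Dom C g) \<longrightarrow> k' \<in> Hom C (Dom C h) (Dom C g) \<longrightarrow>
        l \<in> Hom C (Dom C v) (Dom C w) \<longrightarrow> l' \<in> Hom C (Dom C v) (Dom C w) \<longrightarrow>
        g \<cdot>\<^bsub>C\<^esub> k = h \<longrightarrow> g \<cdot>\<^bsub>C\<^esub> k' = h \<longrightarrow> w \<cdot>\<^bsub>C\<^esub> l = v \<longrightarrow> w \<cdot>\<^bsub>C\<^esub> l' = v \<longrightarrow>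
        \<theta> \<cdot>\<^bsub>C\<^esub> l = k \<cdot>\<^bsub>C\<^esub> n \<longrightarrow> \<theta> \<cdot>\<^bsub>C\<^esub> l' = k' \<cdot>\<^bsub>C\<^esub> n \<longrightarrow> \<epsilon> \<cdot>\<^bsub>C\<^esub> l = \<epsilon> \<cdot>\<^bsub>C\<^esub> l' \<longrightarrow> k = k')"

text \<open>The uniqueness clause of \<open>dep_prod\<close> with equality weakened to fibrewise
  homotopy. In this form, preservation of homotopy equivalences by \<open>\<Pi>\<close> can be
  applied to individual sections, again at arbitrary stages \<open>h\<close>.\<close>

definition reflects_fhomotopic :: "('o, 'm, 'x) fcat_scheme \<Rightarrow> 'm \<Rightarrow> 'm \<Rightarrow> 'm \<Rightarrow> 'm \<Rightarrow> 'm \<Rightarrow> 'm \<Rightarrow> bool" where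
  "reflects_fhomotopic C q f g w \<theta> \<epsilon> \<longleftrightarrow>
     (\<forall>h v n k k' l l'. is_pullback C q h v n \<longrightarrow>
        k \<in> Hom C (Dom C h) (Dom C g) \<longrightarrow> k' \<in> Hom C (Dom C h) (Dom C g) \<longrightarrow>
        l \<in> Hom C (Dom C v) (Dom C w) \<longrightarrow> l' \<in> Hom C (Dom C v) (Dom C w) \<longrightarrow>
        g \<cdot>\<^bsub>C\<^esub> k = h \<longrightarrow> g \<cdot>\<^bsub>C\<^esub> k' = h \<longrightarrow> w \<cdot>\<^bsub>C\<^esub> l = v \<longrightarrow> w \<cdot>\<^bsub>C\<^esub> l' = v \<longrightarrow>
        \<theta> \<cdot>\<^bsub>C\<^esub> l = k \<cdot>\<^bsub>C\<^esub> n \<longrightarrow> \<theta> \<cdot>\<^bsub>C\<^esub> l' = k' \<cdot>\<^bsub>C\<^esub> n \<longrightarrow> fhomotopic C f (\<epsilon> \<cdot>\<^bsub>C\<^esub> l) (\<epsilon> \<cdot>\<^bsub>C\<^esub> l') \<longrightarrow>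
        fhomotopic C g k k')"

context tribe
begin

lemma dep_prodD:
  assumes "dep_prod C q f g w \<theta> \<epsilon>"
  shows "q \<in> Fib C" "f \<in> Fib C" "Cod C f = Dom C q" "g \<in> Fib C" "Cod C g = Cod C q" "is_pullback C q g w \<theta>"
    "\<epsilon> \<in> Arr C" "Dom C \<epsilon> = Dom C w" "Cod C \<epsilon> = Dom C f" "f \<cdot> \<epsilon> = w"
  using assms unfolding dep_prod_def Hom_iff by - (elim conjE, assumption)+

lemma dep_prod_ex:
  assumes "dep_prod C q f g w \<theta> \<epsilon>" "is_pullback C q h v n" "u \<in> Arr C" "Dom C u = Dom C v" "Cod C u = Dom C f"
      "f \<cdot> u = v"
  obtains k l where "k \<in> Arr C" "Dom C k = Dom C h" "Cod C k = Dom C g" "g \<cdot> k = h"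
    "l \<in> Arr C" "Dom C l = Dom C v" "Cod C l = Dom C w" "w \<cdot> l = v" "\<theta> \<cdot> l = k \<cdot> n" "\<epsilon> \<cdot> l = u"
proof -
  have "\<exists>k l. k \<in> Hom C (Dom C h) (Dom C g) \<and> l \<in> Hom C (Dom C v) (Dom C w) \<and>
           g \<cdot> k = h \<and> w \<cdot> l = v \<and> \<theta> \<cdot> l = k \<cdot> n \<and> \<epsilon> \<cdot> l = u"
  proof -
    have "\<forall>h v n u. is_pullback C q h v n \<longrightarrow> u \<in> Hom C (Dom C v) (Dom C f) \<longrightarrow> f \<cdot> u = v \<longrightarrow>
        (\<exists>k l. k \<in> Hom C (Dom C h) (Dom C g) \<and> l \<in> Hom C (Dom C v) (Dom C w) \<and>
           g \<cdot> k = h \<and> w \<cdot> l = v \<and> \<theta> \<cdot> l = k \<cdot> n \<and> \<epsilon> \<cdot> l = u)"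
      using assms(1) unfolding dep_prod_def by (elim conjE)
    then show ?thesis by (elim allE impE) (use assms in simp_all)
  qed
  then show thesis using that by auto
qed

lemma dep_prod_uniq:
  assumes "dep_prod C q f g w \<theta> \<epsilon>" "is_pullback C q h v n"
    "k \<in> Arr C" "Dom C k = Dom C h" "Cod C k = Dom C g" "k' \<in> Arr C" "Dom C k' = Dom C h" "Cod C k' = Dom C g"
    "l \<in> Arr C" "Dom C l = Dom C v" "Cod C l = Dom C w" "l' \<in> Arr C" "Dom C l' = Dom C v" "Cod C l' = Dom C w"
    "g \<cdot> k = h" "g \<cdot> k' = h" "w \<cdot> l = v" "w \<cdot> l' = v" "\<theta> \<cdot> l = k \<cdot> n" "\<theta> \<cdot> l' = k' \<cdot> n" "\<epsilon> \<cdot> l = \<epsilon> \<cdot> l'"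
  shows "k = k'"
proof -
  have *: "\<forall>h v n k k' l l'. is_pullback C q h v n \<longrightarrow>
        k \<in> Hom C (Dom C h) (Dom C g) \<longrightarrow> k' \<in> Hom C (Dom C h) (Dom C g) \<longrightarrow>
        l \<in> Hom C (Dom C v) (Dom C w) \<longrightarrow> l' \<in> Hom C (Dom C v) (Dom C w) \<longrightarrow>
        g \<cdot> k = h \<longrightarrow> g \<cdot> k' = h \<longrightarrow> w \<cdot> l = v \<longrightarrow> w \<cdot> l' = v \<longrightarrow>
        \<theta> \<cdot> l = k \<cdot> n \<longrightarrow> \<theta> \<cdot> l' = k' \<cdot> n \<longrightarrow> \<epsilon> \<cdot> l = \<epsilon> \<cdot> l' \<longrightarrow> k = k'"
    using assms(1) unfolding dep_prod_def by (elim conjE)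
  show ?thesis
    by (rule *[rule_format, of h v n k k' l l']) (use assms in simp_all)
qed

lemma reflects_fhomotopicD:
  assumes "reflects_fhomotopic C q f g w \<theta> \<epsilon>" "is_pullback C q h v n"
    "k \<in> Arr C" "Dom C k = Dom C h" "Cod C k = Dom C g" "k' \<in> Arr C" "Dom C k' = Dom C h" "Cod C k' = Dom C g"
    "l \<in> Arr C" "Dom C l = Dom C v" "Cod C l = Dom C w" "l' \<in> Arr C" "Dom C l' = Dom C v" "Cod C l' = Dom C w"
    "g \<cdot> k = h" "g \<cdot> k' = h" "w \<cdot> l = v" "w \<cdot> l' = v" "\<theta> \<cdot> l = k \<cdot> n" "\<theta> \<cdot> l' = k' \<cdot> n"
    "fhomotopic C f (\<epsilon> \<cdot> l) (\<epsilon> \<cdot> l')"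
  shows "fhomotopic C g k k'"
  by (rule assms(1)[unfolded reflects_fhomotopic_def, rule_format, of h v n k k' l l']) (use assms(2-) in
      simp_all)

text \<open>The homotopical conclusion is conditional because the adjoint that computes a given
  value of \<open>\<Pi>\<close> need not be the one for which preservation of homotopy equivalences
  is assumed.\<close>

lemma adjoint_dep_prod:
  assumes p: "p \<in> Fib C" and f: "f \<in> Fib C" "Cod C f = Dom C p"
    and F: "pullback_functor C p Fo Fa" and G: "partial_right_adjoint C p Fo Fa Go Ga"
  obtains w \<theta> \<epsilon> where "dep_prod C p f (Go f) w \<theta> \<epsilon>"
    "(\<forall>w \<in> Arr (fslice C (Dom C p)). homotopy_equivalence (fslice C (Dom C p)) w
         \<longrightarrow> homotopy_equivalence (fslice C (Cod C p)) (Ga w)) \<Longrightarrow> reflects_fhomotopic C p f (Go f) w \<theta> \<epsilon>"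
proof -
  define X Y where "X = Dom C p" and "Y = Cod C p"
  obtain th where th0: "\<forall>h \<in> Obj (slice C Y). is_pullback C p h (Fo h) (th h)"
    and th1: "\<forall>k \<in> Arr (slice C Y). th (snd (snd k)) \<cdot> und (Fa k) = und k \<cdot> th (fst k)"
    and funF: "is_functor (slice C Y) (slice C X) Fo Fa"
    using F unfolding pullback_functor_def X_def Y_def by blast
  obtain ph where gfun: "is_functor (fslice C X) (fslice C Y) Go Ga"
    and ph0: "\<forall>h \<in> Obj (slice C Y). \<forall>f \<in> Obj (fslice C X).
          bij_betw (ph h f) (Hom (slice C X) (Fo h) f) (Hom (slice C Y) h (Go f))"
    and ph1: "\<forall>h \<in> Obj (slice C Y). \<forall>f \<in> Obj (fslice C X).
          \<forall>u \<in> Hom (slice C X) (Fo h) f. \<forall>k \<in> Arr (slice C Y). snd (snd k) = h \<longrightarrow>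
            ph (fst k) f (u \<cdot>\<^bsub>slice C X\<^esub> Fa k) = ph h f u \<cdot>\<^bsub>slice C Y\<^esub> k"
    and ph2: "\<forall>h \<in> Obj (slice C Y). \<forall>f \<in> Obj (fslice C X).
          \<forall>u \<in> Hom (slice C X) (Fo h) f. \<forall>w \<in> Arr (fslice C X). fst w = f \<longrightarrow>
            ph h (snd (snd w)) (w \<cdot>\<^bsub>slice C X\<^esub> u) = Ga w \<cdot>\<^bsub>slice C Y\<^esub> ph h f u"
    using G unfolding partial_right_adjoint_def Let_def X_def Y_def by blast
  have [simp]: "Dom C p = X" "Cod C p = Y" "Cod C f = X" using f by (simp_all add: X_def Y_def)
  have [simp]: "Y \<in> Obj C" using cod_obj[of p] p by simp
  note [simp] = p f(1)
  have Gob: "Go x \<in> Fib C" "Cod C (Go x) = Y" if "x \<in> Fib C" "Cod C x = X" for x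
    using gfun that unfolding is_functor_def by auto
  have Gar: "Ga k \<in> Hom (fslice C Y) (Go (fst k)) (Go (snd (snd k)))" if "k \<in> Arr (fslice C X)" for k
    using gfun that unfolding is_functor_def by (metis fslice_simps(2,3))
  have Far: "Fa k \<in> Hom (slice C X) (Fo (fst k)) (Fo (snd (snd k)))" if "k \<in> Arr (slice C Y)" for k
    using funF that unfolding is_functor_def by (metis slice_simps(2,3))
  have Fob: "is_pullback C p h (Fo h) (th h)" if "h \<in> Arr C" "Cod C h = Y" for h
    using th0 that by simp
  define g where "g = Go f"
  have [simp]: "g \<in> Fib C" "Cod C g = Y" using Gob[OF f(1)] by (simp_all add: g_def)
  note pbg = Fob[of g, simplified]
  note [simp] = pbD(4-6,8)[OF pbg]
  have [simp]: "Cod C (Fo g) = X" using pbD(7)[OF pbg] by simp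
  have "(g, Idn C (Dom C g), g) \<in> Hom (slice C Y) g (Go f)" by (simp add: g_def[symmetric])
  moreover have bij: "bij_betw (ph h f) (Hom (slice C X) (Fo h) f) (Hom (slice C Y) h g)" if "h \<in> Arr C"
      "Cod C h = Y" for h
    using ph0 that by (simp add: g_def del: Hom_iff)
  \<comment> \<open>The counit is the map whose transpose is the identity of
    \<open>Go f\<close>.\<close>
  ultimately obtain u0 where u0: "u0 \<in> Hom (slice C X) (Fo g) f" "ph g f u0 = (g, Idn C (Dom C g), g)"
    using bij_betw_imp_surj_on[OF bij[of g]] unfolding g_def[symmetric] by (metis (no_types, lifting) \<open>g \<in> Fib
        C\<close> \<open>Cod C g = Y\<close> fib_in_arr imageE)
  obtain \<epsilon> where u0': "u0 = (Fo g, \<epsilon>, f)" and [simp]: "\<epsilon> \<in> Arr C" "Dom C \<epsilon> = Dom C (Fo g)" "Cod C \<epsilon> = Dom C f"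
    and f\<epsilon>: "f \<cdot> \<epsilon> = Fo g"
    using u0(1) by (cases u0) auto
  \<comment> \<open>By naturality of the bijection in \<open>h\<close>, every map \<open>k\<close>
    into \<open>g\<close> is the transpose of the counit after the pullback of
    \<open>k\<close>.\<close>
  have core: "\<exists>l. Fa (h, k, g) = (Fo h, l, Fo g) \<and> l \<in> Arr C \<and> Dom C l = Dom C (Fo h) \<and> Cod C l = Dom C (Fo g) \<and>
      Fo g \<cdot> l = Fo h \<and> th g \<cdot> l = k \<cdot> th h \<and> ph h f (Fo h, \<epsilon> \<cdot> l, f) = (h, k, g)"
    if k: "k \<in> Arr C" "Cod C k = Dom C g" and h: "g \<cdot> k = h" for h k
  proof -
    have [simp]: "h \<in> Arr C" "Dom C h = Dom C k" "Cod C h = Y" using k h by auto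
    have K: "(h, k, g) \<in> Arr (slice C Y)" using k h by simp
    note Fk = Far[OF K]
    define l where "l = und (Fa (h, k, g))"
    have eq: "Fa (h, k, g) = (Fo h, l, Fo g)" using Fk by (simp add: l_def prod_eq_iff)
    have l: "l \<in> Arr C" "Dom C l = Dom C (Fo h)" "Cod C l = Dom C (Fo g)" "Fo g \<cdot> l = Fo h"
      using Fk by (simp_all add: eq)
    have "th g \<cdot> l = k \<cdot> th h" using th1[rule_format, OF K] by (simp add: eq)
    moreover have "ph h f (Fo h, \<epsilon> \<cdot> l, f) = (h, k, g)"
    proof -
      have "ph (fst (h, k, g)) f (u0 \<cdot>\<^bsub>slice C X\<^esub> Fa (h, k, g)) = ph g f u0 \<cdot>\<^bsub>slice C Y\<^esub> (h, k, g)"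
        by (rule ph1[rule_format]) (rule K u0(1) | simp)+
      then show ?thesis using k u0(2) by (simp add: eq u0')
    qed
    ultimately show ?thesis using eq l by blast
  qed
  have D: "dep_prod C p f g (Fo g) (th g) \<epsilon>"
    unfolding dep_prod_def
  proof (intro conjI allI impI)
    fix h v n u assume pb: "is_pullback C p h v n" and u: "u \<in> Hom C (Dom C v) (Dom C f)" "f \<cdot> u = v"
    note [simp] = pbD(2-6,8)[OF pb]
    have [simp]: "Cod C v = X" using pbD(7)[OF pb] by simp
    have hY: "Cod C h = Y" "h \<in> Arr C" by simp_all
    \<comment> \<open>The universal property concerns any pullback of \<open>h\<close>, but the
      adjunction only the chosen one. The isomorphisms \<open>i\<close>, \<open>j\<close> pass
      between the two.\<close>
    obtain i j where [simp]: "i \<in> Arr C" "Dom C i = Dom C v" "Cod C i = Dom C (Fo h)"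
      and i: "Fo h \<cdot> i = v" "th h \<cdot> i = n"
      and [simp]: "j \<in> Arr C" "Dom C j = Dom C (Fo h)" "Cod C j = Dom C v" and j: "v \<cdot> j = Fo h" "n \<cdot> j = th h"
      and "i \<cdot> j = Idn C (Dom C (Fo h))" and ji: "j \<cdot> i = Idn C (Dom C v)"
      by (rule pb_unique_iso[OF Fob[OF hY(2,1)] pb])
    note pbh = Fob[OF hY(2,1)]
    note [simp] = pbD(4,5,6,8)[OF pbh]
    have [simp]: "Cod C (Fo h) = X" using pbD(7)[OF pbh] by simp
    have fuj: "f \<cdot> (u \<cdot> j) = Fo h" using u j by (simp add: reassoc[OF u(2)])
    have "(Fo h, u \<cdot> j, f) \<in> Hom (slice C X) (Fo h) f" using u fuj by simp
    then have "ph h f (Fo h, u \<cdot> j, f) \<in> Hom (slice C Y) h g"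
      using bij_betwE[OF bij[OF hY(2,1)]] by blast
    then obtain k where k: "ph h f (Fo h, u \<cdot> j, f) = (h, k, g)" "k \<in> Arr C" "Dom C k = Dom C h"
        "Cod C k = Dom C g" "g \<cdot> k = h"
      by (cases "ph h f (Fo h, u \<cdot> j, f)") auto
    obtain l where l: "l \<in> Arr C" "Dom C l = Dom C (Fo h)" "Cod C l = Dom C (Fo g)"
      "Fo g \<cdot> l = Fo h" "th g \<cdot> l = k \<cdot> th h" "ph h f (Fo h, \<epsilon> \<cdot> l, f) = (h, k, g)"
      using core[OF k(2,4,5)] by blast
    have "(Fo h, \<epsilon> \<cdot> l, f) = (Fo h, u \<cdot> j, f)"
    proof (rule inj_onD[OF bij_betw_imp_inj_on[OF bij[OF hY(2,1)]]])
      show "(Fo h, \<epsilon> \<cdot> l, f) \<in> Hom (slice C X) (Fo h) f" using l by (simp add: reassoc[OF f\<epsilon>])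
      show "(Fo h, u \<cdot> j, f) \<in> Hom (slice C X) (Fo h) f" using u fuj by simp
    qed (simp add: k l)
    then have e: "\<epsilon> \<cdot> l = u \<cdot> j" by simp
    have "\<epsilon> \<cdot> (l \<cdot> i) = u" using l u by (simp add: reassoc[OF e] ji)
    moreover have "th g \<cdot> (l \<cdot> i) = k \<cdot> n" using l k by (simp add: reassoc[OF l(5)] i)
    moreover have "Fo g \<cdot> (l \<cdot> i) = v" using l k by (simp add: reassoc[OF l(4)] i)
    ultimately show "\<exists>k l. k \<in> Hom C (Dom C h) (Dom C g) \<and> l \<in> Hom C (Dom C v) (Dom C (Fo g)) \<and>
           g \<cdot> k = h \<and> Fo g \<cdot> l = v \<and> th g \<cdot> l = k \<cdot> n \<and> \<epsilon> \<cdot> l = u"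
      using k l by (intro exI[of _ k] exI[of _ "l \<cdot> i"]) simp
  next
    fix h v n k k' l l'
    assume pb: "is_pullback C p h v n" and k: "k \<in> Hom C (Dom C h) (Dom C g)" "k' \<in> Hom C (Dom C h) (Dom C g)"
      and l: "l \<in> Hom C (Dom C v) (Dom C (Fo g))" "l' \<in> Hom C (Dom C v) (Dom C (Fo g))"
      and e: "g \<cdot> k = h" "g \<cdot> k' = h" "Fo g \<cdot> l = v" "Fo g \<cdot> l' = v" "th g \<cdot> l = k \<cdot> n" "th g \<cdot> l' = k' \<cdot> n"
        "\<epsilon> \<cdot> l = \<epsilon> \<cdot> l'"
    note [simp] = pbD(2-6,8)[OF pb]
    have [simp]: "Cod C v = X" using pbD(7)[OF pb] by simp
    have hY: "Cod C h = Y" "h \<in> Arr C" by simp_all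
    note pbh = Fob[OF hY(2,1)]
    obtain i j where [simp]: "i \<in> Arr C" "Dom C i = Dom C v" "Cod C i = Dom C (Fo h)"
      and i: "Fo h \<cdot> i = v" "th h \<cdot> i = n"
      and [simp]: "j \<in> Arr C" "Dom C j = Dom C (Fo h)" "Cod C j = Dom C v" and j: "v \<cdot> j = Fo h" "n \<cdot> j = th h"
      and "i \<cdot> j = Idn C (Dom C (Fo h))" and ji: "j \<cdot> i = Idn C (Dom C v)"
      by (rule pb_unique_iso[OF pbh pb])
    have aux: "(Fo h, \<epsilon> \<cdot> (l \<cdot> j), f) \<in> {u. ph h f u = (h, k, g)}"
      if [simp]: "k \<in> Arr C" "Dom C k = Dom C h" "Cod C k = Dom C g" "l \<in> Arr C" "Dom C l = Dom C v"
          "Cod C l = Dom C (Fo g)"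
        and e: "g \<cdot> k = h" "Fo g \<cdot> l = v" "th g \<cdot> l = k \<cdot> n" for k l
    proof -
      obtain l' where l': "l' \<in> Arr C" "Dom C l' = Dom C (Fo h)" "Cod C l' = Dom C (Fo g)"
        "Fo g \<cdot> l' = Fo h" "th g \<cdot> l' = k \<cdot> th h" "ph h f (Fo h, \<epsilon> \<cdot> l', f) = (h, k, g)"
        using core[OF _ _ e(1)] by auto
      have "l' = l \<cdot> j"
        by (rule pb_uniq[OF pbg]) (use l' in \<open>simp_all add: reassoc[OF e(2)] reassoc[OF e(3)] j\<close>)
      then show ?thesis using l' by simp
    qed
    have "\<epsilon> \<cdot> (l \<cdot> j) = \<epsilon> \<cdot> (l' \<cdot> j)" using l by (simp add: reassoc[OF e(7)])
    then show "k = k'" using aux[of k l] aux[of k' l'] k l e by simp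
  qed (simp_all add: pbg f\<epsilon>)
  have R: "reflects_fhomotopic C p f g (Fo g) (th g) \<epsilon>"
    if HE: "\<And>w. \<lbrakk>w \<in> Arr (fslice C X); homotopy_equivalence (fslice C X) w\<rbrakk>
         \<Longrightarrow> homotopy_equivalence (fslice C Y) (Ga w)"
    unfolding reflects_fhomotopic_def
  proof (intro allI impI)
    fix h v n k k' l l'
    assume pb: "is_pullback C p h v n" and k: "k \<in> Hom C (Dom C h) (Dom C g)" "k' \<in> Hom C (Dom C h) (Dom C g)"
      and l: "l \<in> Hom C (Dom C v) (Dom C (Fo g))" "l' \<in> Hom C (Dom C v) (Dom C (Fo g))"
      and e: "g \<cdot> k = h" "g \<cdot> k' = h" "Fo g \<cdot> l = v" "Fo g \<cdot> l' = v" "th g \<cdot> l = k \<cdot> n" "th g \<cdot> l' = k' \<cdot> n"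
      and H: "fhomotopic C f (\<epsilon> \<cdot> l) (\<epsilon> \<cdot> l')"
    note [simp] = pbD(2-6,8)[OF pb]
    have [simp]: "Cod C v = X" using pbD(7)[OF pb] by simp
    have hY: "Cod C h = Y" "h \<in> Arr C" by simp_all
    note pbh = Fob[OF hY(2,1)]
    note [simp] = pbD(4,5,6,8)[OF pbh]
    have [simp]: "Cod C (Fo h) = X" using pbD(7)[OF pbh] by simp
    obtain i j where [simp]: "i \<in> Arr C" "Dom C i = Dom C v" "Cod C i = Dom C (Fo h)"
      and i: "Fo h \<cdot> i = v" "th h \<cdot> i = n"
      and [simp]: "j \<in> Arr C" "Dom C j = Dom C (Fo h)" "Cod C j = Dom C v" and j: "v \<cdot> j = Fo h" "n \<cdot> j = th h"
      and "i \<cdot> j = Idn C (Dom C (Fo h))" and ji: "j \<cdot> i = Idn C (Dom C v)"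
      by (rule pb_unique_iso[OF pbh pb])
    have aux: "ph h f (Fo h, \<epsilon> \<cdot> (l \<cdot> j), f) = (h, k, g)"
      if [simp]: "k \<in> Arr C" "Dom C k = Dom C h" "Cod C k = Dom C g" "l \<in> Arr C" "Dom C l = Dom C v"
          "Cod C l = Dom C (Fo g)"
        and e: "g \<cdot> k = h" "Fo g \<cdot> l = v" "th g \<cdot> l = k \<cdot> n" for k l
    proof -
      obtain l' where l': "l' \<in> Arr C" "Dom C l' = Dom C (Fo h)" "Cod C l' = Dom C (Fo g)"
        "Fo g \<cdot> l' = Fo h" "th g \<cdot> l' = k \<cdot> th h" "ph h f (Fo h, \<epsilon> \<cdot> l', f) = (h, k, g)"
        using core[OF _ _ e(1)] by auto
      have "l' = l \<cdot> j"
        by (rule pb_uniq[OF pbg]) (use l' in \<open>simp_all add: reassoc[OF e(2)] reassoc[OF e(3)] j\<close>)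
      then show ?thesis using l' by simp
    qed
    \<comment> \<open>The path object of \<open>f\<close> is viewed as the object \<open>fd\<close>
      of the slice over \<open>X\<close>, with \<open>r\<close>, \<open>e0\<close>,
      \<open>e1\<close> as slice maps. Their images under \<open>Ga\<close> then behave like a path
      object of \<open>g\<close>, and the given homotopy \<open>m\<close> becomes a point of
      it.\<close>
    obtain r e0 e1 where P: "fpath C f r e0 e1" using fpath_ex[OF f(1)] .
    note [simp] = fpathD(2-9)[OF P]
    note P10 = fpathD(10)[OF P] and P11 = fpathD(11)[OF P] and P12 = fpathD(12)[OF P]
    obtain m where [simp]: "m \<in> Arr C" "Dom C m = Dom C (Fo h)" "Cod C m = Cod C r"
      and m: "e0 \<cdot> m = \<epsilon> \<cdot> (l \<cdot> j)" "e1 \<cdot> m = \<epsilon> \<cdot> (l' \<cdot> j)"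
      by (rule fhomotopic_path[OF fhomotopic_pre[OF H, of j] P]) (use l in simp_all)
    define fd where "fd = f \<cdot> e0"
    have fd [simp]: "fd \<in> Fib C" "Cod C fd = X" "Dom C fd = Cod C r" by (simp_all add: fd_def)
    have fdr: "fd \<cdot> r = f" by (simp add: fd_def P10)
    have e1fd: "f \<cdot> e1 = fd" by (simp add: fd_def P12)
    have fdm: "fd \<cdot> m = Fo h" using l by (simp add: fd_def m reassoc[OF f\<epsilon>] reassoc[OF e(3)] j)
    have W: "(f, r, fd) \<in> Arr (fslice C X)" "(fd, e0, f) \<in> Arr (fslice C X)" "(fd, e1, f) \<in> Arr (fslice C X)"
      by (simp_all add: fdr e1fd fd_def[symmetric])
    define gd where "gd = Go fd"
    have [simp]: "gd \<in> Fib C" "Cod C gd = Y" using Gob[OF fd(1,2)] by (simp_all add: gd_def)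
    obtain R where R: "Ga (f, r, fd) = (g, R, gd)" and [simp]: "R \<in> Arr C" "Dom C R = Dom C g"
        "Cod C R = Dom C gd" and gR: "gd \<cdot> R = g"
      using Gar[OF W(1)] by (rule fslice_HomE) (simp add: g_def gd_def)
    obtain E0 where E0: "Ga (fd, e0, f) = (gd, E0, g)" and [simp]: "E0 \<in> Arr C" "Dom C E0 = Dom C gd"
        "Cod C E0 = Dom C g" and gE0: "g \<cdot> E0 = gd"
      using Gar[OF W(2)] by (rule fslice_HomE) (simp add: g_def gd_def)
    obtain E1 where E1: "Ga (fd, e1, f) = (gd, E1, g)" and [simp]: "E1 \<in> Arr C" "Dom C E1 = Dom C gd"
        "Cod C E1 = Dom C g" and gE1: "g \<cdot> E1 = gd"
      using Gar[OF W(3)] by (rule fslice_HomE) (simp add: g_def gd_def)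
    have gid: "Ga (f, Idn C (Dom C f), f) = (g, Idn C (Dom C g), g)"
      using gfun f unfolding is_functor_def by (simp add: g_def)
    have gcmp: "Ga (y \<cdot>\<^bsub>fslice C X\<^esub> x) = Ga y \<cdot>\<^bsub>fslice C Y\<^esub> Ga x"
      if "x \<in> Arr (fslice C X)" "y \<in> Arr (fslice C X)" "fst y = snd (snd x)" for x y
      using gfun that unfolding is_functor_def fslice_simps(2,3) by blast
    \<comment> \<open>Both image endpoint maps are retractions of \<open>R\<close>. As
      \<open>R\<close> is a homotopy equivalence over \<open>Y\<close>, they are both homotopic to
      its inverse \<open>n0\<close>, hence to each other.\<close>
    have E0R: "E0 \<cdot> R = Idn C (Dom C g)" using gcmp[OF W(1,2)] by (simp add: gid P10 E0 R)
    have E1R: "E1 \<cdot> R = Idn C (Dom C g)" using gcmp[OF W(1,3)] by (simp add: gid P11 E1 R)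
    have "homotopy_equivalence (fslice C X) (f, r, fd)"
      unfolding homotopy_equivalence_def
    proof (intro conjI bexI[of _ "(fd, e0, f)"])
      have "homotopic (fslice C X) (f, Idn C (Dom C f), f) (f, Idn C (Dom C f), f)"
        by (rule fhomotopic_homotopic_fslice) (simp_all add: fhomotopic_refl)
      then show "homotopic (fslice C X) ((fd, e0, f) \<cdot>\<^bsub>fslice C X\<^esub> (f, r, fd)) (Idn (fslice C X) (Dom (fslice C
          X) (f, r, fd)))"
        by (simp add: P10)
      have "fhomotopic C fd (r \<cdot> e0) (Idn C (Dom C fd))"
        by (rule fhomotopic_ext_eq[of r]) (simp_all add: P10 reassoc[OF fdr] fd_def[symmetric])
      then have "homotopic (fslice C X) (fd, r \<cdot> e0, fd) (fd, Idn C (Dom C fd), fd)"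
        by (rule fhomotopic_homotopic_fslice) (simp_all add: reassoc[OF fdr] fd_def[symmetric])
      then show "homotopic (fslice C X) ((f, r, fd) \<cdot>\<^bsub>fslice C X\<^esub> (fd, e0, f)) (Idn (fslice C X) (Cod (fslice C
          X) (f, r, fd)))"
        by simp
    qed (use W in \<open>simp_all\<close>)
    from HE[OF W(1) this] obtain N where N: "N \<in> Hom (fslice C Y) gd g"
      "homotopic (fslice C Y) ((g, R, gd) \<cdot>\<^bsub>fslice C Y\<^esub> N) (gd, Idn C (Dom C gd), gd)"
      unfolding homotopy_equivalence_def R by (auto simp del: Hom_iff)
    obtain n0 where n0: "N = (gd, n0, g)" and [simp]: "n0 \<in> Arr C" "Dom C n0 = Dom C gd" "Cod C n0 = Dom C g"
      using N(1) by (rule fslice_HomE) simp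
    have RN: "fhomotopic C gd (R \<cdot> n0) (Idn C (Dom C gd))"
      using homotopic_fslice_fhomotopic[OF N(2)] by (simp add: n0)
    have "fhomotopic C g (E0 \<cdot> (R \<cdot> n0)) (E0 \<cdot> Idn C (Dom C gd))"
      by (rule fhomotopic_post[OF RN, where v = "Idn C Y"]) (simp_all add: gE0)
    then have h0: "fhomotopic C g n0 E0" by (simp add: reassoc[OF E0R])
    have "fhomotopic C g (E1 \<cdot> (R \<cdot> n0)) (E1 \<cdot> Idn C (Dom C gd))"
      by (rule fhomotopic_post[OF RN, where v = "Idn C Y"]) (simp_all add: gE1)
    then have h1: "fhomotopic C g n0 E1" by (simp add: reassoc[OF E1R])
    have E01: "fhomotopic C g E0 E1" using fhomotopic_trans[OF fhomotopic_sym[OF h0] h1] .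
    have M: "(Fo h, m, fd) \<in> Hom (slice C X) (Fo h) fd" by (simp add: fdm)
    have "bij_betw (ph h fd) (Hom (slice C X) (Fo h) fd) (Hom (slice C Y) h gd)"
      using ph0 hY fd by (simp add: gd_def del: Hom_iff)
    from bij_betwE[OF this] M have "ph h fd (Fo h, m, fd) \<in> Hom (slice C Y) h gd" by blast
    then obtain \<kappa> where \<kappa>: "ph h fd (Fo h, m, fd) = (h, \<kappa>, gd)" and [simp]: "\<kappa> \<in> Arr C" "Dom C \<kappa> = Dom C h"
        "Cod C \<kappa> = Dom C gd"
      by (cases "ph h fd (Fo h, m, fd)") auto
    \<comment> \<open>By naturality in the second argument, the transpose \<open>\<kappa>\<close> of
      \<open>m\<close> has the transposes of the two ends of \<open>m\<close> as its ends under
      \<open>E0\<close> and \<open>E1\<close>; these are \<open>k\<close> and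
      \<open>k'\<close>.\<close>
    have *: "ph h f (Fo h, e \<cdot> m, f) = Ga (fd, e, f) \<cdot>\<^bsub>slice C Y\<^esub> (h, \<kappa>, gd)" if "(fd, e, f) \<in> Arr (fslice C X)"
        for e
    proof -
      have "ph h (snd (snd (fd, e, f))) ((fd, e, f) \<cdot>\<^bsub>slice C X\<^esub> (Fo h, m, fd)) = Ga (fd, e, f) \<cdot>\<^bsub>slice C Y\<^esub> ph
          h fd (Fo h, m, fd)"
        by (rule ph2[rule_format]) (use that M hY fd in simp_all)
      then show ?thesis by (simp add: \<kappa>)
    qed
    have "(h, k, g) = (h, E0 \<cdot> \<kappa>, g)" using *[OF W(2)] aux[of k l] k l e by (simp add: m E0)
    moreover have "(h, k', g) = (h, E1 \<cdot> \<kappa>, g)" using *[OF W(3)] aux[of k' l'] k l e by (simp add: m E1)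
    ultimately show "fhomotopic C g k k'" using fhomotopic_pre[OF E01, of \<kappa>] by simp
  qed
  show thesis
    by (rule that[OF D[unfolded g_def]]) (use R in \<open>auto simp: g_def\<close>)
qed

end

context pi_tribe
begin

text \<open>\<open>is_Pi\<close> allows any partial right adjoint, whereas the axiom gives the
  homotopical property for one of them. The universal property yields a comparison map
  \<open>\<psi>\<close> between the two values, and homotopies are pushed along it.\<close>

lemma is_Pi_dep_prod:
  assumes "is_Pi C q f g"
  obtains w \<theta> \<epsilon> where "dep_prod C q f g w \<theta> \<epsilon>" "reflects_fhomotopic C q f g w \<theta> \<epsilon>"
proof -
  have q: "q \<in> Fib C" and f: "f \<in> Fib C" "Cod C f = Dom C q"
    using assms unfolding is_Pi_def by simp_all
  obtain Fo Fa Go Ga where "pullback_functor C q Fo Fa" "partial_right_adjoint C q Fo Fa Go Ga" and g: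
      "g = Go f"
    using assms unfolding is_Pi_def by blast
  then obtain w \<theta> \<epsilon> where D: "dep_prod C q f g w \<theta> \<epsilon>"
    using adjoint_dep_prod[OF q f] by metis
  obtain Fo' Fa' Go' Ga' where A: "pullback_functor C q Fo' Fa'" "partial_right_adjoint C q Fo' Fa' Go' Ga'"
    and HE: "\<forall>w \<in> Arr (fslice C (Dom C q)). homotopy_equivalence (fslice C (Dom C q)) w
         \<longrightarrow> homotopy_equivalence (fslice C (Cod C q)) (Ga' w)"
    using pi_ex[OF q] by blast
  obtain w' \<theta>' \<epsilon>' where D': "dep_prod C q f (Go' f) w' \<theta>' \<epsilon>'" and R':
      "reflects_fhomotopic C q f (Go' f) w' \<theta>' \<epsilon>'"
    using adjoint_dep_prod[OF q f A] HE by metis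
  define g' where "g' = Go' f"
  note D' = D'[folded g'_def] and R' = R'[folded g'_def]
  note [simp] = dep_prodD(1-5,7-9)[OF D] dep_prodD(4,5,7-9)[OF D']
  note pb = dep_prodD(6)[OF D] and pb' = dep_prodD(6)[OF D']
  note [simp] = pbD(4-8)[OF pb] pbD(4-8)[OF pb']
  obtain \<psi> m where [simp]: "\<psi> \<in> Arr C" "Dom C \<psi> = Dom C g'" "Cod C \<psi> = Dom C g" and \<psi>: "g \<cdot> \<psi> = g'"
    and [simp]: "m \<in> Arr C" "Dom C m = Dom C w'" "Cod C m = Dom C w" and m: "w \<cdot> m = w'" "\<theta> \<cdot> m = \<psi> \<cdot> \<theta>'"
        "\<epsilon> \<cdot> m = \<epsilon>'"
    by (rule dep_prod_ex[OF D pb', of \<epsilon>']) (simp_all add: dep_prodD(10)[OF D'])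
  have "reflects_fhomotopic C q f g w \<theta> \<epsilon>"
    unfolding reflects_fhomotopic_def
  proof (intro allI impI)
    fix h v n k k' l l'
    assume pbh: "is_pullback C q h v n" and k: "k \<in> Hom C (Dom C h) (Dom C g)" "k' \<in> Hom C (Dom C h) (Dom C g)"
      and l: "l \<in> Hom C (Dom C v) (Dom C w)" "l' \<in> Hom C (Dom C v) (Dom C w)"
      and e: "g \<cdot> k = h" "g \<cdot> k' = h" "w \<cdot> l = v" "w \<cdot> l' = v" "\<theta> \<cdot> l = k \<cdot> n" "\<theta> \<cdot> l' = k' \<cdot> n"
      and H: "fhomotopic C f (\<epsilon> \<cdot> l) (\<epsilon> \<cdot> l')"
    note [simp] = pbD(2-8)[OF pbh]
    \<comment> \<open>Each map \<open>k\<close> into \<open>g\<close> is retransposed to a map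
      \<open>\<kappa>\<close> into \<open>g'\<close>; uniqueness of transposes gives
      \<open>\<psi> \<cdot> \<kappa> = k\<close>.\<close>
    have "\<exists>\<kappa> i. \<kappa> \<in> Arr C \<and> Dom C \<kappa> = Dom C h \<and> Cod C \<kappa> = Dom C g' \<and> g' \<cdot> \<kappa> = h \<and>
      i \<in> Arr C \<and> Dom C i = Dom C v \<and> Cod C i = Dom C w' \<and> w' \<cdot> i = v \<and> \<theta>' \<cdot> i = \<kappa> \<cdot> n \<and> \<epsilon>' \<cdot> i = \<epsilon> \<cdot> l \<and> \<psi> \<cdot> \<kappa>
          = k"
      if k: "k \<in> Arr C" "Dom C k = Dom C h" "Cod C k = Dom C g" and l: "l \<in> Arr C" "Dom C l = Dom C v"
          "Cod C l = Dom C w"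
        and e: "g \<cdot> k = h" "w \<cdot> l = v" "\<theta> \<cdot> l = k \<cdot> n" for k l
    proof -
      have "f \<cdot> (\<epsilon> \<cdot> l) = v" using l e by (simp add: reassoc[OF dep_prodD(10)[OF D]])
      then obtain \<kappa> i where \<kappa>: "\<kappa> \<in> Arr C" "Dom C \<kappa> = Dom C h" "Cod C \<kappa> = Dom C g'" "g' \<cdot> \<kappa> = h" and
        i: "i \<in> Arr C" "Dom C i = Dom C v" "Cod C i = Dom C w'" "w' \<cdot> i = v" "\<theta>' \<cdot> i = \<kappa> \<cdot> n" "\<epsilon>' \<cdot> i = \<epsilon> \<cdot> l"
        using dep_prod_ex[OF D' pbh, of "\<epsilon> \<cdot> l"] l by auto
      have "\<psi> \<cdot> \<kappa> = k"
        by (rule dep_prod_uniq[OF D pbh, of _ _ "m \<cdot> i" l])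
          (use \<kappa> i k l e in \<open>simp_all add: reassoc[OF \<psi>] reassoc[OF m(1)] reassoc[OF m(2)] reassoc[OF m(3)]\<close>)
      then show ?thesis using \<kappa> i by blast
    qed
    note X = this
    obtain \<kappa> i where 1: "\<kappa> \<in> Arr C" "Dom C \<kappa> = Dom C h" "Cod C \<kappa> = Dom C g'" "g' \<cdot> \<kappa> = h"
      "i \<in> Arr C" "Dom C i = Dom C v" "Cod C i = Dom C w'" "w' \<cdot> i = v" "\<theta>' \<cdot> i = \<kappa> \<cdot> n" "\<epsilon>' \<cdot> i = \<epsilon> \<cdot> l"
          "\<psi> \<cdot> \<kappa> = k"
      using X[of k l] k l e by (simp only: Hom_iff) blast
    obtain \<kappa>' i' where 2: "\<kappa>' \<in> Arr C" "Dom C \<kappa>' = Dom C h" "Cod C \<kappa>' = Dom C g'" "g' \<cdot> \<kappa>' = h"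
      "i' \<in> Arr C" "Dom C i' = Dom C v" "Cod C i' = Dom C w'" "w' \<cdot> i' = v" "\<theta>' \<cdot> i' = \<kappa>' \<cdot> n"
          "\<epsilon>' \<cdot> i' = \<epsilon> \<cdot> l'" "\<psi> \<cdot> \<kappa>' = k'"
      using X[of k' l'] k l e by (simp only: Hom_iff) blast
    have "fhomotopic C g' \<kappa> \<kappa>'"
      by (rule reflects_fhomotopicD[OF R' pbh, of \<kappa> \<kappa>' i i']) (use 1 2 H in simp_all)
    then have "fhomotopic C g (\<psi> \<cdot> \<kappa>) (\<psi> \<cdot> \<kappa>')"
      by (rule fhomotopic_post[where v = "Idn C (Cod C q)"]) (simp_all add: \<psi>)
    then show "fhomotopic C g k k'" using 1 2 by simp
  qed
  then show thesis using that D by blast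
qed

end

section \<open>The classifying map\<close>

text \<open>Here \<open>g\<close> is the paper's \<open>Pr\<^sub>p\<close>; its counit \<open>\<epsilon>\<close> assigns to a point of
  \<open>\<Omega>\<^sub>p\<close> over \<open>b\<close> and to \<open>y, y'\<close> in the fibre of \<open>p\<close> over \<open>b\<close> a path from \<open>y\<close> to \<open>y'\<close>.\<close>

locale omega = pi_tribe C for C :: "('o, 'm, 'x) fcat_scheme" (structure) +
  fixes p q1 q2 r d g w \<theta> \<epsilon>
  assumes p [simp]: "p \<in> Fib C" and pb: "is_pullback C p p q1 q2"
    and d [simp]: "d \<in> Fib C" "Dom C d = Cod C r" "Cod C d = Dom C q1"
    and r [simp]: "anodyne C r" "Dom C r = Dom C p"
    and dr: "q1 \<cdot> (d \<cdot> r) = Idn C (Dom C p)" "q2 \<cdot> (d \<cdot> r) = Idn C (Dom C p)"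
    and D: "dep_prod C (p \<cdot> q1) d g w \<theta> \<epsilon>" and R: "reflects_fhomotopic C (p \<cdot> q1) d g w \<theta> \<epsilon>"
begin

lemmas pb_simps [simp] = pbD(4-8)[OF pb]

lemma q_fib [simp]: "q1 \<in> Fib C" "q2 \<in> Fib C"
  using fib_pb1[OF pb] fib_pb2[OF pb] by simp_all

lemmas pq = pbD(9)[OF pb]

lemma drx: "\<lbrakk>x \<in> Arr C; Cod C x = Dom C p\<rbrakk> \<Longrightarrow> q1 \<cdot> (d \<cdot> (r \<cdot> x)) = x"
  "\<lbrakk>x \<in> Arr C; Cod C x = Dom C p\<rbrakk> \<Longrightarrow> q2 \<cdot> (d \<cdot> (r \<cdot> x)) = x"
  using reassoc[OF dr(1), of x] reassoc[OF dr(2), of x] by simp_all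

lemma g_fib [simp]: "g \<in> Fib C" "Cod C g = Cod C p"
  and \<epsilon>_simps [simp]: "\<epsilon> \<in> Arr C" "Dom C \<epsilon> = Dom C w" "Cod C \<epsilon> = Cod C r" and d\<epsilon>: "d \<cdot> \<epsilon> = w"
  using dep_prodD[OF D] by simp_all

lemmas pbw = dep_prodD(6)[OF D]

lemma w_simps [simp]: "w \<in> Arr C" "\<theta> \<in> Arr C" "Dom C \<theta> = Dom C w" "Cod C w = Dom C q1" "Cod C \<theta> = Dom C g"
  using pbD[OF pbw] by simp_all

lemma path_monic_Pr: "path_monic C g"
proof -
  obtain g1 g2 where pbg: "is_pullback C g g g1 g2" using pb_ex[of g g] by auto
  note [simp] = pbD(4-8)[OF pbg]
  have [simp]: "g1 \<in> Fib C" using fib_pb1[OF pbg] by simp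
  \<comment> \<open>\<open>v\<close> ranges over pairs \<open>(y, y')\<close> in a fibre of
    \<open>p\<close> together with two points of the dependent product over the same base point.
    Since \<open>g\<close> is a fibration, so is \<open>g \<cdot> g1\<close>, as the comparison of
    sections requires.\<close>
  obtain v n where pbv: "is_pullback C (p \<cdot> q1) (g \<cdot> g1) v n" using pb_ex[of "g \<cdot> g1" "p \<cdot> q1"] by auto
  note [simp] = pbD(4-6)[OF pbv]
  have [simp]: "Cod C v = Dom C q1" "Cod C n = Dom C g1" using pbD(7,8)[OF pbv] by simp_all
  have e: "p \<cdot> (q1 \<cdot> v) = g \<cdot> (g1 \<cdot> n)" "p \<cdot> (q1 \<cdot> v) = g \<cdot> (g2 \<cdot> n)" using pbD(9)[OF pbv] by (simp_all add:
      reassoc[OF pbD(9)[OF pbg]])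
  obtain l1 where l1: "l1 \<in> Arr C" "Dom C l1 = Dom C v" "Cod C l1 = Dom C w" "w \<cdot> l1 = v" "\<theta> \<cdot> l1 = g1 \<cdot> n"
    using pb_lift[OF pbw, of v "g1 \<cdot> n"] e by auto
  obtain l2 where l2: "l2 \<in> Arr C" "Dom C l2 = Dom C v" "Cod C l2 = Dom C w" "w \<cdot> l2 = v" "\<theta> \<cdot> l2 = g2 \<cdot> n"
    using pb_lift[OF pbw, of v "g2 \<cdot> n"] e by auto
  \<comment> \<open>Both points assign a path to every pair \<open>(y, y')\<close>, so these are two
    sections of the path fibration over \<open>v\<close>.\<close>
  have "fhomotopic C d (\<epsilon> \<cdot> l1) (\<epsilon> \<cdot> l2)"
    by (rule path_space_sections_homotopic[OF p pb d r dr _ pbv]) (use l1 l2 in \<open>simp_all add: reassoc[OF d\<epsilon>]\<close>)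
  then have "fhomotopic C g g1 g2"
    by - (rule reflects_fhomotopicD[OF R pbv, of g1 g2 l1 l2], use l1 l2 pbD(9)[OF pbg] in simp_all)
  then show ?thesis by (rule path_monicI[OF pbg])
qed

lemma fpath_p: "fpath C p r (q1 \<cdot> d) (q2 \<cdot> d)"
  unfolding fpath_def using dr pb
  by (intro conjI exI[of _ q1] exI[of _ q2] exI[of _ d]) simp_all

lemma path_monic_top:
  assumes T: "is_pullback C g p tr t"
  shows "path_monic C tr"
  unfolding path_monic_def
proof (intro conjI allI impI)
  note [simp] = pbD(4-8)[OF T]
  show "tr \<in> Fib C" using fib_pb1[OF T] by simp
  fix a b assume [simp]: "a \<in> Arr C" "b \<in> Arr C" "Dom C b = Dom C a" "Cod C a = Dom C tr" "Cod C b = Dom C tr"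
    and e: "tr \<cdot> a = tr \<cdot> b"
  have e1: "p \<cdot> (t \<cdot> a) = g \<cdot> (tr \<cdot> a)" and e2: "p \<cdot> (t \<cdot> b) = g \<cdot> (tr \<cdot> a)"
    using reassoc[OF pbD(9)[OF T], of a] reassoc[OF pbD(9)[OF T], of b] e by simp_all
  \<comment> \<open>The two points of the fibre and their common base point in
    \<open>Dom C g\<close> form an argument \<open>l\<close> for the counit, which returns a path
    between them.\<close>
  obtain m where [simp]: "m \<in> Arr C" "Dom C m = Dom C a" "Cod C m = Dom C q1" and m: "q1 \<cdot> m = t \<cdot> a"
      "q2 \<cdot> m = t \<cdot> b"
    using pb_lift[OF pb, of "t \<cdot> a" "t \<cdot> b"] e1 e2 by auto
  obtain l where [simp]: "l \<in> Arr C" "Dom C l = Dom C a" "Cod C l = Dom C w" and l: "w \<cdot> l = m" "\<theta> \<cdot> l = tr \<cdot> a"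
    using pb_lift[OF pbw, of m "tr \<cdot> a"] e1 m by auto
  have "fhomotopic C p (t \<cdot> a) (t \<cdot> b)"
    by (rule fhomotopicI[OF fpath_p, of "\<epsilon> \<cdot> l"]) (simp_all add: reassoc[OF d\<epsilon>] l m)
  then show "fhomotopic C tr a b" by (rule fhomotopic_pullback[OF T g_fib(1)]) (simp_all add: e)
qed

text \<open>A lift of \<open>f\<close> through \<open>g\<close> is by transposition a choice of path
  between any two points of a fibre of \<open>q\<close>. Homotopy monicity provides the choice,
  first up to homotopy and then strictly. Once \<open>f = g \<cdot> k\<close>, cancellation of
  pullbacks shows that \<open>q\<close> is the pullback of \<open>tr\<close> along
  \<open>k\<close>.\<close>

lemma homotopy_monic_classified:
  assumes T: "is_pullback C g p tr t" and q: "is_pullback C f p q s" and M: "homotopy_monic C q"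
  shows "\<exists>k s'. is_pullback C k tr q s'"
proof -
  note [simp] = pbD(1-6,8)[OF q] pbD(4-8)[OF T]
  have [simp]: "Cod C q = Dom C f" "q \<in> Fib C" using pbD(7)[OF q] fib_pb1[OF q] by simp_all
  obtain c1 c2 where pbc: "is_pullback C q q c1 c2"
    and HE: "homotopy_equivalence C (tuple C c1 c2 (Idn C (Dom C q)) (Idn C (Dom C q)))" (is
        "homotopy_equivalence C ?m")
    using M unfolding homotopy_monic_def by blast
  note [simp] = pbD(4-8)[OF pbc]
  have m: "?m \<in> Arr C" "Dom C ?m = Dom C q" "Cod C ?m = Dom C c1" "c1 \<cdot> ?m = Idn C (Dom C q)"
      "c2 \<cdot> ?m = Idn C (Dom C q)"
    using pb_tuple[OF pbc, of "Idn C (Dom C q)" "Idn C (Dom C q)"] by simp_all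
  note [simp] = m(1-3)
  note cq = pbD(9)[OF pbc] and fq = pbD(9)[OF q]
  have pss: "p \<cdot> (s \<cdot> c1) = f \<cdot> (q \<cdot> c1)" "p \<cdot> (s \<cdot> c2) = f \<cdot> (q \<cdot> c1)"
    by (simp_all add: cq reassoc[OF fq[symmetric]])
  obtain ss where [simp]: "ss \<in> Arr C" "Dom C ss = Dom C c1" "Cod C ss = Dom C q1"
    and ss: "q1 \<cdot> ss = s \<cdot> c1" "q2 \<cdot> ss = s \<cdot> c2"
    using pb_lift[OF pb, of "s \<cdot> c1" "s \<cdot> c2"] pss by auto
  \<comment> \<open>The points of \<open>d'\<close> are pairs in a fibre of \<open>q\<close> with a
    path between their images in \<open>p\<close>. Constant paths give \<open>r'\<close>, through
    which the diagonal of \<open>q\<close> factors.\<close>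
  obtain d' x where pbd: "is_pullback C ss d d' x" using pb_ex[of d ss] by auto
  note [simp] = pbD(4-6,8)[OF pbd]
  have [simp]: "Cod C d' = Dom C c1" "d' \<in> Fib C" using pbD(7)[OF pbd] fib_pb1[OF pbd] by simp_all
  have "ss \<cdot> ?m = d \<cdot> (r \<cdot> s)"
    by (rule pb_uniq[OF pb]) (simp_all add: reassoc[OF ss(1)] reassoc[OF ss(2)] m drx)
  then obtain r' where [simp]: "r' \<in> Arr C" "Dom C r' = Dom C q" "Cod C r' = Dom C d'" and r': "d' \<cdot> r' = ?m"
      "x \<cdot> r' = r \<cdot> s"
    using pb_lift[OF pbd, of ?m "r \<cdot> s"] by auto
  obtain \<sigma> where [simp]: "\<sigma> \<in> Arr C" "Dom C \<sigma> = Dom C c1" "Cod C \<sigma> = Dom C d'" and \<sigma>: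
      "d' \<cdot> \<sigma> = Idn C (Dom C c1)"
    using homotopy_monic_section[OF HE, of d' r'] r' by auto
  \<comment> \<open>The fibre product of \<open>q\<close> with itself is the pullback of that of
    \<open>p\<close> along \<open>f\<close>. This makes it the stage at which the dependent product
    classifies sections over \<open>f\<close>.\<close>
  have pbss: "is_pullback C (p \<cdot> q1) f ss (q \<cdot> c1)"
  proof (rule pbI)
    show "(p \<cdot> q1) \<cdot> ss = f \<cdot> (q \<cdot> c1)" using ss pss by simp
  next
    fix a b assume [simp]: "a \<in> Arr C" "b \<in> Arr C" "Dom C b = Dom C a" and c: "Cod C a = Dom C (p \<cdot> q1)"
      and [simp]: "Cod C b = Dom C f" and e: "(p \<cdot> q1) \<cdot> a = f \<cdot> b"
    have [simp]: "Cod C a = Dom C q1" using c by simp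
    obtain y1 where [simp]: "y1 \<in> Arr C" "Dom C y1 = Dom C a" "Cod C y1 = Dom C q" and y1: "q \<cdot> y1 = b"
        "s \<cdot> y1 = q1 \<cdot> a"
      using pb_lift[OF q, of b "q1 \<cdot> a"] e by auto
    obtain y2 where [simp]: "y2 \<in> Arr C" "Dom C y2 = Dom C a" "Cod C y2 = Dom C q" and y2: "q \<cdot> y2 = b"
        "s \<cdot> y2 = q2 \<cdot> a"
      using pb_lift[OF q, of b "q2 \<cdot> a"] e by (auto simp: reassoc[OF pq])
    obtain y where [simp]: "y \<in> Arr C" "Dom C y = Dom C a" "Cod C y = Dom C c1" and y: "c1 \<cdot> y = y1"
        "c2 \<cdot> y = y2"
      using pb_lift[OF pbc, of y1 y2] y1 y2 by auto
    have "ss \<cdot> y = a" by (rule pb_uniq[OF pb]) (simp_all add: reassoc[OF ss(1)] reassoc[OF ss(2)] y y1 y2)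
    then show "\<exists>h. h \<in> Arr C \<and> Dom C h = Dom C a \<and> Cod C h = Dom C ss \<and> ss \<cdot> h = a \<and> (q \<cdot> c1) \<cdot> h = b"
      using y y1 by (intro exI[of _ y]) simp
  next
    fix h k assume [simp]: "h \<in> Arr C" "k \<in> Arr C" "Dom C k = Dom C h" and c: "Cod C h = Dom C ss"
        "Cod C k = Dom C ss"
      and e: "ss \<cdot> h = ss \<cdot> k" "(q \<cdot> c1) \<cdot> h = (q \<cdot> c1) \<cdot> k"
    have [simp]: "Cod C h = Dom C c1" "Cod C k = Dom C c1" using c by simp_all
    have "q1 \<cdot> (ss \<cdot> h) = q1 \<cdot> (ss \<cdot> k)" "q2 \<cdot> (ss \<cdot> h) = q2 \<cdot> (ss \<cdot> k)" using e by simp_all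
    then have e': "s \<cdot> (c1 \<cdot> h) = s \<cdot> (c1 \<cdot> k)" "s \<cdot> (c2 \<cdot> h) = s \<cdot> (c2 \<cdot> k)"
      by (simp_all add: reassoc[OF ss(1)] reassoc[OF ss(2)])
    have qc: "q \<cdot> (c2 \<cdot> h) = q \<cdot> (c2 \<cdot> k)" using e by (simp add: reassoc[OF cq[symmetric]])
    have 1: "c1 \<cdot> h = c1 \<cdot> k"
      by (rule pb_uniq[OF q]) (use e e' in simp_all)
    have 2: "c2 \<cdot> h = c2 \<cdot> k"
      by (rule pb_uniq[OF q]) (use qc e' in simp_all)
    show "h = k" by (rule pb_uniq[OF pbc]) (use 1 2 in simp_all)
  qed simp_all
  have "d \<cdot> (x \<cdot> \<sigma>) = ss" by (simp add: reassoc[OF pbD(9)[OF pbd, symmetric]] \<sigma>)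
  then obtain k where [simp]: "k \<in> Arr C" "Dom C k = Dom C f" "Cod C k = Dom C g" and k: "g \<cdot> k = f"
    using dep_prod_ex[OF D pbss, of "x \<cdot> \<sigma>"] by auto
  have gk: "g \<cdot> (k \<cdot> q) = p \<cdot> s" by (simp add: reassoc[OF k] fq)
  obtain s' where [simp]: "s' \<in> Arr C" "Dom C s' = Dom C q" "Cod C s' = Dom C tr" and s': "tr \<cdot> s' = k \<cdot> q"
      "t \<cdot> s' = s"
    using pb_lift[OF T, of "k \<cdot> q" s] gk by auto
  have "is_pullback C k tr q s'"
    by (rule pb_unpaste[OF T, where t = s]) (use q in \<open>simp_all add: k s'\<close>)
  then show ?thesis by blast
qed

end

section \<open>Internal homs in fibrant slices\<close>

context tribe
begin

text \<open>\<open>F\<close> and \<open>G\<close> need not be fibrations, so a pullback in the slice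
  is not identified with one in \<open>C\<close>. Its universal property is unpacked as it stands,
  with fibrant test objects \<open>Z\<close>.\<close>

lemma fslice_pbE:
  assumes "is_pullback (fslice C X) (a, F, c) (b, G, c) u v"
  obtains z x y where "u = (z, x, a)" "v = (z, y, b)" "z \<in> Fib C" "Cod C z = X"
    "x \<in> Arr C" "Dom C x = Dom C z" "Cod C x = Dom C a" "a \<cdot> x = z"
    "y \<in> Arr C" "Dom C y = Dom C z" "Cod C y = Dom C b" "b \<cdot> y = z" "F \<cdot> x = G \<cdot> y"
    "\<And>Z x' y'. \<lbrakk>Z \<in> Fib C; Cod C Z = X; x' \<in> Arr C; Dom C x' = Dom C Z; Cod C x' = Dom C a; a \<cdot> x' = Z;
       y' \<in> Arr C; Dom C y' = Dom C Z; Cod C y' = Dom C b; b \<cdot> y' = Z; F \<cdot> x' = G \<cdot> y'\<rbrakk>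
      \<Longrightarrow> \<exists>h. h \<in> Arr C \<and> Dom C h = Dom C Z \<and> Cod C h = Dom C z \<and> z \<cdot> h = Z \<and> x \<cdot> h = x' \<and> y \<cdot> h = y'"
    "\<And>Z h k. \<lbrakk>Z \<in> Fib C; Cod C Z = X; h \<in> Arr C; Dom C h = Dom C Z; Cod C h = Dom C z; z \<cdot> h = Z;
       k \<in> Arr C; Dom C k = Dom C Z; Cod C k = Dom C z; z \<cdot> k = Z; x \<cdot> h = x \<cdot> k; y \<cdot> h = y \<cdot> k\<rbrakk> \<Longrightarrow> h = k"
proof -
  interpret T: category "fslice C X" by (rule fslice_category)
  note D = T.pbD[OF assms]
  have "u \<in> Hom (fslice C X) (fst u) a" using D by simp
  then obtain x where x: "u = (fst u, x, a)" "x \<in> Arr C" "Dom C x = Dom C (fst u)" "Cod C x = Dom C a"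
      "a \<cdot> x = fst u"
    "fst u \<in> Fib C" "a \<in> Fib C" "Cod C (fst u) = X" "Cod C a = X" by (rule fslice_HomE)
  have "v \<in> Hom (fslice C X) (fst u) b" using D by simp
  then obtain y where y: "v = (fst u, y, b)" "y \<in> Arr C" "Dom C y = Dom C (fst u)" "Cod C y = Dom C b"
      "b \<cdot> y = fst u"
    "b \<in> Fib C" "Cod C b = X" by (rule fslice_HomE)
  define z where "z = fst u"
  note x = x[folded z_def] and y = y[folded z_def]
  show thesis
  proof (rule that[OF x(1) y(1) x(6,8,2-5) y(2-5)])
    show "F \<cdot> x = G \<cdot> y" using D(9) x(1) y(1) by simp
  next
    fix Z x' y' assume *: "Z \<in> Fib C" "Cod C Z = X" "x' \<in> Arr C" "Dom C x' = Dom C Z" "Cod C x' = Dom C a"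
        "a \<cdot> x' = Z"
       "y' \<in> Arr C" "Dom C y' = Dom C Z" "Cod C y' = Dom C b" "b \<cdot> y' = Z" "F \<cdot> x' = G \<cdot> y'"
    have "(Z, x', a) \<in> Arr (fslice C X)" "(Z, y', b) \<in> Arr (fslice C X)"
      "Dom (fslice C X) (Z, y', b) = Dom (fslice C X) (Z, x', a)"
      "Cod (fslice C X) (Z, x', a) = Dom (fslice C X) (a, F, c)"
          "Cod (fslice C X) (Z, y', b) = Dom (fslice C X) (b, G, c)"
      "(a, F, c) \<cdot>\<^bsub>fslice C X\<^esub> (Z, x', a) = (b, G, c) \<cdot>\<^bsub>fslice C X\<^esub> (Z, y', b)"
      using * x(7,9) y(6,7) D(3) by simp_all
    from T.pb_lift[OF assms this] obtain h where h: "h \<in> Arr (fslice C X)"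
        "Dom (fslice C X) h = Dom (fslice C X) (Z, x', a)"
      "Cod (fslice C X) h = Dom (fslice C X) u" "u \<cdot>\<^bsub>fslice C X\<^esub> h = (Z, x', a)"
          "v \<cdot>\<^bsub>fslice C X\<^esub> h = (Z, y', b)" .
    have "h \<in> Hom (fslice C X) Z z" using h(1-3) by (simp add: z_def)
    then obtain h0 where h0: "h = (Z, h0, z)" "h0 \<in> Arr C" "Dom C h0 = Dom C Z" "Cod C h0 = Dom C z"
        "z \<cdot> h0 = Z"
      by (rule fslice_HomE)
    show "\<exists>h. h \<in> Arr C \<and> Dom C h = Dom C Z \<and> Cod C h = Dom C z \<and> z \<cdot> h = Z \<and> x \<cdot> h = x' \<and> y \<cdot> h = y'"
      using h(4,5)[unfolded x(1) y(1) h0(1)] h0 by (intro exI[of _ h0]) simp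
  next
    fix Z h k assume *: "Z \<in> Fib C" "Cod C Z = X" "h \<in> Arr C" "Dom C h = Dom C Z" "Cod C h = Dom C z"
        "z \<cdot> h = Z"
       "k \<in> Arr C" "Dom C k = Dom C Z" "Cod C k = Dom C z" "z \<cdot> k = Z" "x \<cdot> h = x \<cdot> k" "y \<cdot> h = y \<cdot> k"
    have "(Z, h, z) = (Z, k, z)"
      by (rule T.pb_uniq[OF assms]) (use * x(2-) y(2-) in \<open>simp_all add: x(1) y(1)\<close>)
    then show "h = k" by simp
  qed
qed

lemma fslice_pbI:
  assumes abc: "a \<in> Fib C" "b \<in> Fib C" "c \<in> Fib C" "Cod C a = X" "Cod C b = X" "Cod C c = X"
    and F: "F \<in> Arr C" "Dom C F = Dom C a" "Cod C F = Dom C c" "c \<cdot> F = a"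
    and G: "G \<in> Arr C" "Dom C G = Dom C b" "Cod C G = Dom C c" "c \<cdot> G = b"
    and z: "z \<in> Fib C" "Cod C z = X"
    and x: "x \<in> Arr C" "Dom C x = Dom C z" "Cod C x = Dom C a" "a \<cdot> x = z"
    and y: "y \<in> Arr C" "Dom C y = Dom C z" "Cod C y = Dom C b" "b \<cdot> y = z" and e: "F \<cdot> x = G \<cdot> y"
    and ex: "\<And>Z x' y'. \<lbrakk>Z \<in> Fib C; Cod C Z = X; x' \<in> Arr C; Dom C x' = Dom C Z; Cod C x' = Dom C a; a \<cdot> x' = Z;
       y' \<in> Arr C; Dom C y' = Dom C Z; Cod C y' = Dom C b; b \<cdot> y' = Z; F \<cdot> x' = G \<cdot> y'\<rbrakk>
      \<Longrightarrow> \<exists>h. h \<in> Arr C \<and> Dom C h = Dom C Z \<and> Cod C h = Dom C z \<and> z \<cdot> h = Z \<and> x \<cdot> h = x' \<and> y \<cdot> h = y'"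
    and un: "\<And>Z h k. \<lbrakk>Z \<in> Fib C; Cod C Z = X; h \<in> Arr C; Dom C h = Dom C Z; Cod C h = Dom C z; z \<cdot> h = Z;
       k \<in> Arr C; Dom C k = Dom C Z; Cod C k = Dom C z; z \<cdot> k = Z; x \<cdot> h = x \<cdot> k; y \<cdot> h = y \<cdot> k\<rbrakk> \<Longrightarrow> h = k"
  shows "is_pullback (fslice C X) (a, F, c) (b, G, c) (z, x, a) (z, y, b)"
proof -
  interpret T: category "fslice C X" by (rule fslice_category)
  show ?thesis
  proof (rule T.pbI)
    fix k l assume k: "k \<in> Arr (fslice C X)" "l \<in> Arr (fslice C X)" "Dom (fslice C X) l = Dom (fslice C X) k"
      "Cod (fslice C X) k = Dom (fslice C X) (a, F, c)" "Cod (fslice C X) l = Dom (fslice C X) (b, G, c)"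
      "(a, F, c) \<cdot>\<^bsub>fslice C X\<^esub> k = (b, G, c) \<cdot>\<^bsub>fslice C X\<^esub> l"
    define Z where "Z = fst k"
    have "k \<in> Hom (fslice C X) Z a" "l \<in> Hom (fslice C X) Z b" using k by (simp_all add: Z_def)
    note kl = this
    obtain x' where x': "k = (Z, x', a)" "x' \<in> Arr C" "Dom C x' = Dom C Z" "Cod C x' = Dom C a" "a \<cdot> x' = Z"
        "Z \<in> Fib C" "Cod C Z = X"
      using kl(1) by (rule fslice_HomE)
    obtain y' where y': "l = (Z, y', b)" "y' \<in> Arr C" "Dom C y' = Dom C Z" "Cod C y' = Dom C b" "b \<cdot> y' = Z"
      using kl(2) by (rule fslice_HomE)
    have "F \<cdot> x' = G \<cdot> y'" using k(6) by (simp add: x' y')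
    from ex[OF x'(6,7,2-5) y'(2-5) this] obtain h where h: "h \<in> Arr C" "Dom C h = Dom C Z" "Cod C h = Dom C z"
        "z \<cdot> h = Z" "x \<cdot> h = x'" "y \<cdot> h = y'"
      by blast
    then show "\<exists>h. h \<in> Arr (fslice C X) \<and> Dom (fslice C X) h = Dom (fslice C X) k \<and> Cod (fslice C X) h = Dom
        (fslice C X) (z, x, a) \<and>
        (z, x, a) \<cdot>\<^bsub>fslice C X\<^esub> h = k \<and> (z, y, b) \<cdot>\<^bsub>fslice C X\<^esub> h = l"
      using x' y' z by (intro exI[of _ "(Z, h, z)"]) simp
  next
    fix k l assume k: "k \<in> Arr (fslice C X)" "l \<in> Arr (fslice C X)" "Dom (fslice C X) l = Dom (fslice C X) k"
      "Cod (fslice C X) k = Dom (fslice C X) (z, x, a)" "Cod (fslice C X) l = Dom (fslice C X) (z, x, a)"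
      "(z, x, a) \<cdot>\<^bsub>fslice C X\<^esub> k = (z, x, a) \<cdot>\<^bsub>fslice C X\<^esub> l"
          "(z, y, b) \<cdot>\<^bsub>fslice C X\<^esub> k = (z, y, b) \<cdot>\<^bsub>fslice C X\<^esub> l"
    define Z where "Z = fst k"
    have "k \<in> Hom (fslice C X) Z z" "l \<in> Hom (fslice C X) Z z" using k by (simp_all add: Z_def)
    note kl = this
    obtain x' where x': "k = (Z, x', z)" "x' \<in> Arr C" "Dom C x' = Dom C Z" "Cod C x' = Dom C z" "z \<cdot> x' = Z"
        "Z \<in> Fib C" "Cod C Z = X"
      using kl(1) by (rule fslice_HomE)
    obtain y' where y': "l = (Z, y', z)" "y' \<in> Arr C" "Dom C y' = Dom C Z" "Cod C y' = Dom C z" "z \<cdot> y' = Z"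
      using kl(2) by (rule fslice_HomE)
    have "x' = y'" by (rule un[OF x'(6,7,2-5) y'(2-5)]) (use k in \<open>simp_all add: x' y'\<close>)
    then show "k = l" using x' y' by simp
  qed (use abc F G z x y e in simp_all)
qed

end

locale fslice_ccs = tribe C for C :: "('o, 'm, 'x) fcat_scheme" (structure) +
  fixes X K
  assumes ccs: "is_ccs (fslice C X) K"
begin

definition P1 where "P1 A B = und (Pr1 K A B)"
definition P2 where "P2 A B = und (Pr2 K A B)"

text \<open>Evaluation of generalised elements: \<open>x\<close> of the internal hom and \<open>y\<close> of \<open>A\<close>, at the same stage.\<close>

definition app where
  "app A B x y = und (Ev K A B) \<cdot> tuple C (P1 (IHom K A B) A) (P2 (IHom K A B) A) x y"

context
  fixes A B
  assumes A [simp]: "A \<in> Fib C" "Cod C A = X" and B [simp]: "B \<in> Fib C" "Cod C B = X"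
begin

lemma pr_pb: "is_pullback C A B (P1 A B) (P2 A B)"
  and Pr1_eq: "Pr1 K A B = (A \<cdot> P1 A B, P1 A B, A)"
  and Pr2_eq: "Pr2 K A B = (A \<cdot> P1 A B, P2 A B, B)"
  and P1_fib: "P1 A B \<in> Fib C"
proof -
  have "is_product (fslice C X) A B (Pr1 K A B) (Pr2 K A B)"
    using ccs unfolding is_ccs_def by simp
  then obtain p1 p2 where *: "is_pullback C A B p1 p2" "Pr1 K A B = (A \<cdot> p1, p1, A)"
      "Pr2 K A B = (A \<cdot> p1, p2, B)"
    "p1 \<in> Fib C" by (rule fslice_productE) simp_all
  then have "P1 A B = p1" "P2 A B = p2" by (simp_all add: P1_def P2_def)
  then show "is_pullback C A B (P1 A B) (P2 A B)" "Pr1 K A B = (A \<cdot> P1 A B, P1 A B, A)"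
    "Pr2 K A B = (A \<cdot> P1 A B, P2 A B, B)" "P1 A B \<in> Fib C" using * by simp_all
qed

lemma P_simps [simp]: "P1 A B \<in> Fib C" "P2 A B \<in> Arr C" "Dom C (P2 A B) = Dom C (P1 A B)"
  "Cod C (P1 A B) = Dom C A" "Cod C (P2 A B) = Dom C B"
  and AP: "A \<cdot> P1 A B = B \<cdot> P2 A B"
  using P1_fib pbD[OF pr_pb] by simp_all

lemma prod_ob_eq: "prod_ob (fslice C X) K A B = A \<cdot> P1 A B"
  by (simp add: prod_ob_def Pr1_eq)

lemma pair_eq:
  assumes "x \<in> Arr C" "Dom C x = Dom C z" "Cod C x = Dom C A" "A \<cdot> x = z"
     "y \<in> Arr C" "Dom C y = Dom C z" "Cod C y = Dom C B" "B \<cdot> y = z" "z \<in> Fib C"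
  shows "pair (fslice C X) K (z, x, A) (z, y, B) = (z, tuple C (P1 A B) (P2 A B) x y, A \<cdot> P1 A B)"
  using fslice_tuple[OF pr_pb A(1) B(1) A(2) assms] by (simp add: pair_def Pr1_eq Pr2_eq)

lemma IHom_ob [simp]: "IHom K A B \<in> Fib C" "Cod C (IHom K A B) = X"
proof -
  have "IHom K A B \<in> Obj (fslice C X)" using ccs unfolding is_ccs_def by simp
  then show "IHom K A B \<in> Fib C" "Cod C (IHom K A B) = X" by simp_all
qed

end

context
  fixes A B
  assumes A [simp]: "A \<in> Fib C" "Cod C A = X" and B [simp]: "B \<in> Fib C" "Cod C B = X"
begin

lemma Ev_eq: "Ev K A B = (IHom K A B \<cdot> P1 (IHom K A B) A, und (Ev K A B), B)"
  and und_Ev [simp]: "und (Ev K A B) \<in> Arr C" "Dom C (und (Ev K A B)) = Dom C (P1 (IHom K A B) A)"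
    "Cod C (und (Ev K A B)) = Dom C B"
  and B_Ev: "B \<cdot> und (Ev K A B) = IHom K A B \<cdot> P1 (IHom K A B) A"
proof -
  have "A \<in> Obj (fslice C X)" "B \<in> Obj (fslice C X)" by simp_all
  then have "Ev K A B \<in> Hom (fslice C X) (prod_ob (fslice C X) K (IHom K A B) A) B"
    using ccs unfolding is_ccs_def by blast
  then have "Ev K A B \<in> Hom (fslice C X) (IHom K A B \<cdot> P1 (IHom K A B) A) B"
    by (simp only: prod_ob_eq IHom_ob A B)
  then obtain e where e: "Ev K A B = (IHom K A B \<cdot> P1 (IHom K A B) A, e, B)" "e \<in> Arr C"
    "Dom C e = Dom C (IHom K A B \<cdot> P1 (IHom K A B) A)" "Cod C e = Dom C B"
        "B \<cdot> e = IHom K A B \<cdot> P1 (IHom K A B) A"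
    by (rule fslice_HomE)
  then show "Ev K A B = (IHom K A B \<cdot> P1 (IHom K A B) A, und (Ev K A B), B)" "und (Ev K A B) \<in> Arr C"
    "Dom C (und (Ev K A B)) = Dom C (P1 (IHom K A B) A)" "Cod C (und (Ev K A B)) = Dom C B"
    "B \<cdot> und (Ev K A B) = IHom K A B \<cdot> P1 (IHom K A B) A" by simp_all
qed

lemma app_typ:
  assumes "x \<in> Arr C" "y \<in> Arr C" "Dom C y = Dom C x" "Cod C x = Dom C (IHom K A B)" "Cod C y = Dom C A"
    "IHom K A B \<cdot> x = A \<cdot> y"
  shows "app A B x y \<in> Arr C" "Dom C (app A B x y) = Dom C x" "Cod C (app A B x y) = Dom C B"
    "B \<cdot> app A B x y = A \<cdot> y"
proof -
  note pb = pr_pb[OF IHom_ob[OF A B] A]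
  note t = pb_tuple[OF pb assms(1-6)]
  show "app A B x y \<in> Arr C" "Dom C (app A B x y) = Dom C x" "Cod C (app A B x y) = Dom C B"
    using t by (simp_all add: app_def)
  show "B \<cdot> app A B x y = A \<cdot> y"
    using t assms by (simp add: app_def reassoc[OF B_Ev])
qed

lemma app_cmp:
  assumes "x \<in> Arr C" "y \<in> Arr C" "Dom C y = Dom C x" "Cod C x = Dom C (IHom K A B)" "Cod C y = Dom C A"
    "IHom K A B \<cdot> x = A \<cdot> y" "w \<in> Arr C" "Cod C w = Dom C x"
  shows "app A B x y \<cdot> w = app A B (x \<cdot> w) (y \<cdot> w)"
proof -
  note pb = pr_pb[OF IHom_ob[OF A B] A]
  note t = pb_tuple[OF pb assms(1-6)]
  show ?thesis using t pb_tuple_cmp[OF pb assms(1-8)] assms by (simp add: app_def)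
qed

lemma uncurry_eq:
  assumes Z [simp]: "Z \<in> Fib C" "Cod C Z = X" and h: "h \<in> Arr C" "Dom C h = Dom C Z"
      "Cod C h = Dom C (IHom K A B)"
    "IHom K A B \<cdot> h = Z"
  shows "uncurry (fslice C X) K Z A B (Z, h, IHom K A B) = (Z \<cdot> P1 Z A, app A B (h \<cdot> P1 Z A) (P2 Z A), B)"
proof -
  have c: "IHom K A B \<cdot> (h \<cdot> P1 Z A) = Z \<cdot> P1 Z A" using h by (simp add: reassoc[OF h(4)])
  have "pair (fslice C X) K (Z \<cdot> P1 Z A, h \<cdot> P1 Z A, IHom K A B) (Z \<cdot> P1 Z A, P2 Z A, A)
     = (Z \<cdot> P1 Z A, tuple C (P1 (IHom K A B) A) (P2 (IHom K A B) A) (h \<cdot> P1 Z A) (P2 Z A), IHom K A B \<cdot> P1 (IHom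
         K A B) A)"
    by (rule pair_eq) (simp_all add: h(1-3) c AP[OF Z A, symmetric])
  moreover have "snd (snd (Ev K A B)) = B" using arg_cong[OF Ev_eq, of "\<lambda>k. snd (snd k)"] by simp
  ultimately show ?thesis by (simp add: uncurry_def Pr1_eq Pr2_eq app_def)
qed

lemma uncurry_ex1:
  assumes Z [simp]: "Z \<in> Fib C" "Cod C Z = X" and k: "k \<in> Arr C" "Dom C k = Dom C (P1 Z A)" "Cod C k = Dom C B"
    "B \<cdot> k = Z \<cdot> P1 Z A"
  shows "\<exists>!h. h \<in> Hom (fslice C X) Z (IHom K A B) \<and> uncurry (fslice C X) K Z A B h = (Z \<cdot> P1 Z A, k, B)"
proof -
  have "(Z \<cdot> P1 Z A, k, B) \<in> Hom (fslice C X) (prod_ob (fslice C X) K Z A) B"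
    using k by (simp add: prod_ob_eq)
  moreover have "Z \<in> Obj (fslice C X)" "A \<in> Obj (fslice C X)" "B \<in> Obj (fslice C X)" by simp_all
  ultimately show ?thesis using ccs unfolding is_ccs_def by blast
qed

lemma app_uniq:
  assumes Z [simp]: "Z \<in> Fib C" "Cod C Z = X" and h: "h \<in> Arr C" "Dom C h = Dom C Z"
      "Cod C h = Dom C (IHom K A B)"
      "IHom K A B \<cdot> h = Z"
    and k: "k \<in> Arr C" "Dom C k = Dom C Z" "Cod C k = Dom C (IHom K A B)" "IHom K A B \<cdot> k = Z"
    and e: "app A B (h \<cdot> P1 Z A) (P2 Z A) = app A B (k \<cdot> P1 Z A) (P2 Z A)"
  shows "h = k"
proof -
  have c: "IHom K A B \<cdot> (h \<cdot> P1 Z A) = A \<cdot> P2 Z A" using h AP[OF Z A] by (simp add: reassoc[OF h(4)])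
  note t = app_typ[of "h \<cdot> P1 Z A" "P2 Z A", OF _ _ _ _ _ c]
  have "\<exists>!x. x \<in> Hom (fslice C X) Z (IHom K A B) \<and> uncurry (fslice C X) K Z A B x = (Z \<cdot> P1 Z A, app A B (h \<cdot> P1
      Z A) (P2 Z A), B)"
    by (rule uncurry_ex1[OF Z]) (use t h AP[OF Z A] in simp_all)
  moreover have "(Z, h, IHom K A B) \<in> Hom (fslice C X) Z (IHom K A B)"
      "(Z, k, IHom K A B) \<in> Hom (fslice C X) Z (IHom K A B)"
    using h k by simp_all
  ultimately have "(Z, h, IHom K A B) = (Z, k, IHom K A B)"
    using uncurry_eq[OF Z h] uncurry_eq[OF Z k] e by (metis (no_types, lifting))
  then show ?thesis by simp
qed

text \<open>Abstraction requires a fibrant context \<open>Z\<close> but accepts any pullback of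
  \<open>A\<close> to it. The resulting evaluation rule holds at arbitrary stages \<open>w\<close>,
  because evaluation commutes with every change of stage.\<close>

lemma lam:
  assumes Z [simp]: "Z \<in> Fib C" "Cod C Z = X" and pb: "is_pullback C Z A s1 s2"
    and k: "k \<in> Arr C" "Dom C k = Dom C s1" "Cod C k = Dom C B" "B \<cdot> k = Z \<cdot> s1"
  obtains h where "h \<in> Arr C" "Dom C h = Dom C Z" "Cod C h = Dom C (IHom K A B)" "IHom K A B \<cdot> h = Z"
    "\<And>w y. \<lbrakk>w \<in> Arr C; Dom C y = Dom C w; y \<in> Arr C; Cod C w = Dom C Z; Cod C y = Dom C A; Z \<cdot> w = A \<cdot> y\<rbrakk>
      \<Longrightarrow> app A B (h \<cdot> w) y = k \<cdot> tuple C s1 s2 w y"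
proof -
  obtain i j where [simp]: "i \<in> Arr C" "Dom C i = Dom C (P1 Z A)" "Cod C i = Dom C s1"
      and i: "s1 \<cdot> i = P1 Z A" "s2 \<cdot> i = P2 Z A"
    by (rule pb_unique_iso[OF pb pr_pb[OF Z A]])
  note [simp] = k(1-3) pbD(4-8)[OF pb]
  have Bki: "B \<cdot> (k \<cdot> i) = Z \<cdot> P1 Z A" by (simp add: reassoc[OF k(4)] i)
  from uncurry_ex1[OF Z, of "k \<cdot> i"] Bki
  obtain h' where h': "h' \<in> Hom (fslice C X) Z (IHom K A B)" "uncurry (fslice C X) K Z A B h' = (Z \<cdot> P1 Z A, k \<cdot>
      i, B)"
    by (auto simp del: Hom_iff)
  obtain h where h: "h' = (Z, h, IHom K A B)" "h \<in> Arr C" "Dom C h = Dom C Z" "Cod C h = Dom C (IHom K A B)"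
      "IHom K A B \<cdot> h = Z"
    using h'(1) by (rule fslice_HomE)
  have app: "app A B (h \<cdot> P1 Z A) (P2 Z A) = k \<cdot> i" using h'(2) uncurry_eq[OF Z h(2-5)] by (simp add: h(1))
  have c: "IHom K A B \<cdot> (h \<cdot> P1 Z A) = A \<cdot> P2 Z A" using h AP[OF Z A] by (simp add: reassoc[OF h(5)])
  show thesis
  proof (rule that[OF h(2-5)])
    fix w y assume wy: "w \<in> Arr C" "Dom C y = Dom C w" "y \<in> Arr C" "Cod C w = Dom C Z" "Cod C y = Dom C A"
        "Z \<cdot> w = A \<cdot> y"
    note t = pb_tuple[OF pr_pb[OF Z A] wy(1,3,2,4,5,6)] and t' = pb_tuple[OF pb wy(1,3,2,4,5,6)]
    have "tuple C s1 s2 w y = i \<cdot> tuple C (P1 Z A) (P2 Z A) w y"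
      by (rule pb_tuple_eq[OF pb]) (use t in \<open>simp_all add: reassoc[OF i(1)] reassoc[OF i(2)]\<close>)
    then have "k \<cdot> tuple C s1 s2 w y = (k \<cdot> i) \<cdot> tuple C (P1 Z A) (P2 Z A) w y" using t by simp
    also have "\<dots> = app A B (h \<cdot> w) y"
      unfolding app[symmetric] using t wy h app_cmp[of "h \<cdot> P1 Z A" "P2 Z A" "tuple C (P1 Z A) (P2 Z A) w y", OF
          _ _ _ _ _ c] by simp
    finally show "app A B (h \<cdot> w) y = k \<cdot> tuple C s1 s2 w y" ..
  qed
qed

lemma app_ext:
  assumes Z [simp]: "Z \<in> Fib C" "Cod C Z = X" and h: "h \<in> Arr C" "Dom C h = Dom C Z"
      "Cod C h = Dom C (IHom K A B)"
      "IHom K A B \<cdot> h = Z"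
    and k: "k \<in> Arr C" "Dom C k = Dom C Z" "Cod C k = Dom C (IHom K A B)" "IHom K A B \<cdot> k = Z"
    and e: "\<And>w y. \<lbrakk>w \<in> Arr C; Dom C y = Dom C w; y \<in> Arr C; Cod C w = Dom C Z; Cod C y = Dom C A; Z \<cdot> w = A \<cdot> y\<rbrakk>
      \<Longrightarrow> app A B (h \<cdot> w) y = app A B (k \<cdot> w) y"
  shows "h = k"
  by (rule app_uniq[OF Z h k], rule e) (simp_all add: AP)

text \<open>Resolves the description in \<open>curry_map\<close>: abstraction over the chosen
  product satisfies its defining equation, and uniqueness of currying identifies the two.\<close>

lemma curry_mapE:
  assumes Z [simp]: "Z \<in> Fib C" "Cod C Z = X" and k: "k \<in> Arr C" "Dom C k = Dom C (P1 Z A)" "Cod C k = Dom C B"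
    "B \<cdot> k = Z \<cdot> P1 Z A"
  obtains h where "curry_map (fslice C X) K Z A (Z \<cdot> P1 Z A, k, B) = (Z, h, IHom K A B)"
    "h \<in> Arr C" "Dom C h = Dom C Z" "Cod C h = Dom C (IHom K A B)" "IHom K A B \<cdot> h = Z"
    "\<And>w y. \<lbrakk>w \<in> Arr C; Dom C y = Dom C w; y \<in> Arr C; Cod C w = Dom C Z; Cod C y = Dom C A; Z \<cdot> w = A \<cdot> y\<rbrakk>
      \<Longrightarrow> app A B (h \<cdot> w) y = k \<cdot> tuple C (P1 Z A) (P2 Z A) w y"
proof -
  obtain h where h: "h \<in> Arr C" "Dom C h = Dom C Z" "Cod C h = Dom C (IHom K A B)" "IHom K A B \<cdot> h = Z"
    and hk: "\<And>w y. \<lbrakk>w \<in> Arr C; Dom C y = Dom C w; y \<in> Arr C; Cod C w = Dom C Z; Cod C y = Dom C A;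
        Z \<cdot> w = A \<cdot> y\<rbrakk>
      \<Longrightarrow> app A B (h \<cdot> w) y = k \<cdot> tuple C (P1 Z A) (P2 Z A) w y"
    by (rule lam[OF Z pr_pb[OF Z A] k]) blast
  have t: "tuple C (P1 Z A) (P2 Z A) (P1 Z A) (P2 Z A) = Idn C (Dom C (P1 Z A))"
    by (rule pb_tuple_eq[OF pr_pb[OF Z A]]) simp_all
  have "app A B (h \<cdot> P1 Z A) (P2 Z A) = k"
    using hk[of "P1 Z A" "P2 Z A"] t k AP[OF Z A] by simp
  then have "uncurry (fslice C X) K Z A B (Z, h, IHom K A B) = (Z \<cdot> P1 Z A, k, B)"
    using uncurry_eq[OF Z h] by simp
  moreover have "(Z, h, IHom K A B) \<in> Hom (fslice C X) Z (IHom K A B)" using h by simp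
  ultimately have "(THE h. h \<in> Hom (fslice C X) Z (IHom K A B) \<and> uncurry (fslice C X) K Z A B h = (Z \<cdot> P1 Z A,
      k, B)) = (Z, h, IHom K A B)"
    using the1_equality[OF uncurry_ex1[OF Z k], of "(Z, h, IHom K A B)"] by blast
  then have "curry_map (fslice C X) K Z A (Z \<cdot> P1 Z A, k, B) = (Z, h, IHom K A B)"
    unfolding curry_map_def by simp
  then show thesis using that h hk by blast
qed

end

end

section \<open>Objects of equivalences\<close>

text \<open>A morphism from \<open>z\<close> to \<open>a\<close> in the full slice, stored as its
  underlying arrow. The source \<open>z\<close> need not be a fibration; it can be the diagonal of
  the base.\<close>

definition over :: "('o, 'm, 'x) cat_scheme \<Rightarrow> 'm \<Rightarrow> 'm \<Rightarrow> 'm \<Rightarrow> bool" where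
  "over C z a x \<longleftrightarrow> x \<in> Arr C \<and> Dom C x = Dom C z \<and> Cod C x = Dom C a \<and> a \<cdot>\<^bsub>C\<^esub> x = z"

lemma overD:
  assumes "over C z a x"
  shows "x \<in> Arr C" "Dom C x = Dom C z" "Cod C x = Dom C a" "a \<cdot>\<^bsub>C\<^esub> x = z"
  using assms by (simp_all add: over_def)

lemma (in category) over_cmp:
  assumes "over C z a x" "a \<in> Arr C" "w \<in> Arr C" "Cod C w = Dom C z"
  shows "over C (z \<cdot> w) a (x \<cdot> w)"
proof -
  note [simp] = overD(1-3)[OF assms(1)] assms(2-)
  have "a \<cdot> x \<in> Arr C" by simp
  then have [simp]: "z \<in> Arr C" by (simp only: overD(4)[OF assms(1)])
  show ?thesis by (simp add: over_def reassoc[OF overD(4)[OF assms(1)]])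
qed

lemma (in category) over_post:
  assumes "over C z a x" "over C a b y" "b \<in> Arr C"
  shows "over C z b (y \<cdot> x)"
  using overD[OF assms(1)] overD[OF assms(2)] assms(3) unfolding over_def
  by (simp add: reassoc[OF overD(4)[OF assms(2)]])

context fslice_ccs
begin

section \<open>Elements of internal homs over a base\<close>

lemma app_over:
  assumes "A \<in> Fib C" "Cod C A = X" "B \<in> Fib C" "Cod C B = X" "over C v (IHom K A B) x" "over C v A y"
  shows "over C v B (app A B x y)"
  using app_typ[OF assms(1-4), of x y] overD[OF assms(5)] overD[OF assms(6)] by (simp add: over_def)

lemma app_over_cmp:
  assumes "A \<in> Fib C" "Cod C A = X" "B \<in> Fib C" "Cod C B = X" "over C v (IHom K A B) x" "over C v A y"
    "w \<in> Arr C" "Cod C w = Dom C v"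
  shows "app A B x y \<cdot> w = app A B (x \<cdot> w) (y \<cdot> w)"
  using app_cmp[OF assms(1-4), of x y w] overD[OF assms(5)] overD[OF assms(6)] assms(7,8) by simp

lemma P_over:
  assumes "A \<in> Fib C" "Cod C A = X" "B \<in> Fib C" "Cod C B = X"
  shows "over C (A \<cdot> P1 A B) A (P1 A B)" "over C (A \<cdot> P1 A B) B (P2 A B)"
  using assms AP[OF assms] by (simp_all add: over_def)

lemma over_tuple:
  assumes AB: "A \<in> Fib C" "Cod C A = X" "B \<in> Fib C" "Cod C B = X" and xy: "over C z A x" "over C z B y"
  shows "over C z (A \<cdot> P1 A B) (tuple C (P1 A B) (P2 A B) x y)"
    "P1 A B \<cdot> tuple C (P1 A B) (P2 A B) x y = x" "P2 A B \<cdot> tuple C (P1 A B) (P2 A B) x y = y"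
  using pb_tuple[OF pr_pb[OF AB], of x y] overD[OF xy(1)] overD[OF xy(2)] AB by (simp_all add: over_def)

lemma Ev_pair:
  assumes AB: "A \<in> Fib C" "Cod C A = X" "B \<in> Fib C" "Cod C B = X" and z: "z \<in> Fib C"
    and xy: "over C z (IHom K A B) x" "over C z A y"
  shows "Ev K A B \<cdot>\<^bsub>fslice C X\<^esub> pair (fslice C X) K (z, x, IHom K A B) (z, y, A) = (z, app A B x y, B)"
proof -
  note x = overD[OF xy(1)] and y = overD[OF xy(2)]
  have "snd (snd (Ev K A B)) = B" using arg_cong[OF Ev_eq[OF AB], of "\<lambda>k. snd (snd k)"] by simp
  then show ?thesis using pair_eq[OF IHom_ob[OF AB] AB(1,2) x y z] by (simp add: app_def)
qed

lemma curry_overE: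
  assumes AB: "A \<in> Fib C" "Cod C A = X" "B \<in> Fib C" "Cod C B = X" and Z: "Z \<in> Fib C" "Cod C Z = X"
    and k: "over C (Z \<cdot> P1 Z A) B k"
  obtains h where "curry_map (fslice C X) K Z A (Z \<cdot> P1 Z A, k, B) = (Z, h, IHom K A B)"
    "over C Z (IHom K A B) h"
    "\<And>w y. \<lbrakk>w \<in> Arr C; Cod C w = Dom C Z; over C (Z \<cdot> w) A y\<rbrakk>
      \<Longrightarrow> app A B (h \<cdot> w) y = k \<cdot> tuple C (P1 Z A) (P2 Z A) w y"
proof -
  note [simp] = AB Z
  note k' = overD[OF k]
  obtain h where h: "curry_map (fslice C X) K Z A (Z \<cdot> P1 Z A, k, B) = (Z, h, IHom K A B)"
    "h \<in> Arr C" "Dom C h = Dom C Z" "Cod C h = Dom C (IHom K A B)" "IHom K A B \<cdot> h = Z"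
    and hk: "\<And>w y. \<lbrakk>w \<in> Arr C; Dom C y = Dom C w; y \<in> Arr C; Cod C w = Dom C Z; Cod C y = Dom C A;
        Z \<cdot> w = A \<cdot> y\<rbrakk>
      \<Longrightarrow> app A B (h \<cdot> w) y = k \<cdot> tuple C (P1 Z A) (P2 Z A) w y"
    by (rule curry_mapE[OF AB Z, of k]) (use k' in simp_all)
  show thesis
  proof (rule that[OF h(1)])
    show "over C Z (IHom K A B) h" using h by (simp add: over_def)
    fix w y assume w: "w \<in> Arr C" "Cod C w = Dom C Z" and y: "over C (Z \<cdot> w) A y"
    show "app A B (h \<cdot> w) y = k \<cdot> tuple C (P1 Z A) (P2 Z A) w y"
      by (rule hk) (use w overD[OF y] in simp_all)
  qed
qed

lemma over_ext:
  assumes AB: "A \<in> Fib C" "Cod C A = X" "B \<in> Fib C" "Cod C B = X" and Z: "Z \<in> Fib C" "Cod C Z = X"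
    and h: "over C Z (IHom K A B) h" and k: "over C Z (IHom K A B) k"
    and e: "\<And>w y. \<lbrakk>w \<in> Arr C; Cod C w = Dom C Z; over C (Z \<cdot> w) A y\<rbrakk> \<Longrightarrow> app A B (h \<cdot> w) y = app A B (k \<cdot> w) y"
  shows "h = k"
proof (rule app_ext[OF AB Z overD[OF h] overD[OF k]])
  fix w y assume "w \<in> Arr C" "Dom C y = Dom C w" "y \<in> Arr C" "Cod C w = Dom C Z" "Cod C y = Dom C A"
      "Z \<cdot> w = A \<cdot> y"
  then show "app A B (h \<cdot> w) y = app A B (k \<cdot> w) y" using Z AB by (intro e) (simp_all add: over_def)
qed

text \<open>This and the next two facts replace the curried maps of the definition of
  \<open>LInv\<close> by their effect on elements: composition, identity and postcomposition are
  read off pointwise.\<close>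

lemma icompE:
  assumes A: "A \<in> Fib C" "Cod C A = X" and B: "B \<in> Fib C" "Cod C B = X" and D: "D \<in> Fib C" "Cod C D = X"
    and Q: "Q = IHom K B D \<cdot> P1 (IHom K B D) (IHom K A B)"
  obtains c where "icomp (fslice C X) K A B D = (Q, c, IHom K A D)" "over C Q (IHom K A D) c"
    "\<And>w y. \<lbrakk>w \<in> Arr C; Cod C w = Dom C Q; over C (Q \<cdot> w) A y\<rbrakk> \<Longrightarrow>
       app A D (c \<cdot> w) y = app B D (P1 (IHom K B D) (IHom K A B) \<cdot> w) (app A B (P2 (IHom K B D) (IHom K A B) \<cdot>
           w) y)"
proof -
  let ?H = "IHom K B D" and ?H' = "IHom K A B"
  note H [simp] = IHom_ob[OF B D] and H' [simp] = IHom_ob[OF A B]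
  have Qo [simp]: "Q \<in> Fib C" "Cod C Q = X" using P1_fib[OF H H'] P_simps(4)[OF H H'] by (simp_all add: Q)
  note pH = P_over[OF H H', folded Q] and pQ = P_over[OF Qo A]
  define z where "z = Q \<cdot> P1 Q A"
  have z [simp]: "z \<in> Fib C" "Dom C z = Dom C (P1 Q A)" "Cod C z = X" using P_simps[OF Qo A] by (simp_all add:
      z_def)
  define g f x where "g = P1 ?H ?H' \<cdot> P1 Q A" and "f = P2 ?H ?H' \<cdot> P1 Q A" and "x = P2 Q A"
  have g: "over C z ?H g" and f: "over C z ?H' f" and x: "over C z A x"
    unfolding g_def f_def x_def z_def using over_post[OF pQ(1) pH(1)] over_post[OF pQ(1) pH(2)] pQ(2) by
        simp_all
  have fx: "over C z B (app A B f x)" by (rule app_over[OF A B f x])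
  have gfx: "over C z D (app B D g (app A B f x))" by (rule app_over[OF B D g fx])
  obtain c where c: "curry_map (fslice C X) K Q A (z, app B D g (app A B f x), D) = (Q, c, IHom K A D)"
    "over C Q (IHom K A D) c"
    and cc: "\<And>w y. \<lbrakk>w \<in> Arr C; Cod C w = Dom C Q; over C (Q \<cdot> w) A y\<rbrakk>
      \<Longrightarrow> app A D (c \<cdot> w) y = app B D g (app A B f x) \<cdot> tuple C (P1 Q A) (P2 Q A) w y"
    by (rule curry_overE[OF A D Qo, of "app B D g (app A B f x)"]) (use gfx in \<open>simp_all add: z_def\<close>)
  have pr: "Pr1 K ?H ?H' \<cdot>\<^bsub>fslice C X\<^esub> Pr1 K Q A = (z, g, ?H)"
      "Pr2 K ?H ?H' \<cdot>\<^bsub>fslice C X\<^esub> Pr1 K Q A = (z, f, ?H')"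
    "Pr2 K Q A = (z, x, A)"
    unfolding Pr1_eq[OF H H'] Pr2_eq[OF H H'] Pr1_eq[OF Qo A] Pr2_eq[OF Qo A]
    by (simp_all add: z_def g_def f_def x_def)
  have "icomp (fslice C X) K A B D = (Q, c, IHom K A D)"
    unfolding icomp_def Let_def prod_ob_eq[OF H H'] Q[symmetric] pr
    unfolding Ev_pair[OF A B z(1) f x] Ev_pair[OF B D z(1) g fx] by (rule c(1))
  then show thesis
  proof (rule that[OF _ c(2)])
    fix w y assume w: "w \<in> Arr C" "Cod C w = Dom C Q" and y: "over C (Q \<cdot> w) A y"
    have wQ: "over C (Q \<cdot> w) Q w" using w by (simp add: over_def)
    note t = over_tuple[OF Qo A wQ y]
    have tz: "over C (Q \<cdot> w) z (tuple C (P1 Q A) (P2 Q A) w y)" using t(1) by (simp add: z_def)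
    note t1 = overD(1-3)[OF tz]
    have "app A D (c \<cdot> w) y = app B D g (app A B f x) \<cdot> tuple C (P1 Q A) (P2 Q A) w y" by (rule cc[OF w y])
    also have "\<dots> = app B D (g \<cdot> tuple C (P1 Q A) (P2 Q A) w y) (app A B (f \<cdot> tuple C (P1 Q A) (P2 Q A) w y) (x \<cdot>
        tuple C (P1 Q A) (P2 Q A) w y))"
      using app_over_cmp[OF B D g fx t1(1)] app_over_cmp[OF A B f x t1(1)] t1 by simp
    finally show "app A D (c \<cdot> w) y = app B D (P1 ?H ?H' \<cdot> w) (app A B (P2 ?H ?H' \<cdot> w) y)"
      using t(2,3) t1 P_simps[OF H H'] P_simps[OF Qo A] overD(3)[OF pH(1)] overD(2)[OF pH(1)]
      by (simp add: g_def f_def x_def)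
  qed
qed

lemma iconstE:
  assumes A: "A \<in> Fib C" "Cod C A = X" and Z: "Z \<in> Fib C" "Cod C Z = X"
  obtains c where "iconst (fslice C X) K Z A = (Z, c, IHom K A A)" "over C Z (IHom K A A) c"
    "\<And>w y. \<lbrakk>w \<in> Arr C; Cod C w = Dom C Z; over C (Z \<cdot> w) A y\<rbrakk> \<Longrightarrow> app A A (c \<cdot> w) y = y"
proof -
  have T: "is_terminal (fslice C X) (One K)" using ccs unfolding is_ccs_def by blast
  then have O: "One K \<in> Fib C" "Cod C (One K) = X" unfolding is_terminal_def by simp_all
  have ex: "\<exists>!t. t \<in> Hom (fslice C X) Z (One K)" using T Z unfolding is_terminal_def by (simp del: Hom_iff)
  define t where "t = (THE t. t \<in> Hom (fslice C X) Z (One K))"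
  have "t \<in> Hom (fslice C X) Z (One K)" unfolding t_def by (rule theI'[OF ex])
  then obtain t0 where t0: "t = (Z, t0, One K)" "over C Z (One K) t0"
    by (rule fslice_HomE) (simp add: over_def)
  obtain c where c: "curry_map (fslice C X) K (One K) A (One K \<cdot> P1 (One K) A, P2 (One K) A, A) = (One K, c,
      IHom K A A)"
    "over C (One K) (IHom K A A) c"
    and cc: "\<And>w y. \<lbrakk>w \<in> Arr C; Cod C w = Dom C (One K); over C (One K \<cdot> w) A y\<rbrakk>
      \<Longrightarrow> app A A (c \<cdot> w) y = P2 (One K) A \<cdot> tuple C (P1 (One K) A) (P2 (One K) A) w y"
    by (rule curry_overE[OF A A O P_over(2)[OF O A]]) blast
  have o: "over C Z (IHom K A A) (c \<cdot> t0)" by (rule over_post[OF t0(2) c(2)]) (use IHom_ob[OF A A] in simp)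
  have "iconst (fslice C X) K Z A = (Z, c \<cdot> t0, IHom K A A)"
    unfolding iconst_def t_def[symmetric] t0(1) Pr2_eq[OF O A] c(1) by simp
  then show thesis
  proof (rule that[OF _ o])
    fix w y assume w: "w \<in> Arr C" "Cod C w = Dom C Z" and y: "over C (Z \<cdot> w) A y"
    note T0 = overD[OF t0(2)]
    have e: "One K \<cdot> (t0 \<cdot> w) = Z \<cdot> w" using T0 w O by (simp add: reassoc[OF T0(4)])
    have y': "over C (One K \<cdot> (t0 \<cdot> w)) A y" using y by (simp add: e)
    have w': "over C (One K \<cdot> (t0 \<cdot> w)) (One K) (t0 \<cdot> w)" using T0 w O by (simp add: over_def)
    show "app A A ((c \<cdot> t0) \<cdot> w) y = y"
      using cc[OF _ _ y'] w T0 overD[OF c(2)] over_tuple(3)[OF O A w' y'] by simp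
  qed
qed

lemma ipostE:
  assumes A: "A \<in> Fib C" "Cod C A = X" and B: "B \<in> Fib C" "Cod C B = X" and D: "D \<in> Fib C" "Cod C D = X"
    and f: "over C D B f"
  obtains c where "ipost (fslice C X) K A (D, f, B) = (IHom K A D, c, IHom K A B)"
      "over C (IHom K A D) (IHom K A B) c"
    "\<And>w y. \<lbrakk>w \<in> Arr C; Cod C w = Dom C (IHom K A D); over C (IHom K A D \<cdot> w) A y\<rbrakk> \<Longrightarrow> app A B (c \<cdot> w) y = f \<cdot> app
        A D w y"
proof -
  let ?H = "IHom K A D"
  note H = IHom_ob[OF A D]
  have ev: "over C (?H \<cdot> P1 ?H A) D (und (Ev K A D))"
    using und_Ev[OF A D] B_Ev[OF A D] P_simps[OF H A] H by (simp add: over_def)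
  have fe: "over C (?H \<cdot> P1 ?H A) B (f \<cdot> und (Ev K A D))" by (rule over_post[OF ev f]) (use B in simp)
  obtain c where c: "curry_map (fslice C X) K ?H A (?H \<cdot> P1 ?H A, f \<cdot> und (Ev K A D), B) = (?H, c, IHom K A B)"
    "over C ?H (IHom K A B) c"
    and cc: "\<And>w y. \<lbrakk>w \<in> Arr C; Cod C w = Dom C ?H; over C (?H \<cdot> w) A y\<rbrakk>
      \<Longrightarrow> app A B (c \<cdot> w) y = (f \<cdot> und (Ev K A D)) \<cdot> tuple C (P1 ?H A) (P2 ?H A) w y"
    by (rule curry_overE[OF A B H fe]) blast
  have "(D, f, B) \<cdot>\<^bsub>fslice C X\<^esub> Ev K A D = (?H \<cdot> P1 ?H A, f \<cdot> und (Ev K A D), B)"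
    using arg_cong[OF Ev_eq[OF A D], of fst] by simp
  then have "ipost (fslice C X) K A (D, f, B) = (?H, c, IHom K A B)"
    unfolding ipost_def fslice_simps(2) fst_conv using c(1) by simp
  then show thesis
  proof (rule that[OF _ c(2)])
    fix w y assume w: "w \<in> Arr C" "Cod C w = Dom C ?H" and y: "over C (?H \<cdot> w) A y"
    have wH: "over C (?H \<cdot> w) ?H w" using w H by (simp add: over_def)
    note t = overD[OF over_tuple(1)[OF H A wH y]]
    show "app A B (c \<cdot> w) y = f \<cdot> app A D w y"
      unfolding cc[OF w y] unfolding app_def using t und_Ev[OF A D] overD[OF f] P_simps[OF H A] H by simp
  qed
qed

text \<open>\<open>s\<close> is a homotopy from \<open>g \<circ> f\<close> to the identity of \<open>A\<close>, expressed on generalised elements \<open>y\<close> of \<open>A\<close>.\<close>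

definition linv_eq where
  "linv_eq A B D e0 e1 z g f s \<longleftrightarrow> (\<forall>w y. w \<in> Arr C \<longrightarrow> Cod C w = Dom C z \<longrightarrow> over C (z \<cdot> w) A y \<longrightarrow>
     e0 \<cdot> app A D (s \<cdot> w) y = app B A (g \<cdot> w) (app A B (f \<cdot> w) y) \<and> e1 \<cdot> app A D (s \<cdot> w) y = y)"

text \<open>\<open>L\<close> with the universal triple \<open>(g, f, s)\<close> as above, tested on fibrations only.\<close>

definition linv where
  "linv A B D e0 e1 L g f s \<longleftrightarrow> L \<in> Fib C \<and> Cod C L = X \<and>
     over C L (IHom K B A) g \<and> over C L (IHom K A B) f \<and> over C L (IHom K A D) s \<and> linv_eq A B D e0 e1 L g f s \<and>
     (\<forall>z g' f' s'. z \<in> Fib C \<longrightarrow> Cod C z = X \<longrightarrow> over C z (IHom K B A) g' \<longrightarrow> over C z (IHom K A B) f' \<longrightarrow>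
        over C z (IHom K A D) s' \<longrightarrow> linv_eq A B D e0 e1 z g' f' s' \<longrightarrow>
        (\<exists>h. over C z L h \<and> g \<cdot> h = g' \<and> f \<cdot> h = f' \<and> s \<cdot> h = s')) \<and>
     (\<forall>z h k. z \<in> Fib C \<longrightarrow> Cod C z = X \<longrightarrow> over C z L h \<longrightarrow> over C z L k \<longrightarrow>
        g \<cdot> h = g \<cdot> k \<longrightarrow> f \<cdot> h = f \<cdot> k \<longrightarrow> s \<cdot> h = s \<cdot> k \<longrightarrow> h = k)"

text \<open>The two legs land in pairs of endomaps of \<open>A\<close>, so equality after them means
  two equations between maps into an internal hom. By extensionality these are pointwise equations:
  one for the source, one for the target of the homotopy. The path object enters only through its
  endpoint maps \<open>e0\<close>, \<open>e1\<close>.\<close>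

lemma LInv_cospan:
  assumes A: "A \<in> Fib C" "Cod C A = X" and B: "B \<in> Fib C" "Cod C B = X" and D: "D \<in> Fib C" "Cod C D = X"
    and d: "Pr1 K A A \<cdot>\<^bsub>fslice C X\<^esub> d = (D, e0, A)" "Pr2 K A A \<cdot>\<^bsub>fslice C X\<^esub> d = (D, e1, A)"
    and e: "over C D A e0" "over C D A e1"
    and Q: "Q = IHom K B A \<cdot> P1 (IHom K B A) (IHom K A B)"
  obtains F G R where
    "pair (fslice C X) K (icomp (fslice C X) K A B A)
       (iconst (fslice C X) K (prod_ob (fslice C X) K (IHom K B A) (IHom K A B)) A) = (Q, F, R)"
    "pair (fslice C X) K (ipost (fslice C X) K A (Pr1 K A A \<cdot>\<^bsub>fslice C X\<^esub> d)) (ipost (fslice C X) K A (Pr2 K A A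
        \<cdot>\<^bsub>fslice C X\<^esub> d))
      = (IHom K A D, G, R)"
    "R \<in> Fib C" "Cod C R = X" "over C Q R F" "over C (IHom K A D) R G"
    "\<And>z u s. \<lbrakk>z \<in> Fib C; Cod C z = X; over C z Q u; over C z (IHom K A D) s\<rbrakk> \<Longrightarrow>
       F \<cdot> u = G \<cdot> s \<longleftrightarrow> linv_eq A B D e0 e1 z (P1 (IHom K B A) (IHom K A B) \<cdot> u) (P2 (IHom K B A) (IHom K A B) \<cdot>
           u) s"
proof -
  let ?H1 = "IHom K B A" and ?H2 = "IHom K A B" and ?S = "IHom K A D" and ?I = "IHom K A A"
  note H1 = IHom_ob[OF B A] and H2 = IHom_ob[OF A B] and S = IHom_ob[OF A D] and I = IHom_ob[OF A A]
  have Qo: "Q \<in> Fib C" "Cod C Q = X" using P_simps[OF H1 H2] H1 by (simp_all add: Q)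
  obtain ic where ic: "icomp (fslice C X) K A B A = (Q, ic, ?I)" "over C Q ?I ic"
    and ic': "\<And>w y. \<lbrakk>w \<in> Arr C; Cod C w = Dom C Q; over C (Q \<cdot> w) A y\<rbrakk> \<Longrightarrow>
       app A A (ic \<cdot> w) y = app B A (P1 ?H1 ?H2 \<cdot> w) (app A B (P2 ?H1 ?H2 \<cdot> w) y)"
    by (rule icompE[OF A B A Q]) blast
  obtain co where co: "iconst (fslice C X) K Q A = (Q, co, ?I)" "over C Q ?I co"
    and co': "\<And>w y. \<lbrakk>w \<in> Arr C; Cod C w = Dom C Q; over C (Q \<cdot> w) A y\<rbrakk> \<Longrightarrow> app A A (co \<cdot> w) y = y"
    by (rule iconstE[OF A Qo]) blast
  obtain c0 where c0: "ipost (fslice C X) K A (D, e0, A) = (?S, c0, ?I)" "over C ?S ?I c0"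
    and c0': "\<And>w y. \<lbrakk>w \<in> Arr C; Cod C w = Dom C ?S; over C (?S \<cdot> w) A y\<rbrakk> \<Longrightarrow> app A A (c0 \<cdot> w) y = e0 \<cdot> app A D w
        y"
    by (rule ipostE[OF A A D e(1)]) blast
  obtain c1 where c1: "ipost (fslice C X) K A (D, e1, A) = (?S, c1, ?I)" "over C ?S ?I c1"
    and c1': "\<And>w y. \<lbrakk>w \<in> Arr C; Cod C w = Dom C ?S; over C (?S \<cdot> w) A y\<rbrakk> \<Longrightarrow> app A A (c1 \<cdot> w) y = e1 \<cdot> app A D w
        y"
    by (rule ipostE[OF A A D e(2)]) blast
  define R where "R = ?I \<cdot> P1 ?I ?I"
  have Ro: "R \<in> Fib C" "Cod C R = X" using P_simps[OF I I] I by (simp_all add: R_def)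
  define F G where "F = tuple C (P1 ?I ?I) (P2 ?I ?I) ic co" and "G = tuple C (P1 ?I ?I) (P2 ?I ?I) c0 c1"
  note F = over_tuple[OF I I ic(2) co(2), folded F_def R_def] and G = over_tuple[OF I I c0(2) c1(2), folded
      G_def R_def]
  show thesis
  proof (rule that[of F R G])
    show "pair (fslice C X) K (icomp (fslice C X) K A B A)
       (iconst (fslice C X) K (prod_ob (fslice C X) K ?H1 ?H2) A) = (Q, F, R)"
      unfolding prod_ob_eq[OF H1 H2] Q[symmetric] ic(1) co(1)
      using pair_eq[OF I I overD[OF ic(2)] overD[OF co(2)] Qo(1)] by (simp add: F_def R_def)
    show "pair (fslice C X) K (ipost (fslice C X) K A (Pr1 K A A \<cdot>\<^bsub>fslice C X\<^esub> d)) (ipost (fslice C X) K A (Pr2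
        K A A \<cdot>\<^bsub>fslice C X\<^esub> d))
      = (?S, G, R)"
      unfolding d c0(1) c1(1)
      using pair_eq[OF I I overD[OF c0(2)] overD[OF c1(2)] S(1)] by (simp add: G_def R_def)
  next
    fix z u s assume z: "z \<in> Fib C" "Cod C z = X" and u: "over C z Q u" and s: "over C z ?S s"
    note u' = overD[OF u] and s' = overD[OF s] and F' = overD(1-3)[OF F(1)] and G' = overD(1-3)[OF G(1)]
    note icD = overD(1-3)[OF ic(2)] and coD = overD(1-3)[OF co(2)] and c0D = overD(1-3)[OF c0(2)] and c1D =
        overD(1-3)[OF c1(2)]
    note PI = P_simps[OF I I] and PH = P_simps[OF H1 H2]
    have dR: "Dom C R = Dom C (P1 ?I ?I)" "Dom C Q = Dom C (P1 ?H1 ?H2)" using PI PH I H1 by (simp_all add: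
        R_def Q)
    have zi: "over C z ?I (ic \<cdot> u)" "over C z ?I (co \<cdot> u)" "over C z ?I (c0 \<cdot> s)" "over C z ?I (c1 \<cdot> s)"
      using over_post[OF u ic(2)] over_post[OF u co(2)] over_post[OF s c0(2)] over_post[OF s c1(2)] I by
          simp_all
    \<comment> \<open>A map into the product of two internal homs is determined by its components,
      which separates the two endpoints of the homotopy.\<close>
    have "F \<cdot> u = G \<cdot> s \<longleftrightarrow> ic \<cdot> u = c0 \<cdot> s \<and> co \<cdot> u = c1 \<cdot> s"
    proof
      assume FG: "F \<cdot> u = G \<cdot> s"
      have "P1 ?I ?I \<cdot> (F \<cdot> u) = P1 ?I ?I \<cdot> (G \<cdot> s)" "P2 ?I ?I \<cdot> (F \<cdot> u) = P2 ?I ?I \<cdot> (G \<cdot> s)" by (simp_all add: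
          FG)
      then show "ic \<cdot> u = c0 \<cdot> s \<and> co \<cdot> u = c1 \<cdot> s"
        using u' s' F' G' PI dR by (simp add: reassoc[OF F(2)] reassoc[OF F(3)] reassoc[OF G(2)] reassoc[OF
            G(3)])
    next
      assume "ic \<cdot> u = c0 \<cdot> s \<and> co \<cdot> u = c1 \<cdot> s"
      then show "F \<cdot> u = G \<cdot> s"
        using u' s' F' G' PI dR
        by - (rule pb_uniq[OF pr_pb[OF I I]], simp_all add: reassoc[OF F(2)] reassoc[OF F(3)] reassoc[OF G(2)]
            reassoc[OF G(3)])
    qed
    moreover have app_eq: "app A A ((ic \<cdot> u) \<cdot> w) y = app B A ((P1 ?H1 ?H2 \<cdot> u) \<cdot> w) (app A B ((P2 ?H1 ?H2 \<cdot> u)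
        \<cdot> w) y)"
      "app A A ((co \<cdot> u) \<cdot> w) y = y" "app A A ((c0 \<cdot> s) \<cdot> w) y = e0 \<cdot> app A D (s \<cdot> w) y"
      "app A A ((c1 \<cdot> s) \<cdot> w) y = e1 \<cdot> app A D (s \<cdot> w) y"
      if w: "w \<in> Arr C" "Cod C w = Dom C z" and y: "over C (z \<cdot> w) A y" for w y
    proof -
      have Qu: "Q \<cdot> (u \<cdot> w) = z \<cdot> w" "?S \<cdot> (s \<cdot> w) = z \<cdot> w"
        using u' s' w Qo S by (simp_all add: reassoc[OF u'(4)] reassoc[OF s'(4)])
      show "app A A ((ic \<cdot> u) \<cdot> w) y = app B A ((P1 ?H1 ?H2 \<cdot> u) \<cdot> w) (app A B ((P2 ?H1 ?H2 \<cdot> u) \<cdot> w) y)"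
        using ic'[of "u \<cdot> w" y] u' w y icD PH dR Qu by simp
      show "app A A ((co \<cdot> u) \<cdot> w) y = y" using co'[of "u \<cdot> w" y] u' w y coD Qu by simp
      show "app A A ((c0 \<cdot> s) \<cdot> w) y = e0 \<cdot> app A D (s \<cdot> w) y" using c0'[of "s \<cdot> w" y] s' w y c0D Qu by simp
      show "app A A ((c1 \<cdot> s) \<cdot> w) y = e1 \<cdot> app A D (s \<cdot> w) y" using c1'[of "s \<cdot> w" y] s' w y c1D Qu by simp
    qed
    have "ic \<cdot> u = c0 \<cdot> s \<and> co \<cdot> u = c1 \<cdot> s \<longleftrightarrow> linv_eq A B D e0 e1 z (P1 ?H1 ?H2 \<cdot> u) (P2 ?H1 ?H2 \<cdot> u) s"
    proof
      assume *: "ic \<cdot> u = c0 \<cdot> s \<and> co \<cdot> u = c1 \<cdot> s"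
      show "linv_eq A B D e0 e1 z (P1 ?H1 ?H2 \<cdot> u) (P2 ?H1 ?H2 \<cdot> u) s"
        unfolding linv_eq_def
      proof (intro allI impI conjI)
        fix w y assume w: "w \<in> Arr C" "Cod C w = Dom C z" "over C (z \<cdot> w) A y"
        show "e0 \<cdot> app A D (s \<cdot> w) y = app B A ((P1 ?H1 ?H2 \<cdot> u) \<cdot> w) (app A B ((P2 ?H1 ?H2 \<cdot> u) \<cdot> w) y)"
          unfolding app_eq(1)[OF w, symmetric] app_eq(3)[OF w, symmetric] using * by simp
        have "e1 \<cdot> app A D (s \<cdot> w) y = app A A ((co \<cdot> u) \<cdot> w) y" unfolding app_eq(4)[OF w, symmetric] using * by
            simp
        then show "e1 \<cdot> app A D (s \<cdot> w) y = y" using app_eq(2)[OF w] by simp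
      qed
    next
      assume *: "linv_eq A B D e0 e1 z (P1 ?H1 ?H2 \<cdot> u) (P2 ?H1 ?H2 \<cdot> u) s"
      have "ic \<cdot> u = c0 \<cdot> s"
      proof (rule over_ext[OF A A z zi(1) zi(3)])
        fix w y assume w: "w \<in> Arr C" "Cod C w = Dom C z" "over C (z \<cdot> w) A y"
        show "app A A ((ic \<cdot> u) \<cdot> w) y = app A A ((c0 \<cdot> s) \<cdot> w) y"
          unfolding app_eq(1)[OF w] app_eq(3)[OF w] using * w unfolding linv_eq_def by simp
      qed
      moreover have "co \<cdot> u = c1 \<cdot> s"
      proof (rule over_ext[OF A A z zi(2) zi(4)])
        fix w y assume w: "w \<in> Arr C" "Cod C w = Dom C z" "over C (z \<cdot> w) A y"
        show "app A A ((co \<cdot> u) \<cdot> w) y = app A A ((c1 \<cdot> s) \<cdot> w) y"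
          unfolding app_eq(2)[OF w] app_eq(4)[OF w] using * w unfolding linv_eq_def by simp
      qed
      ultimately show "ic \<cdot> u = c0 \<cdot> s \<and> co \<cdot> u = c1 \<cdot> s" by simp
    qed
    ultimately show "F \<cdot> u = G \<cdot> s \<longleftrightarrow> linv_eq A B D e0 e1 z (P1 ?H1 ?H2 \<cdot> u) (P2 ?H1 ?H2 \<cdot> u) s"
      by blast
  qed (use Ro F G in simp_all)
qed

end

context fslice_ccs
begin

lemma linvD:
  assumes "linv A B D e0 e1 L g f s"
  shows "L \<in> Fib C" "Cod C L = X" "over C L (IHom K B A) g" "over C L (IHom K A B) f" "over C L (IHom K A D) s"
    "linv_eq A B D e0 e1 L g f s"
    and "\<lbrakk>z \<in> Fib C; Cod C z = X; over C z (IHom K B A) g'; over C z (IHom K A B) f';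
        over C z (IHom K A D) s'; linv_eq A B D e0 e1 z g' f' s'\<rbrakk> \<Longrightarrow>
        \<exists>h. over C z L h \<and> g \<cdot> h = g' \<and> f \<cdot> h = f' \<and> s \<cdot> h = s'"
    and "\<lbrakk>z \<in> Fib C; Cod C z = X; over C z L h; over C z L k; g \<cdot> h = g \<cdot> k;
        f \<cdot> h = f \<cdot> k; s \<cdot> h = s \<cdot> k\<rbrakk> \<Longrightarrow> h = k"
proof -
  have *: "L \<in> Fib C \<and> Cod C L = X \<and>
     over C L (IHom K B A) g \<and> over C L (IHom K A B) f \<and> over C L (IHom K A D) s \<and> linv_eq A B D e0 e1 L g f s"
    and 1: "\<forall>z g' f' s'. z \<in> Fib C \<longrightarrow> Cod C z = X \<longrightarrow> over C z (IHom K B A) g' \<longrightarrow> over C z (IHom K A B) f' \<longrightarrow>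
        over C z (IHom K A D) s' \<longrightarrow> linv_eq A B D e0 e1 z g' f' s' \<longrightarrow>
        (\<exists>h. over C z L h \<and> g \<cdot> h = g' \<and> f \<cdot> h = f' \<and> s \<cdot> h = s')"
    and 2: "\<forall>z h k. z \<in> Fib C \<longrightarrow> Cod C z = X \<longrightarrow> over C z L h \<longrightarrow> over C z L k \<longrightarrow>
        g \<cdot> h = g \<cdot> k \<longrightarrow> f \<cdot> h = f \<cdot> k \<longrightarrow> s \<cdot> h = s \<cdot> k \<longrightarrow> h = k"
    using assms unfolding linv_def by blast+
  show "L \<in> Fib C" "Cod C L = X" "over C L (IHom K B A) g" "over C L (IHom K A B) f" "over C L (IHom K A D) s"
    "linv_eq A B D e0 e1 L g f s" using * by simp_all
  show "\<lbrakk>z \<in> Fib C; Cod C z = X; over C z (IHom K B A) g'; over C z (IHom K A B) f';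
        over C z (IHom K A D) s'; linv_eq A B D e0 e1 z g' f' s'\<rbrakk> \<Longrightarrow>
        \<exists>h. over C z L h \<and> g \<cdot> h = g' \<and> f \<cdot> h = f' \<and> s \<cdot> h = s'"
    by (rule 1[rule_format])
  show "\<lbrakk>z \<in> Fib C; Cod C z = X; over C z L h; over C z L k; g \<cdot> h = g \<cdot> k;
      f \<cdot> h = f \<cdot> k; s \<cdot> h = s \<cdot> k\<rbrakk> \<Longrightarrow> h = k"
    by (rule 2[rule_format])
qed

context
  fixes A B D d e0 e1 Q
  assumes A: "A \<in> Fib C" "Cod C A = X" and B: "B \<in> Fib C" "Cod C B = X" and D: "D \<in> Fib C" "Cod C D = X"
    and d: "Pr1 K A A \<cdot>\<^bsub>fslice C X\<^esub> d = (D, e0, A)" "Pr2 K A A \<cdot>\<^bsub>fslice C X\<^esub> d = (D, e1, A)"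
    and e: "over C D A e0" "over C D A e1"
    and Q: "Q = IHom K B A \<cdot> P1 (IHom K B A) (IHom K A B)"
begin

text \<open>Only evaluation remains visible in \<open>linv\<close>; the chosen products, internal
  composition and constants are gone. This is the form in which the constructions over two bases can
  be compared.\<close>

lemma LInvE:
  assumes "is_LInv (fslice C X) K A B d u v"
  obtains L u0 v0 where "u = (L, u0, Q)" "v = (L, v0, IHom K A D)" "over C L Q u0"
    "linv A B D e0 e1 L (P1 (IHom K B A) (IHom K A B) \<cdot> u0) (P2 (IHom K B A) (IHom K A B) \<cdot> u0) v0"
proof -
  note H1 = IHom_ob[OF B A] and H2 = IHom_ob[OF A B] and S = IHom_ob[OF A D]
  note PH = P_simps[OF H1 H2] and pH = P_over[OF H1 H2, folded Q]
  have Qo: "Q \<in> Fib C" "Cod C Q = X" "Dom C Q = Dom C (P1 (IHom K B A) (IHom K A B))" using PH H1 by (simp_all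
      add: Q)
  obtain F G R where eq:
    "pair (fslice C X) K (icomp (fslice C X) K A B A)
       (iconst (fslice C X) K (prod_ob (fslice C X) K (IHom K B A) (IHom K A B)) A) = (Q, F, R)"
    "pair (fslice C X) K (ipost (fslice C X) K A (Pr1 K A A \<cdot>\<^bsub>fslice C X\<^esub> d)) (ipost (fslice C X) K A (Pr2 K A A
        \<cdot>\<^bsub>fslice C X\<^esub> d))
      = (IHom K A D, G, R)"
    and R: "R \<in> Fib C" "Cod C R = X" and FG: "over C Q R F" "over C (IHom K A D) R G"
    and iff: "\<And>z u s. \<lbrakk>z \<in> Fib C; Cod C z = X; over C z Q u; over C z (IHom K A D) s\<rbrakk> \<Longrightarrow>
       F \<cdot> u = G \<cdot> s \<longleftrightarrow> linv_eq A B D e0 e1 z (P1 (IHom K B A) (IHom K A B) \<cdot> u) (P2 (IHom K B A) (IHom K A B) \<cdot>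
           u) s"
    by (rule LInv_cospan[OF A B D d e Q]) blast
  have pb: "is_pullback (fslice C X) (Q, F, R) (IHom K A D, G, R) u v"
    using assms unfolding is_LInv_def eq .
  obtain L u0 v0 where uv: "u = (L, u0, Q)" "v = (L, v0, IHom K A D)" and L: "L \<in> Fib C" "Cod C L = X"
    and u0: "u0 \<in> Arr C" "Dom C u0 = Dom C L" "Cod C u0 = Dom C Q" "Q \<cdot> u0 = L"
    and v0: "v0 \<in> Arr C" "Dom C v0 = Dom C L" "Cod C v0 = Dom C (IHom K A D)" "IHom K A D \<cdot> v0 = L" and FGuv:
        "F \<cdot> u0 = G \<cdot> v0"
    and ex: "\<And>Z x' y'. \<lbrakk>Z \<in> Fib C; Cod C Z = X; x' \<in> Arr C; Dom C x' = Dom C Z; Cod C x' = Dom C Q; Q \<cdot> x' = Z;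
       y' \<in> Arr C; Dom C y' = Dom C Z; Cod C y' = Dom C (IHom K A D); IHom K A D \<cdot> y' = Z; F \<cdot> x' = G \<cdot> y'\<rbrakk>
      \<Longrightarrow> \<exists>h. h \<in> Arr C \<and> Dom C h = Dom C Z \<and> Cod C h = Dom C L \<and> L \<cdot> h = Z \<and> u0 \<cdot> h = x' \<and> v0 \<cdot> h = y'"
    and un: "\<And>Z h k. \<lbrakk>Z \<in> Fib C; Cod C Z = X; h \<in> Arr C; Dom C h = Dom C Z; Cod C h = Dom C L; L \<cdot> h = Z;
       k \<in> Arr C; Dom C k = Dom C Z; Cod C k = Dom C L; L \<cdot> k = Z; u0 \<cdot> h = u0 \<cdot> k; v0 \<cdot> h = v0 \<cdot> k\<rbrakk> \<Longrightarrow> h = k"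
    by (rule fslice_pbE[OF pb]) blast
  have ou: "over C L Q u0" and ov: "over C L (IHom K A D) v0" using u0 v0 by (simp_all add: over_def)
  show thesis
  proof (rule that[OF uv ou])
    show "linv A B D e0 e1 L (P1 (IHom K B A) (IHom K A B) \<cdot> u0) (P2 (IHom K B A) (IHom K A B) \<cdot> u0) v0"
      unfolding linv_def
    proof (intro conjI allI impI)
      show "over C L (IHom K B A) (P1 (IHom K B A) (IHom K A B) \<cdot> u0)"
          "over C L (IHom K A B) (P2 (IHom K B A) (IHom K A B) \<cdot> u0)"
        using over_post[OF ou pH(1)] over_post[OF ou pH(2)] H1 H2 by simp_all
      show "linv_eq A B D e0 e1 L (P1 (IHom K B A) (IHom K A B) \<cdot> u0) (P2 (IHom K B A) (IHom K A B) \<cdot> u0) v0"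
        using iff[OF L ou ov] FGuv by simp
    next
      fix z g' f' s' assume z: "z \<in> Fib C" "Cod C z = X" and g: "over C z (IHom K B A) g'" and f:
          "over C z (IHom K A B) f'"
        and s: "over C z (IHom K A D) s'" and eq: "linv_eq A B D e0 e1 z g' f' s'"
      note t = over_tuple[OF H1 H2 g f, folded Q]
      have "F \<cdot> tuple C (P1 (IHom K B A) (IHom K A B)) (P2 (IHom K B A) (IHom K A B)) g' f' = G \<cdot> s'"
        using iff[OF z t(1) s] t(2,3) eq by simp
      from ex[OF z overD[OF t(1)] overD[OF s] this] obtain h where h: "over C z L h"
        "u0 \<cdot> h = tuple C (P1 (IHom K B A) (IHom K A B)) (P2 (IHom K B A) (IHom K A B)) g' f'" "v0 \<cdot> h = s'"
        by (auto simp: over_def)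
      then show "\<exists>h. over C z L h \<and> (P1 (IHom K B A) (IHom K A B) \<cdot> u0) \<cdot> h = g' \<and> (P2 (IHom K B A) (IHom K A B)
          \<cdot> u0) \<cdot> h = f' \<and> v0 \<cdot> h = s'"
        using t u0 PH Qo overD[OF h(1)] by (intro exI[of _ h]) simp
    next
      fix z h k assume z: "z \<in> Fib C" "Cod C z = X" and h: "over C z L h" and k: "over C z L k"
        and e: "(P1 (IHom K B A) (IHom K A B) \<cdot> u0) \<cdot> h = (P1 (IHom K B A) (IHom K A B) \<cdot> u0) \<cdot> k"
          "(P2 (IHom K B A) (IHom K A B) \<cdot> u0) \<cdot> h = (P2 (IHom K B A) (IHom K A B) \<cdot> u0) \<cdot> k" "v0 \<cdot> h = v0 \<cdot> k"
      note h' = overD[OF h] and k' = overD[OF k]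
      have "u0 \<cdot> h = u0 \<cdot> k"
        by (rule pb_uniq[OF pr_pb[OF H1 H2]]) (use e h' k' u0 PH Qo in simp_all)
      then show "h = k" using un[OF z h' k'] e by simp
    qed (use L ov in simp_all)
  qed
qed

lemma LInvI:
  assumes L: "linv A B D e0 e1 L g f s"
  shows "is_LInv (fslice C X) K A B d (L, tuple C (P1 (IHom K B A) (IHom K A B)) (P2 (IHom K B A) (IHom K A B))
      g f, Q) (L, s, IHom K A D)"
proof -
  note H1 = IHom_ob[OF B A] and H2 = IHom_ob[OF A B] and S = IHom_ob[OF A D]
  note PH = P_simps[OF H1 H2] and pH = P_over[OF H1 H2, folded Q]
  have Qo: "Q \<in> Fib C" "Cod C Q = X" "Dom C Q = Dom C (P1 (IHom K B A) (IHom K A B))" using PH H1 by (simp_all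
      add: Q)
  obtain F G R where eq:
    "pair (fslice C X) K (icomp (fslice C X) K A B A)
       (iconst (fslice C X) K (prod_ob (fslice C X) K (IHom K B A) (IHom K A B)) A) = (Q, F, R)"
    "pair (fslice C X) K (ipost (fslice C X) K A (Pr1 K A A \<cdot>\<^bsub>fslice C X\<^esub> d)) (ipost (fslice C X) K A (Pr2 K A A
        \<cdot>\<^bsub>fslice C X\<^esub> d))
      = (IHom K A D, G, R)"
    and R: "R \<in> Fib C" "Cod C R = X" and FG: "over C Q R F" "over C (IHom K A D) R G"
    and iff: "\<And>z u s. \<lbrakk>z \<in> Fib C; Cod C z = X; over C z Q u; over C z (IHom K A D) s\<rbrakk> \<Longrightarrow>
       F \<cdot> u = G \<cdot> s \<longleftrightarrow> linv_eq A B D e0 e1 z (P1 (IHom K B A) (IHom K A B) \<cdot> u) (P2 (IHom K B A) (IHom K A B) \<cdot>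
           u) s"
    by (rule LInv_cospan[OF A B D d e Q]) blast
  note Lo = linvD(1,2)[OF L] and g = linvD(3)[OF L] and f = linvD(4)[OF L] and s = linvD(5)[OF L]
  note t = over_tuple[OF H1 H2 g f, folded Q]
  define u0 where "u0 = tuple C (P1 (IHom K B A) (IHom K A B)) (P2 (IHom K B A) (IHom K A B)) g f"
  note t = t[folded u0_def]
  have gf: "P1 (IHom K B A) (IHom K A B) \<cdot> (u0 \<cdot> h) = g \<cdot> h" "P2 (IHom K B A) (IHom K A B) \<cdot> (u0 \<cdot> h) = f \<cdot> h"
    if "over C z L h" for z h
    using t overD[OF t(1)] overD[OF that] PH Qo by (simp_all add: reassoc[OF t(2)] reassoc[OF t(3)])
  show ?thesis unfolding is_LInv_def eq u0_def[symmetric]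
  proof (rule fslice_pbI[OF Qo(1) S(1) R(1) Qo(2) S(2) R(2) overD[OF FG(1)] overD[OF FG(2)] Lo overD[OF t(1)]
      overD[OF s]])
    show "F \<cdot> u0 = G \<cdot> s" using iff[OF Lo t(1) s] t(2,3) linvD(6)[OF L] by simp
  next
    fix Z x' y' assume Z: "Z \<in> Fib C" "Cod C Z = X" and "x' \<in> Arr C" "Dom C x' = Dom C Z" "Cod C x' = Dom C Q"
        "Q \<cdot> x' = Z"
       "y' \<in> Arr C" "Dom C y' = Dom C Z" "Cod C y' = Dom C (IHom K A D)" "IHom K A D \<cdot> y' = Z" and FG:
           "F \<cdot> x' = G \<cdot> y'"
    then have x: "over C Z Q x'" and y: "over C Z (IHom K A D) y'" by (simp_all add: over_def)
    have "linv_eq A B D e0 e1 Z (P1 (IHom K B A) (IHom K A B) \<cdot> x') (P2 (IHom K B A) (IHom K A B) \<cdot> x') y'"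
      using iff[OF Z x y] FG by simp
    moreover have "over C Z (IHom K B A) (P1 (IHom K B A) (IHom K A B) \<cdot> x')"
        "over C Z (IHom K A B) (P2 (IHom K B A) (IHom K A B) \<cdot> x')"
      using over_post[OF x pH(1)] over_post[OF x pH(2)] H1 H2 by simp_all
    ultimately obtain h where h: "over C Z L h" "g \<cdot> h = P1 (IHom K B A) (IHom K A B) \<cdot> x'"
      "f \<cdot> h = P2 (IHom K B A) (IHom K A B) \<cdot> x'" "s \<cdot> h = y'"
      using linvD(7)[OF L Z] y by blast
    have "u0 \<cdot> h = x'"
      by (rule pb_uniq[OF pr_pb[OF H1 H2]])
        (use overD[OF h(1)] overD[OF t(1)] overD[OF x] Qo gf[OF h(1)] h in simp_all)
    then show "\<exists>h. h \<in> Arr C \<and> Dom C h = Dom C Z \<and> Cod C h = Dom C L \<and> L \<cdot> h = Z \<and> u0 \<cdot> h = x' \<and> s \<cdot> h = y'"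
      using h overD[OF h(1)] by blast
  next
    fix Z h k assume Z: "Z \<in> Fib C" "Cod C Z = X" and "h \<in> Arr C" "Dom C h = Dom C Z" "Cod C h = Dom C L"
        "L \<cdot> h = Z"
       "k \<in> Arr C" "Dom C k = Dom C Z" "Cod C k = Dom C L" "L \<cdot> k = Z" and e: "u0 \<cdot> h = u0 \<cdot> k" "s \<cdot> h = s \<cdot> k"
    then have h: "over C Z L h" and k: "over C Z L k" by (simp_all add: over_def)
    have "P1 (IHom K B A) (IHom K A B) \<cdot> (u0 \<cdot> h) = P1 (IHom K B A) (IHom K A B) \<cdot> (u0 \<cdot> k)"
      "P2 (IHom K B A) (IHom K A B) \<cdot> (u0 \<cdot> h) = P2 (IHom K B A) (IHom K A B) \<cdot> (u0 \<cdot> k)"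
      by (simp_all add: e)
    then have "g \<cdot> h = g \<cdot> k" "f \<cdot> h = f \<cdot> k" unfolding gf[OF h] gf[OF k] .
    then show "h = k" using linvD(8)[OF L Z h k] e by simp
  qed
qed

end

end

context pi_tribe
begin

text \<open>The exponential is the dependent product along \<open>A\<close> of the projection from
  the fibre product of \<open>A\<close> and \<open>B\<close> to \<open>A\<close>. Its counit
  followed by the projection to \<open>B\<close> is evaluation.\<close>

lemma exponential_ex:
  assumes A: "A \<in> Fib C" "Cod C A = X" and B: "B \<in> Fib C" "Cod C B = X"
    and pp: "\<And>Z. \<lbrakk>Z \<in> Fib C; Cod C Z = X\<rbrakk> \<Longrightarrow> is_pullback C Z A (p1 Z) (p2 Z)"
  shows "\<exists>H ev. H \<in> Fib C \<and> Cod C H = X \<and> over C (H \<cdot> p1 H) B ev \<and>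
    (\<forall>Z k. Z \<in> Fib C \<longrightarrow> Cod C Z = X \<longrightarrow> over C (Z \<cdot> p1 Z) B k \<longrightarrow>
       (\<exists>!h. over C Z H h \<and> ev \<cdot> tuple C (p1 H) (p2 H) (h \<cdot> p1 Z) (p2 Z) = k))"
proof -
  note [simp] = A B
  obtain f b where pbf: "is_pullback C A B f b" using pb_ex[of B A] by auto
  note [simp] = pbD(4-8)[OF pbf]
  have [simp]: "f \<in> Fib C" using fib_pb1[OF pbf] by simp
  obtain g where "is_Pi C A f g" using pi_ex[OF A(1)] unfolding is_Pi_def by fastforce
  then obtain w \<theta> \<epsilon> where D: "dep_prod C A f g w \<theta> \<epsilon>" by (rule is_Pi_dep_prod)
  note [simp] = dep_prodD(4,5,7-9)[OF D]
  note pbw = dep_prodD(6)[OF D] and f\<epsilon> = dep_prodD(10)[OF D]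
  note [simp] = pbD(4-8)[OF pbw]
  have [simp]: "Cod C g = X" by (simp add: dep_prodD(5)[OF D])
  note pbg = pp[of g, simplified]
  obtain i j where [simp]: "i \<in> Arr C" "Dom C i = Dom C (p2 g)" "Cod C i = Dom C w" and i: "w \<cdot> i = p2 g"
      "\<theta> \<cdot> i = p1 g"
    by (rule pb_unique_iso[OF pbw pb_sym[OF pbg]])
  note [simp] = pbD(4-8)[OF pbg]
  define ev where "ev = b \<cdot> (\<epsilon> \<cdot> i)"
  have Ab: "A \<cdot> f = B \<cdot> b" by (rule pbD(9)[OF pbf])
  have "B \<cdot> ev = g \<cdot> p1 g"
    by (simp add: ev_def reassoc[OF Ab[symmetric]] reassoc[OF f\<epsilon>] i pbD(9)[OF pbg])
  then have ev: "over C (g \<cdot> p1 g) B ev" by (simp add: over_def) (simp add: ev_def)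
  have "\<exists>!h. over C Z g h \<and> ev \<cdot> tuple C (p1 g) (p2 g) (h \<cdot> p1 Z) (p2 Z) = k"
    if Z [simp]: "Z \<in> Fib C" "Cod C Z = X" and k: "over C (Z \<cdot> p1 Z) B k" for Z k
  proof -
    note pbZ = pp[OF Z]
    note [simp] = pbD(4-8)[OF pbZ]
    note k' = overD[OF k]
    have Zp: "Z \<cdot> p1 Z = A \<cdot> p2 Z" by (rule pbD(9)[OF pbZ])
    obtain u where [simp]: "u \<in> Arr C" "Dom C u = Dom C (p1 Z)" "Cod C u = Dom C f" and u: "f \<cdot> u = p2 Z"
        "b \<cdot> u = k"
      by (rule pb_lift[OF pbf, of "p2 Z" k]) (use k' Zp in simp_all)
    have t: "tuple C (p1 g) (p2 g) (h \<cdot> p1 Z) (p2 Z) \<in> Arr C"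
        "Dom C (tuple C (p1 g) (p2 g) (h \<cdot> p1 Z) (p2 Z)) = Dom C (p1 Z)"
      "Cod C (tuple C (p1 g) (p2 g) (h \<cdot> p1 Z) (p2 Z)) = Dom C (p1 g)"
      "p1 g \<cdot> tuple C (p1 g) (p2 g) (h \<cdot> p1 Z) (p2 Z) = h \<cdot> p1 Z"
      "p2 g \<cdot> tuple C (p1 g) (p2 g) (h \<cdot> p1 Z) (p2 Z) = p2 Z" if h: "over C Z g h" for h
      using pb_tuple[OF pbg, of "h \<cdot> p1 Z" "p2 Z"] overD[OF h] Zp by (simp_all add: reassoc[OF overD(4)[OF h]])
    obtain h l where h: "h \<in> Arr C" "Dom C h = Dom C Z" "Cod C h = Dom C g" "g \<cdot> h = Z"
      and l: "l \<in> Arr C" "Dom C l = Dom C (p2 Z)" "Cod C l = Dom C w" "w \<cdot> l = p2 Z" "\<theta> \<cdot> l = h \<cdot> p1 Z"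
          "\<epsilon> \<cdot> l = u"
      by (rule dep_prod_ex[OF D pb_sym[OF pbZ], of u]) (simp_all add: u)
    have oh: "over C Z g h" using h by (simp add: over_def)
    show ?thesis
    proof (rule ex1I[of _ h])
      have "i \<cdot> tuple C (p1 g) (p2 g) (h \<cdot> p1 Z) (p2 Z) = l"
        by (rule pb_uniq[OF pbw]) (use t[OF oh] l h in \<open>simp_all add: reassoc[OF i(1)] reassoc[OF i(2)]\<close>)
      then show "over C Z g h \<and> ev \<cdot> tuple C (p1 g) (p2 g) (h \<cdot> p1 Z) (p2 Z) = k"
        using t[OF oh] oh l u by (simp add: ev_def)
    next
      fix h' assume h': "over C Z g h' \<and> ev \<cdot> tuple C (p1 g) (p2 g) (h' \<cdot> p1 Z) (p2 Z) = k"
      then have oh': "over C Z g h'" by simp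
      define l' where "l' = i \<cdot> tuple C (p1 g) (p2 g) (h' \<cdot> p1 Z) (p2 Z)"
      have l': "l' \<in> Arr C" "Dom C l' = Dom C (p2 Z)" "Cod C l' = Dom C w" "w \<cdot> l' = p2 Z" "\<theta> \<cdot> l' = h' \<cdot> p1 Z"
          "b \<cdot> (\<epsilon> \<cdot> l') = k"
        using t[OF oh'] h' by (simp_all add: l'_def ev_def reassoc[OF i(1)] reassoc[OF i(2)])
      have "\<epsilon> \<cdot> l' = \<epsilon> \<cdot> l"
        by (rule pb_uniq[OF pbf]) (use l l' u in \<open>simp_all add: reassoc[OF f\<epsilon>]\<close>)
      then show "h' = h"
        using dep_prod_uniq[OF D pb_sym[OF pbZ] overD(1-3)[OF oh'] overD(1-3)[OF oh] l'(1-3) l(1-3)]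
          overD(4)[OF oh] overD(4)[OF oh'] l l' by simp
    qed
  qed
  then show ?thesis using ev by (intro exI[of _ g] exI[of _ ev]) simp
qed

text \<open>Univalence asks for some cartesian closed structure on the slice over the square of the
  base. For the pulled back fibration it has to be produced over a new base.\<close>

lemma ccs_ex:
  assumes X: "X \<in> Obj C"
  shows "\<exists>K. is_ccs (fslice C X) K"
proof -
  note [simp] = X
  have "\<exists>q. is_pullback C A B (fst q) (snd q)" if AB: "A \<in> Fib C" "Cod C A = X" "B \<in> Fib C" "Cod C B = X" for A
      B
  proof -
    obtain q1 q2 where "is_pullback C A B q1 q2" using pb_ex[of B A] AB by auto
    then show ?thesis by (intro exI[of _ "(q1, q2)"]) simp
  qed
  then obtain q where q: "\<And>A B. \<lbrakk>A \<in> Fib C; Cod C A = X; B \<in> Fib C; Cod C B = X\<rbrakk> \<Longrightarrow> is_pullback C A B (fst (q A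
      B)) (snd (q A B))"
    by metis
  define p1 p2 where "p1 A B = fst (q A B)" and "p2 A B = snd (q A B)" for A B
  note pp = q[folded p1_def p2_def]
  have "\<exists>G. fst G \<in> Fib C \<and> Cod C (fst G) = X \<and> over C (fst G \<cdot> p1 (fst G) A) B (snd G) \<and>
    (\<forall>Z k. Z \<in> Fib C \<longrightarrow> Cod C Z = X \<longrightarrow> over C (Z \<cdot> p1 Z A) B k \<longrightarrow>
       (\<exists>!h. over C Z (fst G) h \<and> snd G \<cdot> tuple C (p1 (fst G) A) (p2 (fst G) A) (h \<cdot> p1 Z A) (p2 Z A) = k))"
    if A: "A \<in> Fib C" "Cod C A = X" and B: "B \<in> Fib C" "Cod C B = X" for A B
    using exponential_ex[OF A B, of "\<lambda>Z. p1 Z A" "\<lambda>Z. p2 Z A"] pp A by auto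
  then obtain G where G: "\<And>A B. \<lbrakk>A \<in> Fib C; Cod C A = X; B \<in> Fib C; Cod C B = X\<rbrakk> \<Longrightarrow> fst (G A B) \<in> Fib C \<and> Cod C
      (fst (G A B)) = X \<and>
    over C (fst (G A B) \<cdot> p1 (fst (G A B)) A) B (snd (G A B)) \<and>
    (\<forall>Z k. Z \<in> Fib C \<longrightarrow> Cod C Z = X \<longrightarrow> over C (Z \<cdot> p1 Z A) B k \<longrightarrow>
       (\<exists>!h. over C Z (fst (G A B)) h \<and> snd (G A B) \<cdot> tuple C (p1 (fst (G A B)) A) (p2 (fst (G A B)) A) (h \<cdot> p1
           Z A) (p2 Z A) = k))"
    by metis
  define H e where "H A B = fst (G A B)" and "e A B = snd (G A B)" for A B
  note G = G[folded H_def e_def]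
  \<comment> \<open>The terminal object of the slice is the identity of \<open>X\<close>; products
    are chosen pullbacks, and internal homs come from dependent products.\<close>
  define K where "K = \<lparr>One = Idn C X, Pr1 = \<lambda>A B. (A \<cdot> p1 A B, p1 A B, A), Pr2 = \<lambda>A B. (A \<cdot> p1 A B, p2 A B, B),
    IHom = H, Ev = \<lambda>A B. (H A B \<cdot> p1 (H A B) A, e A B, B)\<rparr>"
  have Ks [simp]: "One K = Idn C X" "Pr1 K = (\<lambda>A B. (A \<cdot> p1 A B, p1 A B, A))"
      "Pr2 K = (\<lambda>A B. (A \<cdot> p1 A B, p2 A B, B))"
    "IHom K = H" "Ev K = (\<lambda>A B. (H A B \<cdot> p1 (H A B) A, e A B, B))"
    by (simp_all add: K_def)
  have "is_ccs (fslice C X) K"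
    unfolding is_ccs_def
  proof (intro conjI ballI)
    show "is_terminal (fslice C X) (One K)"
      unfolding is_terminal_def
    proof (intro conjI ballI)
      fix Z assume Z: "Z \<in> Obj (fslice C X)"
      show "\<exists>!f. f \<in> Hom (fslice C X) Z (One K)"
      proof (rule ex1I[of _ "(Z, Z, Idn C X)"])
        fix f assume "f \<in> Hom (fslice C X) Z (One K)"
        then obtain f0 where "f = (Z, f0, One K)" "f0 \<in> Arr C" "Cod C f0 = Dom C (One K)" "One K \<cdot> f0 = Z"
          by (rule fslice_HomE)
        then show "f = (Z, Z, Idn C X)" by simp
      qed (use Z in simp)
    qed simp
  next
    fix A B assume "A \<in> Obj (fslice C X)" "B \<in> Obj (fslice C X)"
    then have A: "A \<in> Fib C" "Cod C A = X" and B: "B \<in> Fib C" "Cod C B = X" by simp_all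
    show "is_product (fslice C X) A B (Pr1 K A B) (Pr2 K A B)"
      using pb_fslice_product[OF pp[OF A B] A(1) B(1) A(2)] by simp
  next
    fix A B assume "A \<in> Obj (fslice C X)" "B \<in> Obj (fslice C X)"
    then have A: "A \<in> Fib C" "Cod C A = X" and B: "B \<in> Fib C" "Cod C B = X" by simp_all
    have Ho: "H A B \<in> Fib C" "Cod C (H A B) = X" using G[OF A B] by simp_all
    show "IHom K A B \<in> Obj (fslice C X)" using Ho by simp
    note pbH = pp[OF Ho A]
    have pf: "p1 (H A B) A \<in> Fib C" using fib_pb1[OF pbH] A by simp
    have pe: "prod_ob (fslice C X) K Z A = Z \<cdot> p1 Z A" for Z by (simp add: prod_ob_def)
    show "Ev K A B \<in> Hom (fslice C X) (prod_ob (fslice C X) K (IHom K A B) A) B"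
      using G[OF A B] pf pbD(4-8)[OF pbH] Ho B by (simp add: pe over_def)
    fix Z f assume "Z \<in> Obj (fslice C X)" and f: "f \<in> Hom (fslice C X) (prod_ob (fslice C X) K Z A) B"
    then have Z: "Z \<in> Fib C" "Cod C Z = X" by simp_all
    note pbZ = pp[OF Z A]
    have pZ: "p1 Z A \<in> Fib C" using fib_pb1[OF pbZ] A by simp
    obtain f0 where f0: "f = (Z \<cdot> p1 Z A, f0, B)" "over C (Z \<cdot> p1 Z A) B f0"
      using f unfolding pe by (rule fslice_HomE) (simp add: over_def)
    have unc: "uncurry (fslice C X) K Z A B (Z, h, H A B) = (Z \<cdot> p1 Z A, e A B \<cdot> tuple C (p1 (H A B) A) (p2 (H A
        B) A) (h \<cdot> p1 Z A) (p2 Z A), B)"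
      if h: "over C Z (H A B) h" for h
    proof -
      note h' = overD[OF h]
      have "tuple (fslice C X) (H A B \<cdot> p1 (H A B) A, p1 (H A B) A, H A B) (H A B \<cdot> p1 (H A B) A, p2 (H A B) A,
          A)
          (Z \<cdot> p1 Z A, h \<cdot> p1 Z A, H A B) (Z \<cdot> p1 Z A, p2 Z A, A) =
        (Z \<cdot> p1 Z A, tuple C (p1 (H A B) A) (p2 (H A B) A) (h \<cdot> p1 Z A) (p2 Z A), H A B \<cdot> p1 (H A B) A)"
        by (rule fslice_tuple[OF pbH Ho(1) A(1) Ho(2)])
          (use h' Z pZ Ho A pbD(4-8)[OF pbZ] in \<open>simp_all add: reassoc[OF h'(4)] pbD(9)[OF pbZ, symmetric]\<close>)
      then show ?thesis by (simp add: uncurry_def pair_def)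
    qed
    obtain h where h: "over C Z (H A B) h" "e A B \<cdot> tuple C (p1 (H A B) A) (p2 (H A B) A) (h \<cdot> p1 Z A) (p2 Z A)
        = f0"
      and un: "\<And>k. \<lbrakk>over C Z (H A B) k; e A B \<cdot> tuple C (p1 (H A B) A) (p2 (H A B) A) (k \<cdot> p1 Z A) (p2 Z A) =
          f0\<rbrakk> \<Longrightarrow> k = h"
      using G[OF A B] Z f0(2) by metis
    show "\<exists>!h. h \<in> Hom (fslice C X) Z (IHom K A B) \<and> uncurry (fslice C X) K Z A B h = f"
    proof (rule ex1I[of _ "(Z, h, H A B)"])
      show "(Z, h, H A B) \<in> Hom (fslice C X) Z (IHom K A B) \<and> uncurry (fslice C X) K Z A B (Z, h, H A B) = f"
        using unc[OF h(1)] h f0 overD[OF h(1)] Z Ho by simp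
      fix k assume k: "k \<in> Hom (fslice C X) Z (IHom K A B) \<and> uncurry (fslice C X) K Z A B k = f"
      then have "k \<in> Hom (fslice C X) Z (H A B)" by (simp only: Ks(4))
      then obtain k0 where k0: "k = (Z, k0, H A B)" "over C Z (H A B) k0"
        by (rule fslice_HomE) (simp add: over_def)
      have "k0 = h" by (rule un[OF k0(2)]) (use k unc[OF k0(2)] k0(1) f0(1) in simp)
      then show "k = (Z, h, H A B)" using k0 by simp
    qed
  qed
  then show ?thesis by blast
qed

end

section \<open>Base change of internal homs and objects of equivalences\<close>

text \<open>Since \<open>f\<close> is a fibration, composition with \<open>f\<close> sends fibrations over \<open>X'\<close> to fibrations over \<open>X\<close>, so
  universal properties in the fibrant slices can be transported along \<open>f\<close>.\<close>

locale base_change = tribe C + S: fslice_ccs C X K + T: fslice_ccs C X' K'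
  for C :: "('o, 'm, 'x) fcat_scheme" (structure) and X K X' K' +
  fixes f
  assumes f [simp]: "f \<in> Fib C" "Dom C f = X'" "Cod C f = X"
begin

lemma bc_simps:
  assumes "is_pullback C f A A' a" "A \<in> Fib C"
  shows "A' \<in> Fib C" "Cod C A' = X'" "a \<in> Arr C" "Dom C a = Dom C A'" "Cod C a = Dom C A" "f \<cdot> A' = A \<cdot> a"
      "Cod C A = X"
    "a \<in> Fib C" "over C (f \<cdot> A') A a"
  using pbD[OF assms(1)] fib_pb1[OF assms] fib_pb2[OF assms(1)] assms(2) by (simp_all add: over_def)

text \<open>Together with the next two facts this is the adjunction between composition with
  \<open>f\<close> and pullback along \<open>f\<close>: elements of \<open>A'\<close> at a stage
  over \<open>X'\<close> are the elements of \<open>A\<close> at the same stage over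
  \<open>X\<close>.\<close>

lemma bc_push:
  assumes "is_pullback C f A A' a" "A \<in> Fib C" "over C v A' y"
  shows "over C (f \<cdot> v) A (a \<cdot> y)"
proof -
  note [simp] = bc_simps(1-5,7)[OF assms(1,2)] overD(1,3)[OF assms(3)] assms(2)
  have "A' \<cdot> y \<in> Arr C" "Dom C (A' \<cdot> y) = Dom C y" "Cod C (A' \<cdot> y) = X'" by simp_all
  then have [simp]: "v \<in> Arr C" "Dom C v = Dom C y" "Cod C v = X'" unfolding overD(4)[OF assms(3)] .
  show ?thesis by (simp add: over_def reassoc[OF bc_simps(6)[OF assms(1,2), symmetric]] overD(4)[OF assms(3)])
qed

lemma bc_pull:
  assumes pb: "is_pullback C f A A' a" and A: "A \<in> Fib C" and y: "over C (f \<cdot> v) A y" and v: "v \<in> Arr C"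
      "Cod C v = X'"
  obtains y' where "over C v A' y'" "a \<cdot> y' = y"
proof -
  obtain y' where "y' \<in> Arr C" "Dom C y' = Dom C v" "Cod C y' = Dom C A'" "A' \<cdot> y' = v" "a \<cdot> y' = y"
    by (rule pb_lift[OF pb, of v y]) (use overD[OF y] v in simp_all)
  then show thesis using that by (simp add: over_def)
qed

lemma bc_uniq:
  assumes pb: "is_pullback C f A A' a" and "over C v A' y" "over C v A' z" "a \<cdot> y = a \<cdot> z"
  shows "y = z"
  by (rule pb_uniq[OF pb]) (use overD[OF assms(2)] overD[OF assms(3)] assms(4) in simp_all)

lemma bc_post:
  assumes L: "is_pullback C f L L' l" "L \<in> Fib C" and M: "is_pullback C f M M' m" "M \<in> Fib C"
    and x: "over C L M x"
  obtains x' where "over C L' M' x'" "m \<cdot> x' = x \<cdot> l"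
proof -
  note l = bc_simps[OF L] and x' = overD[OF x]
  have "over C (f \<cdot> L') M (x \<cdot> l)" by (rule over_post[OF l(9) x]) (use M in simp)
  then show thesis by (rule bc_pull[OF M]) (use l that in simp_all)
qed

text \<open>A map \<open>k\<close> over the base of \<open>g\<close> pulls back along
  \<open>f\<close> to a map \<open>m\<close> that is itself a pullback of \<open>k\<close>, now
  along the total map \<open>q2\<close>. Fibrations and anodyne maps are transferred in this
  way.\<close>

lemma bc_cmp_section:
  assumes 1: "is_pullback C f g q1 q2" and 2: "is_pullback C f (g \<cdot> k) s1 s2"
    and k: "k \<in> Arr C" "Cod C k = Dom C g" and m: "m \<in> Arr C" "Dom C m = Dom C s1" "Cod C m = Dom C q1"
        "q1 \<cdot> m = s1" "q2 \<cdot> m = k \<cdot> s2"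
  shows "is_pullback C q2 k m s2"
  by (rule pb_sym, rule pb_unpaste[OF pb_sym[OF 1] pb_sym[OF 2]])
    (use k m pbD[OF 1] pbD[OF 2] in simp_all)

text \<open>The structure \<open>K'\<close> is unrelated to \<open>K\<close>, so its internal hom is
  shown to be isomorphic to the pullback of that of \<open>K\<close>. The two maps are obtained by
  abstraction over \<open>X\<close> and over \<open>X'\<close>, and extensionality on each side
  shows that they are inverse.\<close>

lemma IHom_base_change:
  assumes a: "is_pullback C f A A' a" "A \<in> Fib C" and b: "is_pullback C f B B' b" "B \<in> Fib C"
  obtains \<kappa> where "is_pullback C f (IHom K A B) (IHom K' A' B') \<kappa>"
    "\<And>v x y. \<lbrakk>over C v (IHom K' A' B') x; over C v A' y\<rbrakk> \<Longrightarrow> b \<cdot> T.app A' B' x y = S.app A B (\<kappa> \<cdot> x) (a \<cdot> y)"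
proof -
  note as = bc_simps[OF a] and bs = bc_simps[OF b]
  note [simp] = as(1-5,7,8) bs(1-5,7,8) a(2) b(2)
  define H H' where "H = IHom K A B" and "H' = IHom K' A' B'"
  have H [simp]: "H \<in> Fib C" "Cod C H = X" and H' [simp]: "H' \<in> Fib C" "Cod C H' = X'"
    using S.IHom_ob[of A B] T.IHom_ob[of A' B'] by (simp_all add: H_def H'_def)
  note pH' = T.pr_pb[OF H' as(1,2)] and ps = T.P_simps[OF H' as(1,2)]
  note [simp] = ps
  have pb1: "is_pullback C (f \<cdot> H') A (T.P1 H' A') (a \<cdot> T.P2 H' A')" by (rule pb_paste[OF a(1) pH'])
  note po = T.P_over[OF H' as(1,2)]
  have ev: "over C (H' \<cdot> T.P1 H' A') B' (T.app A' B' (T.P1 H' A') (T.P2 H' A'))"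
    by (rule T.app_over[OF as(1,2) bs(1,2) po[unfolded H'_def] , folded H'_def])
  note ev' = overD[OF ev]
  note [simp] = ev'(1-3)
  have Bk: "B \<cdot> (b \<cdot> T.app A' B' (T.P1 H' A') (T.P2 H' A')) = (f \<cdot> H') \<cdot> T.P1 H' A'"
    by (simp add: reassoc[OF bs(6)[symmetric]] ev'(4))
  \<comment> \<open>The canonical comparison: evaluate over \<open>X'\<close>, project to
    \<open>B\<close> and abstract over \<open>X\<close>. The context \<open>f \<cdot> H'\<close> is
    fibrant since \<open>f\<close> is a fibration, and by pasting its pullback of \<open>A\<close>
    is the product with \<open>A'\<close> over \<open>X'\<close>.\<close>
  obtain \<kappa> where [simp]: "\<kappa> \<in> Arr C" "Dom C \<kappa> = Dom C H'" "Cod C \<kappa> = Dom C H" and \<kappa>: "H \<cdot> \<kappa> = f \<cdot> H'"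
    and \<kappa>': "\<And>w y. \<lbrakk>w \<in> Arr C; Dom C y = Dom C w; y \<in> Arr C; Cod C w = Dom C H'; Cod C y = Dom C A;
        (f \<cdot> H') \<cdot> w = A \<cdot> y\<rbrakk>
      \<Longrightarrow> S.app A B (\<kappa> \<cdot> w) y = (b \<cdot> T.app A' B' (T.P1 H' A') (T.P2 H' A')) \<cdot> tuple C (T.P1 H' A') (a \<cdot> T.P2 H'
          A') w y"
    by (rule S.lam[OF a(2) as(7) b(2) bs(7), of "f \<cdot> H'" "T.P1 H' A'" "a \<cdot> T.P2 H' A'"
        "b \<cdot> T.app A' B' (T.P1 H' A') (T.P2 H' A')", folded H_def])
      (use pb1 Bk in simp_all)
  have comp: "b \<cdot> T.app A' B' x y = S.app A B (\<kappa> \<cdot> x) (a \<cdot> y)" if x: "over C v H' x" and y: "over C v A' y" for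
      v x y
  proof -
    note x' = overD[OF x] and y' = overD[OF y]
    note t = T.over_tuple[OF H' as(1,2) x y]
    note t1 = overD(1-3)[OF t(1)]
    note [simp] = x'(1-3) y'(1-3) t1
    have "v \<in> Arr C" using arr_cmp[of x H'] by (simp add: x'(4))
    have "tuple C (T.P1 H' A') (a \<cdot> T.P2 H' A') x (a \<cdot> y) = tuple C (T.P1 H' A') (T.P2 H' A') x y"
      by (rule pb_tuple_eq[OF pb1]) (simp_all add: t)
    moreover have "T.app A' B' (T.P1 H' A') (T.P2 H' A') \<cdot> tuple C (T.P1 H' A') (T.P2 H' A') x y = T.app A' B' x
        y"
      using T.app_over_cmp[OF as(1,2) bs(1,2) po[unfolded H'_def], of "tuple C (T.P1 H' A') (T.P2 H' A') x y",
          folded H'_def] t by simp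
    moreover have "(f \<cdot> H') \<cdot> x = A \<cdot> (a \<cdot> y)"
      by (simp add: reassoc[OF as(6)[symmetric]] x'(4) y'(4))
    ultimately show ?thesis using \<kappa>'[of x "a \<cdot> y"] by simp
  qed
  obtain H2 k2 where pb2: "is_pullback C f H H2 k2" using pb_ex[of H f] by auto
  note h2 = bc_simps[OF pb2 H(1)]
  note [simp] = h2(1-5,8)
  obtain m where m: "over C H' H2 m" "k2 \<cdot> m = \<kappa>"
    by (rule bc_pull[OF pb2 H(1), of H' \<kappa>]) (simp_all add: over_def \<kappa>)
  note [simp] = overD(1-3)[OF m(1)]
  note p2 = T.pr_pb[OF h2(1,2) as(1,2)] and po2 = T.P_over[OF h2(1,2) as(1,2)]
  note [simp] = T.P_simps[OF h2(1,2) as(1,2)]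
  have k2o: "over C (f \<cdot> (H2 \<cdot> T.P1 H2 A')) H (k2 \<cdot> T.P1 H2 A')" by (rule bc_push[OF pb2 H(1) po2(1)])
  have ao: "over C (f \<cdot> (H2 \<cdot> T.P1 H2 A')) A (a \<cdot> T.P2 H2 A')" by (rule bc_push[OF a po2(2)])
  have ko: "over C (f \<cdot> (H2 \<cdot> T.P1 H2 A')) B (S.app A B (k2 \<cdot> T.P1 H2 A') (a \<cdot> T.P2 H2 A'))"
    by (rule S.app_over[OF a(2) as(7) b(2) bs(7) k2o[unfolded H_def] ao])
  obtain k where k: "over C (H2 \<cdot> T.P1 H2 A') B' k" "b \<cdot> k = S.app A B (k2 \<cdot> T.P1 H2 A') (a \<cdot> T.P2 H2 A')"
    by (rule bc_pull[OF b ko]) simp_all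
  note k' = overD[OF k(1)]
  \<comment> \<open>In the opposite direction, a point of the pulled back internal hom is evaluated
    over \<open>X\<close>, the result is lifted to \<open>B'\<close>, and abstraction takes place
    over \<open>X'\<close>.\<close>
  obtain n where [simp]: "n \<in> Arr C" "Dom C n = Dom C H2" "Cod C n = Dom C H'" and n: "H' \<cdot> n = H2"
    and n': "\<And>w y. \<lbrakk>w \<in> Arr C; Dom C y = Dom C w; y \<in> Arr C; Cod C w = Dom C H2; Cod C y = Dom C A';
        H2 \<cdot> w = A' \<cdot> y\<rbrakk>
      \<Longrightarrow> T.app A' B' (n \<cdot> w) y = k \<cdot> tuple C (T.P1 H2 A') (T.P2 H2 A') w y"
    by (rule T.lam[OF as(1,2) bs(1,2) h2(1,2) p2, of k, folded H'_def]) (use k' in simp_all)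
  have n_app: "b \<cdot> T.app A' B' (n \<cdot> w) y = S.app A B (k2 \<cdot> w) (a \<cdot> y)"
    if w: "w \<in> Arr C" "Cod C w = Dom C H2" and y: "over C (H2 \<cdot> w) A' y" for w y
  proof -
    note y' = overD[OF y]
    have ow: "over C (H2 \<cdot> w) H2 w" using w by (simp add: over_def)
    note t = T.over_tuple[OF h2(1,2) as(1,2) ow y]
    note t1 = overD(1-3)[OF t(1)]
    have "b \<cdot> T.app A' B' (n \<cdot> w) y = (b \<cdot> k) \<cdot> tuple C (T.P1 H2 A') (T.P2 H2 A') w y"
    proof -
      have "Dom C y = Dom C w" using y'(2) w by simp
      from n'[OF w(1) this y'(1) w(2) y'(3) y'(4)[symmetric]] show ?thesis using k'(1-3) t1 w by simp
    qed
    also have "\<dots> = S.app A B ((k2 \<cdot> T.P1 H2 A') \<cdot> tuple C (T.P1 H2 A') (T.P2 H2 A') w y) ((a \<cdot> T.P2 H2 A') \<cdot>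
        tuple C (T.P1 H2 A') (T.P2 H2 A') w y)"
      unfolding k(2) by (rule S.app_over_cmp[OF a(2) as(7) b(2) bs(7) k2o[unfolded H_def] ao]) (use t1 in
          simp_all)
    also have "\<dots> = S.app A B (k2 \<cdot> w) (a \<cdot> y)" using t t1 by simp
    finally show ?thesis .
  qed
  have \<kappa>n: "\<kappa> \<cdot> n = k2"
  proof (rule S.over_ext[OF a(2) as(7) b(2) bs(7), of "f \<cdot> H2", folded H_def])
    show "over C (f \<cdot> H2) H (\<kappa> \<cdot> n)" by (simp add: over_def reassoc[OF \<kappa>] n)
    show "over C (f \<cdot> H2) H k2" by (rule h2(9))
    fix w y assume w: "w \<in> Arr C" "Cod C w = Dom C (f \<cdot> H2)" and y: "over C ((f \<cdot> H2) \<cdot> w) A y"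
    have w2 [simp]: "w \<in> Arr C" "Cod C w = Dom C H2" using w by simp_all
    have "over C (f \<cdot> (H2 \<cdot> w)) A y" using y by simp
    then obtain y' where y': "over C (H2 \<cdot> w) A' y'" "a \<cdot> y' = y"
      by (rule bc_pull[OF a]) simp_all
    have nw: "over C (H2 \<cdot> w) H' (n \<cdot> w)" by (simp add: over_def reassoc[OF n])
    show "S.app A B ((\<kappa> \<cdot> n) \<cdot> w) y = S.app A B (k2 \<cdot> w) y"
      using n_app[OF w2 y'(1)] comp[OF nw y'(1)] y'(2) by simp
  qed simp_all
  have mn: "m \<cdot> n = Idn C (Dom C H2)"
    by (rule pb_uniq[OF pb2]) (simp_all add: reassoc[OF overD(4)[OF m(1)]] reassoc[OF m(2)] n \<kappa>n)
  have nm: "n \<cdot> m = Idn C (Dom C H')"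
  proof (rule T.over_ext[OF as(1,2) bs(1,2) H', folded H'_def])
    show "over C H' H' (n \<cdot> m)" by (simp add: over_def reassoc[OF n] overD(4)[OF m(1)])
    show "over C H' H' (Idn C (Dom C H'))" by (simp add: over_def)
    fix w y assume [simp]: "w \<in> Arr C" "Cod C w = Dom C H'" and y: "over C (H' \<cdot> w) A' y"
    have ow: "over C (H' \<cdot> w) H' w" by (simp add: over_def)
    have onw: "over C (H' \<cdot> w) H' (n \<cdot> (m \<cdot> w))" by (simp add: over_def reassoc[OF n] reassoc[OF overD(4)[OF
        m(1)]])
    have y2: "over C (H2 \<cdot> (m \<cdot> w)) A' y" using y by (simp add: reassoc[OF overD(4)[OF m(1)]])
    have "T.app A' B' (n \<cdot> (m \<cdot> w)) y = T.app A' B' w y"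
    proof (rule bc_uniq[OF b(1)])
      show "over C (H' \<cdot> w) B' (T.app A' B' (n \<cdot> (m \<cdot> w)) y)" "over C (H' \<cdot> w) B' (T.app A' B' w y)"
        using T.app_over[OF as(1,2) bs(1,2)] onw ow y by (simp_all add: H'_def)
      show "b \<cdot> T.app A' B' (n \<cdot> (m \<cdot> w)) y = b \<cdot> T.app A' B' w y"
        using n_app[of "m \<cdot> w" y] y2 comp[OF ow y] by (simp add: reassoc[OF m(2)])
    qed
    then show "T.app A' B' ((n \<cdot> m) \<cdot> w) y = T.app A' B' (Idn C (Dom C H') \<cdot> w) y" by simp
  qed
  have "is_pullback C f H (H2 \<cdot> m) (k2 \<cdot> m)"
    by (rule pb_iso[OF pb2, of m n]) (simp_all add: mn nm)
  then have "is_pullback C f H H' \<kappa>" by (simp add: overD(4)[OF m(1)] m(2))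
  then show thesis using that comp by (simp add: H_def H'_def)
qed

context
  fixes A A' a B B' b D D' dd e0 e1 e0' e1' \<kappa>1 \<kappa>2 \<kappa>3
  assumes a: "is_pullback C f A A' a" "A \<in> Fib C" and b: "is_pullback C f B B' b" "B \<in> Fib C"
    and dd: "is_pullback C f D D' dd" "D \<in> Fib C"
    and e: "over C D A e0" "over C D A e1" and e': "over C D' A' e0'" "over C D' A' e1'"
    and ee: "a \<cdot> e0' = e0 \<cdot> dd" "a \<cdot> e1' = e1 \<cdot> dd"
    and k1: "is_pullback C f (IHom K B A) (IHom K' B' A') \<kappa>1"
      "\<And>v x y. \<lbrakk>over C v (IHom K' B' A') x; over C v B' y\<rbrakk> \<Longrightarrow> a \<cdot> T.app B' A' x y = S.app B A (\<kappa>1 \<cdot> x) (b \<cdot> y)"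
    and k2: "is_pullback C f (IHom K A B) (IHom K' A' B') \<kappa>2"
      "\<And>v x y. \<lbrakk>over C v (IHom K' A' B') x; over C v A' y\<rbrakk> \<Longrightarrow> b \<cdot> T.app A' B' x y = S.app A B (\<kappa>2 \<cdot> x) (a \<cdot> y)"
    and k3: "is_pullback C f (IHom K A D) (IHom K' A' D') \<kappa>3"
      "\<And>v x y. \<lbrakk>over C v (IHom K' A' D') x; over C v A' y\<rbrakk> \<Longrightarrow> dd \<cdot> T.app A' D' x y = S.app A D (\<kappa>3 \<cdot> x) (a \<cdot> y)"
begin

text \<open>Both sides quantify over the same elements: those of \<open>A'\<close> at a stage over
  \<open>X'\<close> are those of \<open>A\<close> at that stage over \<open>X\<close>. The
  comparison maps respect evaluation, and equality in \<open>A'\<close> is detected by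
  \<open>a\<close> together with the base.\<close>

lemma linv_eq_base_change:
  assumes g: "over C z (IHom K' B' A') g" and h: "over C z (IHom K' A' B') h" and s:
      "over C z (IHom K' A' D') s"
  shows "T.linv_eq A' B' D' e0' e1' z g h s \<longleftrightarrow> S.linv_eq A B D e0 e1 (f \<cdot> z) (\<kappa>1 \<cdot> g) (\<kappa>2 \<cdot> h) (\<kappa>3 \<cdot> s)"
proof -
  note as = bc_simps[OF a] and bs = bc_simps[OF b] and ds = bc_simps[OF dd]
  note ob = a(2) as(7) b(2) bs(7) dd(2) ds(7) as(1,2) bs(1,2) ds(1,2)
  have I: "IHom K B A \<in> Fib C" "IHom K A B \<in> Fib C" "IHom K A D \<in> Fib C"
    "IHom K' B' A' \<in> Fib C" "IHom K' A' B' \<in> Fib C" "IHom K' A' D' \<in> Fib C" "Cod C (IHom K' A' D') = X'"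
    using ob by simp_all
  note ks = bc_simps[OF k1(1) I(1)] bc_simps[OF k2(1) I(2)] bc_simps[OF k3(1) I(3)]
  note [simp] = overD(1-3)[OF g] overD(1-3)[OF h] overD(1-3)[OF s] as(3-5) bs(3-5) ds(3-5) overD(1-3)[OF e'(1)]
      overD(1-3)[OF e'(2)]
    overD(1-3)[OF e(1)] overD(1-3)[OF e(2)] ks(3-5) ks(12-14) ks(21-23)
  have "IHom K' A' D' \<cdot> s \<in> Arr C" "Cod C (IHom K' A' D' \<cdot> s) = X'" using I by simp_all
  then have [simp]: "z \<in> Arr C" "Cod C z = X'" unfolding overD(4)[OF s] .
  have main: "a \<cdot> (e0' \<cdot> T.app A' D' (s \<cdot> w) y) = e0 \<cdot> S.app A D ((\<kappa>3 \<cdot> s) \<cdot> w) (a \<cdot> y) \<and>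
     a \<cdot> (e1' \<cdot> T.app A' D' (s \<cdot> w) y) = e1 \<cdot> S.app A D ((\<kappa>3 \<cdot> s) \<cdot> w) (a \<cdot> y) \<and>
     a \<cdot> T.app B' A' (g \<cdot> w) (T.app A' B' (h \<cdot> w) y) = S.app B A ((\<kappa>1 \<cdot> g) \<cdot> w) (S.app A B ((\<kappa>2 \<cdot> h) \<cdot> w) (a \<cdot>
         y)) \<and>
     over C (z \<cdot> w) A' (e0' \<cdot> T.app A' D' (s \<cdot> w) y) \<and> over C (z \<cdot> w) A' (e1' \<cdot> T.app A' D' (s \<cdot> w) y) \<and>
     over C (z \<cdot> w) A' (T.app B' A' (g \<cdot> w) (T.app A' B' (h \<cdot> w) y))"
    if w [simp]: "w \<in> Arr C" "Cod C w = Dom C z" and y: "over C (z \<cdot> w) A' y" for w y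
  proof -
    have gw: "over C (z \<cdot> w) (IHom K' B' A') (g \<cdot> w)" and hw: "over C (z \<cdot> w) (IHom K' A' B') (h \<cdot> w)"
      and sw: "over C (z \<cdot> w) (IHom K' A' D') (s \<cdot> w)"
      using over_cmp[OF g] over_cmp[OF h] over_cmp[OF s] I by simp_all
    note hy = T.app_over[OF ob(7-10) hw y] and sy = T.app_over[OF ob(7,8) ob(11,12) sw y]
    note gy = T.app_over[OF ob(9,10) ob(7,8) gw hy]
    note [simp] = overD(1-3)[OF hy] overD(1-3)[OF sy] overD(1-3)[OF gy] overD(1-3)[OF y]
    show ?thesis
      using k3(2)[OF sw y] k2(2)[OF hw y] k1(2)[OF gw hy] over_post[OF sy e'(1)] over_post[OF sy e'(2)] gy ob
      by (simp add: reassoc[OF ee(1)] reassoc[OF ee(2)])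
  qed
  show ?thesis
  proof
    assume T: "T.linv_eq A' B' D' e0' e1' z g h s"
    show "S.linv_eq A B D e0 e1 (f \<cdot> z) (\<kappa>1 \<cdot> g) (\<kappa>2 \<cdot> h) (\<kappa>3 \<cdot> s)"
      unfolding S.linv_eq_def
    proof (intro allI impI)
      fix w y assume w: "w \<in> Arr C" "Cod C w = Dom C (f \<cdot> z)" and y: "over C ((f \<cdot> z) \<cdot> w) A y"
      have w2 [simp]: "w \<in> Arr C" "Cod C w = Dom C z" using w by simp_all
      have "over C (f \<cdot> (z \<cdot> w)) A y" using y by simp
      then obtain y' where y': "over C (z \<cdot> w) A' y'" "a \<cdot> y' = y" by (rule bc_pull[OF a]) simp_all
      have "e0' \<cdot> T.app A' D' (s \<cdot> w) y' = T.app B' A' (g \<cdot> w) (T.app A' B' (h \<cdot> w) y')"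
          "e1' \<cdot> T.app A' D' (s \<cdot> w) y' = y'"
        using T w2 y'(1) unfolding T.linv_eq_def by blast+
      then show "e0 \<cdot> S.app A D ((\<kappa>3 \<cdot> s) \<cdot> w) y = S.app B A ((\<kappa>1 \<cdot> g) \<cdot> w) (S.app A B ((\<kappa>2 \<cdot> h) \<cdot> w) y) \<and> e1 \<cdot>
          S.app A D ((\<kappa>3 \<cdot> s) \<cdot> w) y = y"
        using main[OF w2 y'(1)] y'(2) by metis
    qed
  next
    assume S: "S.linv_eq A B D e0 e1 (f \<cdot> z) (\<kappa>1 \<cdot> g) (\<kappa>2 \<cdot> h) (\<kappa>3 \<cdot> s)"
    show "T.linv_eq A' B' D' e0' e1' z g h s"
      unfolding T.linv_eq_def
    proof (intro allI impI)
      fix w y assume w [simp]: "w \<in> Arr C" "Cod C w = Dom C z" and y: "over C (z \<cdot> w) A' y"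
      have "over C ((f \<cdot> z) \<cdot> w) A (a \<cdot> y)" using bc_push[OF a y] by simp
      then have "e0 \<cdot> S.app A D ((\<kappa>3 \<cdot> s) \<cdot> w) (a \<cdot> y) = S.app B A ((\<kappa>1 \<cdot> g) \<cdot> w) (S.app A B ((\<kappa>2 \<cdot> h) \<cdot> w) (a \<cdot>
          y)) \<and> e1 \<cdot> S.app A D ((\<kappa>3 \<cdot> s) \<cdot> w) (a \<cdot> y) = a \<cdot> y"
        using S unfolding S.linv_eq_def by (metis w dom_cmp fib_in_arr f(1,2) \<open>z \<in> Arr C\<close> \<open>Cod C z = X'\<close>)
      then show "e0' \<cdot> T.app A' D' (s \<cdot> w) y = T.app B' A' (g \<cdot> w) (T.app A' B' (h \<cdot> w) y) \<and> e1' \<cdot> T.app A' D'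
          (s \<cdot> w) y = y"
        using main[OF w y] bc_uniq[OF a(1)] y by (metis (no_types, lifting))
    qed
  qed
qed

text \<open>A fibrant test object \<open>z\<close> over \<open>X'\<close> is used as the fibrant
  test object \<open>f \<cdot> z\<close> over \<open>X\<close>; the solution found there is lifted
  to \<open>L'\<close>.\<close>

lemma linv_base_change:
  assumes L: "S.linv A B D e0 e1 L g h s" and l: "is_pullback C f L L' l"
    and g': "over C L' (IHom K' B' A') g'" "\<kappa>1 \<cdot> g' = g \<cdot> l" and h': "over C L' (IHom K' A' B') h'"
        "\<kappa>2 \<cdot> h' = h \<cdot> l"
    and s': "over C L' (IHom K' A' D') s'" "\<kappa>3 \<cdot> s' = s \<cdot> l"
  shows "T.linv A' B' D' e0' e1' L' g' h' s'"
proof -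
  note as = bc_simps[OF a] and bs = bc_simps[OF b] and ds = bc_simps[OF dd]
  note ob = a(2) as(7) b(2) bs(7) dd(2) ds(7) as(1,2) bs(1,2) ds(1,2)
  have I: "IHom K B A \<in> Fib C" "IHom K A B \<in> Fib C" "IHom K A D \<in> Fib C"
    "IHom K' B' A' \<in> Fib C" "IHom K' A' B' \<in> Fib C" "IHom K' A' D' \<in> Fib C"
    using ob by simp_all
  note ks = bc_simps[OF k1(1) I(1)] bc_simps[OF k2(1) I(2)] bc_simps[OF k3(1) I(3)]
  note LD = S.linvD[OF L]
  note ls = bc_simps[OF l LD(1)]
  note [simp] = ls(1-5,7) LD(1) ks(3-5) ks(12-14) ks(21-23) overD(1-3)[OF g'(1)] overD(1-3)[OF h'(1)]
      overD(1-3)[OF s'(1)]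
    overD(1-3)[OF LD(3)] overD(1-3)[OF LD(4)] overD(1-3)[OF LD(5)]
  have eqL: "T.linv_eq A' B' D' e0' e1' L' g' h' s'"
    unfolding linv_eq_base_change[OF g'(1) h'(1) s'(1)] g'(2) h'(2) s'(2) S.linv_eq_def
  proof (intro allI impI)
    fix w y assume w: "w \<in> Arr C" "Cod C w = Dom C (f \<cdot> L')" and y: "over C ((f \<cdot> L') \<cdot> w) A y"
    have [simp]: "w \<in> Arr C" "Cod C w = Dom C L'" using w by simp_all
    have "over C (L \<cdot> (l \<cdot> w)) A y" using y by (simp add: reassoc[OF ls(6)])
    then show "e0 \<cdot> S.app A D ((s \<cdot> l) \<cdot> w) y = S.app B A ((g \<cdot> l) \<cdot> w) (S.app A B ((h \<cdot> l) \<cdot> w) y) \<and> e1 \<cdot> S.app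
        A D ((s \<cdot> l) \<cdot> w) y = y"
      using LD(6)[unfolded S.linv_eq_def, rule_format, of "l \<cdot> w" y] by simp
  qed
  show ?thesis
    unfolding T.linv_def
  proof (intro conjI allI impI)
    fix z g1 h1 s1 assume z [simp]: "z \<in> Fib C" "Cod C z = X'" and g1: "over C z (IHom K' B' A') g1" and h1:
        "over C z (IHom K' A' B') h1"
      and s1: "over C z (IHom K' A' D') s1" and eq: "T.linv_eq A' B' D' e0' e1' z g1 h1 s1"
    have "S.linv_eq A B D e0 e1 (f \<cdot> z) (\<kappa>1 \<cdot> g1) (\<kappa>2 \<cdot> h1) (\<kappa>3 \<cdot> s1)"
      using eq linv_eq_base_change[OF g1 h1 s1] by simp
    moreover have "over C (f \<cdot> z) (IHom K B A) (\<kappa>1 \<cdot> g1)" "over C (f \<cdot> z) (IHom K A B) (\<kappa>2 \<cdot> h1)"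
        "over C (f \<cdot> z) (IHom K A D) (\<kappa>3 \<cdot> s1)"
      using bc_push[OF k1(1) I(1) g1] bc_push[OF k2(1) I(2) h1] bc_push[OF k3(1) I(3) s1] by simp_all
    ultimately have "\<exists>x. over C (f \<cdot> z) L x \<and> g \<cdot> x = \<kappa>1 \<cdot> g1 \<and> h \<cdot> x = \<kappa>2 \<cdot> h1 \<and> s \<cdot> x = \<kappa>3 \<cdot> s1"
      by (intro LD(7)) simp_all
    then obtain x where x: "over C (f \<cdot> z) L x" "g \<cdot> x = \<kappa>1 \<cdot> g1" "h \<cdot> x = \<kappa>2 \<cdot> h1" "s \<cdot> x = \<kappa>3 \<cdot> s1"
      by blast
    obtain x' where x': "over C z L' x'" "l \<cdot> x' = x" by (rule bc_pull[OF l LD(1) x(1)]) simp_all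
    note [simp] = overD(1-3)[OF x'(1)]
    have "g' \<cdot> x' = g1"
      by (rule bc_uniq[OF k1(1) over_post[OF x'(1) g'(1)] g1]) (use I x x' in \<open>simp_all add: reassoc[OF g'(2)]\<close>)
    moreover have "h' \<cdot> x' = h1"
      by (rule bc_uniq[OF k2(1) over_post[OF x'(1) h'(1)] h1]) (use I x x' in \<open>simp_all add: reassoc[OF h'(2)]\<close>)
    moreover have "s' \<cdot> x' = s1"
      by (rule bc_uniq[OF k3(1) over_post[OF x'(1) s'(1)] s1]) (use I x x' in \<open>simp_all add: reassoc[OF s'(2)]\<close>)
    ultimately show "\<exists>x. over C z L' x \<and> g' \<cdot> x = g1 \<and> h' \<cdot> x = h1 \<and> s' \<cdot> x = s1" using x' by blast
  next
    fix z x y assume z [simp]: "z \<in> Fib C" "Cod C z = X'" and x: "over C z L' x" and y: "over C z L' y"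
      and e: "g' \<cdot> x = g' \<cdot> y" "h' \<cdot> x = h' \<cdot> y" "s' \<cdot> x = s' \<cdot> y"
    note [simp] = overD(1-3)[OF x] overD(1-3)[OF y]
    have "\<kappa>1 \<cdot> (g' \<cdot> x) = \<kappa>1 \<cdot> (g' \<cdot> y)" "\<kappa>2 \<cdot> (h' \<cdot> x) = \<kappa>2 \<cdot> (h' \<cdot> y)" "\<kappa>3 \<cdot> (s' \<cdot> x) = \<kappa>3 \<cdot> (s' \<cdot> y)"
      by (simp_all add: e)
    then have "g \<cdot> (l \<cdot> x) = g \<cdot> (l \<cdot> y)" "h \<cdot> (l \<cdot> x) = h \<cdot> (l \<cdot> y)" "s \<cdot> (l \<cdot> x) = s \<cdot> (l \<cdot> y)"
      by (simp_all add: reassoc[OF g'(2)] reassoc[OF h'(2)] reassoc[OF s'(2)])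
    then have "l \<cdot> x = l \<cdot> y"
      using LD(8)[of "f \<cdot> z" "l \<cdot> x" "l \<cdot> y"] bc_push[OF l LD(1) x] bc_push[OF l LD(1) y] by simp
    then show "x = y" by (rule bc_uniq[OF l x y])
  qed (use g' h' s' eqL in simp_all)
qed

end

end

text \<open>Exchanging \<open>A\<close> and \<open>B\<close> turns right inverses into left
  inverses, so base change need only be treated for the latter.\<close>

lemma is_RInv_iff: "is_RInv C K A B d u v \<longleftrightarrow> is_LInv C K B A d u v"
  by (simp add: is_RInv_def is_LInv_def)

context base_change
begin

text \<open>The pullback of a path object along the fibration \<open>f\<close> is again one: its
  endpoint map is a pullback of the old endpoint fibration, and its constant paths are a pullback of
  the old ones along the fibration \<open>dd\<close>.\<close>

lemma path_object_base_change:
  assumes a: "is_pullback C f A A' a" "A \<in> Fib C"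
    and P: "path_object (fslice C X) A (Pr1 K A A) (Pr2 K A A) r d"
  obtains r0 d0 D e0 e1 D' dd r0' d' e0' e1' where "r = (A, r0, D)" "d = (D, d0, A \<cdot> S.P1 A A)" "D \<in> Fib C"
    "Pr1 K A A \<cdot>\<^bsub>fslice C X\<^esub> d = (D, e0, A)" "Pr2 K A A \<cdot>\<^bsub>fslice C X\<^esub> d = (D, e1, A)"
    "over C D A e0" "over C D A e1" "is_pullback C f D D' dd" "over C D' A' e0'" "over C D' A' e1'"
    "a \<cdot> e0' = e0 \<cdot> dd" "a \<cdot> e1' = e1 \<cdot> dd"
    "path_object (fslice C X') A' (Pr1 K' A' A') (Pr2 K' A' A') (A', r0', D') (D', d', A' \<cdot> T.P1 A' A')"
    "Pr1 K' A' A' \<cdot>\<^bsub>fslice C X'\<^esub> (D', d', A' \<cdot> T.P1 A' A') = (D', e0', A')"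
    "Pr2 K' A' A' \<cdot>\<^bsub>fslice C X'\<^esub> (D', d', A' \<cdot> T.P1 A' A') = (D', e1', A')"
    "over C A' D' r0'" "dd \<cdot> r0' = r0 \<cdot> a" "over C A D r0"
proof -
  note as = bc_simps[OF a]
  note [simp] = as(1-5,7,8) a(2)
  note oA = a(2) as(7) and oA' = as(1,2)
  define p1 p2 where "p1 = S.P1 A A" and "p2 = S.P2 A A"
  note pr = S.Pr1_eq[OF oA oA, folded p1_def] S.Pr2_eq[OF oA oA, folded p1_def p2_def]
  obtain p1' p2' r0 d0 where p': "Pr1 K A A = (A \<cdot> p1', p1', A)" "Pr2 K A A = (A \<cdot> p1', p2', A)"
    "r = (A, r0, A \<cdot> (p1' \<cdot> d0))" "d = (A \<cdot> (p1' \<cdot> d0), d0, A \<cdot> p1')"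
    "is_pullback C A A p1' p2'"
    and r0 [simp]: "anodyne C r0" "Dom C r0 = Dom C A" "d0 \<in> Fib C" "Dom C d0 = Cod C r0" and
        "Cod C d0 = Dom C p1'"
    "p1' \<cdot> (d0 \<cdot> r0) = Idn C (Dom C A)" "p2' \<cdot> (d0 \<cdot> r0) = Idn C (Dom C A)"
    by (rule path_object_fsliceE[OF P])
  moreover have "p1' = p1" "p2' = p2" using p'(1,2) pr by simp_all
  ultimately have rd: "r = (A, r0, A \<cdot> (p1 \<cdot> d0))" "d = (A \<cdot> (p1 \<cdot> d0), d0, A \<cdot> p1)"
    and pb: "is_pullback C A A p1 p2" and c [simp]: "Cod C d0 = Dom C p1"
    and dr: "p1 \<cdot> (d0 \<cdot> r0) = Idn C (Dom C A)" "p2 \<cdot> (d0 \<cdot> r0) = Idn C (Dom C A)" by simp_all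
  note [simp] = pbD(4-8)[OF pb]
  have [simp]: "p1 \<in> Fib C" using fib_pb1[OF pb] by simp
  define D e0 e1 where "D = A \<cdot> (p1 \<cdot> d0)" and "e0 = p1 \<cdot> d0" and "e1 = p2 \<cdot> d0"
  have App: "A \<cdot> p1 = A \<cdot> p2" by (rule pbD(9)[OF pb])
  have D [simp]: "D \<in> Fib C" "Dom C D = Cod C r0" "Cod C D = X" by (simp_all add: D_def)
  have e: "over C D A e0" "over C D A e1"
    by (simp_all add: over_def D_def e0_def e1_def reassoc[OF App])
  note [simp] = overD(1-3)[OF e(1)] overD(1-3)[OF e(2)]
  have oDr: "over C A D r0" by (simp add: over_def) (simp add: D_def dr)
  obtain D' dd where dd: "is_pullback C f D D' dd" using pb_ex[of D f] by auto
  note ds = bc_simps[OF dd D(1)]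
  note [simp] = ds(1-5,8)
  obtain e0' where e0': "over C D' A' e0'" "a \<cdot> e0' = e0 \<cdot> dd" by (rule bc_post[OF dd D(1) a e(1)])
  obtain e1' where e1': "over C D' A' e1'" "a \<cdot> e1' = e1 \<cdot> dd" by (rule bc_post[OF dd D(1) a e(2)])
  obtain r0' where r0': "over C A' D' r0'" "dd \<cdot> r0' = r0 \<cdot> a" by (rule bc_post[OF a dd D(1) oDr])
  note [simp] = overD(1-3)[OF e0'(1)] overD(1-3)[OF e1'(1)] overD(1-3)[OF r0'(1)]
  define p1' p2' where "p1' = T.P1 A' A'" and "p2' = T.P2 A' A'"
  have pb': "is_pullback C A' A' p1' p2'" using T.pr_pb[OF oA' oA'] by (simp add: p1'_def p2'_def)
  note pr' = T.Pr1_eq[OF oA' oA', folded p1'_def] T.Pr2_eq[OF oA' oA', folded p1'_def p2'_def]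
  note [simp] = pbD(4-8)[OF pb']
  have [simp]: "p1' \<in> Fib C" using fib_pb1[OF pb'] by simp
  have App': "A' \<cdot> p1' = A' \<cdot> p2'" by (rule pbD(9)[OF pb'])
  have fA: "f \<cdot> A' = A \<cdot> a" by (rule as(6))
  obtain M where [simp]: "M \<in> Arr C" "Dom C M = Dom C p1'" "Cod C M = Dom C p1" and M: "p1 \<cdot> M = a \<cdot> p1'"
      "p2 \<cdot> M = a \<cdot> p2'"
    by (rule pb_lift[OF pb, of "a \<cdot> p1'" "a \<cdot> p2'"]) (simp_all add: reassoc[OF fA[symmetric]] App')
  have "is_pullback C (A \<cdot> a) A p1' (a \<cdot> p2')"
    using pb_paste[OF a(1) pb'] by (simp add: fA)
  \<comment> \<open>\<open>M\<close> maps pairs in a fibre of \<open>A'\<close> to pairs in a fibre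
    of \<open>A\<close>. This square and the next show that the square of \<open>A'\<close> is the
    pullback of the square of \<open>A\<close> along \<open>f\<close>, so pulled back paths have
    endpoints in it.\<close>
  then have "is_pullback C a p1 p1' M"
    by (rule pb_unpaste[OF pb]) (simp_all add: M)
  have pbM: "is_pullback C f (A \<cdot> p1) (A' \<cdot> p1') M"
    using pb_sym[OF pb_paste[OF pb_sym[OF a(1)] pb_sym[OF \<open>is_pullback C a p1 p1' M\<close>]]] .
  obtain d' where [simp]: "d' \<in> Arr C" "Dom C d' = Dom C D'" "Cod C d' = Dom C p1'" and d': "p1' \<cdot> d' = e0'"
      "p2' \<cdot> d' = e1'"
    by (rule pb_lift[OF pb', of e0' e1']) (simp_all add: overD(4)[OF e0'(1)] overD(4)[OF e1'(1)])
  have Md: "M \<cdot> d' = d0 \<cdot> dd"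
    by (rule pb_uniq[OF pb]) (simp_all add: reassoc[OF M(1)] reassoc[OF M(2)] d' e0' e1' e0_def e1_def)
  have dd2: "is_pullback C f ((A \<cdot> p1) \<cdot> d0) D' dd" using dd by (simp add: D_def)
  have "is_pullback C M d0 d' dd"
    by (rule bc_cmp_section[OF pbM dd2]) (simp_all add: d' overD(4)[OF e0'(1)] Md)
  then have d'f [simp]: "d' \<in> Fib C" using fib_pb1 by simp
  have Dr0: "D \<cdot> r0 = A" using overD(4)[OF oDr] .
  have "is_pullback C f (D \<cdot> r0) A' a" using a(1) by (simp add: Dr0)
  then have "is_pullback C dd r0 r0' a"
    by (rule bc_cmp_section[OF dd]) (simp_all add: overD(4)[OF r0'(1)] r0'(2))
  then have ar' [simp]: "anodyne C r0'" using anodyne_stable[of r0 dd r0' a] by simp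
  have oid: "over C A' A' (Idn C (Dom C A'))" by (simp add: over_def)
  have drx: "p1 \<cdot> (d0 \<cdot> (r0 \<cdot> a)) = a" "p2 \<cdot> (d0 \<cdot> (r0 \<cdot> a)) = a"
    using reassoc[OF dr(1), of a] reassoc[OF dr(2), of a] by simp_all
  have e0r: "e0' \<cdot> r0' = Idn C (Dom C A')"
    by (rule bc_uniq[OF a(1) over_post[OF r0'(1) e0'(1)] oid])
      (simp_all add: reassoc[OF e0'(2)] r0'(2), simp_all add: e0_def drx)
  have e1r: "e1' \<cdot> r0' = Idn C (Dom C A')"
    by (rule bc_uniq[OF a(1) over_post[OF r0'(1) e1'(1)] oid])
      (simp_all add: reassoc[OF e1'(2)] r0'(2), simp_all add: e1_def drx)
  have D'eq: "A' \<cdot> (p1' \<cdot> d') = D'" by (simp add: d' overD(4)[OF e0'(1)])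
  have "path_object (fslice C X') A' (A' \<cdot> p1', p1', A') (A' \<cdot> p1', p2', A') (A', r0', A' \<cdot> (p1' \<cdot> d')) (A' \<cdot>
      (p1' \<cdot> d'), d', A' \<cdot> p1')"
    by (rule path_object_fslice[OF pb']) (simp_all add: reassoc[OF d'(1)] reassoc[OF d'(2)] e0r e1r)
  then have PO: "path_object (fslice C X') A' (Pr1 K' A' A') (Pr2 K' A' A') (A', r0', D') (D', d', A' \<cdot> p1')"
    by (simp add: pr' D'eq)
  show thesis
    by (rule that[of r0 D d0 e0 e1 D' dd e0' e1' r0' d'])
      (use rd e dd e0' e1' r0' PO oDr d' in \<open>simp_all add: D_def[symmetric] p1_def[symmetric] p1'_def[symmetric]
          pr pr' e0_def e1_def\<close>)
qed

text \<open>\<open>x'\<close> is the base change of \<open>x\<close> up to the canonical isomorphism of internal homs.\<close>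

definition transfers where
  "transfers A A' a D D' dd E E' \<eta> x x' \<longleftrightarrow> (\<exists>\<kappa>. is_pullback C f (IHom K A D) (IHom K' A' D') \<kappa> \<and>
     (\<forall>v x y. over C v (IHom K' A' D') x \<longrightarrow> over C v A' y \<longrightarrow> dd \<cdot> T.app A' D' x y = S.app A D (\<kappa> \<cdot> x) (a \<cdot> y)) \<and>
     over C E (IHom K A D) x \<and> over C E' (IHom K' A' D') x' \<and> \<kappa> \<cdot> x' = x \<cdot> \<eta>)"

text \<open>The equations that determine \<open>\<delta>\<close> hold at the diagonal, a stage that
  need not be fibrant, so they cannot be abstracted. The new equation is checked after
  \<open>dd\<close>, where evaluation over \<open>X'\<close> becomes evaluation over
  \<open>X\<close> and the old equation applies; equality in \<open>D'\<close> is detected by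
  \<open>dd\<close> together with the base.\<close>

lemma uncurry_transfer:
  assumes tr: "transfers A A' a D D' dd E E' \<eta> x x'"
    and a: "is_pullback C f A A' a" "A \<in> Fib C" and d: "is_pullback C f D D' dd" "D \<in> Fib C"
    and E: "is_pullback C f E E' \<eta>" "E \<in> Fib C"
    and \<delta>: "over C m E \<delta>" "over C m' E' \<delta>'" "\<eta> \<cdot> \<delta>' = \<delta> \<cdot> g"
    and g: "g \<in> Arr C" "Cod C g = Dom C m" "Dom C g = Dom C m'"
    and p: "p \<in> Arr C" "Cod C p = Dom C m" "q \<in> Arr C" "Cod C q = Dom C m'" "t \<in> Arr C" "Dom C t = Dom C q"
        "Cod C t = Dom C p"
      "g \<cdot> q = p \<cdot> t"
    and e: "over C (m \<cdot> p) A e" "over C (m' \<cdot> q) A' e'" "a \<cdot> e' = e \<cdot> t"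
    and y: "S.app A D ((x \<cdot> \<delta>) \<cdot> p) e = y" "over C (m' \<cdot> q) D' y'" "dd \<cdot> y' = y \<cdot> t"
  shows "T.app A' D' ((x' \<cdot> \<delta>') \<cdot> q) e' = y'"
proof -
  note as = bc_simps[OF a] and ds = bc_simps[OF d] and Es = bc_simps[OF E]
  obtain \<kappa> where \<kappa>: "is_pullback C f (IHom K A D) (IHom K' A' D') \<kappa>"
    and ap: "\<And>v x y. \<lbrakk>over C v (IHom K' A' D') x; over C v A' y\<rbrakk> \<Longrightarrow> dd \<cdot> T.app A' D' x y = S.app A D (\<kappa> \<cdot> x) (a \<cdot>
        y)"
    and x: "over C E (IHom K A D) x" "over C E' (IHom K' A' D') x'" "\<kappa> \<cdot> x' = x \<cdot> \<eta>"
    using tr unfolding transfers_def by blast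
  have I: "IHom K A D \<in> Fib C" "IHom K' A' D' \<in> Fib C" using S.IHom_ob[OF a(2) as(7) d(2) ds(7)] T.IHom_ob[OF
      as(1,2) ds(1,2)] by simp_all
  note ks = bc_simps[OF \<kappa> I(1)]
  have [simp]: "m \<in> Arr C" using arr_cmp[of \<delta> E] overD[OF \<delta>(1)] E(2) by simp
  have [simp]: "m' \<in> Arr C" using arr_cmp[of \<delta>' E'] overD[OF \<delta>(2)] Es by simp
  note [simp] = as(3-5) ds(3-5) Es(3-5) ks(3-5) overD(1-3)[OF \<delta>(1)] overD(1-3)[OF \<delta>(2)] overD(1-3)[OF x(1)]
      overD(1-3)[OF x(2)]
    g p(1-7) overD(1-3)[OF e(1)] overD(1-3)[OF e(2)]
  have ox: "over C (m' \<cdot> q) (IHom K' A' D') ((x' \<cdot> \<delta>') \<cdot> q)"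
    by (rule over_cmp[OF over_post[OF \<delta>(2) x(2)]]) (use I in simp_all)
  have ox1: "over C (m \<cdot> p) (IHom K A D) ((x \<cdot> \<delta>) \<cdot> p)"
    by (rule over_cmp[OF over_post[OF \<delta>(1) x(1)]]) (use I in simp_all)
  have "\<kappa> \<cdot> ((x' \<cdot> \<delta>') \<cdot> q) = ((x \<cdot> \<delta>) \<cdot> p) \<cdot> t"
    by (simp add: reassoc[OF x(3)] reassoc[OF \<delta>(3)] p(8))
  then have "dd \<cdot> T.app A' D' ((x' \<cdot> \<delta>') \<cdot> q) e' = S.app A D (((x \<cdot> \<delta>) \<cdot> p) \<cdot> t) (e \<cdot> t)"
    using ap[OF ox e(2)] e(3) by simp
  also have "\<dots> = y \<cdot> t"
    unfolding y(1)[symmetric]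
    by (rule S.app_over_cmp[OF a(2) as(7) d(2) ds(7) ox1 e(1), symmetric]) simp_all
  finally have "dd \<cdot> T.app A' D' ((x' \<cdot> \<delta>') \<cdot> q) e' = dd \<cdot> y'" using y(3) by simp
  then show ?thesis
    by (rule bc_uniq[OF d(1) T.app_over[OF as(1,2) ds(1,2) ox e(2)] y(2)])
qed

text \<open>Every ingredient of the object of equivalences is characterised by a universal property
  over \<open>X\<close>, and each is carried to \<open>X'\<close>. Besides the pullback square with
  \<open>\<eta>\<close>, the conclusion records how the projections of \<open>Eq\<close> and the
  constant paths correspond, since these determine \<open>\<delta>\<close>.\<close>

lemma Eq_base_change:
  assumes a: "is_pullback C f A A' a" "A \<in> Fib C" and b: "is_pullback C f B B' b" "B \<in> Fib C"
    and Q: "is_Eq (fslice C X) K A B Q"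
  obtains Q' E E' \<eta> da db where "is_Eq (fslice C X') K' A' B' Q'" "E \<in> Fib C" "fst (eql Q) = E"
      "fst (eql Q') = E'"
    "is_pullback C f E E' \<eta>"
    "transfers A A' a B B' b E E' \<eta>
      (und (Pr2 K (IHom K B A) (IHom K A B) \<cdot>\<^bsub>fslice C X\<^esub> lu Q \<cdot>\<^bsub>fslice C X\<^esub> eql Q))
      (und (Pr2 K' (IHom K' B' A') (IHom K' A' B') \<cdot>\<^bsub>fslice C X'\<^esub> lu Q' \<cdot>\<^bsub>fslice C X'\<^esub> eql Q'))"
    "transfers B B' b A A' a E E' \<eta>
      (und (Pr1 K (IHom K B A) (IHom K A B) \<cdot>\<^bsub>fslice C X\<^esub> lu Q \<cdot>\<^bsub>fslice C X\<^esub> eql Q))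
      (und (Pr1 K' (IHom K' B' A') (IHom K' A' B') \<cdot>\<^bsub>fslice C X'\<^esub> lu Q' \<cdot>\<^bsub>fslice C X'\<^esub> eql Q'))"
    "transfers B B' b A A' a E E' \<eta>
      (und (Pr2 K (IHom K A B) (IHom K B A) \<cdot>\<^bsub>fslice C X\<^esub> ru Q \<cdot>\<^bsub>fslice C X\<^esub> eqr Q))
      (und (Pr2 K' (IHom K' A' B') (IHom K' B' A') \<cdot>\<^bsub>fslice C X'\<^esub> ru Q' \<cdot>\<^bsub>fslice C X'\<^esub> eqr Q'))"
    "transfers A A' a (fst (dA Q)) (fst (dA Q')) da E E' \<eta>
      (und (lv Q \<cdot>\<^bsub>fslice C X\<^esub> eql Q)) (und (lv Q' \<cdot>\<^bsub>fslice C X'\<^esub> eql Q'))"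
    "transfers B B' b (fst (dB Q)) (fst (dB Q')) db E E' \<eta>
      (und (rv Q \<cdot>\<^bsub>fslice C X\<^esub> eqr Q)) (und (rv Q' \<cdot>\<^bsub>fslice C X'\<^esub> eqr Q'))"
    "fst (dA Q) \<in> Fib C" "is_pullback C f (fst (dA Q)) (fst (dA Q')) da" "over C A (fst (dA Q)) (und (rA Q))"
    "over C A' (fst (dA Q')) (und (rA Q'))" "da \<cdot> und (rA Q') = und (rA Q) \<cdot> a"
    "fst (dB Q) \<in> Fib C" "is_pullback C f (fst (dB Q)) (fst (dB Q')) db" "over C B (fst (dB Q)) (und (rB Q))"
    "over C B' (fst (dB Q')) (und (rB Q'))" "db \<cdot> und (rB Q') = und (rB Q) \<cdot> b"
proof -
  note as = bc_simps[OF a] and bs = bc_simps[OF b]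
  note oA = a(2) as(7) and oA' = as(1,2) and oB = b(2) bs(7) and oB' = bs(1,2)
  have PA: "path_object (fslice C X) A (Pr1 K A A) (Pr2 K A A) (rA Q) (dA Q)"
    and PB: "path_object (fslice C X) B (Pr1 K B B) (Pr2 K B B) (rB Q) (dB Q)"
    and LI: "is_LInv (fslice C X) K A B (dA Q) (lu Q) (lv Q)"
    and RI: "is_LInv (fslice C X) K B A (dB Q) (ru Q) (rv Q)"
    and PQ: "is_pullback (fslice C X) (Pr2 K (IHom K B A) (IHom K A B) \<cdot>\<^bsub>fslice C X\<^esub> lu Q)
       (Pr1 K (IHom K A B) (IHom K B A) \<cdot>\<^bsub>fslice C X\<^esub> ru Q) (eql Q) (eqr Q)"
    using Q unfolding is_Eq_def is_RInv_iff by blast+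
  obtain rA0 dA0 DA a0 a1 DA' da rA0' dA0' a0' a1' where rdA: "rA Q = (A, rA0, DA)"
      "dA Q = (DA, dA0, A \<cdot> S.P1 A A)"
    and DA: "DA \<in> Fib C" and prA: "Pr1 K A A \<cdot>\<^bsub>fslice C X\<^esub> dA Q = (DA, a0, A)"
        "Pr2 K A A \<cdot>\<^bsub>fslice C X\<^esub> dA Q = (DA, a1, A)"
    and oa: "over C DA A a0" "over C DA A a1" and da: "is_pullback C f DA DA' da" and oa': "over C DA' A' a0'"
        "over C DA' A' a1'"
    and ea: "a \<cdot> a0' = a0 \<cdot> da" "a \<cdot> a1' = a1 \<cdot> da"
    and PA': "path_object (fslice C X') A' (Pr1 K' A' A') (Pr2 K' A' A') (A', rA0', DA') (DA', dA0', A' \<cdot> T.P1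
        A' A')"
    and prA': "Pr1 K' A' A' \<cdot>\<^bsub>fslice C X'\<^esub> (DA', dA0', A' \<cdot> T.P1 A' A') = (DA', a0', A')"
    "Pr2 K' A' A' \<cdot>\<^bsub>fslice C X'\<^esub> (DA', dA0', A' \<cdot> T.P1 A' A') = (DA', a1', A')"
    and orA: "over C A' DA' rA0'" "da \<cdot> rA0' = rA0 \<cdot> a" "over C A DA rA0"
    by (rule path_object_base_change[OF a PA])
  obtain rB0 dB0 DB b0 b1 DB' db rB0' dB0' b0' b1' where rdB: "rB Q = (B, rB0, DB)"
      "dB Q = (DB, dB0, B \<cdot> S.P1 B B)"
    and DB: "DB \<in> Fib C" and prB: "Pr1 K B B \<cdot>\<^bsub>fslice C X\<^esub> dB Q = (DB, b0, B)"
        "Pr2 K B B \<cdot>\<^bsub>fslice C X\<^esub> dB Q = (DB, b1, B)"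
    and ob: "over C DB B b0" "over C DB B b1" and db: "is_pullback C f DB DB' db" and ob': "over C DB' B' b0'"
        "over C DB' B' b1'"
    and eb: "b \<cdot> b0' = b0 \<cdot> db" "b \<cdot> b1' = b1 \<cdot> db"
    and PB': "path_object (fslice C X') B' (Pr1 K' B' B') (Pr2 K' B' B') (B', rB0', DB') (DB', dB0', B' \<cdot> T.P1
        B' B')"
    and prB': "Pr1 K' B' B' \<cdot>\<^bsub>fslice C X'\<^esub> (DB', dB0', B' \<cdot> T.P1 B' B') = (DB', b0', B')"
    "Pr2 K' B' B' \<cdot>\<^bsub>fslice C X'\<^esub> (DB', dB0', B' \<cdot> T.P1 B' B') = (DB', b1', B')"
    and orB: "over C B' DB' rB0'" "db \<cdot> rB0' = rB0 \<cdot> b" "over C B DB rB0"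
    by (rule path_object_base_change[OF b PB])
  note oDA = DA bc_simps(7)[OF da DA] and oDA' = bc_simps(1,2)[OF da DA]
  note oDB = DB bc_simps(7)[OF db DB] and oDB' = bc_simps(1,2)[OF db DB]
  define H12 H21 SA SB where "H12 = IHom K A B" and "H21 = IHom K B A" and "SA = IHom K A DA" and
      "SB = IHom K B DB"
  define H12' H21' SA' SB' where "H12' = IHom K' A' B'" and "H21' = IHom K' B' A'" and "SA' = IHom K' A' DA'"
      and "SB' = IHom K' B' DB'"
  note fold = H12_def[symmetric] H21_def[symmetric] SA_def[symmetric] SB_def[symmetric]
  note fold' = H12'_def[symmetric] H21'_def[symmetric] SA'_def[symmetric] SB'_def[symmetric]
  have o12: "H12 \<in> Fib C" "Cod C H12 = X" and o21: "H21 \<in> Fib C" "Cod C H21 = X" and oSA: "SA \<in> Fib C" and oSB: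
      "SB \<in> Fib C"
    using S.IHom_ob[OF oA oB] S.IHom_ob[OF oB oA] S.IHom_ob[OF oA oDA] S.IHom_ob[OF oB oDB] by (simp_all add:
        fold)
  have o12': "H12' \<in> Fib C" "Cod C H12' = X'" and o21': "H21' \<in> Fib C" "Cod C H21' = X'" and oSA': "SA' \<in> Fib C"
      and oSB': "SB' \<in> Fib C"
    using T.IHom_ob[OF oA' oB'] T.IHom_ob[OF oB' oA'] T.IHom_ob[OF oA' oDA'] T.IHom_ob[OF oB' oDB'] by (simp_all
        add: fold')
  obtain k12 where k12: "is_pullback C f H12 H12' k12"
    "\<And>v x y. \<lbrakk>over C v H12' x; over C v A' y\<rbrakk> \<Longrightarrow> b \<cdot> T.app A' B' x y = S.app A B (k12 \<cdot> x) (a \<cdot> y)"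
    by (rule IHom_base_change[OF a b, unfolded fold fold']) blast
  obtain k21 where k21: "is_pullback C f H21 H21' k21"
    "\<And>v x y. \<lbrakk>over C v H21' x; over C v B' y\<rbrakk> \<Longrightarrow> a \<cdot> T.app B' A' x y = S.app B A (k21 \<cdot> x) (b \<cdot> y)"
    by (rule IHom_base_change[OF b a, unfolded fold fold']) blast
  obtain kA where kA: "is_pullback C f SA SA' kA"
    "\<And>v x y. \<lbrakk>over C v SA' x; over C v A' y\<rbrakk> \<Longrightarrow> da \<cdot> T.app A' DA' x y = S.app A DA (kA \<cdot> x) (a \<cdot> y)"
    by (rule IHom_base_change[OF a da DA, unfolded fold fold']) blast
  obtain kB where kB: "is_pullback C f SB SB' kB"
    "\<And>v x y. \<lbrakk>over C v SB' x; over C v B' y\<rbrakk> \<Longrightarrow> db \<cdot> T.app B' DB' x y = S.app B DB (kB \<cdot> x) (b \<cdot> y)"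
    by (rule IHom_base_change[OF b db DB, unfolded fold fold']) blast
  define PL PR PL' PR' where "PL = H21 \<cdot> S.P1 H21 H12" and "PR = H12 \<cdot> S.P1 H12 H21"
    and "PL' = H21' \<cdot> T.P1 H21' H12'" and "PR' = H12' \<cdot> T.P1 H12' H21'"
  obtain L u0 sL where lu: "lu Q = (L, u0, PL)" and lv: "lv Q = (L, sL, SA)" and ou: "over C L PL u0"
    and linvL: "S.linv A B DA a0 a1 L (S.P1 H21 H12 \<cdot> u0) (S.P2 H21 H12 \<cdot> u0) sL"
    by (rule S.LInvE[OF oA oB oDA prA oa refl LI, unfolded fold PL_def[symmetric]])
  obtain R w0 sR where ru: "ru Q = (R, w0, PR)" and rv: "rv Q = (R, sR, SB)" and ow: "over C R PR w0"
    and linvR: "S.linv B A DB b0 b1 R (S.P1 H12 H21 \<cdot> w0) (S.P2 H12 H21 \<cdot> w0) sR"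
    by (rule S.LInvE[OF oB oA oDB prB ob refl RI, unfolded fold PR_def[symmetric]])
  define gL hL gR hR where "gL = S.P1 H21 H12 \<cdot> u0" and "hL = S.P2 H21 H12 \<cdot> u0" and "gR = S.P1 H12 H21 \<cdot> w0"
      and "hR = S.P2 H12 H21 \<cdot> w0"
  note linvL = linvL[folded gL_def hL_def] and linvR = linvR[folded gR_def hR_def]
  note LD = S.linvD[OF linvL, unfolded fold] and RD = S.linvD[OF linvR, unfolded fold]
  note pr = S.Pr1_eq[OF o21 o12, folded PL_def] S.Pr2_eq[OF o21 o12, folded PL_def] S.Pr1_eq[OF o12 o21, folded
      PR_def] S.Pr2_eq[OF o12 o21, folded PR_def]
  note pr' = T.Pr1_eq[OF o21' o12', folded PL'_def] T.Pr2_eq[OF o21' o12', folded PL'_def] T.Pr1_eq[OF o12'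
      o21', folded PR'_def] T.Pr2_eq[OF o12' o21', folded PR'_def]
  have lu2: "Pr2 K H21 H12 \<cdot>\<^bsub>fslice C X\<^esub> lu Q = (L, hL, H12)" "Pr1 K H21 H12 \<cdot>\<^bsub>fslice C X\<^esub> lu Q = (L, gL, H21)"
    "Pr1 K H12 H21 \<cdot>\<^bsub>fslice C X\<^esub> ru Q = (R, gR, H12)" "Pr2 K H12 H21 \<cdot>\<^bsub>fslice C X\<^esub> ru Q = (R, hR, H21)"
    by (simp_all add: lu ru pr gL_def hL_def gR_def hR_def)
  note PQ = PQ[unfolded fold lu2]
  obtain E el er where eq: "eql Q = (E, el, L)" "eqr Q = (E, er, R)" and E: "E \<in> Fib C" "Cod C E = X"
    and el: "el \<in> Arr C" "Dom C el = Dom C E" "Cod C el = Dom C L" "L \<cdot> el = E"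
    and er: "er \<in> Arr C" "Dom C er = Dom C E" "Cod C er = Dom C R" "R \<cdot> er = E" and hg: "hL \<cdot> el = gR \<cdot> er"
    and Eex: "\<And>Z x' y'. \<lbrakk>Z \<in> Fib C; Cod C Z = X; x' \<in> Arr C; Dom C x' = Dom C Z; Cod C x' = Dom C L; L \<cdot> x' = Z;
       y' \<in> Arr C; Dom C y' = Dom C Z; Cod C y' = Dom C R; R \<cdot> y' = Z; hL \<cdot> x' = gR \<cdot> y'\<rbrakk>
      \<Longrightarrow> \<exists>h. h \<in> Arr C \<and> Dom C h = Dom C Z \<and> Cod C h = Dom C E \<and> E \<cdot> h = Z \<and> el \<cdot> h = x' \<and> er \<cdot> h = y'"
    and Eun: "\<And>Z h k. \<lbrakk>Z \<in> Fib C; Cod C Z = X; h \<in> Arr C; Dom C h = Dom C Z; Cod C h = Dom C E; E \<cdot> h = Z;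
       k \<in> Arr C; Dom C k = Dom C Z; Cod C k = Dom C E; E \<cdot> k = Z; el \<cdot> h = el \<cdot> k; er \<cdot> h = er \<cdot> k\<rbrakk> \<Longrightarrow> h = k"
    by (rule fslice_pbE[OF PQ]) blast
  have oel: "over C E L el" and oer: "over C E R er" using el er by (simp_all add: over_def)
  \<comment> \<open>The objects of left inverses, of right inverses and of equivalences over
    \<open>X'\<close> are taken to be the pullbacks of those over \<open>X\<close>; their
    projections are pulled back along with them.\<close>
  obtain L' l where l: "is_pullback C f L L' l" using pb_ex[of L f] LD(1,2) by auto
  obtain R' \<rho> where \<rho>: "is_pullback C f R R' \<rho>" using pb_ex[of R f] RD(1,2) by auto
  obtain E' \<eta> where \<eta>: "is_pullback C f E E' \<eta>" using pb_ex[of E f] E by auto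
  note ls = bc_simps[OF l LD(1)] and \<rho>s = bc_simps[OF \<rho> RD(1)] and \<eta>s = bc_simps[OF \<eta> E(1)]
  obtain gL' where gL': "over C L' H21' gL'" "k21 \<cdot> gL' = gL \<cdot> l" by (rule bc_post[OF l LD(1) k21(1) o21(1)
      LD(3)])
  obtain hL' where hL': "over C L' H12' hL'" "k12 \<cdot> hL' = hL \<cdot> l" by (rule bc_post[OF l LD(1) k12(1) o12(1)
      LD(4)])
  obtain sL' where sL': "over C L' SA' sL'" "kA \<cdot> sL' = sL \<cdot> l" by (rule bc_post[OF l LD(1) kA(1) oSA LD(5)])
  obtain gR' where gR': "over C R' H12' gR'" "k12 \<cdot> gR' = gR \<cdot> \<rho>" by (rule bc_post[OF \<rho> RD(1) k12(1) o12(1)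
      RD(3)])
  obtain hR' where hR': "over C R' H21' hR'" "k21 \<cdot> hR' = hR \<cdot> \<rho>" by (rule bc_post[OF \<rho> RD(1) k21(1) o21(1)
      RD(4)])
  obtain sR' where sR': "over C R' SB' sR'" "kB \<cdot> sR' = sR \<cdot> \<rho>" by (rule bc_post[OF \<rho> RD(1) kB(1) oSB RD(5)])
  obtain el' where el': "over C E' L' el'" "l \<cdot> el' = el \<cdot> \<eta>" by (rule bc_post[OF \<eta> E(1) l LD(1) oel])
  obtain er' where er': "over C E' R' er'" "\<rho> \<cdot> er' = er \<cdot> \<eta>" by (rule bc_post[OF \<eta> E(1) \<rho> RD(1) oer])
  have linvL': "T.linv A' B' DA' a0' a1' L' gL' hL' sL'"
    by (rule linv_base_change[OF a b da DA oa oa' ea, unfolded fold fold', OF k21 k12 kA linvL l gL' hL' sL'])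
  have linvR': "T.linv B' A' DB' b0' b1' R' gR' hR' sR'"
    by (rule linv_base_change[OF b a db DB ob ob' eb, unfolded fold fold', OF k12 k21 kB linvR \<rho> gR' hR' sR'])
  define tL tR where "tL = tuple C (T.P1 H21' H12') (T.P2 H21' H12') gL' hL'" and
      "tR = tuple C (T.P1 H12' H21') (T.P2 H12' H21') gR' hR'"
  have LI': "is_LInv (fslice C X') K' A' B' (DA', dA0', A' \<cdot> T.P1 A' A') (L', tL, PL') (L', sL', SA')"
    using T.LInvI[OF oA' oB' oDA' prA' oa' refl linvL'] by (simp only: fold' PL'_def tL_def)
  have RI': "is_LInv (fslice C X') K' B' A' (DB', dB0', B' \<cdot> T.P1 B' B') (R', tR, PR') (R', sR', SB')"
    using T.LInvI[OF oB' oA' oDB' prB' ob' refl linvR'] by (simp only: fold' PR'_def tR_def)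
  have lu2': "Pr2 K' H21' H12' \<cdot>\<^bsub>fslice C X'\<^esub> (L', tL, PL') = (L', hL', H12')"
      "Pr1 K' H21' H12' \<cdot>\<^bsub>fslice C X'\<^esub> (L', tL, PL') = (L', gL', H21')"
    "Pr1 K' H12' H21' \<cdot>\<^bsub>fslice C X'\<^esub> (R', tR, PR') = (R', gR', H12')"
        "Pr2 K' H12' H21' \<cdot>\<^bsub>fslice C X'\<^esub> (R', tR, PR') = (R', hR', H21')"
    using T.over_tuple[OF o21' o12' gL'(1) hL'(1)] T.over_tuple[OF o12' o21' gR'(1) hR'(1)]
    by (simp_all add: pr' tL_def tR_def)
  note [simp] = ls(3-5) \<rho>s(3-5) \<eta>s(3-5) overD(1-3)[OF gL'(1)] overD(1-3)[OF hL'(1)] overD(1-3)[OF sL'(1)]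
    overD(1-3)[OF gR'(1)] overD(1-3)[OF hR'(1)] overD(1-3)[OF sR'(1)] overD(1-3)[OF el'(1)] overD(1-3)[OF
        er'(1)]
    overD(1-3)[OF LD(3)] overD(1-3)[OF LD(4)] overD(1-3)[OF LD(5)] overD(1-3)[OF RD(3)] overD(1-3)[OF RD(4)]
        overD(1-3)[OF RD(5)]
    el(1-3) er(1-3) bc_simps(3-5)[OF k12(1) o12(1)] bc_simps(3-5)[OF k21(1) o21(1)] bc_simps(3-5)[OF kA(1) oSA]
        bc_simps(3-5)[OF kB(1) oSB]
  \<comment> \<open>The square over \<open>X\<close> is a pullback for fibrant test objects only. A
    test object \<open>Z\<close> over \<open>X'\<close> is therefore pushed forward to
    \<open>f \<cdot> Z\<close>, and the induced map is lifted to \<open>E'\<close>.\<close>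
  have PQ': "is_pullback (fslice C X') (L', hL', H12') (R', gR', H12') (E', el', L') (E', er', R')"
  proof (rule fslice_pbI[OF ls(1) \<rho>s(1) o12'(1) ls(2) \<rho>s(2) o12'(2) overD[OF hL'(1)] overD[OF gR'(1)] \<eta>s(1,2)
      overD[OF el'(1)] overD[OF er'(1)]])
    have *: "over C E' H12' (hL' \<cdot> el')" "over C E' H12' (gR' \<cdot> er')"
      using over_post[OF el'(1) hL'(1)] over_post[OF er'(1) gR'(1)] o12' by simp_all
    show "hL' \<cdot> el' = gR' \<cdot> er'"
      by (rule bc_uniq[OF k12(1) *]) (simp add: reassoc[OF hL'(2)] reassoc[OF gR'(2)] el'(2) er'(2) reassoc[OF
          hg])
  next
    fix Z x y assume Z: "Z \<in> Fib C" "Cod C Z = X'" and "x \<in> Arr C" "Dom C x = Dom C Z" "Cod C x = Dom C L'"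
        "L' \<cdot> x = Z"
       "y \<in> Arr C" "Dom C y = Dom C Z" "Cod C y = Dom C R'" "R' \<cdot> y = Z" and hgxy: "hL' \<cdot> x = gR' \<cdot> y"
    then have x: "over C Z L' x" and y: "over C Z R' y" by (simp_all add: over_def)
    note [simp] = overD(1-3)[OF x] overD(1-3)[OF y] Z
    have "k12 \<cdot> (hL' \<cdot> x) = k12 \<cdot> (gR' \<cdot> y)" by (simp add: hgxy)
    then have "hL \<cdot> (l \<cdot> x) = gR \<cdot> (\<rho> \<cdot> y)" by (simp add: reassoc[OF hL'(2)] reassoc[OF gR'(2)])
    moreover have lx: "over C (f \<cdot> Z) L (l \<cdot> x)" and ry: "over C (f \<cdot> Z) R (\<rho> \<cdot> y)"
      using bc_push[OF l LD(1) x] bc_push[OF \<rho> RD(1) y] .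
    ultimately have "\<exists>h. h \<in> Arr C \<and> Dom C h = Dom C (f \<cdot> Z) \<and> Cod C h = Dom C E \<and> E \<cdot> h = f \<cdot> Z \<and> el \<cdot> h = l \<cdot>
        x \<and> er \<cdot> h = \<rho> \<cdot> y"
      using overD[OF lx] overD[OF ry] by (intro Eex) simp_all
    then obtain h where h: "over C (f \<cdot> Z) E h" "el \<cdot> h = l \<cdot> x" "er \<cdot> h = \<rho> \<cdot> y" by (auto simp: over_def)
    obtain h' where h': "over C Z E' h'" "\<eta> \<cdot> h' = h" by (rule bc_pull[OF \<eta> E(1) h(1)]) simp_all
    note [simp] = overD(1-3)[OF h'(1)]
    have "el' \<cdot> h' = x"
      by (rule bc_uniq[OF l over_post[OF h'(1) el'(1)] x]) (use ls(1) h h' in \<open>simp_all add: reassoc[OF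
          el'(2)]\<close>)
    moreover have "er' \<cdot> h' = y"
      by (rule bc_uniq[OF \<rho> over_post[OF h'(1) er'(1)] y]) (use \<rho>s(1) h h' in \<open>simp_all add: reassoc[OF
          er'(2)]\<close>)
    ultimately show "\<exists>h. h \<in> Arr C \<and> Dom C h = Dom C Z \<and> Cod C h = Dom C E' \<and> E' \<cdot> h = Z \<and> el' \<cdot> h = x \<and> er' \<cdot> h
        = y"
      using overD[OF h'(1)] by blast
  next
    fix Z h k assume Z: "Z \<in> Fib C" "Cod C Z = X'" and "h \<in> Arr C" "Dom C h = Dom C Z" "Cod C h = Dom C E'"
        "E' \<cdot> h = Z"
       "k \<in> Arr C" "Dom C k = Dom C Z" "Cod C k = Dom C E'" "E' \<cdot> k = Z" and e: "el' \<cdot> h = el' \<cdot> k"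
           "er' \<cdot> h = er' \<cdot> k"
    then have h: "over C Z E' h" and k: "over C Z E' k" by (simp_all add: over_def)
    note [simp] = overD(1-3)[OF h] overD(1-3)[OF k] Z
    have "l \<cdot> (el' \<cdot> h) = l \<cdot> (el' \<cdot> k)" "\<rho> \<cdot> (er' \<cdot> h) = \<rho> \<cdot> (er' \<cdot> k)" by (simp_all add: e)
    then have "el \<cdot> (\<eta> \<cdot> h) = el \<cdot> (\<eta> \<cdot> k)" "er \<cdot> (\<eta> \<cdot> h) = er \<cdot> (\<eta> \<cdot> k)"
      by (simp_all add: reassoc[OF el'(2)] reassoc[OF er'(2)])
    then have "\<eta> \<cdot> h = \<eta> \<cdot> k"
      using overD[OF bc_push[OF \<eta> E(1) h]] overD[OF bc_push[OF \<eta> E(1) k]] by - (rule Eun[of "f \<cdot> Z"], simp_all)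
    then show "h = k" by (rule bc_uniq[OF \<eta> h k])
  qed
  define Q' where "Q' = \<lparr>rA = (A', rA0', DA'), dA = (DA', dA0', A' \<cdot> T.P1 A' A'), rB = (B', rB0', DB'), dB =
      (DB', dB0', B' \<cdot> T.P1 B' B'),
    lu = (L', tL, PL'), lv = (L', sL', SA'), ru = (R', tR, PR'), rv = (R', sR', SB'), eql = (E', el', L'), eqr =
        (E', er', R')\<rparr>"
  have Qs: "rA Q' = (A', rA0', DA')" "dA Q' = (DA', dA0', A' \<cdot> T.P1 A' A')" "rB Q' = (B', rB0', DB')"
      "dB Q' = (DB', dB0', B' \<cdot> T.P1 B' B')"
    "lu Q' = (L', tL, PL')" "lv Q' = (L', sL', SA')" "ru Q' = (R', tR, PR')" "rv Q' = (R', sR', SB')"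
        "eql Q' = (E', el', L')" "eqr Q' = (E', er', R')"
    by (simp_all add: Q'_def)
  have EQ': "is_Eq (fslice C X') K' A' B' Q'"
    unfolding is_Eq_def is_RInv_iff Qs fold' lu2' using PA' PB' LI' RI' PQ' by (intro conjI)
  have tr: "transfers A A' a B B' b E E' \<eta> (hL \<cdot> el) (hL' \<cdot> el')"
      "transfers B B' b A A' a E E' \<eta> (gL \<cdot> el) (gL' \<cdot> el')"
    "transfers B B' b A A' a E E' \<eta> (hR \<cdot> er) (hR' \<cdot> er')" "transfers A A' a DA DA' da E E' \<eta> (sL \<cdot> el) (sL' \<cdot>
        el')"
    "transfers B B' b DB DB' db E E' \<eta> (sR \<cdot> er) (sR' \<cdot> er')"
  proof -
    show "transfers A A' a B B' b E E' \<eta> (hL \<cdot> el) (hL' \<cdot> el')"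
      unfolding transfers_def fold fold'
      using k12 over_post[OF oel LD(4)] over_post[OF el'(1) hL'(1)] o12 o12'
      by (intro exI[of _ k12] conjI) (simp_all add: reassoc[OF hL'(2)] el'(2))
    show "transfers B B' b A A' a E E' \<eta> (gL \<cdot> el) (gL' \<cdot> el')"
      unfolding transfers_def fold fold'
      using k21 over_post[OF oel LD(3)] over_post[OF el'(1) gL'(1)] o21 o21'
      by (intro exI[of _ k21] conjI) (simp_all add: reassoc[OF gL'(2)] el'(2))
    show "transfers B B' b A A' a E E' \<eta> (hR \<cdot> er) (hR' \<cdot> er')"
      unfolding transfers_def fold fold'
      using k21 over_post[OF oer RD(4)] over_post[OF er'(1) hR'(1)] o21 o21'
      by (intro exI[of _ k21] conjI) (simp_all add: reassoc[OF hR'(2)] er'(2))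
    show "transfers A A' a DA DA' da E E' \<eta> (sL \<cdot> el) (sL' \<cdot> el')"
      unfolding transfers_def fold fold'
      using kA over_post[OF oel LD(5)] over_post[OF el'(1) sL'(1)] oSA oSA'
      by (intro exI[of _ kA] conjI) (simp_all add: reassoc[OF sL'(2)] el'(2))
    show "transfers B B' b DB DB' db E E' \<eta> (sR \<cdot> er) (sR' \<cdot> er')"
      unfolding transfers_def fold fold'
      using kB over_post[OF oer RD(5)] over_post[OF er'(1) sR'(1)] oSB oSB'
      by (intro exI[of _ kB] conjI) (simp_all add: reassoc[OF sR'(2)] er'(2))
  qed
  have cm: "Pr2 K H21 H12 \<cdot>\<^bsub>fslice C X\<^esub> lu Q \<cdot>\<^bsub>fslice C X\<^esub> eql Q = (E, hL \<cdot> el, H12)"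
    "Pr1 K H21 H12 \<cdot>\<^bsub>fslice C X\<^esub> lu Q \<cdot>\<^bsub>fslice C X\<^esub> eql Q = (E, gL \<cdot> el, H21)"
    "Pr2 K H12 H21 \<cdot>\<^bsub>fslice C X\<^esub> ru Q \<cdot>\<^bsub>fslice C X\<^esub> eqr Q = (E, hR \<cdot> er, H21)"
    "lv Q \<cdot>\<^bsub>fslice C X\<^esub> eql Q = (E, sL \<cdot> el, SA)" "rv Q \<cdot>\<^bsub>fslice C X\<^esub> eqr Q = (E, sR \<cdot> er, SB)"
    "Pr2 K' H21' H12' \<cdot>\<^bsub>fslice C X'\<^esub> lu Q' \<cdot>\<^bsub>fslice C X'\<^esub> eql Q' = (E', hL' \<cdot> el', H12')"
    "Pr1 K' H21' H12' \<cdot>\<^bsub>fslice C X'\<^esub> lu Q' \<cdot>\<^bsub>fslice C X'\<^esub> eql Q' = (E', gL' \<cdot> el', H21')"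
    "Pr2 K' H12' H21' \<cdot>\<^bsub>fslice C X'\<^esub> ru Q' \<cdot>\<^bsub>fslice C X'\<^esub> eqr Q' = (E', hR' \<cdot> er', H21')"
    "lv Q' \<cdot>\<^bsub>fslice C X'\<^esub> eql Q' = (E', sL' \<cdot> el', SA')" "rv Q' \<cdot>\<^bsub>fslice C X'\<^esub> eqr Q' = (E', sR' \<cdot> er', SB')"
    unfolding lu2 Qs lu2' eq lv rv by simp_all
  have fe: "fst (eql Q) = E" "fst (eql Q') = E'" by (simp_all add: eq Qs(9))
  show thesis
    by (rule that[of Q' E E' \<eta> da db])
      (use EQ' E \<eta> tr DA da orA DB db orB in \<open>simp_all only: fold fold' cm fe rdA rdB Qs(1-4) fst_conv
          snd_conv\<close>)
qed

end

section \<open>Univalence of pullbacks along path monic fibrations\<close>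

context pi_tribe
begin

text \<open>\<open>f\<close> is the square of \<open>g\<close>, built from two pullbacks of
  \<open>g\<close> that replace one factor at a time. Each is path monic, hence so is their
  composite.\<close>

lemma fibration_square:
  assumes M: "path_monic C g" and b: "is_product C (Cod C g) (Cod C g) b1 b2" and bf: "b1 \<in> Fib C" "b2 \<in> Fib C"
  obtains b1' b2' f where "is_product C (Dom C g) (Dom C g) b1' b2'" "path_monic C f"
    "Dom C f = Dom C b1'" "Cod C f = Dom C b1" "b1 \<cdot> f = g \<cdot> b1'" "b2 \<cdot> f = g \<cdot> b2'"
    "b1' \<in> Fib C" "b2' \<in> Fib C"
proof -
  note [simp] = path_monicD(1)[OF M] bf
  have [simp]: "Dom C b2 = Dom C b1" "Cod C b1 = Cod C g" "Cod C b2 = Cod C g"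
    using b unfolding is_product_def by simp_all
  have ex: "\<exists>!h. h \<in> Hom C Z (Dom C b1) \<and> b1 \<cdot> h = x \<and> b2 \<cdot> h = y"
    if "x \<in> Hom C Z (Cod C g)" "y \<in> Hom C Z (Cod C g)" for x y Z
    using b that unfolding is_product_def by (simp del: Hom_iff)
  obtain f2 h2 where p2: "is_pullback C b1 g f2 h2" using pb_ex[of g b1] by auto
  note [simp] = pbD(4-8)[OF p2]
  have [simp]: "f2 \<in> Fib C" "h2 \<in> Fib C" using fib_pb1[OF p2] fib_pb2[OF p2] by simp_all
  obtain f1 h1 where p1: "is_pullback C (b2 \<cdot> f2) g f1 h1" using pb_ex[of g "b2 \<cdot> f2"] by auto
  note [simp] = pbD(4-6,8)[OF p1]
  have [simp]: "Cod C f1 = Dom C f2" "f1 \<in> Fib C" "h1 \<in> Fib C" using pbD(7)[OF p1] fib_pb1[OF p1] fib_pb2[OF p1]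
      by simp_all
  have M2: "path_monic C f2" by (rule path_monic_pullback[OF M p2]) simp
  have M1: "path_monic C f1" by (rule path_monic_pullback[OF M p1]) simp
  have Mf: "path_monic C (f2 \<cdot> f1)" by (rule path_monic_cmp[OF M1 M2]) simp
  have e1: "b1 \<cdot> f2 = g \<cdot> h2" by (rule pbD(9)[OF p2])
  have e2: "b2 \<cdot> (f2 \<cdot> f1) = g \<cdot> h1" using pbD(9)[OF p1] by simp
  have "is_product C (Dom C g) (Dom C g) (h2 \<cdot> f1) h1"
    unfolding is_product_def
  proof (intro conjI allI impI)
    fix Z x y assume "x \<in> Hom C Z (Dom C g)" "y \<in> Hom C Z (Dom C g)"
    then have [simp]: "x \<in> Arr C" "Dom C x = Z" "Cod C x = Dom C g" "y \<in> Arr C" "Dom C y = Z"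
        "Cod C y = Dom C g" by simp_all
    have "g \<cdot> x \<in> Hom C Z (Cod C g)" "g \<cdot> y \<in> Hom C Z (Cod C g)" by simp_all
    from ex[OF this] obtain k where [simp]: "k \<in> Arr C" "Dom C k = Z" "Cod C k = Dom C b1" and k:
        "b1 \<cdot> k = g \<cdot> x" "b2 \<cdot> k = g \<cdot> y"
      by (auto dest: ex1_implies_ex)
    obtain l where [simp]: "l \<in> Arr C" "Dom C l = Z" "Cod C l = Dom C f2" and l: "f2 \<cdot> l = k" "h2 \<cdot> l = x"
      by (rule pb_lift[OF p2, of k x]) (simp_all add: k)
    obtain n where n: "n \<in> Arr C" "Dom C n = Z" "Cod C n = Dom C f1" "f1 \<cdot> n = l" "h1 \<cdot> n = y"
      by (rule pb_lift[OF p1, of l y]) (simp_all add: l k)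
    show "\<exists>!h. h \<in> Hom C Z (Dom C (h2 \<cdot> f1)) \<and> (h2 \<cdot> f1) \<cdot> h = x \<and> h1 \<cdot> h = y"
    proof (rule ex1I[of _ n])
      show "n \<in> Hom C Z (Dom C (h2 \<cdot> f1)) \<and> (h2 \<cdot> f1) \<cdot> n = x \<and> h1 \<cdot> n = y" using n l by simp
      fix h assume h: "h \<in> Hom C Z (Dom C (h2 \<cdot> f1)) \<and> (h2 \<cdot> f1) \<cdot> h = x \<and> h1 \<cdot> h = y"
      then have [simp]: "h \<in> Arr C" "Dom C h = Z" "Cod C h = Dom C f1" by simp_all
      have h2h: "h2 \<cdot> (f1 \<cdot> h) = x" and h1h: "h1 \<cdot> h = y" using h by simp_all
      have "b1 \<cdot> (f2 \<cdot> (f1 \<cdot> h)) = g \<cdot> x" by (simp add: reassoc[OF e1] h2h)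
      moreover have "b2 \<cdot> (f2 \<cdot> (f1 \<cdot> h)) = g \<cdot> y" using reassoc[OF e2, of h] by (simp add: h1h)
      moreover have "f2 \<cdot> (f1 \<cdot> h) \<in> Hom C Z (Dom C b1)" "k \<in> Hom C Z (Dom C b1)" by simp_all
      ultimately have "f2 \<cdot> (f1 \<cdot> h) = k" using ex[OF \<open>g \<cdot> x \<in> Hom C Z (Cod C g)\<close> \<open>g \<cdot> y \<in> Hom C Z (Cod C g)\<close>] k
          by blast
      then have "f1 \<cdot> h = l" using l h2h by - (rule pb_uniq[OF p2], simp_all)
      then show "h = n" using n h1h by - (rule pb_uniq[OF p1], simp_all)
    qed
  qed simp_all
  then show thesis
    by (rule that[of "h2 \<cdot> f1" h1 "f2 \<cdot> f1"]) (simp_all add: Mf e2 reassoc[OF e1])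
qed

lemma product_tuple:
  assumes b: "is_product C Y Z b1 b2" and "b1 \<in> Arr C" "b2 \<in> Arr C" and x: "x \<in> Arr C" "y \<in> Arr C"
      "Dom C y = Dom C x" "Cod C x = Y" "Cod C y = Z"
  shows "tuple C b1 b2 x y \<in> Arr C" "Dom C (tuple C b1 b2 x y) = Dom C x" "Cod C (tuple C b1 b2 x y) = Dom C b1"
    "b1 \<cdot> tuple C b1 b2 x y = x" "b2 \<cdot> tuple C b1 b2 x y = y"
proof -
  have "x \<in> Hom C (Dom C x) Y" "y \<in> Hom C (Dom C x) Z" using x by simp_all
  then have "\<exists>!h. h \<in> Hom C (Dom C x) (Dom C b1) \<and> b1 \<cdot> h = x \<and> b2 \<cdot> h = y"
    using b unfolding is_product_def by blast
  from theI'[OF this] show "tuple C b1 b2 x y \<in> Arr C" "Dom C (tuple C b1 b2 x y) = Dom C x"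
      "Cod C (tuple C b1 b2 x y) = Dom C b1"
    "b1 \<cdot> tuple C b1 b2 x y = x" "b2 \<cdot> tuple C b1 b2 x y = y"
    unfolding tuple_def by simp_all
qed

lemma product_uniq:
  assumes b: "is_product C Y Z b1 b2" and h: "h \<in> Arr C" "k \<in> Arr C" "Dom C k = Dom C h" "Cod C h = Dom C b1"
      "Cod C k = Dom C b1"
    "b1 \<cdot> h = b1 \<cdot> k" "b2 \<cdot> h = b2 \<cdot> k"
  shows "h = k"
proof -
  have bb: "b1 \<in> Arr C" "b2 \<in> Arr C" "Cod C b1 = Y" "Cod C b2 = Z" "Dom C b2 = Dom C b1" using b unfolding
      is_product_def by simp_all
  then have "b1 \<cdot> h \<in> Hom C (Dom C h) Y" "b2 \<cdot> h \<in> Hom C (Dom C h) Z" using h by simp_all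
  then have "\<exists>!x. x \<in> Hom C (Dom C h) (Dom C b1) \<and> b1 \<cdot> x = b1 \<cdot> h \<and> b2 \<cdot> x = b2 \<cdot> h"
    using b unfolding is_product_def by blast
  moreover have "h \<in> Hom C (Dom C h) (Dom C b1)" "k \<in> Hom C (Dom C h) (Dom C b1)" using h by simp_all
  ultimately show ?thesis using h(6,7) by metis
qed

text \<open>Product projections are pullbacks of maps to the terminal object, all of which are
  fibrations.\<close>

lemma product_fib:
  assumes b: "is_product C Y Z b1 b2" and Y: "Y \<in> Obj C" "Z \<in> Obj C"
  shows "b1 \<in> Fib C" "b2 \<in> Fib C"
proof -
  obtain u bang where u: "is_terminal C u" "\<And>X. X \<in> Obj C \<Longrightarrow> bang X \<in> Fib C"
    "\<And>X. X \<in> Obj C \<Longrightarrow> Dom C (bang X) = X" "\<And>X. X \<in> Obj C \<Longrightarrow> Cod C (bang X) = u"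
    by (rule terminal_obtain) blast
  have "is_pullback C (bang Y) (bang Z) b1 b2"
    using b product_iff_pb[OF u(1), of "bang Y" Y "bang Z" Z b1 b2] u(2-4)[OF Y(1)] u(2-4)[OF Y(2)] by simp
  then show "b1 \<in> Fib C" "b2 \<in> Fib C" using fib_pb1 fib_pb2 u(2) Y by blast+
qed

text \<open>Univalence is existential in all its data, so data for \<open>q\<close> are assembled: a
  fresh cartesian closed structure, the base change of the object of equivalences, and the map
  \<open>\<delta>'\<close> induced by \<open>\<delta>\<close>. It then remains to show that
  \<open>\<delta>'\<close> satisfies the defining equations and is a homotopy equivalence.\<close>

lemma univalent_path_monic_pullback:
  assumes p: "univalent C p" and M: "path_monic C g" and T: "is_pullback C g p q t"
  shows "univalent C q"
proof -
  have pf [simp]: "p \<in> Fib C" using p unfolding univalent_def by blast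
  note [simp] = path_monicD(1)[OF M] pbD(4-8)[OF T]
  have qf [simp]: "q \<in> Fib C" using fib_pb1[OF T] by simp
  have gp [simp]: "Cod C g = Cod C p" using pbD(3)[OF T] by simp
  have gq: "g \<cdot> q = p \<cdot> t" by (rule pbD(9)[OF T])
  obtain b1 b2 A1 t1 A2 t2 K Q \<delta> where b: "is_product C (Cod C p) (Cod C p) b1 b2"
    and A1: "is_pullback C b1 p A1 t1" and A2: "is_pullback C b2 p A2 t2" and K:
        "is_ccs (fslice C (Dom C b1)) K"
    and Q: "is_Eq (fslice C (Dom C b1)) K A1 A2 Q"
    and \<delta>: "is_delta C (Dom C b1) K p (tuple C b1 b2 (Idn C (Cod C p)) (Idn C (Cod C p))) A1
        (tuple C A1 t1 (tuple C b1 b2 (Idn C (Cod C p)) (Idn C (Cod C p)) \<cdot> p) (Idn C (Dom C p))) A2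
        (tuple C A2 t2 (tuple C b1 b2 (Idn C (Cod C p)) (Idn C (Cod C p)) \<cdot> p) (Idn C (Dom C p))) Q \<delta>"
    and HE: "homotopy_equivalence C \<delta>"
    using p unfolding univalent_def Let_def by blast
  have bf [simp]: "b1 \<in> Fib C" "b2 \<in> Fib C" using product_fib[OF b] by simp_all
  have bc [simp]: "Cod C b1 = Cod C p" "Cod C b2 = Cod C p" "Dom C b2 = Dom C b1" using b unfolding
      is_product_def by simp_all
  define X where "X = Dom C b1"
  obtain b1' b2' f where b': "is_product C (Dom C g) (Dom C g) b1' b2'" and Mf: "path_monic C f"
    and fd [simp]: "Dom C f = Dom C b1'" "Cod C f = Dom C b1" and fb: "b1 \<cdot> f = g \<cdot> b1'" "b2 \<cdot> f = g \<cdot> b2'"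
    and bf' [simp]: "b1' \<in> Fib C" "b2' \<in> Fib C"
    using fibration_square[OF M, of b1 b2] b by (metis bf gp)
  have bc' [simp]: "Cod C b1' = Dom C g" "Cod C b2' = Dom C g" "Dom C b2' = Dom C b1'" using b' unfolding
      is_product_def by simp_all
  define X' where "X' = Dom C b1'"
  note [simp] = path_monicD(1)[OF Mf]
  obtain K' where K': "is_ccs (fslice C X') K'" using ccs_ex[of X'] by (auto simp: X'_def)
  interpret BC: base_change C X K X' K' f
    using K K' by unfold_locales (simp_all add: X_def X'_def)
  define m m' where "m = tuple C b1 b2 (Idn C (Cod C p)) (Idn C (Cod C p))"
    and "m' = tuple C b1' b2' (Idn C (Dom C g)) (Idn C (Dom C g))"
  have m [simp]: "m \<in> Arr C" "Dom C m = Cod C p" "Cod C m = X" and bm: "b1 \<cdot> m = Idn C (Cod C p)"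
      "b2 \<cdot> m = Idn C (Cod C p)"
    using product_tuple[OF b, of "Idn C (Cod C p)" "Idn C (Cod C p)"] by (simp_all add: m_def X_def)
  have m' [simp]: "m' \<in> Arr C" "Dom C m' = Dom C g" "Cod C m' = X'" and bm': "b1' \<cdot> m' = Idn C (Dom C g)"
      "b2' \<cdot> m' = Idn C (Dom C g)"
    using product_tuple[OF b', of "Idn C (Dom C g)" "Idn C (Dom C g)"] by (simp_all add: m'_def X'_def)
  have [simp]: "Dom C b1 = X" "Dom C b1' = X'" by (simp_all add: X_def X'_def)
  have fm: "f \<cdot> m' = m \<cdot> g"
    by (rule product_uniq[OF b]) (simp_all add: reassoc[OF fb(1)] reassoc[OF fb(2)] bm' reassoc[OF bm(1)]
        reassoc[OF bm(2)])
  \<comment> \<open>The two pullbacks of \<open>q\<close> to \<open>X'\<close> are also the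
    pullbacks along \<open>f\<close> of the two pullbacks of \<open>p\<close> to \<open>X\<close>,
    by pasting and cancellation.\<close>
  have "\<exists>A' t' a. is_pullback C bi' q A' t' \<and> is_pullback C f A A' a \<and> s \<cdot> a = t \<cdot> t' \<and> A \<in> Fib C"
    if A: "is_pullback C bi p A s" and bi: "bi \<in> Fib C" "bi' \<in> Fib C" "Dom C bi = X" "Dom C bi' = X'"
        "Cod C bi' = Dom C g"
      and e: "bi \<cdot> f = g \<cdot> bi'" for bi bi' A s
  proof -
    note [simp] = bi pbD(3-8)[OF A]
    obtain A' t' where A': "is_pullback C bi' q A' t'" using pb_ex[of q bi'] by auto
    note [simp] = pbD(4-8)[OF A']
    have P: "is_pullback C (bi \<cdot> f) p A' (t \<cdot> t')" unfolding e by (rule pb_paste[OF T A'])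
    have [simp]: "Cod C bi = Cod C p" using pbD(3)[OF A] by simp
    obtain a where [simp]: "a \<in> Arr C" "Dom C a = Dom C A'" "Cod C a = Dom C A" and a: "A \<cdot> a = f \<cdot> A'"
        "s \<cdot> a = t \<cdot> t'"
      by (rule pb_lift[OF A, of "f \<cdot> A'" "t \<cdot> t'"]) (use pbD(9)[OF P] in simp_all)
    have "is_pullback C f A A' a" by (rule pb_unpaste[OF A P]) (simp_all add: a)
    then show ?thesis using A' a fib_pb1[OF A] by auto
  qed
  note pull = this
  obtain A1' t1' a1 where A1': "is_pullback C b1' q A1' t1'" and a1: "is_pullback C f A1 A1' a1" and ta1:
      "t1 \<cdot> a1 = t \<cdot> t1'" and A1f: "A1 \<in> Fib C"
    using pull[OF A1, of b1'] fb by auto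
  obtain A2' t2' a2 where A2': "is_pullback C b2' q A2' t2'" and a2: "is_pullback C f A2 A2' a2" and ta2:
      "t2 \<cdot> a2 = t \<cdot> t2'" and A2f: "A2 \<in> Fib C"
    using pull[OF A2, of b2'] fb by auto
  define e1 e2 e1' e2' where "e1 = tuple C A1 t1 (m \<cdot> p) (Idn C (Dom C p))" and
      "e2 = tuple C A2 t2 (m \<cdot> p) (Idn C (Dom C p))"
    and "e1' = tuple C A1' t1' (m' \<cdot> q) (Idn C (Dom C q))" and
        "e2' = tuple C A2' t2' (m' \<cdot> q) (Idn C (Dom C q))"
  have e1: "over C (m \<cdot> p) A1 e1" "t1 \<cdot> e1 = Idn C (Dom C p)"
    using pb_tuple[OF A1, of "m \<cdot> p" "Idn C (Dom C p)"] reassoc[OF bm(1), of p] by (simp_all add: over_def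
        e1_def)
  have e2: "over C (m \<cdot> p) A2 e2" "t2 \<cdot> e2 = Idn C (Dom C p)"
    using pb_tuple[OF A2, of "m \<cdot> p" "Idn C (Dom C p)"] reassoc[OF bm(2), of p] by (simp_all add: over_def
        e2_def)
  have e1': "over C (m' \<cdot> q) A1' e1'" "t1' \<cdot> e1' = Idn C (Dom C q)"
    using pb_tuple[OF A1', of "m' \<cdot> q" "Idn C (Dom C q)"] reassoc[OF bm'(1), of q] by (simp_all add: over_def
        e1'_def)
  have e2': "over C (m' \<cdot> q) A2' e2'" "t2' \<cdot> e2' = Idn C (Dom C q)"
    using pb_tuple[OF A2', of "m' \<cdot> q" "Idn C (Dom C q)"] reassoc[OF bm'(2), of q] by (simp_all add: over_def
        e2'_def)
  note [simp] = overD(1-3)[OF e1(1)] overD(1-3)[OF e2(1)] overD(1-3)[OF e1'(1)] overD(1-3)[OF e2'(1)]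
    pbD(4-8)[OF A1] pbD(4-8)[OF A2] pbD(4-8)[OF A1'] pbD(4-8)[OF A2'] pbD(4-8)[OF a1] pbD(4-8)[OF a2]
  \<comment> \<open>The identifications of \<open>q\<close> and \<open>p\<close> with pullbacks
    along the diagonals are compatible, because both components of \<open>A1\<close> agree.\<close>
  have ae1: "a1 \<cdot> e1' = e1 \<cdot> t"
    by (rule pb_uniq[OF A1])
      (simp_all add: reassoc[OF pbD(9)[OF a1, symmetric]] reassoc[OF overD(4)[OF e1(1)]] overD(4)[OF e1'(1)]
          reassoc[OF fm] gq reassoc[OF ta1] e1' reassoc[OF e1(2)])
  have ae2: "a2 \<cdot> e2' = e2 \<cdot> t"
    by (rule pb_uniq[OF A2])
      (simp_all add: reassoc[OF pbD(9)[OF a2, symmetric]] reassoc[OF overD(4)[OF e2(1)]] overD(4)[OF e2'(1)]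
          reassoc[OF fm] gq reassoc[OF ta2] e2' reassoc[OF e2(2)])
  obtain Q' E E' \<eta> da db where Q': "is_Eq (fslice C X') K' A1' A2' Q'" and E: "E \<in> Fib C" "fst (eql Q) = E"
      "fst (eql Q') = E'"
    and \<eta>: "is_pullback C f E E' \<eta>"
    and tr: "BC.transfers A1 A1' a1 A2 A2' a2 E E' \<eta>
      (und (Pr2 K (IHom K A2 A1) (IHom K A1 A2) \<cdot>\<^bsub>fslice C X\<^esub> lu Q \<cdot>\<^bsub>fslice C X\<^esub> eql Q))
      (und (Pr2 K' (IHom K' A2' A1') (IHom K' A1' A2') \<cdot>\<^bsub>fslice C X'\<^esub> lu Q' \<cdot>\<^bsub>fslice C X'\<^esub> eql Q'))"
    "BC.transfers A2 A2' a2 A1 A1' a1 E E' \<eta>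
      (und (Pr1 K (IHom K A2 A1) (IHom K A1 A2) \<cdot>\<^bsub>fslice C X\<^esub> lu Q \<cdot>\<^bsub>fslice C X\<^esub> eql Q))
      (und (Pr1 K' (IHom K' A2' A1') (IHom K' A1' A2') \<cdot>\<^bsub>fslice C X'\<^esub> lu Q' \<cdot>\<^bsub>fslice C X'\<^esub> eql Q'))"
    "BC.transfers A2 A2' a2 A1 A1' a1 E E' \<eta>
      (und (Pr2 K (IHom K A1 A2) (IHom K A2 A1) \<cdot>\<^bsub>fslice C X\<^esub> ru Q \<cdot>\<^bsub>fslice C X\<^esub> eqr Q))
      (und (Pr2 K' (IHom K' A1' A2') (IHom K' A2' A1') \<cdot>\<^bsub>fslice C X'\<^esub> ru Q' \<cdot>\<^bsub>fslice C X'\<^esub> eqr Q'))"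
    "BC.transfers A1 A1' a1 (fst (dA Q)) (fst (dA Q')) da E E' \<eta>
      (und (lv Q \<cdot>\<^bsub>fslice C X\<^esub> eql Q)) (und (lv Q' \<cdot>\<^bsub>fslice C X'\<^esub> eql Q'))"
    "BC.transfers A2 A2' a2 (fst (dB Q)) (fst (dB Q')) db E E' \<eta>
      (und (rv Q \<cdot>\<^bsub>fslice C X\<^esub> eqr Q)) (und (rv Q' \<cdot>\<^bsub>fslice C X'\<^esub> eqr Q'))"
    and da: "fst (dA Q) \<in> Fib C" "is_pullback C f (fst (dA Q)) (fst (dA Q')) da"
        "over C A1 (fst (dA Q)) (und (rA Q))"
    "over C A1' (fst (dA Q')) (und (rA Q'))" "da \<cdot> und (rA Q') = und (rA Q) \<cdot> a1"
    and db: "fst (dB Q) \<in> Fib C" "is_pullback C f (fst (dB Q)) (fst (dB Q')) db"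
        "over C A2 (fst (dB Q)) (und (rB Q))"
    "over C A2' (fst (dB Q')) (und (rB Q'))" "db \<cdot> und (rB Q') = und (rB Q) \<cdot> a2"
    by (rule BC.Eq_base_change[OF a1 A1f a2 A2f Q[folded X_def]])
  note \<delta> = \<delta>[folded m_def e1_def e2_def X_def, unfolded is_delta_def Let_def fslice_simps(2) E(2)]
  have od: "over C m E \<delta>" using \<delta> by (simp add: over_def)
  note ds [simp] = overD(1-3)[OF od]
  note Es = BC.bc_simps[OF \<eta> E(1)]
  note [simp] = Es(1-5,7,8) E(1)
  have fmd: "f \<cdot> m' = E \<cdot> (\<delta> \<cdot> g)" by (simp add: reassoc[OF overD(4)[OF od]] fm)
  \<comment> \<open>\<open>\<delta>'\<close> is forced by the pullback square of \<open>Eq\<close>: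
    it lies over the new diagonal, and \<open>\<eta>\<close> maps it to
    \<open>\<delta> \<cdot> g\<close>.\<close>
  obtain \<delta>' where [simp]: "\<delta>' \<in> Arr C" "Dom C \<delta>' = Dom C g" "Cod C \<delta>' = Dom C E'" and \<delta>': "E' \<cdot> \<delta>' = m'"
      "\<eta> \<cdot> \<delta>' = \<delta> \<cdot> g"
    by (rule pb_lift[OF \<eta>, of m' "\<delta> \<cdot> g"]) (simp_all add: fmd)
  have od': "over C m' E' \<delta>'" by (simp add: over_def \<delta>')
  note UT = BC.uncurry_transfer[OF _ _ _ _ _ \<eta> E(1) od od' \<delta>'(2), where p = p and q = q and t = t]
  \<comment> \<open>Each of the five evaluation equations is transported from the corresponding
    equation for \<open>\<delta>\<close>.\<close>
  have D': "is_delta C X' K' q m' A1' e1' A2' e2' Q' \<delta>'"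
    unfolding is_delta_def Let_def fslice_simps(2) E(3) uncurry_over_def BC.T.P1_def[symmetric]
        BC.T.P2_def[symmetric] BC.T.app_def[symmetric]
  proof (intro conjI)
    note \<delta>u = \<delta>[unfolded uncurry_over_def BC.S.P1_def[symmetric] BC.S.P2_def[symmetric] BC.S.app_def[symmetric],
        THEN conjunct2, THEN conjunct2]
    note \<delta>1 = \<delta>u[THEN conjunct1] and \<delta>2 = \<delta>u[THEN conjunct2, THEN conjunct1]
      and \<delta>3 = \<delta>u[THEN conjunct2, THEN conjunct2, THEN conjunct1]
      and \<delta>4 = \<delta>u[THEN conjunct2, THEN conjunct2, THEN conjunct2, THEN conjunct1]
      and \<delta>5 = \<delta>u[THEN conjunct2, THEN conjunct2, THEN conjunct2, THEN conjunct2]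
    show "BC.T.app A1' A2' ((und (Pr2 K' (IHom K' A2' A1') (IHom K' A1' A2') \<cdot>\<^bsub>fslice C X'\<^esub> lu Q' \<cdot>\<^bsub>fslice C X'\<^esub>
        eql Q') \<cdot> \<delta>') \<cdot> q) e1' = e2'"
      by (rule UT[OF tr(1) a1 A1f a2 A2f _ _ _ _ _ _ _ _ _ _ gq e1(1) e1'(1) ae1 \<delta>1 e2'(1) ae2]) simp_all
    show "BC.T.app A2' A1' ((und (Pr1 K' (IHom K' A2' A1') (IHom K' A1' A2') \<cdot>\<^bsub>fslice C X'\<^esub> lu Q' \<cdot>\<^bsub>fslice C X'\<^esub>
        eql Q') \<cdot> \<delta>') \<cdot> q) e2' = e1'"
      by (rule UT[OF tr(2) a2 A2f a1 A1f _ _ _ _ _ _ _ _ _ _ gq e2(1) e2'(1) ae2 \<delta>2 e1'(1) ae1]) simp_all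
    show "BC.T.app A2' A1' ((und (Pr2 K' (IHom K' A1' A2') (IHom K' A2' A1') \<cdot>\<^bsub>fslice C X'\<^esub> ru Q' \<cdot>\<^bsub>fslice C X'\<^esub>
        eqr Q') \<cdot> \<delta>') \<cdot> q) e2' = e1'"
      by (rule UT[OF tr(3) a2 A2f a1 A1f _ _ _ _ _ _ _ _ _ _ gq e2(1) e2'(1) ae2 \<delta>3 e1'(1) ae1]) simp_all
    note da' = overD(1-3)[OF da(3)] overD(1-3)[OF da(4)] BC.bc_simps(3-5)[OF da(2,1)]
    note db' = overD(1-3)[OF db(3)] overD(1-3)[OF db(4)] BC.bc_simps(3-5)[OF db(2,1)]
    have rA: "over C (m' \<cdot> q) (fst (dA Q')) (und (rA Q') \<cdot> e1')"
        "da \<cdot> (und (rA Q') \<cdot> e1') = (und (rA Q) \<cdot> e1) \<cdot> t"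
      using over_post[OF e1'(1) da(4)] BC.bc_simps(1)[OF da(2,1)] da' by (simp_all add: reassoc[OF da(5)] ae1)
    have rB: "over C (m' \<cdot> q) (fst (dB Q')) (und (rB Q') \<cdot> e2')"
        "db \<cdot> (und (rB Q') \<cdot> e2') = (und (rB Q) \<cdot> e2) \<cdot> t"
      using over_post[OF e2'(1) db(4)] BC.bc_simps(1)[OF db(2,1)] db' by (simp_all add: reassoc[OF db(5)] ae2)
    show "BC.T.app A1' (fst (dA Q')) ((und (lv Q' \<cdot>\<^bsub>fslice C X'\<^esub> eql Q') \<cdot> \<delta>') \<cdot> q) e1' = und (rA Q') \<cdot> e1'"
      by (rule UT[OF tr(4) a1 A1f da(2,1) _ _ _ _ _ _ _ _ _ _ gq e1(1) e1'(1) ae1 \<delta>4 rA]) simp_all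
    show "BC.T.app A2' (fst (dB Q')) ((und (rv Q' \<cdot>\<^bsub>fslice C X'\<^esub> eqr Q') \<cdot> \<delta>') \<cdot> q) e2' = und (rB Q') \<cdot> e2'"
      by (rule UT[OF tr(5) a2 A2f db(2,1) _ _ _ _ _ _ _ _ _ _ gq e2(1) e2'(1) ae2 \<delta>5 rB]) simp_all
  qed (simp_all add: \<delta>')
  \<comment> \<open>Read the other way, the square exhibits \<open>\<eta>\<close> as the pullback of
    the path monic \<open>f\<close> along the fibration \<open>E\<close>.\<close>
  have ME: "path_monic C \<eta>" by (rule path_monic_pullback[OF Mf pb_sym[OF \<eta>]]) simp
  have bE: "b1 \<cdot> (E \<cdot> \<delta>) = Idn C (Cod C p)" by (simp add: overD(4)[OF od] bm)
  have bE': "b1' \<cdot> (E' \<cdot> \<delta>') = Idn C (Dom C g)" by (simp add: \<delta>' bm')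
  have Ecod [simp]: "Cod C E = X" "Cod C E' = X'" by (simp_all add: Es)
  obtain n where [simp]: "n \<in> Arr C" "Dom C n = Dom C E" "Cod C n = Cod C p"
    and n: "homotopic C (\<delta> \<cdot> n) (Idn C (Dom C E))"
    using HE unfolding homotopy_equivalence_def by auto
  \<comment> \<open>\<open>b1 \<cdot> E\<close> is a strict retraction of \<open>\<delta>\<close>.
    Applying it to \<open>\<delta> \<cdot> n \<sim> id\<close> shows that the unknown inverse
    \<open>n\<close> is homotopic to \<open>b1 \<cdot> E\<close>, which has an explicit counterpart
    \<open>b1' \<cdot> E'\<close> upstairs.\<close>
  have "homotopic C ((b1 \<cdot> E) \<cdot> (\<delta> \<cdot> n)) ((b1 \<cdot> E) \<cdot> Idn C (Dom C E))"
    by (rule homotopic_post[OF n]) simp_all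
  then have "homotopic C n (b1 \<cdot> E)" using reassoc[OF bE, of n] by (simp add: overD(4)[OF od] reassoc[OF
      overD(4)[OF od]] reassoc[OF bm(1)])
  from homotopic_post[OF this, of \<delta>] have "homotopic C (\<delta> \<cdot> n) (\<delta> \<cdot> (b1 \<cdot> E))" by simp
  then have "homotopic C (\<delta> \<cdot> (b1 \<cdot> E)) (Idn C (Dom C E))" using n homotopic_sym homotopic_trans by blast
  from homotopic_pre[OF this, of \<eta>] have "homotopic C (\<delta> \<cdot> (b1 \<cdot> (E \<cdot> \<eta>))) \<eta>" by simp
  \<comment> \<open>Through this identity the homotopy downstairs speaks about
    \<open>\<delta>' \<cdot> (b1' \<cdot> E')\<close> after \<open>\<eta>\<close>, so that
    \<open>\<eta>\<close> can be cancelled.\<close>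
  moreover have "\<delta> \<cdot> (b1 \<cdot> (E \<cdot> \<eta>)) = \<eta> \<cdot> (\<delta>' \<cdot> (b1' \<cdot> E'))"
    by (simp add: reassoc[OF \<delta>'(2)] Es(6)[symmetric] reassoc[OF fb(1)])
  ultimately have "homotopic C (\<eta> \<cdot> (\<delta>' \<cdot> (b1' \<cdot> E'))) (\<eta> \<cdot> Idn C (Dom C E'))" by simp
  then have "homotopic C (\<delta>' \<cdot> (b1' \<cdot> E')) (Idn C (Dom C E'))"
    by (rule path_monic_cancel[OF ME]) simp_all
  moreover have "homotopic C ((b1' \<cdot> E') \<cdot> \<delta>') (Idn C (Dom C g))"
    using homotopic_refl[of "Idn C (Dom C g)"] bE' by simp
  ultimately have HE': "homotopy_equivalence C \<delta>'"
    unfolding homotopy_equivalence_def by (intro conjI bexI[of _ "b1' \<cdot> E'"]) simp_all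
  have cq: "Cod C q = Dom C g" by simp
  show ?thesis
    unfolding univalent_def Let_def
    by (rule conjI[OF qf], rule exI[of _ b1'], rule exI[of _ b2'], rule exI[of _ A1'], rule exI[of _ t1'],
        rule exI[of _ A2'], rule exI[of _ t2'], rule exI[of _ K'], rule exI[of _ Q'], rule exI[of _ \<delta>'],
        unfold cq X'_def[symmetric] m'_def[symmetric] e1'_def[symmetric] e2'_def[symmetric])
      (intro conjI b' A1' A2' K' Q' D' HE')
qed

lemma local_class_pullbacks_of:
  assumes "p \<in> Fib C"
  shows "local_class C (pullbacks_of C p)"
  unfolding local_class_def pullbacks_of_def
proof (intro conjI subsetI ballI allI impI)
  fix q assume "q \<in> {q. \<exists>f t. is_pullback C f p q t}"
  then show "q \<in> Fib C" using fib_pb1 assms by blast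
next
  fix q f q1 q2 assume "q \<in> {q. \<exists>f t. is_pullback C f p q t}" "is_pullback C f q q1 q2"
  then show "q1 \<in> {q. \<exists>f t. is_pullback C f p q t}" using pb_paste by blast
qed

end

section \<open>The homotopy subobject classifier of a univalent fibration\<close>

theorem theorem4p25:
  fixes C :: "('o, 'm) fcat"
    and p Pr tr t :: 'm
    and q1 q2 r d :: "'m \<times> 'm \<times> 'm"
  assumes "pi_tribe C"
    and "p \<in> Fib C" and "univalent C p"
    and "is_product (fslice C (Cod C p)) p p q1 q2"
    and "path_object (fslice C (Cod C p)) p q1 q2 r d"
    and "is_Pi C (Dom (fslice C (Cod C p)) q1) (und d) Pr"
    and "is_pullback C Pr p tr t"
  shows "homotopy_subobject_classifier C (pullbacks_of C p) tr"
proof -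
  interpret pi_tribe C by fact
  obtain p1 p2 r0 d0 where eq: "q1 = (p \<cdot>\<^bsub>C\<^esub> p1, p1, p)" "q2 = (p \<cdot>\<^bsub>C\<^esub> p1, p2, p)"
    "r = (p, r0, p \<cdot>\<^bsub>C\<^esub> (p1 \<cdot>\<^bsub>C\<^esub> d0))" "d = (p \<cdot>\<^bsub>C\<^esub> (p1 \<cdot>\<^bsub>C\<^esub> d0), d0, p \<cdot>\<^bsub>C\<^esub> p1)"
    and P: "is_pullback C p p p1 p2"
    "anodyne C r0" "Dom C r0 = Dom C p" "d0 \<in> Fib C" "Dom C d0 = Cod C r0" "Cod C d0 = Dom C p1"
    "p1 \<cdot>\<^bsub>C\<^esub> (d0 \<cdot>\<^bsub>C\<^esub> r0) = Idn C (Dom C p)" "p2 \<cdot>\<^bsub>C\<^esub> (d0 \<cdot>\<^bsub>C\<^esub> r0) = Idn C (Dom C p)"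
    by (rule path_object_fsliceE[OF assms(5)])
  \<comment> \<open>The domain of the projection \<open>q1\<close> in the slice is the product of
    \<open>p\<close> with itself, whose structure map is \<open>p\<close> after \<open>p1\<close>;
    \<open>d0\<close> is the endpoint map seen in \<open>C\<close>.\<close>
  have "is_Pi C (p \<cdot>\<^bsub>C\<^esub> p1) d0 Pr" using assms(6) by (simp add: eq)
  then obtain w \<theta> \<epsilon> where "dep_prod C (p \<cdot>\<^bsub>C\<^esub> p1) d0 Pr w \<theta> \<epsilon>" "reflects_fhomotopic C (p \<cdot>\<^bsub>C\<^esub> p1) d0 Pr w \<theta> \<epsilon>"
    by (rule is_Pi_dep_prod)
  then interpret omega C p p1 p2 r0 d0 Pr w \<theta> \<epsilon>
    using assms(2) P by unfold_locales
  show ?thesis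
    unfolding homotopy_subobject_classifier_def
  proof (intro conjI ballI impI)
    show "local_class C (pullbacks_of C p)" by (rule local_class_pullbacks_of[OF assms(2)])
    show "homotopy_monic C tr" by (rule path_monic_homotopy_monic[OF path_monic_top[OF assms(7)]])
    show "univalent C tr" by (rule univalent_path_monic_pullback[OF assms(3) path_monic_Pr assms(7)])
    fix q assume "q \<in> pullbacks_of C p" "homotopy_monic C q"
    then show "q \<in> pullbacks_of C tr"
      using homotopy_monic_classified[OF assms(7)] unfolding pullbacks_of_def by blast
  qed
qed

end
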